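(* Let $F$ be a nondegenerate distribution function on the positive integers with $F(x)=0$ for $x<2$, and suppose there exist $\tau\in(2,3)$ and $0<c_1\le c_2<\infty$ such that $c_1x^{-(\tau-1)}\le 1-F(x)\le c_2x^{-(\tau-1)}$ for all $x\ge0$. Consider the configuration model on $n$ vertices with i.i.d. degrees with distribution $F$ and i.i.d. exponential edge weights with mean $1$, and let $H_n$ and $W_n$ be, respectively, the number of edges and the total weight of the minimal-weight path between vertices $1$ and $2$, conditioned on vertices $1$ and $2$ being connected. Then: (a) with $\alpha=\frac{2(\tau-2)}{\tau-1}\in(0,1)$, $$\frac{H_n-\alpha\log n}{\sqrt{\alpha\log n}}\xrightarrow{d} Z,$$ where $Z$ is a standard normal random variable; (b) there exists a random variable $V$ such that $W_n\xrightarrow{d} V$.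
   Context: Configuration model: let $D_1,\dots,D_n$ be i.i.d. random variables with distribution function $F$ (if $D_1+\cdots+D_n$ is odd, $D_n$ is replaced by $D_n+1$). Vertex $i\in\{1,\dots,n\}$ is given $D_i$ half-edges (stubs), and the multigraph is obtained by pairing all stubs uniformly at random (self-loops and multiple edges allowed). Each edge independently receives a weight that is exponentially distributed with mean $1$, independent of the graph; the weight of a path is the sum of the weights of its edges. $\xrightarrow{d}$ denotes convergence in distribution as $n\to\infty$.
   Formalization: The two-sided tail bound is required only for real x ≥ 1 instead of all x ≥ 0, since c_1 x^{-(τ-1)} exceeds 1 for small x > 0 and is undefined at x = 0, so that no distribution satisfies the hypothesis as written. *)

theory Defs
  imports "HOL-Probability.Probability"
begin

(* Vertices of the n-vertex configuration model are 0,...,n-1; vertex i+1 of the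
   paper is vertex i here (so the paper's vertices 1 and 2 are 0 and 1).
   A stub (half-edge) is a pair (v, j) with j < d v. *)
type_synonym stub = "nat \<times> nat"

definition stubs :: "nat \<Rightarrow> (nat \<Rightarrow> nat) \<Rightarrow> stub set" where
  "stubs n d = {(v, j). v < n \<and> j < d v}"

definition adjust_degrees :: "nat \<Rightarrow> (nat \<Rightarrow> nat) \<Rightarrow> (nat \<Rightarrow> nat)" where
  "adjust_degrees n D = (if odd (\<Sum>i<n. D i) then D(n - 1 := D (n - 1) + 1) else D)"

(* perfect matchings of the stub set S, encoded as fixed-point-free involutions of S
   (identity outside S); these are in bijection with the pairings of S *)
definition pairings :: "stub set \<Rightarrow> (stub \<Rightarrow> stub) set" where
  "pairings S = {p. (\<forall>s\<in>S. p s \<in> S \<and> p s \<noteq> s \<and> p (p s) = s) \<and> (\<forall>s. s \<notin> S \<longrightarrow> p s = s)}"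

definition CM_graph :: "nat pmf \<Rightarrow> nat \<Rightarrow> ((nat \<Rightarrow> nat) \<times> (stub \<Rightarrow> stub)) pmf" where
  "CM_graph F n =
     Pi_pmf {..<n} 0 (\<lambda>_. F) \<bind> (\<lambda>D.
       pmf_of_set (pairings (stubs n (adjust_degrees n D))) \<bind> (\<lambda>p.
         return_pmf (adjust_degrees n D, p)))"

definition Exp1 :: "real measure" where
  "Exp1 = density lborel (exponential_density 1)"

(* i.i.d. Exp(1) variables w s for every potential stub s; the edge {s, p s} receives
   the weight w (min s (p s)), so that edge weights are i.i.d. Exp(1), independent of
   the graph *)
definition CM_FPP :: "nat pmf \<Rightarrow> nat \<Rightarrow> (((nat \<Rightarrow> nat) \<times> (stub \<Rightarrow> stub)) \<times> (stub \<Rightarrow> real)) measure" where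
  "CM_FPP F n = pair_measure (measure_pmf (CM_graph F n)) (PiM UNIV (\<lambda>_::stub. Exp1))"

definition stub_min :: "stub \<Rightarrow> stub \<Rightarrow> stub" where
  "stub_min s t = (if fst s < fst t \<or> (fst s = fst t \<and> snd s \<le> snd t) then s else t)"

definition edge_weight :: "(stub \<Rightarrow> stub) \<Rightarrow> (stub \<Rightarrow> real) \<Rightarrow> stub \<Rightarrow> real" where
  "edge_weight p w s = w (stub_min s (p s))"

(* a path from u to v: the list of stubs through which the successive edges are left *)
fun is_path :: "stub set \<Rightarrow> (stub \<Rightarrow> stub) \<Rightarrow> nat \<Rightarrow> stub list \<Rightarrow> nat \<Rightarrow> bool" where
  "is_path S p u [] v = (u = v)"
| "is_path S p u (s # ps) v = (s \<in> S \<and> fst s = u \<and> is_path S p (fst (p s)) ps v)"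

definition path_weight :: "(stub \<Rightarrow> stub) \<Rightarrow> (stub \<Rightarrow> real) \<Rightarrow> stub list \<Rightarrow> real" where
  "path_weight p w ps = sum_list (map (edge_weight p w) ps)"

definition CM_connected :: "nat \<Rightarrow> ((nat \<Rightarrow> nat) \<times> (stub \<Rightarrow> stub)) \<times> (stub \<Rightarrow> real) \<Rightarrow> bool" where
  "CM_connected n \<omega> = (case \<omega> of ((d, p), w) \<Rightarrow> \<exists>ps. is_path (stubs n d) p 0 ps 1)"

definition CM_W :: "nat \<Rightarrow> ((nat \<Rightarrow> nat) \<times> (stub \<Rightarrow> stub)) \<times> (stub \<Rightarrow> real) \<Rightarrow> real" where
  "CM_W n \<omega> = (case \<omega> of ((d, p), w) \<Rightarrow>
      Inf {path_weight p w ps | ps. is_path (stubs n d) p 0 ps 1})"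

(* H_n: number of edges of the minimal-weight path (a.s. unique) *)
definition CM_H :: "nat \<Rightarrow> ((nat \<Rightarrow> nat) \<times> (stub \<Rightarrow> stub)) \<times> (stub \<Rightarrow> real) \<Rightarrow> nat" where
  "CM_H n \<omega> = (case \<omega> of ((d, p), w) \<Rightarrow>
      (LEAST k. \<exists>ps. is_path (stubs n d) p 0 ps 1 \<and> length ps = k \<and> path_weight p w ps = CM_W n \<omega>))"

definition CM_cond :: "nat pmf \<Rightarrow> nat \<Rightarrow> (((nat \<Rightarrow> nat) \<times> (stub \<Rightarrow> stub)) \<times> (stub \<Rightarrow> real)) measure" where
  "CM_cond F n = uniform_measure (CM_FPP F n) {\<omega> \<in> space (CM_FPP F n). CM_connected n \<omega>}"

end

theory Submission imports Defs "HOL-Real_Asymp.Real_Asymp" begin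

text \<open>The minimal-weight path is found by exploring the two clusters around the end points in order of
  distance. The step of the exploration that reveals the \<open>i\<close>-th vertex of a cluster takes an exponential time
  whose rate is the number \<open>S\<^sub>i\<close> of active stubs, the new degree is nearly size-biased, and the label (number
  of edges to the root) of the new stubs is one more than that of a uniformly chosen active stub. Since the
  size-biased law has infinite mean, \<open>S\<^sub>i\<close> grows like \<open>i powr (1 / (\<tau> - 2))\<close>, so that the times
  \<open>1 / S\<^sub>i\<close> are summable and the weight converges in law. The label of a uniform active stub is a sum of
  indicators with success probabilities close to \<open>X\<^sub>i / (X\<^sub>1 + \<dots> + X\<^sub>i)\<close>; by exchangeability this sum is
  distributed as the number of records of a random permutation, which gives the central limit theorem.
  The clusters collide once both contain about \<open>m = n powr ((\<tau> - 2) / (\<tau> - 1))\<close> vertices, up to powers of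
  \<open>ln n\<close>, whence \<open>2 * ln m\<close> is asymptotic to \<open>2 * (\<tau> - 2) / (\<tau> - 1) * ln n\<close>.

  Only lower bounds for probabilities of events are proved for the graph. Applied to a half-line and to its
  complement they determine the limit, and applied to the sure event they show that the end points are
  connected with probability tending to one.\<close>

text \<open>The obstacle is the infinite variance of the degrees. Their sum fluctuates on the scale
  b = n^(1/(\<tau> - 1)) of the largest degree, so a comparison with i.i.d. size-biased picks loses
  about b/n per pick and lasts for o(n/b) picks only, while n/b = b^(\<tau> - 2) is just the order
  of steps after which the clusters meet. The comparison therefore stops a factor \<omega>, a small
  power of ln n, below this order, and a late phase bridges the gap. There only averages are
  controlled: the total degree, the sum of squared degrees, and the proportion of stubs in the other
  cluster. This phase typically adds o(sqrt(ln n)) edges and o(1) time.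

  No exploration process is constructed. Uniform pairings allow deferred decisions and exponential
  weights forget their past, so the conditional success probability is a function of the current
  clusters: \<open>meet_prob\<close>, and \<open>ann\<close> after averaging over the unrevealed
  degrees. Each step is an inequality between such functions. The clusters are grown one after the
  other; the weight is the total time spent.\<close>

abbreviation EW :: "(stub \<Rightarrow> real) measure" where
  "EW \<equiv> PiM UNIV (\<lambda>_::stub. Exp1)"

section \<open>Independent exponential weights: resampling, relabelling, and the first clock to
  ring\<close>

definition expect_exp :: "nat \<Rightarrow> (real \<Rightarrow> ennreal) \<Rightarrow> ennreal" where
  "expect_exp S g = (\<integral>\<^sup>+t. ennreal (exponential_density (real S) t) * g t \<partial>lborel)"

lemma sets_Exp1 [simp, measurable_cong]: "sets Exp1 = sets borel"
  by (simp add: Exp1_def)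

lemma space_Exp1 [simp]: "space Exp1 = UNIV"
  by (simp add: Exp1_def)

lemma prob_space_Exp1: "prob_space Exp1"
  unfolding Exp1_def by (rule prob_space_exponential_density) simp

lemma prob_space_EW: "prob_space EW"
  by (intro prob_space_PiM prob_space_Exp1)

lemma space_EW [simp]: "space EW = UNIV"
  by (auto simp: space_PiM)

lemma nn_integral_Exp1:
  assumes [measurable]: "g \<in> borel_measurable borel"
  shows "(\<integral>\<^sup>+t. g t \<partial>Exp1) = expect_exp 1 g"
  unfolding Exp1_def expect_exp_def by (subst nn_integral_density) auto

lemma measurable_component_EW:
  assumes "f \<in> measurable M EW" shows "(\<lambda>\<omega>. f \<omega> i) \<in> borel_measurable M"
proof -
  have "(\<lambda>\<omega>. f \<omega> i) \<in> measurable M Exp1"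
    using measurable_compose[OF assms measurable_component_singleton[of i UNIV "\<lambda>_. Exp1"]] by simp
  then show ?thesis by (simp cong: measurable_cong_sets)
qed

lemma measurable_fun_upd_EW [measurable (raw)]:
  assumes [measurable]: "f \<in> measurable M EW" "g \<in> borel_measurable M"
  shows "(\<lambda>\<omega>. (f \<omega>)(x := g \<omega>)) \<in> measurable M EW"
proof (rule measurable_PiM_single')
  note [measurable] = measurable_component_EW[OF assms(1)]
  fix i show "(\<lambda>\<omega>. ((f \<omega>)(x := g \<omega>)) i) \<in> measurable M Exp1"
    by (cases "i = x") auto
qed auto

text \<open>Overwriting one coordinate of an i.i.d. family by an independent copy preserves its law.
  This isolates a single clock from the others.\<close>

lemma EW_resample:
  assumes [measurable]: "G \<in> borel_measurable EW"
  shows "(\<integral>\<^sup>+w. G w \<partial>EW) = (\<integral>\<^sup>+t. \<integral>\<^sup>+w. G (w(x := t)) \<partial>EW \<partial>Exp1)"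
proof -
  interpret E: prob_space Exp1 by (rule prob_space_Exp1)
  interpret W: prob_space EW by (rule prob_space_EW)
  interpret pair_sigma_finite Exp1 EW ..
  have *: "distr (Exp1 \<Otimes>\<^sub>M EW) EW (\<lambda>(t, w). w(x := t)) = EW"
    using distr_pair_PiM_eq_PiM[of UNIV "\<lambda>_. Exp1" x] prob_space_Exp1 by simp
  have [measurable]: "(\<lambda>(t, w). w(x := t)) \<in> measurable (Exp1 \<Otimes>\<^sub>M EW) EW"
    unfolding split_beta by measurable
  have "(\<integral>\<^sup>+w. G w \<partial>EW) = (\<integral>\<^sup>+w. G w \<partial>distr (Exp1 \<Otimes>\<^sub>M EW) EW (\<lambda>(t, w). w(x := t)))"
    by (simp only: *)
  also have "\<dots> = (\<integral>\<^sup>+z. G ((\<lambda>(t, w). w(x := t)) z) \<partial>(Exp1 \<Otimes>\<^sub>M EW))"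
    by (subst nn_integral_distr) auto
  also have "\<dots> = (\<integral>\<^sup>+t. \<integral>\<^sup>+w. G (w(x := t)) \<partial>EW \<partial>Exp1)"
    by (subst W.nn_integral_fst[symmetric]) auto
  finally show ?thesis .
qed

lemma EW_permute:
  assumes [measurable]: "G \<in> borel_measurable EW" and \<pi>: "inj \<pi>"
  shows "(\<integral>\<^sup>+w. G (\<lambda>z. w (\<pi> z)) \<partial>EW) = (\<integral>\<^sup>+w. G w \<partial>EW)"
proof -
  have *: "distr EW EW (\<lambda>\<omega>. \<lambda>n\<in>UNIV. \<omega> (\<pi> n)) = EW"
    using distr_PiM_reindex[of UNIV "\<lambda>_. Exp1" \<pi> UNIV] prob_space_Exp1 \<pi> by simp
  have "(\<integral>\<^sup>+w. G w \<partial>EW) = (\<integral>\<^sup>+w. G w \<partial>distr EW EW (\<lambda>\<omega>. \<lambda>n\<in>UNIV. \<omega> (\<pi> n)))"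
    by (simp only: *)
  also have "\<dots> = (\<integral>\<^sup>+w. G (\<lambda>n\<in>UNIV. w (\<pi> n)) \<partial>EW)"
    by (subst nn_integral_distr) (auto intro!: measurable_PiM_single')
  also have "\<dots> = (\<integral>\<^sup>+w. G (\<lambda>z. w (\<pi> z)) \<partial>EW)"
    by (simp add: restrict_def)
  finally show ?thesis ..
qed

lemma expect_exp_const:
  assumes "S > 0" shows "expect_exp S (\<lambda>_. c) = c"
proof -
  interpret prob_space "density lborel (exponential_density (real S))"
    using assms by (intro prob_space_exponential_density) simp
  have "expect_exp S (\<lambda>_. c) = (\<integral>\<^sup>+t. c \<partial>density lborel (exponential_density (real S)))"
    unfolding expect_exp_def by (subst nn_integral_density) auto
  then show ?thesis using emeasure_space_1 by simp
qed

lemma expect_exp_add: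
  assumes [measurable]: "f \<in> borel_measurable borel" "g \<in> borel_measurable borel"
  shows "expect_exp S (\<lambda>t. f t + g t) = expect_exp S f + expect_exp S g"
  unfolding expect_exp_def by (simp add: distrib_left nn_integral_add)

lemma expect_exp_cmult:
  assumes [measurable]: "f \<in> borel_measurable borel"
  shows "expect_exp S (\<lambda>t. c * f t) = c * expect_exp S f"
  unfolding expect_exp_def by (subst nn_integral_cmult[symmetric]) (auto simp: mult_ac)

lemma expect_exp_sum:
  assumes "\<And>i. i \<in> I \<Longrightarrow> f i \<in> borel_measurable borel"
  shows "expect_exp S (\<lambda>t. \<Sum>i\<in>I. f i t) = (\<Sum>i\<in>I. expect_exp S (f i))"
  unfolding expect_exp_def sum_distrib_left using assms by (subst nn_integral_sum) auto

lemma expect_exp_mono: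
  assumes "\<And>t. t \<ge> 0 \<Longrightarrow> f t \<le> g t"
  shows "expect_exp S f \<le> expect_exp S g"
  unfolding expect_exp_def using assms
  by (intro nn_integral_mono) (auto simp: exponential_density_def intro!: mult_left_mono)

lemma expect_exp_cong:
  assumes "\<And>t. t \<ge> 0 \<Longrightarrow> f t = g t"
  shows "expect_exp S f = expect_exp S g"
  unfolding expect_exp_def using assms
  by (intro nn_integral_cong) (auto simp: exponential_density_def)

lemma borel_measurable_expect_exp:
  assumes [measurable]: "(\<lambda>(x, t). f x t) \<in> borel_measurable (M \<Otimes>\<^sub>M borel)"
  shows "(\<lambda>x. expect_exp S (f x)) \<in> borel_measurable M"
  unfolding expect_exp_def by measurable

text \<open>The mean waiting time in units of \<open>c\<close>. It is the price of a delay when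
  losses of time are paid for linearly.\<close>

lemma expect_exp_ident:
  assumes "S > 0" shows "expect_exp S (\<lambda>t. ennreal (t / c)) \<le> ennreal (1 / (real S * c))"
proof (cases "c > 0")
  case False
  then have "expect_exp S (\<lambda>t. ennreal (t / c)) \<le> expect_exp S (\<lambda>t. 0)"
    by (intro expect_exp_mono) (auto simp: divide_nonneg_nonpos ennreal_neg)
  also have "\<dots> = 0" using assms by (rule expect_exp_const)
  finally show ?thesis by simp
next
  case True
  have "expect_exp S (\<lambda>t. ennreal (t / c)) =
      (\<integral>\<^sup>+t. ennreal (1 / c) * ennreal (erlang_density 0 (real S) t * t ^ 1) \<partial>lborel)"
    unfolding expect_exp_def using True
    by (intro nn_integral_cong)
       (simp add: exponential_density_def erlang_density_def ennreal_mult[symmetric])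
  also have "\<dots> = ennreal (1 / c) * (\<integral>\<^sup>+t. ennreal (erlang_density 0 (real S) t * t ^ 1) \<partial>lborel)"
    by (subst nn_integral_cmult) simp_all
  also have "(\<integral>\<^sup>+t. ennreal (erlang_density 0 (real S) t * t ^ 1) \<partial>lborel) = ennreal (1 / real S)"
    using assms nn_integral_erlang_ith_moment[of "real S" 0 1] by simp
  finally show ?thesis using True assms by (simp add: ennreal_mult[symmetric] field_simps)
qed

text \<open>Lack of memory: conditionally on all clocks in \<open>C\<close> exceeding \<open>t\<close>, the excesses are again
  independent standard exponentials.\<close>

lemma EW_shift1:
  assumes t: "t \<ge> 0" and [measurable]: "f \<in> borel_measurable EW"
  shows "(\<integral>\<^sup>+w. indicator {t<..} (w c) * f (w(c := w c - t)) \<partial>EW) = ennreal (exp (- t)) * (\<integral>\<^sup>+w. f w \<partial>EW)"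
proof -
  interpret W: prob_space EW by (rule prob_space_EW)
  have [measurable]: "(\<lambda>u. \<integral>\<^sup>+ w. f (w(c := u)) \<partial>EW) \<in> borel_measurable borel" by measurable
  have "(\<integral>\<^sup>+w. indicator {t<..} (w c) * f (w(c := w c - t)) \<partial>EW)
      = (\<integral>\<^sup>+u. \<integral>\<^sup>+w. indicator {t<..} u * f (w(c := u - t)) \<partial>EW \<partial>Exp1)"
    by (subst EW_resample[where x=c]) auto
  also have "\<dots> = (\<integral>\<^sup>+u. indicator {t<..} u * (\<integral>\<^sup>+w. f (w(c := u - t)) \<partial>EW) \<partial>Exp1)"
    by (intro nn_integral_cong) (simp add: nn_integral_cmult)
  also have "\<dots> = (\<integral>\<^sup>+u. ennreal (exponential_density 1 u) * (indicator {t<..} u * (\<integral>\<^sup>+w. f (w(c := u - t)) \<partial>EW)) \<partial>lborel)"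
    by (subst nn_integral_Exp1) (auto simp: expect_exp_def)
  also have "\<dots> = (\<integral>\<^sup>+u. ennreal (exponential_density 1 (t + 1 * u)) * (indicator {t<..} (t + 1 * u) * (\<integral>\<^sup>+w. f (w(c := t + 1 * u - t)) \<partial>EW)) \<partial>lborel)"
    by (subst nn_integral_real_affine[where c=1 and t=t]) auto
  also have "\<dots> = (\<integral>\<^sup>+u. ennreal (exp (-t)) * (ennreal (exponential_density 1 u) * (\<integral>\<^sup>+w. f (w(c := u)) \<partial>EW)) \<partial>lborel)"
  proof (rule nn_integral_cong_AE)
    \<comment> \<open>The two integrands can differ only at \<open>u = 0\<close>, where the strict
      indicator vanishes and the density does not.\<close>
    have "AE u in lborel. u \<noteq> (0::real)" by (rule AE_lborel_singleton)
    then show "AE u in lborel. ennreal (exponential_density 1 (t + 1 * u)) * (indicator {t<..} (t + 1 * u) * (\<integral>\<^sup>+w. f (w(c := t + 1 * u - t)) \<partial>EW)) = ennreal (exp (-t)) * (ennreal (exponential_density 1 u) * (\<integral>\<^sup>+w. f (w(c := u)) \<partial>EW))"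
    proof eventually_elim
      case (elim u)
      show ?case
      proof (cases "u > 0")
        case True
        then have "ennreal (exponential_density 1 (t + u)) = ennreal (exp (-t)) * ennreal (exponential_density 1 u)"
          using t by (simp add: exponential_density_def ennreal_mult[symmetric] exp_add[symmetric])
        then show ?thesis using True by (simp add: mult.assoc)
      qed (use elim in \<open>auto simp: exponential_density_def\<close>)
    qed
  qed
  also have "\<dots> = ennreal (exp (-t)) * (\<integral>\<^sup>+u. (\<integral>\<^sup>+w. f (w(c := u)) \<partial>EW) \<partial>Exp1)"
    by (subst nn_integral_cmult) (auto simp: nn_integral_Exp1 expect_exp_def)
  also have "(\<integral>\<^sup>+u. (\<integral>\<^sup>+w. f (w(c := u)) \<partial>EW) \<partial>Exp1) = (\<integral>\<^sup>+w. f w \<partial>EW)"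
    by (rule EW_resample[symmetric]) simp
  finally show ?thesis .
qed

definition shift_on :: "'a set \<Rightarrow> real \<Rightarrow> ('a \<Rightarrow> real) \<Rightarrow> 'a \<Rightarrow> real" where
  "shift_on C t w = (\<lambda>z. if z \<in> C then w z - t else w z)"

lemma measurable_shift_on [measurable (raw)]:
  assumes [measurable]: "f \<in> measurable M EW" "g \<in> borel_measurable M"
  shows "(\<lambda>\<omega>. shift_on C (g \<omega>) (f \<omega>)) \<in> measurable M EW"
proof (rule measurable_PiM_single')
  note [measurable] = measurable_component_EW[OF assms(1)]
  fix i show "(\<lambda>\<omega>. shift_on C (g \<omega>) (f \<omega>) i) \<in> measurable M Exp1"
    by (cases "i \<in> C") (auto simp: shift_on_def)
qed auto

text \<open>Induction on \<open>C\<close>: every clock that survives to time \<open>t\<close>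
  contributes a factor \<open>exp (- t)\<close> and is replaced by its excess.\<close>

lemma EW_shift:
  assumes "finite C" and t: "t \<ge> 0" and "f \<in> borel_measurable EW"
  shows "(\<integral>\<^sup>+w. indicator {w. \<forall>z\<in>C. t < w z} w * f (shift_on C t w) \<partial>EW)
    = ennreal (exp (- t * card C)) * (\<integral>\<^sup>+w. f w \<partial>EW)"
  using assms(1,3)
proof (induction C arbitrary: f)
  case empty
  have "shift_on {} t = (\<lambda>w::stub\<Rightarrow>real. w)" by (auto simp: shift_on_def)
  then show ?case by simp
next
  case (insert c C)
  note [measurable] = insert.prems
  have eq: "indicator {w. \<forall>z\<in>insert c C. t < w z} w * f (shift_on (insert c C) t w)
     = indicator {w. \<forall>z\<in>C. t < w z} w * (indicator {t<..} (shift_on C t w c) * f ((shift_on C t w)(c := shift_on C t w c - t)))" for w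
  proof -
    have "shift_on (insert c C) t w = (shift_on C t w)(c := shift_on C t w c - t)"
      using insert.hyps by (auto simp: shift_on_def)
    moreover have "shift_on C t w c = w c" using insert.hyps by (auto simp: shift_on_def)
    ultimately show ?thesis by (auto simp: indicator_def)
  qed
  have "(\<integral>\<^sup>+w. indicator {w. \<forall>z\<in>insert c C. t < w z} w * f (shift_on (insert c C) t w) \<partial>EW)
    = ennreal (exp (- t * card C)) * (\<integral>\<^sup>+w. indicator {t<..} (w c) * f (w(c := w c - t)) \<partial>EW)"
    unfolding eq by (subst insert.IH) auto
  also have "\<dots> = ennreal (exp (- t * card (insert c C))) * (\<integral>\<^sup>+w. f w \<partial>EW)"
    using insert.hyps EW_shift1[OF t, of f c]
    by (simp add: mult.assoc[symmetric] ennreal_mult[symmetric] exp_add[symmetric] algebra_simps)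
  finally show ?case .
qed

text \<open>Competing exponential clocks: the position of the minimum is uniform and independent of
  its value, whose rate is \<open>card A\<close>, and the excesses of the other clocks are fresh.
  The test function must ignore the clock at \<open>x\<close>, because the clock that rang is used
  up.\<close>

lemma EW_first:
  assumes A: "finite A" "x \<in> A" and [measurable]: "f \<in> borel_measurable (borel \<Otimes>\<^sub>M EW)"
    and indep: "\<And>t w u. f (t, w(x := u)) = f (t, w)"
  shows "(\<integral>\<^sup>+w. indicator {w. 0 < w x \<and> (\<forall>z\<in>A-{x}. w x < w z)} w * f (w x, shift_on (A-{x}) (w x) w) \<partial>EW)
     = ennreal (1 / card A) * expect_exp (card A) (\<lambda>t. \<integral>\<^sup>+w. f (t, w) \<partial>EW)"
proof -
  interpret W: prob_space EW by (rule prob_space_EW)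
  let ?C = "A - {x}"
  have C: "finite ?C" using A by simp
  have cA: "card A = Suc (card ?C)" using A by (metis card_Suc_Diff1)
  have [measurable]: "Measurable.pred EW (\<lambda>w. 0 < w x \<and> (\<forall>z\<in>?C. w x < w z))"
    using C by measurable
  have [measurable]: "Measurable.pred (borel \<Otimes>\<^sub>M EW) (\<lambda>z. 0 < fst z \<and> (\<forall>y\<in>?C. fst z < snd z y))"
    using C by measurable
  have meas: "(\<lambda>t::real. indicator {0<..} t * (ennreal (exp (- t * card ?C)) * (\<integral>\<^sup>+w. f (t, w) \<partial>EW))) \<in> borel_measurable borel"
    by measurable
  have "(\<integral>\<^sup>+w. indicator {w. 0 < w x \<and> (\<forall>z\<in>?C. w x < w z)} w * f (w x, shift_on ?C (w x) w) \<partial>EW)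
     = (\<integral>\<^sup>+t. \<integral>\<^sup>+w. indicator {0<..} t * (indicator {w. \<forall>z\<in>?C. t < w z} w * f (t, shift_on ?C t w)) \<partial>EW \<partial>Exp1)"
  proof (subst EW_resample[where x=x], measurable, intro nn_integral_cong)
    fix t w
    have "shift_on ?C t (w(x := t)) = (shift_on ?C t w)(x := t)" by (auto simp: shift_on_def)
    then have "f (t, shift_on ?C t (w(x := t))) = f (t, shift_on ?C t w)" by (simp add: indep)
    then show "indicator {w. 0 < w x \<and> (\<forall>z\<in>?C. w x < w z)} (w(x := t)) * f ((w(x := t)) x, shift_on ?C ((w(x := t)) x) (w(x := t)))
       = indicator {0<..} t * (indicator {w. \<forall>z\<in>?C. t < w z} w * f (t, shift_on ?C t w))"
      by (auto simp: indicator_def)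
  qed
  also have "\<dots> = (\<integral>\<^sup>+t. indicator {0<..} t * (ennreal (exp (- t * card ?C)) * (\<integral>\<^sup>+w. f (t, w) \<partial>EW)) \<partial>Exp1)"
  proof (intro nn_integral_cong)
    fix t :: real
    have [measurable]: "(\<lambda>w. f (t, w)) \<in> borel_measurable EW" by measurable
    show "(\<integral>\<^sup>+w. indicator {0<..} t * (indicator {w. \<forall>z\<in>?C. t < w z} w * f (t, shift_on ?C t w)) \<partial>EW)
       = indicator {0<..} t * (ennreal (exp (- t * card ?C)) * (\<integral>\<^sup>+w. f (t, w) \<partial>EW))"
    proof (cases "t > 0")
      case True
      then show ?thesis using EW_shift[OF C, of t "\<lambda>w. f (t, w)"] by simp
    qed simp
  qed
  also have "\<dots> = (\<integral>\<^sup>+t. ennreal (1 / card A) * (ennreal (exponential_density (real (card A)) t) * (\<integral>\<^sup>+w. f (t, w) \<partial>EW)) \<partial>lborel)"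
    unfolding nn_integral_Exp1[OF meas] expect_exp_def
  proof (intro nn_integral_cong_AE)
    have "AE u in lborel. u \<noteq> (0::real)" by (rule AE_lborel_singleton)
    then show "AE t in lborel. ennreal (exponential_density (real 1) t) * (indicator {0<..} t * (ennreal (exp (- t * card ?C)) * (\<integral>\<^sup>+w. f (t, w) \<partial>EW)))
      = ennreal (1 / card A) * (ennreal (exponential_density (real (card A)) t) * (\<integral>\<^sup>+w. f (t, w) \<partial>EW))"
    proof eventually_elim
      case (elim t)
      have "ennreal (exponential_density (real 1) t) * (indicator {0<..} t * ennreal (exp (- t * card ?C)))
         = ennreal (1 / card A) * ennreal (exponential_density (real (card A)) t)"
      proof (cases "t > 0")
        case True
        have "exp (- t) * exp (- t * card ?C) = exp (- t * card A)"
          unfolding cA by (simp add: exp_add[symmetric] algebra_simps)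
        moreover have "real (card A) > 0" unfolding cA by simp
        ultimately show ?thesis using True
          by (simp add: exponential_density_def ennreal_mult[symmetric] mult.commute)
      qed (use elim in \<open>auto simp: exponential_density_def\<close>)
      then show ?case by (simp only: mult.assoc[symmetric])
    qed
  qed
  also have "\<dots> = ennreal (1 / card A) * expect_exp (card A) (\<lambda>t. \<integral>\<^sup>+w. f (t, w) \<partial>EW)"
    unfolding expect_exp_def by (subst nn_integral_cmult) auto
  finally show ?thesis .
qed

subsection \<open>Uniform pairings\<close>

lemma pairingsD:
  assumes "p \<in> pairings S"
  shows "s \<in> S \<Longrightarrow> p s \<in> S" "s \<in> S \<Longrightarrow> p s \<noteq> s" "p (p s) = s" "s \<notin> S \<Longrightarrow> p s = s"
proof -
  have *: "\<forall>s\<in>S. p s \<in> S \<and> p s \<noteq> s \<and> p (p s) = s" "\<forall>s. s \<notin> S \<longrightarrow> p s = s"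
    using assms unfolding pairings_def by blast+
  show "s \<in> S \<Longrightarrow> p s \<in> S" "s \<in> S \<Longrightarrow> p s \<noteq> s" "s \<notin> S \<Longrightarrow> p s = s" using * by blast+
  show "p (p s) = s" using * by (cases "s \<in> S") metis+
qed

text \<open>A pairing is the identity off \<open>S\<close>, hence determined by its restriction to
  \<open>S\<close>, and there are finitely many such restrictions.\<close>

lemma finite_pairings:
  assumes "finite S" shows "finite (pairings S)"
proof (rule finite_imageD)
  show "inj_on (\<lambda>f x. if x \<in> S then f x else undefined) (pairings S)"
  proof (rule inj_onI, rule ext)
    fix p q s assume pq: "p \<in> pairings S" "q \<in> pairings S"
      and eq: "(\<lambda>x. if x \<in> S then p x else undefined) = (\<lambda>x. if x \<in> S then q x else undefined)"
    show "p s = q s"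
      using fun_cong[OF eq, of s] pairingsD(4)[OF pq(1), of s] pairingsD(4)[OF pq(2), of s]
      by (cases "s \<in> S") auto
  qed
  have "(\<lambda>f x. if x \<in> S then f x else undefined) ` pairings S
      \<subseteq> {f. \<forall>x. (x \<in> S \<longrightarrow> f x \<in> S) \<and> (x \<notin> S \<longrightarrow> f x = undefined)}"
    by (auto simp: pairingsD(1))
  then show "finite ((\<lambda>f x. if x \<in> S then f x else undefined) ` pairings S)"
    by (rule finite_subset) (rule finite_set_of_finite_funs[OF assms assms])
qed

text \<open>Deferred decisions: once the partner of \<open>x\<close> is revealed, what remains is an
  arbitrary pairing of the other stubs.\<close>

lemma bij_betw_pairings_remove:
  assumes xy: "x \<in> S" "y \<in> S" "x \<noteq> y"
  shows "bij_betw (\<lambda>q. q(x := y, y := x)) (pairings (S - {x, y})) {p \<in> pairings S. p x = y}"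
proof (rule bij_betwI[where g="\<lambda>p. p(x := x, y := y)"])
  show "(\<lambda>q. q(x := y, y := x)) \<in> pairings (S - {x, y}) \<rightarrow> {p \<in> pairings S. p x = y}"
  proof
    fix q assume q: "q \<in> pairings (S - {x, y})"
    note d = pairingsD[OF q]
    have "q s \<in> S - {x, y}" if "s \<in> S" "s \<noteq> x" "s \<noteq> y" for s using d(1)[of s] that by auto
    then show "q(x := y, y := x) \<in> {p \<in> pairings S. p x = y}"
      using d(2-4) xy unfolding pairings_def by (auto simp del: fun_upd_apply simp: fun_upd_def)
  qed
  show "(\<lambda>p. p(x := x, y := y)) \<in> {p \<in> pairings S. p x = y} \<rightarrow> pairings (S - {x, y})"
  proof
    fix p assume p: "p \<in> {p \<in> pairings S. p x = y}"
    then have d: "s \<in> S \<Longrightarrow> p s \<in> S" "s \<in> S \<Longrightarrow> p s \<noteq> s" "p (p s) = s" "s \<notin> S \<Longrightarrow> p s = s" for s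
      using pairingsD[of p S] by auto
    have "p y = x" using d(3)[of x] p by auto
    moreover have "p s \<noteq> x" if "s \<noteq> y" for s using d(3)[of s] that p by auto
    moreover have "p s \<noteq> y" if "s \<noteq> x" for s using d(3)[of s] that \<open>p y = x\<close> by auto
    ultimately show "p(x := x, y := y) \<in> pairings (S - {x, y})"
      using d xy unfolding pairings_def by auto
  qed
  fix q assume q: "q \<in> pairings (S - {x, y})"
  have "q x = x" "q y = y" using pairingsD(4)[OF q] by auto
  then show "(q(x := y, y := x))(x := x, y := y) = q" by (auto simp: fun_eq_iff)
next
  fix p assume p: "p \<in> {p \<in> pairings S. p x = y}"
  then have "p y = x" using pairingsD(3)[of p S x] by auto
  then show "(p(x := x, y := y))(x := y, y := x) = p" using p by (auto simp: fun_eq_iff)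
qed

lemma sum_pairings:
  assumes "finite S" "x \<in> S"
  shows "(\<Sum>p\<in>pairings S. g p) = (\<Sum>y\<in>S-{x}. \<Sum>q\<in>pairings (S - {x, y}). g (q(x := y, y := x)))"
proof -
  have px: "(\<lambda>p. p x) ` pairings S \<subseteq> S - {x}"
  proof (rule image_subsetI)
    fix p assume "p \<in> pairings S"
    then show "p x \<in> S - {x}" using pairingsD(1,2)[of p S x] assms(2) by simp
  qed
  have "(\<Sum>p\<in>pairings S. g p) = (\<Sum>y\<in>S-{x}. sum g {p \<in> pairings S. p x = y})"
    using sum.group[OF finite_pairings[OF assms(1)] _ px, of g] assms by simp
  also have "\<dots> = (\<Sum>y\<in>S-{x}. \<Sum>q\<in>pairings (S - {x, y}). g (q(x := y, y := x)))"
    using assms bij_betw_pairings_remove[of x S]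
    by (intro sum.cong refl sum.reindex_bij_betw[symmetric]) auto
  finally show ?thesis .
qed

text \<open>The double factorial of \<open>card S - 1\<close>. Since the count depends on
  \<open>card S\<close> alone, the partner of a given stub is uniform.\<close>

lemma card_pairings_formula:
  assumes "finite S" "card S = 2 * k"
  shows "card (pairings S) = (\<Prod>i<k. 2 * i + 1)"
  using assms
proof (induction k arbitrary: S)
  case 0
  then have "pairings S = {id}" by (auto simp: pairings_def fun_eq_iff)
  then show ?case by simp
next
  case (Suc k)
  then have "S \<noteq> {}" by auto
  then obtain x where x: "x \<in> S" by blast
  have "card (pairings S) = (\<Sum>y\<in>S-{x}. card (pairings (S - {x, y})))"
    using sum_pairings[OF Suc.prems(1) x, of "\<lambda>_. 1::nat"] by simp
  also have "\<dots> = (\<Sum>y\<in>S-{x}. (\<Prod>i<k. 2 * i + 1))"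
  proof (intro sum.cong refl Suc.IH)
    fix y assume "y \<in> S - {x}"
    then show "card (S - {x, y}) = 2 * k" "finite (S - {x, y})"
      using Suc.prems x by (auto simp: card_Diff_subset)
  qed
  also have "\<dots> = (\<Prod>i<Suc k. 2 * i + 1)" using x Suc.prems by simp
  finally show ?case .
qed

lemma card_pairings:
  assumes "finite S" "even (card S)" "x \<in> S" "y \<in> S" "x \<noteq> y"
  shows "card (pairings S) = (card S - 1) * card (pairings (S - {x, y}))"
proof -
  obtain k where k: "card S = 2 * k" using assms(2) by (auto elim: evenE)
  with assms have "k > 0" by (cases k) auto
  then obtain k' where k': "k = Suc k'" by (cases k) auto
  have "card (S - {x, y}) = 2 * k'" using assms k k' by (auto simp: card_Diff_subset)
  then show ?thesis
    using assms k k' card_pairings_formula[of S k] card_pairings_formula[of "S - {x, y}" k'] by simp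
qed

lemma card_pairings_pos:
  assumes "finite S" "even (card S)" shows "card (pairings S) > 0"
  using assms by (auto elim!: evenE simp: card_pairings_formula prod_pos)

subsection \<open>Walks between two explored clusters\<close>

text \<open>A walk is recorded by the stubs through which it leaves its vertices. It may land only
  on dormant stubs before its final landing in \<open>B\<close>. The start in \<open>A\<close> is
  demanded separately in \<open>opt\<close>, so that a suffix of a walk is again of this
  form.\<close>

inductive leads :: "(stub \<Rightarrow> stub) \<Rightarrow> stub set \<Rightarrow> stub set \<Rightarrow> stub list \<Rightarrow> bool"
  for p :: "stub \<Rightarrow> stub" and U B :: "stub set" where
  leads_last: "p x \<in> B \<Longrightarrow> leads p U B [x]"
| leads_step: "p x \<in> U \<Longrightarrow> y \<in> U \<Longrightarrow> fst y = fst (p x) \<Longrightarrow> leads p U B (y # ys) \<Longrightarrow> leads p U B (x # y # ys)"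

definition cost :: "(stub \<Rightarrow> real) \<Rightarrow> stub list \<Rightarrow> real" where
  "cost e xs = sum_list (map e xs)"

definition hops :: "(stub \<Rightarrow> nat) \<Rightarrow> (stub \<Rightarrow> stub) \<Rightarrow> stub list \<Rightarrow> nat" where
  "hops h p xs = h (hd xs) + h (p (last xs)) + length xs"

text \<open>\<open>opt p e A U B h t k\<close>: the lexicographically smallest pair (weight, number of edges) over all walks
  from the cluster with active stubs \<open>A\<close> to the cluster with active stubs \<open>B\<close> is \<open>(t, k)\<close>, where an
  active stub \<open>s\<close> already contributes \<open>h s\<close> edges.\<close>

definition opt where
  "opt p e A U B h t k \<longleftrightarrow>
     (\<exists>xs. leads p U B xs \<and> hd xs \<in> A \<and> cost e xs = t \<and> hops h p xs = k) \<and>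
     (\<forall>xs. leads p U B xs \<longrightarrow> hd xs \<in> A \<longrightarrow> t < cost e xs \<or> t = cost e xs \<and> k \<le> hops h p xs)"

lemma leads_nonempty: "leads p U B xs \<Longrightarrow> xs \<noteq> []"
  by (induction rule: leads.induct) auto

lemma leads_tl: "leads p U B xs \<Longrightarrow> set (tl xs) \<subseteq> U"
  by (induction rule: leads.induct) auto

lemma leads_image: "leads p U B xs \<Longrightarrow> p ` set xs \<subseteq> U \<union> B"
  by (induction rule: leads.induct) auto

lemma leads_cong:
  assumes "leads p U B xs" "U \<subseteq> U'" "\<And>s. s \<in> set xs \<Longrightarrow> p' s = p s"
  shows "leads p' U' B xs"
  using assms by (induction rule: leads.induct) (auto intro!: leads.intros)

lemma leads_last_image: "leads p U B xs \<Longrightarrow> p (last xs) \<in> B"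
  by (induction rule: leads.induct) auto

text \<open>When the vertex \<open>v\<close> joins the growing cluster, a walk through
  \<open>v\<close> survives only from its last exit from \<open>v\<close> on. That suffix avoids the
  stubs \<open>N\<close> of \<open>v\<close> after its first stub.\<close>

lemma leads_last_exit:
  assumes "leads p U B xs" "N = {s \<in> U. fst s = v}"
  shows "leads p (U - N) B xs \<or> (\<exists>ys z zs. xs = ys @ z # zs \<and> ys \<noteq> [] \<and> z \<in> N \<and> leads p (U - N) B (z # zs))"
  using assms
proof (induction rule: leads.induct)
  case (leads_last x)
  then show ?case by (auto intro: leads.intros)
next
  case (leads_step x y ys)
  from leads_step.IH[OF leads_step.prems] show ?case
  proof
    assume l: "leads p (U - N) B (y # ys)"
    show ?thesis
    proof (cases "y \<in> N")
      case True
      then have "x # y # ys = [x] @ y # ys \<and> [x] \<noteq> [] \<and> y \<in> N \<and> leads p (U - N) B (y # ys)" using l by simp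
      then show ?thesis by blast
    next
      case False
      then have "p x \<in> U - N" "y \<in> U - N" using leads_step by auto
      then have "leads p (U - N) B (x # y # ys)"
        using l leads_step.hyps(3) by (intro leads.leads_step)
      then show ?thesis ..
    qed
  next
    assume "\<exists>ys' z zs. y # ys = ys' @ z # zs \<and> ys' \<noteq> [] \<and> z \<in> N \<and> leads p (U - N) B (z # zs)"
    then obtain ys' z zs where *: "y # ys = ys' @ z # zs" "z \<in> N" "leads p (U - N) B (z # zs)" by blast
    then have "x # y # ys = (x # ys') @ z # zs \<and> x # ys' \<noteq> [] \<and> z \<in> N \<and> leads p (U - N) B (z # zs)" by simp
    then show ?thesis by blast
  qed
qed

lemma cost_cong: "(\<And>s. s \<in> set xs \<Longrightarrow> e s = e' s) \<Longrightarrow> cost e xs = cost e' xs"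
  unfolding cost_def by (metis map_cong)

lemma cost_append: "cost e (xs @ ys) = cost e xs + cost e ys"
  by (simp add: cost_def)

lemma cost_Cons: "cost e (x # xs) = e x + cost e xs"
  by (simp add: cost_def)

lemma cost_nonneg: "(\<And>s. s \<in> set xs \<Longrightarrow> 0 \<le> e s) \<Longrightarrow> 0 \<le> cost e xs"
  unfolding cost_def by (rule sum_list_nonneg) auto

lemma cost_hd_le: "xs \<noteq> [] \<Longrightarrow> (\<And>s. s \<in> set xs \<Longrightarrow> 0 \<le> e s) \<Longrightarrow> e (hd xs) \<le> cost e xs"
  using cost_nonneg[of "tl xs" e] by (cases xs) (auto simp: cost_Cons)

text \<open>Admissible walks use only edges from \<open>A \<union> U\<close> to
  \<open>U \<union> B\<close>, so edges inside a cluster may carry arbitrary weights.\<close>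

lemma opt_cong:
  assumes o: "opt p e A U B h t k" and e: "\<And>s. s \<in> A \<union> U \<Longrightarrow> p s \<in> U \<union> B \<Longrightarrow> e' s = e s"
  shows "opt p e' A U B h t k"
proof -
  have c: "cost e' xs = cost e xs" if "leads p U B xs" "hd xs \<in> A" for xs
  proof (rule cost_cong, rule e)
    fix s assume s: "s \<in> set xs"
    show "p s \<in> U \<union> B" using leads_image[OF that(1)] s by blast
    show "s \<in> A \<union> U" using leads_tl[OF that(1)] that(2) s leads_nonempty[OF that(1)] by (cases xs) auto
  qed
  show ?thesis using o unfolding opt_def by (metis c)
qed

text \<open>Reduces a step of the exploration to two comparisons: every walk of the new state lifts
  to one of the old state that is longer in time by exactly \<open>t\<close>, and every old walk is
  lexicographically dominated by such a lift.\<close>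

lemma opt_transfer:
  assumes o: "opt p' e' A' U' B h' t' k"
    and new: "\<And>xs. leads p' U' B xs \<Longrightarrow> hd xs \<in> A' \<Longrightarrow>
       \<exists>ys. leads p U B ys \<and> hd ys \<in> A \<and> cost e ys = t + cost e' xs \<and> hops h p ys = hops h' p' xs"
    and old: "\<And>ys. leads p U B ys \<Longrightarrow> hd ys \<in> A \<Longrightarrow>
       (\<exists>xs. leads p' U' B xs \<and> hd xs \<in> A' \<and>
         (t + cost e' xs < cost e ys \<or> t + cost e' xs = cost e ys \<and> hops h' p' xs \<le> hops h p ys))"
  shows "opt p e A U B h (t + t') k"
  unfolding opt_def
proof (intro conjI allI impI)
  obtain xs where xs: "leads p' U' B xs" "hd xs \<in> A'" "cost e' xs = t'" "hops h' p' xs = k"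
    using o unfolding opt_def by blast
  show "\<exists>xs. leads p U B xs \<and> hd xs \<in> A \<and> cost e xs = t + t' \<and> hops h p xs = k"
    using new[OF xs(1,2)] xs(3,4) by auto
next
  fix ys assume "leads p U B ys" "hd ys \<in> A"
  from old[OF this] obtain xs where xs: "leads p' U' B xs" "hd xs \<in> A'"
    "t + cost e' xs < cost e ys \<or> t + cost e' xs = cost e ys \<and> hops h' p' xs \<le> hops h p ys" by blast
  have "t' < cost e' xs \<or> t' = cost e' xs \<and> k \<le> hops h' p' xs"
    using o xs(1,2) unfolding opt_def by blast
  then show "t + t' < cost e ys \<or> t + t' = cost e ys \<and> k \<le> hops h p ys" using xs(3) by auto
qed

section \<open>The optimal walk before and after the first active stub \<open>x\<close> rings and
  reveals its partner \<open>y\<close>\<close>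

context
  fixes p :: "stub \<Rightarrow> stub" and e :: "stub \<Rightarrow> real" and A U B :: "stub set" and h :: "stub \<Rightarrow> nat"
    and x y :: stub
  assumes disj: "A \<inter> B = {}" "A \<inter> U = {}" "U \<inter> B = {}"
    and invol: "\<And>s. p (p s) = s" and nonneg: "\<And>s. 0 \<le> e s"
    and x: "x \<in> A" and y: "p x = y" and first: "\<And>z. z \<in> A - {x} \<Longrightarrow> e x < e z"
begin

lemma py: "p y = x" using y invol by blast

text \<open>A walk costs at least its first edge, and \<open>x\<close> is strictly the cheapest
  active stub. A walk starting with \<open>x\<close> lands in \<open>B\<close> immediately and stops
  there.\<close>

lemma opt_hit:
  assumes "y \<in> B" shows "opt p e A U B h (e x) (h x + h y + 1)"
  unfolding opt_def
proof (intro conjI allI impI)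
  have "leads p U B [x]" using assms y by (auto intro: leads_last)
  then show "\<exists>xs. leads p U B xs \<and> hd xs \<in> A \<and> cost e xs = e x \<and> hops h p xs = h x + h y + 1"
    using x y by (intro exI[of _ "[x]"]) (auto simp: cost_def hops_def)
next
  fix xs assume xs: "leads p U B xs" "hd xs \<in> A"
  note ne = leads_nonempty[OF xs(1)]
  show "e x < cost e xs \<or> e x = cost e xs \<and> h x + h y + 1 \<le> hops h p xs"
  proof (cases "hd xs = x")
    case False
    then have "e x < e (hd xs)" using first xs(2) by blast
    also have "\<dots> \<le> cost e xs" using ne nonneg by (intro cost_hd_le)
    finally show ?thesis by simp
  next
    case True
    have "xs = [x]"
      using xs(1) by (cases rule: leads.cases) (use True y assms disj in auto)
    then show ?thesis using y by (simp add: cost_def hops_def)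
  qed
qed

text \<open>Neither \<open>x\<close> nor \<open>y\<close> can start an admissible walk, as their
  edge stays inside the cluster. All other active stubs have waited for the time \<open>e x\<close>,
  which is taken off their first edge.\<close>

lemma opt_internal:
  assumes "y \<in> A" and p': "\<And>s. s \<noteq> x \<Longrightarrow> s \<noteq> y \<Longrightarrow> p' s = p s"
    and e'A: "\<And>z. z \<in> A - {x, y} \<Longrightarrow> p z \<in> U \<union> B \<Longrightarrow> e' z = e z - e x"
    and e'U: "\<And>s. s \<in> U \<Longrightarrow> p s \<in> U \<union> B \<Longrightarrow> e' s = e s"
    and o: "opt p' e' (A - {x, y}) U B h t' k"
  shows "opt p e A U B h (e x + t') k"
proof -
  have c: "cost e xs = e x + cost e' xs \<and> (\<forall>s\<in>set xs. s \<noteq> x \<and> s \<noteq> y)"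
    if l: "leads p U B xs" and hd: "hd xs \<in> A - {x, y}" for xs
  proof -
    obtain z zs where xs: "xs = z # zs" using leads_nonempty[OF l] by (cases xs) auto
    have tl: "set zs \<subseteq> U" using leads_tl[OF l] xs by simp
    have im: "p ` set xs \<subseteq> U \<union> B" by (rule leads_image[OF l])
    have "e z = e x + e' z" using e'A[of z] hd im xs by auto
    moreover have "cost e zs = cost e' zs" using tl im xs by (intro cost_cong e'U[symmetric]) auto
    moreover have "\<forall>s\<in>set xs. s \<noteq> x \<and> s \<noteq> y" using tl hd xs x assms(1) disj by auto
    ultimately show ?thesis by (simp add: xs cost_Cons)
  qed
  show ?thesis using o
  proof (rule opt_transfer)
    fix xs assume l: "leads p' U B xs" and hd: "hd xs \<in> A - {x, y}"
    have ne: "\<forall>s\<in>set xs. s \<noteq> x \<and> s \<noteq> y"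
      using leads_tl[OF l] hd leads_nonempty[OF l] x assms(1) disj by (cases xs) auto
    have l': "leads p U B xs" using ne p' by (intro leads_cong[OF l]) auto
    have "hops h p xs = hops h p' xs" using ne p' leads_nonempty[OF l] by (simp add: hops_def)
    then show "\<exists>ys. leads p U B ys \<and> hd ys \<in> A \<and> cost e ys = e x + cost e' xs \<and> hops h p ys = hops h p' xs"
      using l' c[OF l' hd] hd by (intro exI[of _ xs]) auto
  next
    fix ys assume l: "leads p U B ys" and hd: "hd ys \<in> A"
    have "p (hd ys) \<in> U \<union> B" using leads_image[OF l] leads_nonempty[OF l] by (cases ys) auto
    then have hd': "hd ys \<in> A - {x, y}" using hd y py x assms(1) disj by auto
    note c' = c[OF l hd']
    have "leads p' U B ys" using c' p' by (intro leads_cong[OF l]) auto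
    moreover have "hops h p ys = hops h p' ys" using c' p' leads_nonempty[OF l] by (simp add: hops_def)
    ultimately show "\<exists>xs. leads p' U B xs \<and> hd xs \<in> A - {x, y} \<and>
         (e x + cost e' xs < cost e ys \<or> e x + cost e' xs = cost e ys \<and> hops h p' xs \<le> hops h p ys)"
      using hd' c' by (intro exI[of _ ys]) auto
  qed
qed

text \<open>A walk entering the new vertex through \<open>x\<close> is replaced by its continuation
  from one of the other stubs of that vertex, which are now active. A walk that visits the vertex in
  any other way is cut at its last exit. Weights may vanish, so ties in cost have to be decided by
  the number of edges.\<close>

lemma opt_fresh:
  assumes "y \<in> U" and N: "N = {s \<in> U. fst s = fst y}" and hv: "\<And>s. s \<in> A \<union> B \<Longrightarrow> fst s \<noteq> fst y"
    and p': "\<And>s. s \<noteq> x \<Longrightarrow> s \<noteq> y \<Longrightarrow> p' s = p s"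
    and e'A: "\<And>z. z \<in> A - {x} \<Longrightarrow> p z \<in> U \<union> B \<Longrightarrow> e' z = e z - e x"
    and e'U: "\<And>s. s \<in> U - {y} \<Longrightarrow> p s \<in> U \<union> B \<Longrightarrow> e' s = e s"
    and o: "opt p' e' (A - {x} \<union> (N - {y})) (U - N) B (\<lambda>s. if fst s = fst y then h x + 1 else h s) t' k"
  shows "opt p e A U B h (e x + t') k"
proof -
  let ?h = "\<lambda>s. if fst s = fst y then h x + 1 else h s"
  have yN: "y \<in> N" using assms(1) N by auto
  have NU: "N \<subseteq> U" using N by auto
  have cU: "cost e xs = cost e' xs \<and> (\<forall>s\<in>set xs. s \<noteq> x \<and> s \<noteq> y)"
    if l: "leads p (U - N) B xs" and hd: "hd xs \<in> N - {y}" for xs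
  proof -
    have tl: "set (tl xs) \<subseteq> U - N" by (rule leads_tl[OF l])
    have im: "p ` set xs \<subseteq> U \<union> B" using leads_image[OF l] by auto
    have *: "set xs \<subseteq> U - {y}" using tl hd NU yN leads_nonempty[OF l] by (cases xs) auto
    then show ?thesis using im x disj by (intro conjI cost_cong e'U[symmetric]) auto
  qed
  have cA: "cost e xs = e x + cost e' xs \<and> (\<forall>s\<in>set xs. s \<noteq> x \<and> s \<noteq> y)"
    if l: "leads p (U - N) B xs" and hd: "hd xs \<in> A - {x}" for xs
  proof -
    obtain z zs where xs: "xs = z # zs" using leads_nonempty[OF l] by (cases xs) auto
    have tl: "set zs \<subseteq> U - N" using leads_tl[OF l] xs by simp
    have im: "p ` set xs \<subseteq> U \<union> B" using leads_image[OF l] by auto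
    have "e z = e x + e' z" using e'A[of z] hd im xs by auto
    moreover have "cost e zs = cost e' zs" using tl im xs yN by (intro cost_cong e'U[symmetric]) auto
    moreover have "\<forall>s\<in>set xs. s \<noteq> x \<and> s \<noteq> y" using tl hd xs x yN NU disj by auto
    ultimately show ?thesis by (simp add: xs cost_Cons)
  qed
  have hB: "?h (p (last xs)) = h (p (last xs))" if "leads p V B xs" for xs V
    using hv leads_last_image[OF that] by auto
  show ?thesis using o
  proof (rule opt_transfer)
    fix xs assume l: "leads p' (U - N) B xs" and hd: "hd xs \<in> A - {x} \<union> (N - {y})"
    note nonempty = leads_nonempty[OF l]
    have ne: "\<forall>s\<in>set xs. s \<noteq> x \<and> s \<noteq> y"
      using leads_tl[OF l] hd nonempty x yN NU disj by (cases xs) auto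
    have l': "leads p (U - N) B xs" using ne p' by (intro leads_cong[OF l]) auto
    have l'': "leads p U B xs" using ne p' by (intro leads_cong[OF l]) auto
    have pl: "p' (last xs) = p (last xs)" using ne p' nonempty by simp
    show "\<exists>ys. leads p U B ys \<and> hd ys \<in> A \<and> cost e ys = e x + cost e' xs \<and> hops h p ys = hops ?h p' xs"
    proof (cases "hd xs \<in> A - {x}")
      case True
      then show ?thesis using l'' cA[OF l' True] hv pl hB[OF l']
        by (intro exI[of _ xs]) (auto simp: hops_def)
    next
      case False
      with hd have hdN: "hd xs \<in> N - {y}" by auto
      obtain z zs where xs: "xs = z # zs" using nonempty by (cases xs) auto
      have "leads p U B (x # z # zs)"
        using l'' xs y yN NU hdN N by (intro leads_step) auto
      then show ?thesis using cU[OF l' hdN] xs x hdN N pl hB[OF l']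
        by (intro exI[of _ "x # xs"]) (auto simp: hops_def cost_Cons)
    qed
  next
    fix ys assume l: "leads p U B ys" and hd: "hd ys \<in> A"
    note nonempty = leads_nonempty[OF l]
    show "\<exists>xs. leads p' (U - N) B xs \<and> hd xs \<in> A - {x} \<union> (N - {y}) \<and>
         (e x + cost e' xs < cost e ys \<or> e x + cost e' xs = cost e ys \<and> hops ?h p' xs \<le> hops h p ys)"
      using leads_last_exit[OF l N]
    proof
      assume l': "leads p (U - N) B ys"
      have "p (hd ys) \<in> (U - N) \<union> B" using leads_image[OF l'] nonempty by (cases ys) auto
      then have hd': "hd ys \<in> A - {x}" using hd y yN NU disj by auto
      note c = cA[OF l' hd']
      have "leads p' (U - N) B ys" using c p' by (intro leads_cong[OF l']) auto
      moreover have "p' (last ys) = p (last ys)" using c p' nonempty by simp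
      ultimately show ?thesis using hd' c hv hB[OF l]
        by (intro exI[of _ ys]) (auto simp: hops_def)
    next
      assume "\<exists>us z zs. ys = us @ z # zs \<and> us \<noteq> [] \<and> z \<in> N \<and> leads p (U - N) B (z # zs)"
      then obtain us z zs where *: "ys = us @ z # zs" "us \<noteq> []" "z \<in> N" and l': "leads p (U - N) B (z # zs)"
        by blast
      have "p z \<in> U \<union> B" using leads_image[OF l'] by auto
      \<comment> \<open>The last exit is not through \<open>y\<close>, since that edge leads back to
        the active stub \<open>x\<close>.\<close>
      then have "z \<noteq> y" using py x disj by auto
      then have z: "hd (z # zs) \<in> N - {y}" using * by simp
      note c = cU[OF l' z]
      have ll: "leads p' (U - N) B (z # zs)" using c p' by (intro leads_cong[OF l']) auto
      have pl: "p' (last (z # zs)) = p (last (z # zs))" using c p' by (cases zs) auto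
      have cy: "cost e ys = cost e us + cost e' (z # zs)" using c * by (simp add: cost_append)
      have hdus: "hd ys = hd us" using * by simp
      have us: "e (hd us) \<le> cost e us" using *(2) nonneg by (intro cost_hd_le)
      \<comment> \<open>The discarded prefix \<open>us\<close> costs strictly more than
        \<open>e x\<close> unless it starts with \<open>x\<close>. In that case its cost may equal
        \<open>e x\<close>, but its length is at least one, which covers the increase of the label
        by one edge.\<close>
      have "e x + cost e' (z # zs) < cost e ys \<or> e x + cost e' (z # zs) = cost e ys \<and> hops ?h p' (z # zs) \<le> hops h p ys"
      proof (cases "hd us = x")
        case False
        then have "e x < e (hd us)" using first hd hdus by auto
        then show ?thesis using us cy by simp
      next
        case True
        have "fst z = fst y" using * N by auto
        moreover have "length us \<ge> 1" using *(2) by (cases us) auto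
        moreover have "last ys = last (z # zs)" using * by simp
        moreover have "hops ?h p' (z # zs) = ?h z + ?h (p (last (z # zs))) + length (z # zs)"
          by (simp add: hops_def pl del: last.simps)
        moreover have "hops h p ys = h x + h (p (last (z # zs))) + (length us + length (z # zs))"
          using * True hdus by (simp add: hops_def)
        ultimately have "hops ?h p' (z # zs) \<le> hops h p ys"
          unfolding hB[OF l'] by simp
        then show ?thesis using us True cy by auto
      qed
      then show ?thesis using ll z by (intro exI[of _ "z # zs"]) auto
    qed
  qed
qed

end

section \<open>Reversal of walks, which makes the roles of the two clusters interchangeable\<close>

lemma leads_snoc:
  assumes "leads p U {y} xs" "y \<in> U" "z \<in> U" "fst z = fst y" "p z \<in> D"
  shows "leads p U D (xs @ [z])"
  using assms
proof (induction rule: leads.induct)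
  case (leads_last x)
  then show ?case by (auto intro!: leads.intros)
qed (auto intro!: leads.intros)

lemma leads_rev:
  assumes "leads p U B xs" "\<And>s. p (p s) = s"
  shows "leads p U {hd xs} (map p (rev xs))"
  using assms
proof (induction rule: leads.induct)
  case (leads_last x)
  have "p (p x) = x" by (rule leads_last.prems)
  then show ?case by (auto intro!: leads.leads_last)
next
  case (leads_step x y ys)
  have "leads p U {y} (map p (rev (y # ys)))" using leads_step by simp
  then have "leads p U {x} (map p (rev (y # ys)) @ [p x])"
    using leads_step.hyps leads_step.prems by (intro leads_snoc[where y=y]) auto
  then show ?case by simp
qed

lemma leads_target_mono: "leads p U B xs \<Longrightarrow> B \<subseteq> B' \<Longrightarrow> leads p U B' xs"
  by (induction rule: leads.induct) (auto intro: leads.intros)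

lemma walk_reverse:
  assumes "leads p U B xs" "hd xs \<in> A" and p: "\<And>s. p (p s) = s" and e: "\<And>s. e (p s) = e s"
  shows "leads p U A (map p (rev xs))" "hd (map p (rev xs)) \<in> B"
    "cost e (map p (rev xs)) = cost e xs" "hops h p (map p (rev xs)) = hops h p xs"
proof -
  have ne: "xs \<noteq> []" by (rule leads_nonempty[OF assms(1)])
  show "leads p U A (map p (rev xs))"
    using leads_rev[OF assms(1) p] assms(2) by (auto intro: leads_target_mono)
  have hd: "hd (map p (rev xs)) = p (last xs)" using ne by (simp add: hd_map hd_rev)
  then show "hd (map p (rev xs)) \<in> B" using leads_last_image[OF assms(1)] by simp
  have "map e (map p (rev xs)) = rev (map e xs)" by (simp add: e rev_map o_def)
  then show "cost e (map p (rev xs)) = cost e xs" by (simp add: cost_def)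
  have "p (last (map p (rev xs))) = hd xs" using ne p by (simp add: last_map last_rev)
  then show "hops h p (map p (rev xs)) = hops h p xs" using hd by (simp add: hops_def)
qed

lemma opt_swap:
  assumes o: "opt p e A U B h t k" and p: "\<And>s. p (p s) = s" and e: "\<And>s. e (p s) = e s"
  shows "opt p e B U A h t k"
  unfolding opt_def
proof (intro conjI allI impI)
  obtain xs where xs: "leads p U B xs" "hd xs \<in> A" "cost e xs = t" "hops h p xs = k"
    using o unfolding opt_def by blast
  show "\<exists>xs. leads p U A xs \<and> hd xs \<in> B \<and> cost e xs = t \<and> hops h p xs = k"
    using walk_reverse[of p U B xs A e, OF xs(1,2) p e] xs(3,4) by metis
next
  fix xs assume "leads p U A xs" "hd xs \<in> B"
  note r = walk_reverse[of p U A xs B e, OF this p e]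
  show "t < cost e xs \<or> t = cost e xs \<and> k \<le> hops h p xs"
    using o r unfolding opt_def by metis
qed

subsection \<open>The two clusters at the start\<close>

lemma stub_min_commute: "stub_min s t = stub_min t s"
  by (auto simp: stub_min_def prod_eq_iff)

lemma edge_weight_sym:
  assumes "p (p s) = s" shows "edge_weight p w (p s) = edge_weight p w s"
  by (simp add: edge_weight_def assms stub_min_commute)

definition dormant_stubs :: "(nat \<Rightarrow> nat) \<Rightarrow> nat set \<Rightarrow> stub set" where
  "dormant_stubs d V = {(v, j). v \<in> V \<and> j < d v}"

text \<open>Paths of the graph may return to the end points, the walks in \<open>opt\<close> may
  not. Cutting out such detours increases neither weight nor length, so the lexicographic minimum is
  the same; in particular the infimum defining the weight is attained.\<close>

lemma opt_imp_CM:
  assumes p: "p \<in> pairings (stubs n d)" and w: "\<And>s. 0 \<le> w s" and n: "n \<ge> 2"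
    and o: "opt p (edge_weight p w) (dormant_stubs d {0}) (dormant_stubs d {2..<n}) (dormant_stubs d {1}) (\<lambda>_. 0) t k"
  shows "CM_connected n ((d, p), w)" "CM_W n ((d, p), w) = t" "CM_H n ((d, p), w) = k"
proof -
  let ?S = "stubs n d" and ?A = "dormant_stubs d {0}" and ?U = "dormant_stubs d {2..<n}" and ?B = "dormant_stubs d {1}"
  let ?e = "edge_weight p w"
  have pS: "p s \<in> ?S" if "s \<in> ?S" for s using pairingsD(1)[OF p that] .
  have e0: "0 \<le> ?e s" for s using w by (simp add: edge_weight_def)
  have cost_eq: "path_weight p w ps = cost ?e ps" for ps by (simp add: path_weight_def cost_def)
  have mem: "s \<in> ?S \<longleftrightarrow> s \<in> ?A \<union> ?U \<union> ?B" for s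
    using n by (cases s) (auto simp: stubs_def dormant_stubs_def)
  have inA: "s \<in> ?A \<longleftrightarrow> s \<in> ?S \<and> fst s = 0" and inB: "s \<in> ?B \<longleftrightarrow> s \<in> ?S \<and> fst s = 1"
    and inU: "s \<in> ?U \<longleftrightarrow> s \<in> ?S \<and> fst s \<ge> 2" for s
    using n by (cases s; auto simp: stubs_def dormant_stubs_def)+
  have path1: "is_path ?S p (fst (hd xs)) xs 1" if "leads p ?U ?B xs" "hd xs \<in> ?S" for xs
    using that
  proof (induction rule: leads.induct)
    case (leads_last x)
    then have "fst (p x) = 1" using inB by blast
    then show ?case using leads_last by simp
  next
    case (leads_step x y ys)
    then show ?case using inU by auto
  qed
  \<comment> \<open>Induction along the path: if the walk obtained from the tail already starts at
    vertex \<open>0\<close>, the first stub is dropped, otherwise it is prepended; the walk is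
    stopped at the first arrival at vertex \<open>1\<close>.\<close>
  have path2: "\<exists>xs. leads p ?U ?B xs \<and> (hd xs \<in> ?A \<or> u \<ge> 2 \<and> hd xs \<in> ?U \<and> fst (hd xs) = u) \<and>
      cost ?e xs \<le> cost ?e ps \<and> length xs \<le> length ps" if "is_path ?S p u ps 1" "u \<noteq> 1" for u ps
    using that
  proof (induction ps arbitrary: u)
    case (Cons s ps)
    then have s: "s \<in> ?S" "fst s = u" "is_path ?S p (fst (p s)) ps 1" by auto
    have start: "s \<in> ?A \<or> u \<ge> 2 \<and> s \<in> ?U \<and> fst s = u" using s Cons.prems(2) inA inU by (cases "u = 0") auto
    have c: "cost ?e (s # ps) = ?e s + cost ?e ps" by (rule cost_Cons)
    show ?case
    proof (cases "fst (p s) = 1")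
      case True
      then have "p s \<in> ?B" using pS[OF s(1)] inB by blast
      then have "leads p ?U ?B [s]" by (rule leads_last)
      moreover have "cost ?e [s] \<le> cost ?e (s # ps)" using cost_nonneg[of ps ?e] e0 by (simp add: cost_Cons cost_def)
      ultimately show ?thesis using start by (intro exI[of _ "[s]"]) auto
    next
      case False
      from Cons.IH[OF s(3) False] obtain xs where xs: "leads p ?U ?B xs"
        "hd xs \<in> ?A \<or> fst (p s) \<ge> 2 \<and> hd xs \<in> ?U \<and> fst (hd xs) = fst (p s)"
        "cost ?e xs \<le> cost ?e ps" "length xs \<le> length ps" by blast
      show ?thesis
      proof (cases "hd xs \<in> ?A")
        case True
        then show ?thesis using xs c e0[of s] by (intro exI[of _ xs]) auto
      next
        case False
        with xs have f: "fst (p s) \<ge> 2" "hd xs \<in> ?U" "fst (hd xs) = fst (p s)" by auto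
        obtain z zs where z: "xs = z # zs" using leads_nonempty[OF xs(1)] by (cases xs) auto
        have "p s \<in> ?U" using pS[OF s(1)] f inU by blast
        then have "leads p ?U ?B (s # xs)" using xs(1) f z by (auto intro: leads_step)
        then show ?thesis using start xs c by (intro exI[of _ "s # xs"]) (auto simp: cost_Cons)
      qed
    qed
  qed simp
  obtain xs where xs: "leads p ?U ?B xs" "hd xs \<in> ?A" "cost ?e xs = t" "hops (\<lambda>_. 0) p xs = k"
    using o unfolding opt_def by blast
  have path: "is_path ?S p 0 xs 1" using path1[OF xs(1)] xs(2) inA by metis
  have len: "length xs = k" using xs(4) by (simp add: hops_def)
  have lower: "t < cost ?e ps \<or> t = cost ?e ps \<and> k \<le> length ps" if "is_path ?S p 0 ps 1" for ps
  proof -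
    from path2[OF that] obtain ys where ys: "leads p ?U ?B ys" "hd ys \<in> ?A" "cost ?e ys \<le> cost ?e ps" "length ys \<le> length ps"
      by auto
    have "t < cost ?e ys \<or> t = cost ?e ys \<and> k \<le> length ys"
      using o ys(1,2) unfolding opt_def hops_def by auto
    then show ?thesis using ys by auto
  qed
  show "CM_connected n ((d, p), w)" using path by (auto simp: CM_connected_def)
  have "Inf {path_weight p w ps | ps. is_path ?S p 0 ps 1} = t"
  proof (rule cInf_eq_minimum)
    show "t \<in> {path_weight p w ps | ps. is_path ?S p 0 ps 1}" using path xs(3) cost_eq by auto
    fix z assume "z \<in> {path_weight p w ps | ps. is_path ?S p 0 ps 1}"
    then obtain ps where "z = cost ?e ps" "is_path ?S p 0 ps 1" using cost_eq by auto
    then show "t \<le> z" using lower by fastforce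
  qed
  then show W: "CM_W n ((d, p), w) = t" by (simp add: CM_W_def)
  show "CM_H n ((d, p), w) = k"
    unfolding CM_H_def prod.case W
  proof (rule Least_equality)
    show "\<exists>ps. is_path ?S p 0 ps 1 \<and> length ps = k \<and> path_weight p w ps = t"
      using path len xs(3) cost_eq by auto
    fix j assume "\<exists>ps. is_path ?S p 0 ps 1 \<and> length ps = j \<and> path_weight p w ps = t"
    then show "k \<le> j" using lower cost_eq by fastforce
  qed
qed

subsection \<open>One step of the exploration\<close>

text \<open>Here \<open>\<tau>\<close> is the time already spent, not the tail exponent. With this
  offset \<open>E\<close> always speaks of the total weight and the total number of edges.\<close>

definition opt_in where
  "opt_in E \<tau> p e A U B h \<longleftrightarrow> (\<exists>t k. opt p e A U B h t k \<and> (\<tau> + t, k) \<in> E)"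

lemma opt_in_cong:
  assumes e: "\<And>s. s \<in> A \<union> U \<Longrightarrow> p s \<in> U \<union> B \<Longrightarrow> e' s = e s"
  shows "opt_in E \<tau> p e' A U B h \<longleftrightarrow> opt_in E \<tau> p e A U B h"
  unfolding opt_in_def using opt_cong[of p e A U B h _ _ e'] opt_cong[of p e' A U B h _ _ e] e by metis

text \<open>Walks are lists over a countable type, so optimality is a countable combination of
  comparisons of finite sums.\<close>

lemma measurable_opt_in:
  fixes e :: "'a \<Rightarrow> stub \<Rightarrow> real"
  assumes E: "E \<in> sets (borel \<Otimes>\<^sub>M count_space UNIV)" and [measurable]: "f \<in> borel_measurable M"
    and [measurable]: "\<And>s. (\<lambda>\<omega>. e \<omega> s) \<in> borel_measurable M"
  shows "Measurable.pred M (\<lambda>\<omega>. opt_in E (f \<omega>) p (e \<omega>) A U B h)"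
proof -
  have c [measurable]: "(\<lambda>\<omega>. cost (e \<omega>) xs) \<in> borel_measurable M" for xs
    by (induction xs) (auto simp: cost_def)
  have [measurable]: "Measurable.pred M (\<lambda>\<omega>. (f \<omega> + cost (e \<omega>) xs, hops h p xs) \<in> E)" for xs
  proof -
    have "(\<lambda>\<omega>. (f \<omega> + cost (e \<omega>) xs, hops h p xs)) \<in> measurable M (borel \<Otimes>\<^sub>M count_space UNIV)"
      by (intro measurable_Pair) auto
    from measurable_compose[OF this, of "\<lambda>z. z \<in> E" "count_space UNIV"] show ?thesis
      using E by (simp add: pred_def)
  qed
  have "opt_in E (f \<omega>) p (e \<omega>) A U B h \<longleftrightarrow>
    (\<exists>xs. leads p U B xs \<and> hd xs \<in> A \<and> (f \<omega> + cost (e \<omega>) xs, hops h p xs) \<in> E \<and>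
      (\<forall>ys. leads p U B ys \<longrightarrow> hd ys \<in> A \<longrightarrow>
        cost (e \<omega>) xs < cost (e \<omega>) ys \<or> cost (e \<omega>) xs = cost (e \<omega>) ys \<and> hops h p xs \<le> hops h p ys))" for \<omega>
    unfolding opt_in_def opt_def by blast
  then show ?thesis by simp
qed

text \<open>Attaches the weight of an edge to its end in \<open>C\<close>, so that distinct active
  stubs own distinct independent clocks. An edge with both ends in \<open>C\<close> receives two
  clocks, which is harmless because \<open>opt\<close> never sees it.\<close>

definition clock_weight :: "stub set \<Rightarrow> (stub \<Rightarrow> stub) \<Rightarrow> (stub \<Rightarrow> real) \<Rightarrow> stub \<Rightarrow> real" where
  "clock_weight C p w s = (if s \<in> C then w s else if p s \<in> C then w (p s) else edge_weight p w s)"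

lemma measurable_edge_weight [measurable]: "(\<lambda>w. edge_weight p w s) \<in> borel_measurable EW"
  unfolding edge_weight_def by (rule measurable_component_EW) simp

lemma measurable_clock_weight [measurable]: "(\<lambda>w. clock_weight C p w s) \<in> borel_measurable EW"
  unfolding clock_weight_def
  by (cases "s \<in> C"; cases "p s \<in> C") (auto intro: measurable_component_EW)

lemma stub_min_cases: "stub_min s t = s \<or> stub_min s t = t"
  by (simp add: stub_min_def)

text \<open>Reading the weight of an edge at its end in \<open>C\<close> instead of at its smaller end amounts to a
  permutation of the i.i.d. weights.\<close>

lemma nn_integral_clock_weight:
  assumes E: "E \<in> sets (borel \<Otimes>\<^sub>M count_space UNIV)" and p: "\<And>s. p (p s) = s"
    and C: "\<And>s. s \<in> A \<union> U \<Longrightarrow> p s \<in> U \<union> B \<Longrightarrow> \<not> (s \<in> C \<and> p s \<in> C)"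
  shows "(\<integral>\<^sup>+w. indicator {w. opt_in E \<tau> p (clock_weight C p w) A U B h} w \<partial>EW)
    = (\<integral>\<^sup>+w. indicator {w. opt_in E \<tau> p (edge_weight p w) A U B h} w \<partial>EW)"
proof -
  \<comment> \<open>Exchanges the two ends of an edge with exactly one end in \<open>C\<close>
    whenever its smaller end is the one outside. This is an involution, hence injective.\<close>
  define \<pi> where "\<pi> = (\<lambda>s. if (s \<in> C \<longleftrightarrow> p s \<notin> C) \<and> stub_min s (p s) \<notin> C then p s else s)"
  have \<pi>\<pi>: "\<pi> (\<pi> s) = s" for s
    by (auto simp: \<pi>_def p stub_min_commute)
  have inj: "inj \<pi>" by (metis \<pi>\<pi> injI)
  let ?G = "\<lambda>w. indicator {w. opt_in E \<tau> p (edge_weight p w) A U B h} w :: ennreal"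
  have [measurable]: "Measurable.pred EW (\<lambda>w. opt_in E \<tau> p (edge_weight p w) A U B h)"
    by (rule measurable_opt_in[OF E]) auto
  have meas: "?G \<in> borel_measurable EW" by measurable
  have "?G (\<lambda>z. w (\<pi> z)) = indicator {w. opt_in E \<tau> p (clock_weight C p w) A U B h} w" for w
  proof -
    have "opt_in E \<tau> p (edge_weight p (\<lambda>z. w (\<pi> z))) A U B h \<longleftrightarrow> opt_in E \<tau> p (clock_weight C p w) A U B h"
    proof (rule opt_in_cong)
      fix s assume s: "s \<in> A \<union> U" "p s \<in> U \<union> B"
      have sm: "stub_min (p s) s = stub_min s (p s)" by (rule stub_min_commute)
      consider "s \<in> C" "p s \<notin> C" | "s \<notin> C" "p s \<in> C" | "s \<notin> C" "p s \<notin> C" using C[OF s] by blast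
      then show "edge_weight p (\<lambda>z. w (\<pi> z)) s = clock_weight C p w s"
        using stub_min_cases[of s "p s"]
        by cases (elim disjE; simp add: edge_weight_def clock_weight_def \<pi>_def p sm)+
    qed
    then show ?thesis by (simp add: indicator_def)
  qed
  then show ?thesis using EW_permute[OF meas inj] by simp
qed

text \<open>The conditional success probability given the explored clusters and all degrees: the
  unrevealed part is a uniform pairing of the remaining stubs with fresh exponential
  weights.\<close>

definition meet_prob ::
    "(nat \<Rightarrow> nat) \<Rightarrow> nat set \<Rightarrow> stub set \<Rightarrow> stub set \<Rightarrow> (stub \<Rightarrow> nat) \<Rightarrow> (real \<times> nat) set \<Rightarrow> real \<Rightarrow> ennreal" where
  "meet_prob d V A B h E \<tau> =
     ennreal (1 / card (pairings (A \<union> B \<union> dormant_stubs d V))) *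
     (\<Sum>p\<in>pairings (A \<union> B \<union> dormant_stubs d V).
        \<integral>\<^sup>+w. indicator {w. opt_in E \<tau> p (edge_weight p w) A (dormant_stubs d V) B h} w \<partial>EW)"

lemma finite_dormant_stubs: "finite V \<Longrightarrow> finite (dormant_stubs d V)"
  by (rule finite_subset[of _ "Sigma V (\<lambda>v. {..<d v})"]) (auto simp: dormant_stubs_def)

lemma measurable_meet_prob:
  assumes E: "E \<in> sets (borel \<Otimes>\<^sub>M count_space UNIV)"
  shows "meet_prob d V A B h E \<in> borel_measurable borel"
proof -
  interpret W: prob_space EW by (rule prob_space_EW)
  have m: "Measurable.pred (borel \<Otimes>\<^sub>M EW) (\<lambda>z. opt_in E (fst z) p (edge_weight p (snd z)) A (dormant_stubs d V) B h)" for p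
  proof (rule measurable_opt_in[OF E])
    fix s show "(\<lambda>\<omega>. edge_weight p (snd \<omega>) s) \<in> borel_measurable (borel \<Otimes>\<^sub>M EW)"
      by (rule measurable_compose[OF measurable_snd measurable_edge_weight])
  qed simp
  have "(\<lambda>\<tau>. \<integral>\<^sup>+w. indicator {w. opt_in E \<tau> p (edge_weight p w) A (dormant_stubs d V) B h} w \<partial>EW) \<in> borel_measurable borel" for p
  proof -
    have "(\<lambda>z. indicator {z. opt_in E (fst z) p (edge_weight p (snd z)) A (dormant_stubs d V) B h} z :: ennreal) \<in> borel_measurable (borel \<Otimes>\<^sub>M EW)"
      using m by measurable
    then have "(\<lambda>\<tau>. \<integral>\<^sup>+w. indicator {z. opt_in E (fst z) p (edge_weight p (snd z)) A (dormant_stubs d V) B h} (\<tau>, w) \<partial>EW) \<in> borel_measurable borel"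
      by (intro W.borel_measurable_nn_integral) (simp add: split_beta')
    then show ?thesis by (simp add: indicator_def)
  qed
  then show ?thesis unfolding meet_prob_def by measurable
qed

lemma meet_prob_swap:
  "meet_prob d V A B h E \<tau> = meet_prob d V B A h E \<tau>"
proof -
  have "opt_in E \<tau> p (edge_weight p w) A U B h \<longleftrightarrow> opt_in E \<tau> p (edge_weight p w) B U A h"
    if "p \<in> pairings X" for p w U X
    unfolding opt_in_def
    using opt_swap[of p _ A U B h] opt_swap[of p _ B U A h] pairingsD(3)[OF that] edge_weight_sym[of p] by metis
  then show ?thesis
    unfolding meet_prob_def by (simp add: Un_commute[of A B] cong: sum.cong)
qed

lemma AE_EW_nonneg: "AE w in EW. \<forall>s. 0 \<le> w s"
proof -
  have "AE t in Exp1. 0 \<le> t"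
    unfolding Exp1_def by (subst AE_density) (auto simp: exponential_density_def)
  then show ?thesis
    unfolding AE_all_countable by (intro allI AE_PiM_component prob_space_Exp1) auto
qed

lemma clock_weight_nonneg: "(\<And>s. 0 \<le> w s) \<Longrightarrow> 0 \<le> clock_weight C p w s"
  by (simp add: clock_weight_def edge_weight_def)

text \<open>The success probability after \<open>x\<close> has rung at total time
  \<open>\<tau>\<close> and its partner is known to be \<open>y\<close>. The cases are a collision,
  an edge inside the cluster, and a new vertex.\<close>

definition next_val where
  "next_val d V A B h E \<tau> x y =
    (if y \<in> B then indicator E (\<tau>, h x + h y + 1)
     else if y \<in> A then meet_prob d V (A - {x, y}) B h E \<tau>
     else meet_prob d (V - {fst y}) (A - {x} \<union> (dormant_stubs d {fst y} - {y})) B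
       (\<lambda>s. if fst s = fst y then h x + 1 else h s) E \<tau>)"

lemma borel_measurable_next_val:
  assumes E: "E \<in> sets (borel \<Otimes>\<^sub>M count_space UNIV)"
  shows "(\<lambda>t. next_val d V A B h E (\<tau> + t) x y) \<in> borel_measurable borel"
proof -
  have "(\<lambda>t. indicator E (\<tau> + t, k) :: ennreal) \<in> borel_measurable borel" for k :: nat
  proof -
    have [measurable]: "(\<lambda>t. (\<tau> + t, k)) \<in> measurable borel (borel \<Otimes>\<^sub>M count_space UNIV)" by measurable
    show ?thesis using E by measurable
  qed
  moreover have "(\<lambda>t. meet_prob d V A B h E (\<tau> + t)) \<in> borel_measurable borel" for V A B h
    by (rule measurable_compose[OF _ measurable_meet_prob[OF E]]) simp
  ultimately show ?thesis unfolding next_val_def by simp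
qed

text \<open>For a fixed pairing and on the event that \<open>x\<close> rings first, the outcome is
  governed by \<open>opt_hit\<close>, \<open>opt_internal\<close> or \<open>opt_fresh\<close>,
  according to the place of \<open>y\<close>. \<open>EW_first\<close> then trades the shifted clocks
  for fresh ones.\<close>

lemma first_ring:
  assumes E: "E \<in> sets (borel \<Otimes>\<^sub>M count_space UNIV)"
    and A: "finite A" "x \<in> A" and U: "U = dormant_stubs d V"
    and disj: "A \<inter> B = {}" "\<And>s. s \<in> A \<union> B \<Longrightarrow> fst s \<notin> V"
    and y: "y \<in> A \<union> B \<union> U" "y \<noteq> x"
    and q: "q \<in> pairings (A \<union> B \<union> U - {x, y})" and p: "p = q(x := y, y := x)"
  shows "ennreal (1 / card A) * expect_exp (card A) (\<lambda>t.
       if y \<in> B then indicator E (\<tau> + t, h x + h y + 1)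
       else if y \<in> A then (\<integral>\<^sup>+w. indicator {w. opt_in E (\<tau> + t) q (edge_weight q w) (A - {x, y}) U B h} w \<partial>EW)
       else (\<integral>\<^sup>+w. indicator {w. opt_in E (\<tau> + t) q (edge_weight q w)
          (A - {x} \<union> (dormant_stubs d {fst y} - {y})) (dormant_stubs d (V - {fst y})) B
          (\<lambda>s. if fst s = fst y then h x + 1 else h s)} w \<partial>EW))
     \<le> (\<integral>\<^sup>+w. indicator {w. 0 < w x \<and> (\<forall>z\<in>A-{x}. w x < w z)} w *
           indicator {w. opt_in E \<tau> p (clock_weight A p w) A U B h} w \<partial>EW)"
    (is "_ * expect_exp _ ?R \<le> ?I")
proof -
  interpret W: prob_space EW by (rule prob_space_EW)
  have UV: "fst s \<in> V" if "s \<in> U" for s using that U by (auto simp: dormant_stubs_def)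
  have disj': "A \<inter> U = {}" "U \<inter> B = {}" using disj(2) UV by blast+
  have qx: "q x = x" "q y = y" using pairingsD(4)[OF q] by auto
  have qq: "q (q s) = s" for s using pairingsD(3)[OF q] .
  have pp: "p (p s) = s" for s
  proof -
    have "s \<noteq> x \<Longrightarrow> s \<noteq> y \<Longrightarrow> q s \<noteq> x \<and> q s \<noteq> y" using qx qq by metis
    then show ?thesis using qq y(2) by (auto simp: p)
  qed
  have px: "p x = y" using y(2) by (simp add: p)
  have q_eq: "q s = p s" if "s \<noteq> x" "s \<noteq> y" for s using that by (simp add: p)
  have finC: "finite (A - {x})" using A by simp
  let ?F = "{w. 0 < w x \<and> (\<forall>z\<in>A-{x}. w x < w z)}"
  let ?T = "{w. opt_in E \<tau> p (clock_weight A p w) A U B h}"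
  have key: "ennreal (1 / card A) * expect_exp (card A) (\<lambda>t. \<integral>\<^sup>+w. f (t, w) \<partial>EW) \<le> ?I"
    if f: "f \<in> borel_measurable (borel \<Otimes>\<^sub>M EW)" and ind: "\<And>t w u. f (t, w(x := u)) = f (t, w)"
      and le: "\<And>w. (\<And>s. 0 \<le> w s) \<Longrightarrow> w \<in> ?F \<Longrightarrow> f (w x, shift_on (A - {x}) (w x) w) \<le> indicator ?T w" for f
    unfolding EW_first[OF A f ind, symmetric]
  proof (rule nn_integral_mono_AE)
    show "AE w in EW. indicator ?F w * f (w x, shift_on (A - {x}) (w x) w) \<le> indicator ?F w * indicator ?T w"
      using AE_EW_nonneg by eventually_elim (auto simp: indicator_def[of ?F] intro: le)
  qed
  have wx: "clock_weight A p w x = w x" for w using A by (simp add: clock_weight_def)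
  have first: "clock_weight A p w x < clock_weight A p w z" if "w \<in> ?F" "z \<in> A - {x}" for w z
    using that A by (auto simp: clock_weight_def)
  have eA: "clock_weight A q (shift_on (A - {x}) (w x) w) z = clock_weight A p w z - clock_weight A p w x"
    if "z \<in> A - {x}" for w z using that A by (auto simp: clock_weight_def shift_on_def)
  have eU: "clock_weight A q (shift_on (A - {x}) (w x) w) s = clock_weight A p w s"
    if "s \<in> U - {y}" "p s \<in> U \<union> B" for w s
  proof -
    have s: "s \<notin> A" "p s \<notin> A" using that disj' disj(1) by blast+
    moreover have "q s = p s" using that s A q_eq[of s] by blast
    ultimately show ?thesis
      using stub_min_cases[of s "p s"] by (auto simp: clock_weight_def edge_weight_def shift_on_def)
  qed
  \<comment> \<open>After the ring \<open>x\<close> has left the state and is a fixed point of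
    \<open>q\<close>, so no remaining edge reads the weight stored at \<open>x\<close>. This is the
    independence required by \<open>EW_first\<close>.\<close>
  have indep: "opt_in E \<tau>' q (clock_weight A q (w(x := u))) A' U' B h' \<longleftrightarrow> opt_in E \<tau>' q (clock_weight A q w) A' U' B h'"
    if "A' \<union> U' \<subseteq> A \<union> U - {x, y}" for w u A' U' h' \<tau>'
  proof (rule opt_in_cong)
    fix s assume "s \<in> A' \<union> U'"
    then have sx: "s \<noteq> x" using that by blast
    have "q s \<noteq> x" using sx qx(1) qq[of s] by metis
    with sx show "clock_weight A q (w(x := u)) s = clock_weight A q w s"
      using stub_min_cases[of s "q s"] by (auto simp: clock_weight_def edge_weight_def)
  qed
  \<comment> \<open>The clocks stay attached to the old set \<open>A\<close> during the step.
    \<open>nn_integral_clock_weight\<close> converts the new state back to the canonical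
    weights.\<close>
  have transfer: "ennreal (1 / card A) * expect_exp (card A)
       (\<lambda>t. \<integral>\<^sup>+w. indicator {w. opt_in E (\<tau> + t) q (edge_weight q w) A' U' B h'} w \<partial>EW) \<le> ?I"
    if sub: "A' \<union> U' \<subseteq> A \<union> U - {x, y}" "U' \<subseteq> U"
      and step: "\<And>w t' k. (\<And>s. 0 \<le> w s) \<Longrightarrow> w \<in> ?F \<Longrightarrow>
        opt q (clock_weight A q (shift_on (A - {x}) (w x) w)) A' U' B h' t' k \<Longrightarrow>
        opt p (clock_weight A p w) A U B h (w x + t') k" for A' U' h'
  proof -
    have "(\<integral>\<^sup>+w. indicator {w. opt_in E (\<tau> + t) q (edge_weight q w) A' U' B h'} w \<partial>EW)
       = (\<integral>\<^sup>+w. indicator {w. opt_in E (\<tau> + t) q (clock_weight A q w) A' U' B h'} w \<partial>EW)" for t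
      by (rule nn_integral_clock_weight[symmetric, OF E qq]) (use sub disj disj' in auto)
    moreover have "ennreal (1 / card A) * expect_exp (card A)
       (\<lambda>t. \<integral>\<^sup>+w. (\<lambda>(t, w). indicator {w. opt_in E (\<tau> + t) q (clock_weight A q w) A' U' B h'} w) (t, w) \<partial>EW) \<le> ?I"
    proof (rule key)
      have "Measurable.pred (borel \<Otimes>\<^sub>M EW) (\<lambda>z. opt_in E (\<tau> + fst z) q (clock_weight A q (snd z)) A' U' B h')"
      proof (rule measurable_opt_in[OF E])
        fix s show "(\<lambda>\<omega>. clock_weight A q (snd \<omega>) s) \<in> borel_measurable (borel \<Otimes>\<^sub>M EW)"
          by (rule measurable_compose[OF measurable_snd measurable_clock_weight])
      qed simp
      then have "(\<lambda>z. indicator {z. opt_in E (\<tau> + fst z) q (clock_weight A q (snd z)) A' U' B h'} z :: ennreal) \<in> borel_measurable (borel \<Otimes>\<^sub>M EW)"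
        by measurable
      then show "(\<lambda>(t, w). indicator {w. opt_in E (\<tau> + t) q (clock_weight A q w) A' U' B h'} w :: ennreal) \<in> borel_measurable (borel \<Otimes>\<^sub>M EW)"
        by (simp add: indicator_def split_beta')
    next
      fix w :: "stub \<Rightarrow> real" assume w: "\<And>s. 0 \<le> w s" "w \<in> ?F"
      show "(case (w x, shift_on (A - {x}) (w x) w) of (t, w) \<Rightarrow> indicator {w. opt_in E (\<tau> + t) q (clock_weight A q w) A' U' B h'} w) \<le> (indicator ?T w :: ennreal)"
        using step[OF w] by (auto simp: indicator_def opt_in_def add.assoc)
    qed (use indep[OF sub(1)] in \<open>simp add: indicator_def\<close>)
    ultimately show ?thesis by simp
  qed
  consider (B) "y \<in> B" | (A) "y \<in> A" "y \<notin> B" | (U) "y \<in> U" "y \<notin> A" "y \<notin> B" using y(1) by blast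
  then show ?thesis
  proof cases
    case B
    have "ennreal (1 / card A) * expect_exp (card A) (\<lambda>t. \<integral>\<^sup>+w. (\<lambda>(t, w). indicator E (\<tau> + t, h x + h y + 1)) (t, w) \<partial>EW) \<le> ?I"
    proof (rule key)
      have "(\<lambda>z. (\<tau> + fst z, h x + h y + 1)) \<in> measurable (borel \<Otimes>\<^sub>M EW) (borel \<Otimes>\<^sub>M count_space UNIV)"
        by measurable
      from measurable_compose[OF this borel_measurable_indicator[OF E]]
      show "(\<lambda>(t, w). indicator E (\<tau> + t, h x + h y + 1) :: ennreal) \<in> borel_measurable (borel \<Otimes>\<^sub>M EW)"
        by (simp add: split_beta')
    next
      fix w :: "stub \<Rightarrow> real" assume w: "\<And>s. 0 \<le> w s" "w \<in> ?F"
      have "opt p (clock_weight A p w) A U B h (clock_weight A p w x) (h x + h y + 1)"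
        using first[OF w(2)] A B disj disj' pp px
        by (intro opt_hit) (auto intro: clock_weight_nonneg w)
      then show "(case (w x, shift_on (A - {x}) (w x) w) of (t, w) \<Rightarrow> indicator E (\<tau> + t, h x + h y + 1)) \<le> (indicator ?T w :: ennreal)"
        unfolding wx by (auto simp: indicator_def opt_in_def)
    qed simp
    moreover have "(\<integral>\<^sup>+w. c \<partial>EW) = c" for c using W.emeasure_space_1 by simp
    ultimately show ?thesis using B by simp
  next
    case A
    have "ennreal (1 / card A) * expect_exp (card A)
       (\<lambda>t. \<integral>\<^sup>+w. indicator {w. opt_in E (\<tau> + t) q (edge_weight q w) (A - {x, y}) U B h} w \<partial>EW) \<le> ?I"
    proof (rule transfer)
      fix w :: "stub \<Rightarrow> real" and t' k
      assume w: "\<And>s. 0 \<le> w s" "w \<in> ?F"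
        and o: "opt q (clock_weight A q (shift_on (A - {x}) (w x) w)) (A - {x, y}) U B h t' k"
      have "opt p (clock_weight A p w) A U B h (clock_weight A p w x + t') k"
      proof (rule opt_internal[where p'=q and e'="clock_weight A q (shift_on (A - {x}) (w x) w)" and y=y])
        show "clock_weight A q (shift_on (A - {x}) (w x) w) z = clock_weight A p w z - clock_weight A p w x"
          if "z \<in> A - {x, y}" "p z \<in> U \<union> B" for z using eA that(1) by blast
        show "clock_weight A q (shift_on (A - {x}) (w x) w) s = clock_weight A p w s"
          if "s \<in> U" "p s \<in> U \<union> B" for s
        proof (rule eU)
          show "s \<in> U - {y}" using that(1) A(1) disj' by blast
        qed (rule that)
      qed (fact disj disj' pp A px q_eq o clock_weight_nonneg[OF w(1)] first[OF w(2)] \<open>x \<in> A\<close>)+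
      then show "opt p (clock_weight A p w) A U B h (w x + t') k" by (simp add: wx)
    qed (use disj' \<open>x \<in> A\<close> A in auto)
    then show ?thesis using A by simp
  next
    case U
    let ?N = "dormant_stubs d {fst y}"
    have N: "?N = {s \<in> U. fst s = fst y}" and U': "dormant_stubs d (V - {fst y}) = U - ?N"
      using U(1) \<open>U = dormant_stubs d V\<close> by (auto simp: dormant_stubs_def)
    have hv: "fst s \<noteq> fst y" if "s \<in> A \<union> B" for s
      using disj(2)[OF that] U(1) \<open>U = dormant_stubs d V\<close> by (auto simp: dormant_stubs_def)
    have yN: "y \<in> ?N" using U(1) N by simp
    have "ennreal (1 / card A) * expect_exp (card A)
       (\<lambda>t. \<integral>\<^sup>+w. indicator {w. opt_in E (\<tau> + t) q (edge_weight q w) (A - {x} \<union> (?N - {y})) (U - ?N) B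
           (\<lambda>s. if fst s = fst y then h x + 1 else h s)} w \<partial>EW) \<le> ?I"
    proof (rule transfer)
      fix w :: "stub \<Rightarrow> real" and t' k
      assume w: "\<And>s. 0 \<le> w s" "w \<in> ?F"
        and o: "opt q (clock_weight A q (shift_on (A - {x}) (w x) w)) (A - {x} \<union> (?N - {y})) (U - ?N) B
           (\<lambda>s. if fst s = fst y then h x + 1 else h s) t' k"
      have "opt p (clock_weight A p w) A U B h (clock_weight A p w x + t') k"
      proof (rule opt_fresh[where p'=q and e'="clock_weight A q (shift_on (A - {x}) (w x) w)" and y=y])
        show "clock_weight A q (shift_on (A - {x}) (w x) w) z = clock_weight A p w z - clock_weight A p w x"
          if "z \<in> A - {x}" "p z \<in> U \<union> B" for z using eA that(1) by blast
      qed (fact disj disj' pp U N hv px q_eq eU o clock_weight_nonneg[OF w(1)] first[OF w(2)] \<open>x \<in> A\<close>)+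
      then show "opt p (clock_weight A p w) A U B h (w x + t') k" by (simp add: wx)
    qed (use disj' \<open>x \<in> A\<close> U N yN in auto)
    then show ?thesis using U by (simp add: U')
  qed
qed

text \<open>One step of the exploration: the ringing stub is uniform in \<open>A\<close> with a
  waiting time of rate \<open>card A\<close>, and its partner is uniform among the other
  \<open>card X - 1\<close> stubs. Summing \<open>first_ring\<close> over \<open>x\<close> uses that
  the ring events are disjoint.\<close>

theorem meet_step:
  assumes E: "E \<in> sets (borel \<Otimes>\<^sub>M count_space UNIV)"
    and fin: "finite A" "finite B" "finite V" and "A \<noteq> {}" and X: "X = A \<union> B \<union> dormant_stubs d V"
    and disj: "A \<inter> B = {}" "\<And>s. s \<in> A \<union> B \<Longrightarrow> fst s \<notin> V" and ev: "even (card X)"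
  shows "ennreal (1 / card A) * (\<Sum>x\<in>A. expect_exp (card A) (\<lambda>t.
      ennreal (1 / real (card X - 1)) * (\<Sum>y\<in>X-{x}. next_val d V A B h E (\<tau> + t) x y)))
    \<le> meet_prob d V A B h E \<tau>"
proof -
  interpret W: prob_space EW by (rule prob_space_EW)
  define U where "U = dormant_stubs d V"
  have XU: "X = A \<union> B \<union> U" by (simp add: X U_def)
  have finX: "finite X" using fin finite_dormant_stubs by (simp add: X)
  have UV: "fst s \<in> V" if "s \<in> U" for s using that U_def by (auto simp: dormant_stubs_def)
  have disj': "A \<inter> U = {}" "U \<inter> B = {}" using disj(2) UV by blast+
  define P where "P = card (pairings X)"
  have P0: "P > 0" using card_pairings_pos[OF finX ev] by (simp add: P_def)
  let ?F = "\<lambda>x. {w. 0 < w x \<and> (\<forall>z\<in>A-{x}. w x < w z)}"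
  let ?T = "\<lambda>p. {w. opt_in E \<tau> p (clock_weight A p w) A U B h}"
  let ?R = "\<lambda>x y q t. if y \<in> B then indicator E (\<tau> + t, h x + h y + 1)
       else if y \<in> A then (\<integral>\<^sup>+w. indicator {w. opt_in E (\<tau> + t) q (edge_weight q w) (A - {x, y}) U B h} w \<partial>EW)
       else (\<integral>\<^sup>+w. indicator {w. opt_in E (\<tau> + t) q (edge_weight q w)
          (A - {x} \<union> (dormant_stubs d {fst y} - {y})) (dormant_stubs d (V - {fst y})) B
          (\<lambda>s. if fst s = fst y then h x + 1 else h s)} w \<partial>EW) :: ennreal"
  have R_meas: "?R x y q \<in> borel_measurable borel" for x y q
  proof -
    have a: "(\<lambda>t. \<integral>\<^sup>+w. indicator {w. opt_in E (\<tau> + t) q (edge_weight q w) A' U' B h'} w \<partial>EW) \<in> borel_measurable borel" for A' U' h'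
    proof -
      have "Measurable.pred (borel \<Otimes>\<^sub>M EW) (\<lambda>z. opt_in E (\<tau> + fst z) q (edge_weight q (snd z)) A' U' B h')"
      proof (rule measurable_opt_in[OF E])
        fix s show "(\<lambda>\<omega>. edge_weight q (snd \<omega>) s) \<in> borel_measurable (borel \<Otimes>\<^sub>M EW)"
          by (rule measurable_compose[OF measurable_snd measurable_edge_weight])
      qed simp
      then have "(\<lambda>z. indicator {z. opt_in E (\<tau> + fst z) q (edge_weight q (snd z)) A' U' B h'} z :: ennreal) \<in> borel_measurable (borel \<Otimes>\<^sub>M EW)"
        by measurable
      then have "(\<lambda>t. \<integral>\<^sup>+w. indicator {z. opt_in E (\<tau> + fst z) q (edge_weight q (snd z)) A' U' B h'} (t, w) \<partial>EW) \<in> borel_measurable borel"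
        by (intro W.borel_measurable_nn_integral) (simp add: split_beta')
      then show ?thesis by (simp add: indicator_def)
    qed
    have b: "(\<lambda>t. indicator E (\<tau> + t, k) :: ennreal) \<in> borel_measurable borel" for k :: nat
    proof -
      have [measurable]: "(\<lambda>t. (\<tau> + t, k)) \<in> measurable borel (borel \<Otimes>\<^sub>M count_space UNIV)" by measurable
      show ?thesis using E by measurable
    qed
    show ?thesis using a b by simp
  qed
  have pairing: "(\<Sum>x\<in>A. \<integral>\<^sup>+w. indicator (?F x) w * indicator (?T p) w \<partial>EW)
      \<le> (\<integral>\<^sup>+w. indicator {w. opt_in E \<tau> p (edge_weight p w) A U B h} w \<partial>EW)" if p: "p \<in> pairings X" for p
  proof -
    have [measurable]: "Measurable.pred EW (\<lambda>w. opt_in E \<tau> p (clock_weight A p w) A U B h)"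
      by (rule measurable_opt_in[OF E]) auto
    have finA: "finite (A - {x})" for x using fin by simp
    note [measurable] = measurable_component_EW[of "\<lambda>w. w" EW, simplified]
    have [measurable]: "Measurable.pred EW (\<lambda>w. 0 < w x \<and> (\<forall>z\<in>A-{x}. w x < w z))" for x
      using finA by measurable
    \<comment> \<open>A strict minimum is attained by at most one stub.\<close>
    have one: "(\<Sum>x\<in>A. indicator (?F x) w) \<le> (1::ennreal)" for w :: "stub \<Rightarrow> real"
    proof (cases "\<exists>x\<in>A. w \<in> ?F x")
      case True
      then obtain x where x: "x \<in> A" "w \<in> ?F x" by blast
      have "(\<Sum>z\<in>A. indicator (?F z) w) = (\<Sum>z\<in>A. if z = x then 1 else 0 :: ennreal)"
      proof (rule sum.cong[OF refl])
        fix z assume z: "z \<in> A"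
        have "w \<notin> ?F z" if "z \<noteq> x"
        proof
          assume "w \<in> ?F z"
          then have "w z < w x" using that x(1) by blast
          moreover have "w x < w z" using that x(2) z by blast
          ultimately show False by simp
        qed
        note notF = this
        show "indicator (?F z) w = (if z = x then 1 else 0 :: ennreal)"
        proof (cases "z = x")
          case True
          show ?thesis unfolding True by (simp only: indicator_simps(1)[OF x(2)] if_True refl)
        next
          case False
          then show ?thesis by (simp only: indicator_simps(2)[OF notF[OF False]] if_False)
        qed
      qed
      then show ?thesis using x fin by simp
    next
      case False
      then have "(\<Sum>x\<in>A. indicator (?F x) w) = (0::ennreal)"
        by (intro sum.neutral ballI indicator_simps(2)) blast
      then show ?thesis by simp
    qed
    have "(\<Sum>x\<in>A. \<integral>\<^sup>+w. indicator (?F x) w * indicator (?T p) w \<partial>EW)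
      = (\<integral>\<^sup>+w. (\<Sum>x\<in>A. indicator (?F x) w * indicator (?T p) w) \<partial>EW)"
      by (subst nn_integral_sum) auto
    also have "\<dots> \<le> (\<integral>\<^sup>+w. indicator (?T p) w \<partial>EW)"
    proof (rule nn_integral_mono)
      fix w show "(\<Sum>x\<in>A. indicator (?F x) w * indicator (?T p) w) \<le> (indicator (?T p) w :: ennreal)"
        unfolding sum_distrib_right[symmetric]
        using mult_right_mono[OF one[of w], of "indicator (?T p) w"] by simp
    qed
    also have "\<dots> = (\<integral>\<^sup>+w. indicator {w. opt_in E \<tau> p (edge_weight p w) A U B h} w \<partial>EW)"
      by (rule nn_integral_clock_weight[OF E pairingsD(3)[OF p]]) (use disj disj' in auto)
    finally show ?thesis .
  qed
  have step: "ennreal (1 / card A) * expect_exp (card A) (\<lambda>t. ennreal (1 / real (card X - 1)) * (\<Sum>y\<in>X-{x}. next_val d V A B h E (\<tau> + t) x y))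
      \<le> ennreal (1 / P) * (\<Sum>p\<in>pairings X. \<integral>\<^sup>+w. indicator (?F x) w * indicator (?T p) w \<partial>EW)"
    if x: "x \<in> A" for x
  proof -
    have xX: "x \<in> X" using x XU by simp
    have nv: "ennreal (1 / real (card X - 1)) * next_val d V A B h E (\<tau> + t) x y
       = ennreal (1 / P) * (\<Sum>q\<in>pairings (X - {x, y}). ?R x y q t)" if y: "y \<in> X - {x}" for y t
    proof -
      define Q where "Q = card (pairings (X - {x, y}))"
      have PQ: "P = (card X - 1) * Q" unfolding P_def Q_def using y xX by (intro card_pairings[OF finX ev]) auto
      then have Q0: "Q > 0" using P0 by (cases "Q = 0") auto
      have m: "ennreal (1 / P) = ennreal (1 / real (card X - 1)) * ennreal (1 / Q)"
        unfolding PQ by (simp add: ennreal_mult[symmetric])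
      have "next_val d V A B h E (\<tau> + t) x y = ennreal (1 / Q) * (\<Sum>q\<in>pairings (X - {x, y}). ?R x y q t)"
      proof (cases "y \<in> B")
        case True
        have "(\<Sum>q\<in>pairings (X - {x, y}). ?R x y q t) = of_nat Q * indicator E (\<tau> + t, h x + h y + 1)"
          using True by (simp add: Q_def)
        moreover have "ennreal (1 / Q) * of_nat Q = 1"
          using Q0 by (simp add: ennreal_of_nat_eq_real_of_nat ennreal_mult[symmetric])
        ultimately show ?thesis using True by (simp add: next_val_def mult.assoc[symmetric])
      next
        case nB: False
        show ?thesis
        proof (cases "y \<in> A")
          case True
          have "A - {x, y} \<union> B \<union> U = X - {x, y}" using XU True x disj disj' by auto
          then show ?thesis using True nB by (simp add: next_val_def meet_prob_def U_def[symmetric] Q_def)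
        next
          case False
          then have yU: "y \<in> U" using y nB XU by auto
          have "A - {x} \<union> (dormant_stubs d {fst y} - {y}) \<union> B \<union> dormant_stubs d (V - {fst y}) = X - {x, y}"
          proof -
            have "dormant_stubs d {fst y} \<union> dormant_stubs d (V - {fst y}) = U"
              using yU by (auto simp: U_def dormant_stubs_def)
            moreover have "y \<notin> dormant_stubs d (V - {fst y})" by (auto simp: dormant_stubs_def)
            ultimately show ?thesis using XU yU x nB False disj disj' by auto
          qed
          then show ?thesis using False nB by (simp add: next_val_def meet_prob_def Q_def)
        qed
      qed
      then show ?thesis by (simp add: m mult.assoc)
    qed
    have "ennreal (1 / card A) * expect_exp (card A) (\<lambda>t. ennreal (1 / real (card X - 1)) * (\<Sum>y\<in>X-{x}. next_val d V A B h E (\<tau> + t) x y))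
      = ennreal (1 / card A) * expect_exp (card A) (\<lambda>t. ennreal (1 / P) * (\<Sum>y\<in>X-{x}. \<Sum>q\<in>pairings (X - {x, y}). ?R x y q t))"
      by (simp only: sum_distrib_left nv cong: sum.cong)
    also have "\<dots> = ennreal (1 / P) * (\<Sum>y\<in>X-{x}. \<Sum>q\<in>pairings (X - {x, y}). ennreal (1 / card A) * expect_exp (card A) (?R x y q))"
      using R_meas
      by (simp only: expect_exp_cmult expect_exp_sum borel_measurable_sum sum_distrib_left[symmetric] mult.left_commute)
    also have "\<dots> \<le> ennreal (1 / P) * (\<Sum>y\<in>X-{x}. \<Sum>q\<in>pairings (X - {x, y}).
        \<integral>\<^sup>+w. indicator (?F x) w * indicator (?T (q(x := y, y := x))) w \<partial>EW)"
      by (intro mult_left_mono sum_mono first_ring[OF E fin(1) x U_def disj _ _ _ refl])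
         (auto simp: XU)
    also have "(\<Sum>y\<in>X-{x}. \<Sum>q\<in>pairings (X - {x, y}).
        \<integral>\<^sup>+w. indicator (?F x) w * indicator (?T (q(x := y, y := x))) w \<partial>EW)
       = (\<Sum>p\<in>pairings X. \<integral>\<^sup>+w. indicator (?F x) w * indicator (?T p) w \<partial>EW)"
      by (rule sum_pairings[OF finX xX, symmetric])
    finally show ?thesis .
  qed
  have "ennreal (1 / card A) * (\<Sum>x\<in>A. expect_exp (card A) (\<lambda>t.
      ennreal (1 / real (card X - 1)) * (\<Sum>y\<in>X-{x}. next_val d V A B h E (\<tau> + t) x y)))
    \<le> (\<Sum>x\<in>A. ennreal (1 / P) * (\<Sum>p\<in>pairings X. \<integral>\<^sup>+w. indicator (?F x) w * indicator (?T p) w \<partial>EW))"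
    unfolding sum_distrib_left by (intro sum_mono) (use step in \<open>simp add: sum_distrib_left\<close>)
  also have "\<dots> = ennreal (1 / P) * (\<Sum>p\<in>pairings X. \<Sum>x\<in>A. \<integral>\<^sup>+w. indicator (?F x) w * indicator (?T p) w \<partial>EW)"
    unfolding sum_distrib_left[symmetric] by (subst sum.swap) simp
  also have "\<dots> \<le> ennreal (1 / P) * (\<Sum>p\<in>pairings X. \<integral>\<^sup>+w. indicator {w. opt_in E \<tau> p (edge_weight p w) A U B h} w \<partial>EW)"
    using pairing by (intro mult_left_mono sum_mono) auto
  also have "\<dots> = meet_prob d V A B h E \<tau>"
    by (simp add: meet_prob_def P_def X U_def)
  finally show ?thesis .
qed

subsection \<open>Two large clusters meet quickly\<close>

text \<open>Passes affine bounds through one step. The loss \<open>M + t / \<epsilon>\<close> is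
  written on the right-hand side because subtraction of extended nonnegative reals truncates; the
  elapsed time contributes its mean \<open>1 / card A\<close> in units of
  \<open>\<epsilon>\<close>.\<close>

lemma meet_step_avg:
  fixes L M :: "stub \<Rightarrow> stub \<Rightarrow> real" and N \<epsilon> :: real
  assumes E: "E \<in> sets (borel \<Otimes>\<^sub>M count_space UNIV)"
    and fin: "finite A" "finite B" "finite V" and A0: "A \<noteq> {}" and X: "X = A \<union> B \<union> dormant_stubs d V"
    and disj: "A \<inter> B = {}" "\<And>s. s \<in> A \<union> B \<Longrightarrow> fst s \<notin> V" and ev: "even (card X)"
    and N: "N = real (card X - 1)" and \<epsilon>: "\<epsilon> > 0"
    and pos: "\<And>x y. x \<in> A \<Longrightarrow> y \<in> X - {x} \<Longrightarrow> 0 \<le> L x y \<and> 0 \<le> M x y"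
    and le: "\<And>x y t. x \<in> A \<Longrightarrow> y \<in> X - {x} \<Longrightarrow> 0 \<le> t \<Longrightarrow>
       ennreal (L x y) \<le> next_val d V A B h E (\<tau> + t) x y + ennreal (M x y + t / \<epsilon>)"
  shows "ennreal ((\<Sum>x\<in>A. \<Sum>y\<in>X-{x}. L x y) / (card A * N))
    \<le> meet_prob d V A B h E \<tau> + ennreal ((\<Sum>x\<in>A. \<Sum>y\<in>X-{x}. M x y) / (card A * N) + 1 / (card A * \<epsilon>))"
proof -
  have finX: "finite X" using fin finite_dormant_stubs by (simp add: X)
  have A_pos: "card A > 0" using A0 fin by (simp add: card_gt_0_iff)
  have "card X \<ge> card A" using finX by (intro card_mono) (auto simp: X)
  \<comment> \<open>Parity guarantees that an active stub has a possible partner.\<close>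
  moreover have "card X \<noteq> 1" using ev by auto
  ultimately have "card X \<ge> 2" using A_pos by linarith
  then have N_pos: "N > 0" unfolding N by simp
  have cN: "real (card (X - {x})) = N" if "x \<in> A" for x using that finX by (simp add: N X)
  note [measurable] = borel_measurable_next_val[OF E]
  let ?c = "ennreal (1 / N)" and ?a = "ennreal (1 / card A)"
  have "ennreal ((\<Sum>x\<in>A. \<Sum>y\<in>X-{x}. L x y) / (card A * N))
    = ?a * (\<Sum>x\<in>A. expect_exp (card A) (\<lambda>t. ?c * (\<Sum>y\<in>X-{x}. ennreal (L x y))))"
  proof -
    have "(\<Sum>x\<in>A. expect_exp (card A) (\<lambda>t. ?c * (\<Sum>y\<in>X-{x}. ennreal (L x y)))) = (\<Sum>x\<in>A. ennreal (1 / N * (\<Sum>y\<in>X-{x}. L x y)))"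
    proof (intro sum.cong refl)
      fix x assume x: "x \<in> A"
      have "(\<Sum>y\<in>X-{x}. ennreal (L x y)) = ennreal (\<Sum>y\<in>X-{x}. L x y)"
        using pos[OF x] by (intro sum_ennreal) blast
      moreover have "0 \<le> (\<Sum>y\<in>X-{x}. L x y)" using pos[OF x] by (intro sum_nonneg) blast
      ultimately show "expect_exp (card A) (\<lambda>t. ?c * (\<Sum>y\<in>X-{x}. ennreal (L x y))) = ennreal (1 / N * (\<Sum>y\<in>X-{x}. L x y))"
        unfolding expect_exp_const[OF A_pos] using N_pos by (simp add: ennreal_mult[symmetric])
    qed
    also have "\<dots> = ennreal (\<Sum>x\<in>A. 1 / N * (\<Sum>y\<in>X-{x}. L x y))"
      using pos N_pos by (intro sum_ennreal mult_nonneg_nonneg sum_nonneg) auto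
    finally have *: "(\<Sum>x\<in>A. expect_exp (card A) (\<lambda>t. ?c * (\<Sum>y\<in>X-{x}. ennreal (L x y)))) = ennreal (\<Sum>x\<in>A. 1 / N * (\<Sum>y\<in>X-{x}. L x y))" .
    have T: "0 \<le> (\<Sum>x\<in>A. 1 / N * (\<Sum>y\<in>X-{x}. L x y))"
      using pos N_pos by (intro sum_nonneg mult_nonneg_nonneg) auto
    have "(\<Sum>x\<in>A. \<Sum>y\<in>X-{x}. L x y) / (card A * N) = 1 / card A * (\<Sum>x\<in>A. 1 / N * (\<Sum>y\<in>X-{x}. L x y))"
      by (simp add: sum_divide_distrib[symmetric] mult.commute)
    then show ?thesis unfolding * using ennreal_mult[OF _ T, of "1 / card A"] by simp
  qed
  also have "\<dots> \<le> ?a * (\<Sum>x\<in>A. expect_exp (card A) (\<lambda>t. ?c * (\<Sum>y\<in>X-{x}. next_val d V A B h E (\<tau> + t) x y)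
       + ?c * (\<Sum>y\<in>X-{x}. ennreal (M x y + t / \<epsilon>))))"
    unfolding distrib_left[symmetric] sum.distrib[symmetric]
    by (intro mult_left_mono sum_mono expect_exp_mono le) auto
  also have "\<dots> = ?a * (\<Sum>x\<in>A. expect_exp (card A) (\<lambda>t. ?c * (\<Sum>y\<in>X-{x}. next_val d V A B h E (\<tau> + t) x y)))
       + ?a * (\<Sum>x\<in>A. expect_exp (card A) (\<lambda>t. ?c * (\<Sum>y\<in>X-{x}. ennreal (M x y + t / \<epsilon>))))"
    by (subst expect_exp_add) (auto simp: sum.distrib distrib_left)
  also have "\<dots> \<le> meet_prob d V A B h E \<tau> + ennreal ((\<Sum>x\<in>A. \<Sum>y\<in>X-{x}. M x y) / (card A * N) + 1 / (card A * \<epsilon>))"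
  proof (rule add_mono)
    show "?a * (\<Sum>x\<in>A. expect_exp (card A) (\<lambda>t. ?c * (\<Sum>y\<in>X-{x}. next_val d V A B h E (\<tau> + t) x y))) \<le> meet_prob d V A B h E \<tau>"
      using meet_step[OF E fin A0 X disj ev, of h \<tau>] by (simp add: N)
    have "expect_exp (card A) (\<lambda>t. ?c * (\<Sum>y\<in>X-{x}. ennreal (M x y + t / \<epsilon>)))
        \<le> ennreal ((\<Sum>y\<in>X-{x}. M x y) / N + 1 / (card A * \<epsilon>))" if x: "x \<in> A" for x
    proof -
      have "expect_exp (card A) (\<lambda>t. ?c * (\<Sum>y\<in>X-{x}. ennreal (M x y + t / \<epsilon>)))
        = expect_exp (card A) (\<lambda>t. ennreal ((\<Sum>y\<in>X-{x}. M x y) / N) + ennreal (t / \<epsilon>))"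
      proof (rule expect_exp_cong)
        fix t :: real assume t: "t \<ge> 0"
        have "(\<Sum>y\<in>X-{x}. ennreal (M x y + t / \<epsilon>)) = ennreal ((\<Sum>y\<in>X-{x}. M x y) + N * (t / \<epsilon>))"
          using pos[OF x] t \<epsilon> cN[OF x] by (subst sum_ennreal) (auto simp: sum.distrib)
        moreover have "1 / N * ((\<Sum>y\<in>X-{x}. M x y) + N * (t / \<epsilon>)) = (\<Sum>y\<in>X-{x}. M x y) / N + t / \<epsilon>"
          using N_pos by (simp add: field_simps)
        moreover have M0: "0 \<le> (\<Sum>y\<in>X-{x}. M x y)" using pos[OF x] by (intro sum_nonneg) blast
        moreover have "0 \<le> N * (t / \<epsilon>)" using t \<epsilon> N_pos by simp
        ultimately have "?c * (\<Sum>y\<in>X-{x}. ennreal (M x y + t / \<epsilon>)) = ennreal ((\<Sum>y\<in>X-{x}. M x y) / N + t / \<epsilon>)"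
          using N_pos ennreal_mult[of "1 / N" "(\<Sum>y\<in>X-{x}. M x y) + N * (t / \<epsilon>)"] by simp
        then show "?c * (\<Sum>y\<in>X-{x}. ennreal (M x y + t / \<epsilon>)) = ennreal ((\<Sum>y\<in>X-{x}. M x y) / N) + ennreal (t / \<epsilon>)"
          using M0 N_pos t \<epsilon> by simp
      qed
      also have "\<dots> = ennreal ((\<Sum>y\<in>X-{x}. M x y) / N) + expect_exp (card A) (\<lambda>t. ennreal (t / \<epsilon>))"
        by (subst expect_exp_add) (auto simp: expect_exp_const A_pos)
      also have "\<dots> \<le> ennreal ((\<Sum>y\<in>X-{x}. M x y) / N) + ennreal (1 / (card A * \<epsilon>))"
        by (intro add_left_mono expect_exp_ident A_pos)
      also have "\<dots> = ennreal ((\<Sum>y\<in>X-{x}. M x y) / N + 1 / (card A * \<epsilon>))"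
        using pos[OF x] N_pos \<epsilon> by (intro ennreal_plus[symmetric]) (auto intro!: divide_nonneg_nonneg sum_nonneg)
      finally show ?thesis .
    qed
    then have "?a * (\<Sum>x\<in>A. expect_exp (card A) (\<lambda>t. ?c * (\<Sum>y\<in>X-{x}. ennreal (M x y + t / \<epsilon>))))
      \<le> ?a * (\<Sum>x\<in>A. ennreal ((\<Sum>y\<in>X-{x}. M x y) / N + 1 / (card A * \<epsilon>)))"
      by (intro mult_left_mono sum_mono) auto
    also have "\<dots> = ?a * ennreal (\<Sum>x\<in>A. (\<Sum>y\<in>X-{x}. M x y) / N + 1 / (card A * \<epsilon>))"
      using pos N_pos \<epsilon> by (subst sum_ennreal) (auto intro!: add_nonneg_nonneg divide_nonneg_nonneg sum_nonneg)
    also have "\<dots> = ennreal (1 / card A * (\<Sum>x\<in>A. (\<Sum>y\<in>X-{x}. M x y) / N + 1 / (card A * \<epsilon>)))"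
      using pos N_pos \<epsilon> by (intro ennreal_mult[symmetric]) (auto intro!: add_nonneg_nonneg divide_nonneg_nonneg sum_nonneg)
    also have "1 / card A * (\<Sum>x\<in>A. (\<Sum>y\<in>X-{x}. M x y) / N + 1 / (card A * \<epsilon>))
      = (\<Sum>x\<in>A. \<Sum>y\<in>X-{x}. M x y) / (card A * N) + 1 / (card A * \<epsilon>)"
      using A_pos by (simp add: sum.distrib sum_divide_distrib[symmetric] distrib_left)
    finally show "?a * (\<Sum>x\<in>A. expect_exp (card A) (\<lambda>t. ?c * (\<Sum>y\<in>X-{x}. ennreal (M x y + t / \<epsilon>))))
      \<le> ennreal ((\<Sum>x\<in>A. \<Sum>y\<in>X-{x}. M x y) / (card A * N) + 1 / (card A * \<epsilon>))" .
  qed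
  finally show ?thesis .
qed

text \<open>Replacing a uniformly chosen active stub \<open>x\<close> by copies with values \<open>g x + \<delta>\<close> keeps the mean of \<open>g\<close>
  over the active stubs, up to the contribution of \<open>\<delta>\<close>; removing a uniform pair keeps it exactly.\<close>

definition next_avg :: "(nat \<Rightarrow> nat) \<Rightarrow> stub set \<Rightarrow> stub set \<Rightarrow> (stub \<Rightarrow> stub \<Rightarrow> real) \<Rightarrow> (stub \<Rightarrow> real) \<Rightarrow> real \<Rightarrow> stub \<Rightarrow> stub \<Rightarrow> real" where
  "next_avg d A B b g \<delta> x y =
    (if y \<in> B then b x y else if y \<in> A then (\<Sum>z\<in>A-{x,y}. g z) / (real (card A) - 2)
     else ((\<Sum>z\<in>A-{x}. g z) + (real (d (fst y)) - 1) * (g x + \<delta>)) / (real (card A) + real (d (fst y)) - 2))"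

text \<open>A martingale identity. For a new vertex of degree \<open>D\<close>, averaging over
  \<open>x\<close> gives \<open>(S * G - G + (D - 1) * G) / (S + D - 2) = G\<close>, and for a pair
  inside the cluster the denominator \<open>S - 2\<close> cancels likewise. What remains is
  \<open>\<delta>\<close> times the probability that a uniform active stub is new.\<close>

lemma sum_next_avg:
  assumes fin: "finite A" "finite B" "finite U" and disj: "A \<inter> B = {}" "A \<inter> U = {}" "B \<inter> U = {}"
    and A3: "card A \<ge> 3" and d: "\<And>y. y \<in> U \<Longrightarrow> d (fst y) \<ge> 2"
  shows "(\<Sum>x\<in>A. \<Sum>y\<in>A\<union>B\<union>U-{x}. next_avg d A B b g \<delta> x y)
    = (\<Sum>x\<in>A. \<Sum>y\<in>B. b x y) + (real (card A) - 1) * (\<Sum>x\<in>A. g x) + real (card U) * (\<Sum>x\<in>A. g x)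
      + \<delta> * real (card A) * (\<Sum>y\<in>U. (real (d (fst y)) - 1) / (real (card A) + real (d (fst y)) - 2))"
proof -
  define S where "S = real (card A)"
  define G where "G = (\<Sum>x\<in>A. g x)"
  have S: "S \<ge> 3" using A3 by (simp add: S_def)
  have rem: "(\<Sum>z\<in>A-{x}. g z) = G - g x" if "x \<in> A" for x
    using that fin by (simp add: G_def sum_diff1)
  have rem2: "(\<Sum>z\<in>A-{x,y}. g z) = G - g x - g y" if "x \<in> A" "y \<in> A - {x}" for x y
  proof -
    have "A - {x, y} = (A - {x}) - {y}" by auto
    then have "(\<Sum>z\<in>A-{x,y}. g z) = (\<Sum>z\<in>A-{x}. g z) - g y" using that fin by (simp add: sum_diff1)
    then show ?thesis using rem[OF that(1)] by simp
  qed
  have split: "(\<Sum>y\<in>A\<union>B\<union>U-{x}. next_avg d A B b g \<delta> x y)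
     = (\<Sum>y\<in>B. b x y) + (\<Sum>y\<in>A-{x}. (G - g x - g y) / (S - 2))
       + (\<Sum>y\<in>U. (G - g x + (real (d (fst y)) - 1) * (g x + \<delta>)) / (S + real (d (fst y)) - 2))" if x: "x \<in> A" for x
  proof -
    have "A\<union>B\<union>U-{x} = (B \<union> (A - {x})) \<union> U" using x disj by auto
    then have "(\<Sum>y\<in>A\<union>B\<union>U-{x}. next_avg d A B b g \<delta> x y)
       = (\<Sum>y\<in>B. next_avg d A B b g \<delta> x y) + (\<Sum>y\<in>A-{x}. next_avg d A B b g \<delta> x y) + (\<Sum>y\<in>U. next_avg d A B b g \<delta> x y)"
    proof -
      have "B \<inter> (A - {x}) = {}" "(B \<union> (A - {x})) \<inter> U = {}" using disj by blast+
      then show ?thesis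
        using fin \<open>A\<union>B\<union>U-{x} = (B \<union> (A - {x})) \<union> U\<close> by (simp add: sum.union_disjoint)
    qed
    moreover have "(\<Sum>y\<in>B. next_avg d A B b g \<delta> x y) = (\<Sum>y\<in>B. b x y)"
      by (intro sum.cong) (auto simp: next_avg_def)
    moreover have "(\<Sum>y\<in>A-{x}. next_avg d A B b g \<delta> x y) = (\<Sum>y\<in>A-{x}. (G - g x - g y) / (S - 2))"
    proof (intro sum.cong refl)
      fix y assume y: "y \<in> A - {x}"
      then have "y \<notin> B" using disj by auto
      then show "next_avg d A B b g \<delta> x y = (G - g x - g y) / (S - 2)"
        using y rem2[OF x y] by (simp add: next_avg_def S_def)
    qed
    moreover have "(\<Sum>y\<in>U. next_avg d A B b g \<delta> x y) = (\<Sum>y\<in>U. (G - g x + (real (d (fst y)) - 1) * (g x + \<delta>)) / (S + real (d (fst y)) - 2))"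
    proof (intro sum.cong refl)
      fix y assume "y \<in> U"
      then have "y \<notin> B" "y \<notin> A" using disj by auto
      then show "next_avg d A B b g \<delta> x y = (G - g x + (real (d (fst y)) - 1) * (g x + \<delta>)) / (S + real (d (fst y)) - 2)"
        using rem[OF x] by (simp add: next_avg_def S_def)
    qed
    ultimately show ?thesis by simp
  qed
  have int: "(\<Sum>x\<in>A. \<Sum>y\<in>A-{x}. (G - g x - g y) / (S - 2)) = (S - 1) * G"
  proof -
    have "(\<Sum>y\<in>A-{x}. (G - g x - g y) / (S - 2)) = ((S - 1) * (G - g x) - (G - g x)) / (S - 2)" if "x \<in> A" for x
      using that rem[OF that] fin A3 by (simp add: sum_divide_distrib[symmetric] sum_subtractf S_def of_nat_diff)
    then have "(\<Sum>x\<in>A. \<Sum>y\<in>A-{x}. (G - g x - g y) / (S - 2)) = (\<Sum>x\<in>A. ((S - 1) * (G - g x) - (G - g x)) / (S - 2))"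
      by (intro sum.cong refl) auto
    also have "\<dots> = (\<Sum>x\<in>A. G - g x)"
    proof (intro sum.cong refl)
      fix x
      have "(S - 1) * (G - g x) - (G - g x) = (S - 2) * (G - g x)" by (simp add: algebra_simps)
      then show "((S - 1) * (G - g x) - (G - g x)) / (S - 2) = G - g x" using S by simp
    qed
    also have "\<dots> = (S - 1) * G" by (simp add: sum_subtractf G_def S_def algebra_simps)
    finally show ?thesis .
  qed
  have fresh: "(\<Sum>x\<in>A. (G - g x + (D - 1) * (g x + \<delta>)) / (S + D - 2)) = G + \<delta> * S * ((D - 1) / (S + D - 2))"
    if "D \<ge> 2" for D :: real
  proof -
    have "(\<Sum>x\<in>A. G - g x + (D - 1) * (g x + \<delta>)) = S * G - G + (D - 1) * (G + S * \<delta>)"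
      by (simp add: sum.distrib sum_subtractf sum_distrib_left[symmetric] G_def S_def)
    also have "\<dots> = (S + D - 2) * G + \<delta> * S * (D - 1)" by (simp add: algebra_simps)
    finally have *: "(\<Sum>x\<in>A. G - g x + (D - 1) * (g x + \<delta>)) = (S + D - 2) * G + \<delta> * S * (D - 1)" .
    have "S + D - 2 \<noteq> 0" using S that by simp
    then have "((S + D - 2) * G + \<delta> * S * (D - 1)) / (S + D - 2) = G + \<delta> * S * ((D - 1) / (S + D - 2))"
      by (simp add: add_divide_distrib)
    then show ?thesis unfolding sum_divide_distrib[symmetric] * .
  qed
  have "(\<Sum>x\<in>A. \<Sum>y\<in>U. (G - g x + (real (d (fst y)) - 1) * (g x + \<delta>)) / (S + real (d (fst y)) - 2))
     = (\<Sum>y\<in>U. G + \<delta> * S * ((real (d (fst y)) - 1) / (S + real (d (fst y)) - 2)))"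
    using d by (subst sum.swap, intro sum.cong refl fresh) auto
  also have "\<dots> = real (card U) * G + \<delta> * S * (\<Sum>y\<in>U. (real (d (fst y)) - 1) / (S + real (d (fst y)) - 2))"
    by (simp add: sum.distrib sum_distrib_left)
  finally show ?thesis using int
    by (simp add: split sum.distrib S_def[symmetric] G_def[symmetric] cong: sum.cong)
qed

lemma sum_dormant_stubs:
  assumes "finite V"
  shows "(\<Sum>y\<in>dormant_stubs d V. f (fst y)) = (\<Sum>v\<in>V. of_nat (d v) * (f v :: 'a :: semiring_1))"
proof -
  have "dormant_stubs d V = Sigma V (\<lambda>v. {..<d v})" by (auto simp: dormant_stubs_def)
  then have "(\<Sum>y\<in>dormant_stubs d V. f (fst y)) = (\<Sum>v\<in>V. \<Sum>j\<in>{..<d v}. f v)"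
    using sum.Sigma[of V "\<lambda>v. {..<d v}" "\<lambda>v _. f v"] assms by (simp add: split_beta)
  then show ?thesis by simp
qed

lemma card_dormant_stubs:
  assumes "finite V" shows "card (dormant_stubs d V) = (\<Sum>v\<in>V. d v)"
  using sum_dormant_stubs[OF assms, of "\<lambda>_. 1::nat" d] by simp

text \<open>The robust interior of \<open>E\<close>: membership must persist under a delay of up to
  \<open>\<epsilon>\<close> and up to \<open>k\<close> additional edges. The summand
  \<open>1\<close> is the edge joining the clusters.\<close>

definition core :: "(real \<times> nat) set \<Rightarrow> real \<Rightarrow> nat \<Rightarrow> real \<Rightarrow> nat \<Rightarrow> nat \<Rightarrow> real" where
  "core E \<epsilon> k \<tau> a b = (if \<forall>\<tau>'\<in>{0..\<epsilon>}. \<forall>r\<le>k. (\<tau> + \<tau>', a + b + 1 + r) \<in> E then 1 else 0)"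

lemma core_bounds: "0 \<le> core E \<epsilon> k \<tau> a b" "core E \<epsilon> k \<tau> a b \<le> 1"
  by (auto simp: core_def)

text \<open>The label \<open>h\<close> on the growing cluster is split into the part \<open>c\<close> inherited from before and the number \<open>r\<close>
  of edges added since then. Losses are paid for by Markov's inequality applied to \<open>r\<close> and
  to the elapsed time \<open>\<tau>\<close>, which keeps the bound linear and hence stable under averaging.\<close>

lemma meet_late:
  assumes E: "E \<in> sets (borel \<Otimes>\<^sub>M count_space UNIV)"
    and par: "s \<ge> 1" "k \<ge> 1" "\<epsilon> > 0" "n0 > 0" "Qm \<ge> 0" and B: "finite B" "B \<noteq> {}"
    and beta: "\<beta> = Qm / (n0 * real s * real k) + 1 / (real s * \<epsilon>)"
  shows "finite A \<Longrightarrow> finite V \<Longrightarrow> A \<inter> B = {} \<Longrightarrow> (\<And>z. z \<in> A \<union> B \<Longrightarrow> fst z \<notin> V) \<Longrightarrow>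
    even (card (A \<union> B \<union> dormant_stubs d V)) \<Longrightarrow> (\<And>v. v \<in> V \<Longrightarrow> d v \<ge> 2) \<Longrightarrow>
    card A \<ge> s + 2 * j \<Longrightarrow> real (card (A \<union> B \<union> dormant_stubs d V)) - 1 \<ge> n0 + 2 * real j \<Longrightarrow>
    real (card (A \<union> B \<union> dormant_stubs d V)) - 1 \<le> l \<Longrightarrow> (\<Sum>v\<in>V. (real (d v))\<^sup>2) \<le> Qm \<Longrightarrow>
    (\<And>x. x \<in> A \<Longrightarrow> h x = c x + r x) \<Longrightarrow> (\<And>y. y \<in> B \<Longrightarrow> h y = hB y) \<Longrightarrow> \<tau> \<ge> 0 \<Longrightarrow>
    ennreal ((\<Sum>x\<in>A. (\<Sum>y\<in>B. core E \<epsilon> k \<tau>0 (c x) (hB y)) / card B) / card A)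
    \<le> meet_prob d V A B h E (\<tau>0 + \<tau>) +
      ennreal ((\<Sum>x\<in>A. real (r x) / k) / card A + \<tau> / \<epsilon> + j * \<beta> + (1 - card B / l) ^ j)"
proof (induction j arbitrary: A V h c r \<tau>)
  case 0
  note p = "0.prems"
  have A0: "card A > 0" using p(7) par by simp
  have "(\<Sum>x\<in>A. (\<Sum>y\<in>B. core E \<epsilon> k \<tau>0 (c x) (hB y)) / card B) \<le> (\<Sum>x\<in>A. 1)"
  proof (rule sum_mono)
    fix x
    have "(\<Sum>y\<in>B. core E \<epsilon> k \<tau>0 (c x) (hB y)) \<le> (\<Sum>y\<in>B. 1)" by (intro sum_mono core_bounds)
    then show "(\<Sum>y\<in>B. core E \<epsilon> k \<tau>0 (c x) (hB y)) / card B \<le> 1" using B by (simp add: divide_le_eq_1 card_gt_0_iff)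
  qed
  then have "(\<Sum>x\<in>A. (\<Sum>y\<in>B. core E \<epsilon> k \<tau>0 (c x) (hB y)) / card B) / card A \<le> 1"
    using A0 by (simp add: divide_le_eq_1)
  \<comment> \<open>With no steps left, the failure term \<open>(1 - card B / l) ^ 0\<close> alone
    pays for everything.\<close>
  also have "1 \<le> (\<Sum>x\<in>A. real (r x) / k) / card A + \<tau> / \<epsilon> + 0 * \<beta> + (1 - card B / l) ^ 0"
    using p(13) par by (simp add: sum_nonneg)
  finally show ?case by (intro order_trans[OF ennreal_leI add_increasing]) (auto)
next
  case (Suc j)
  note p = Suc.prems
  define U where "U = dormant_stubs d V"
  define X where "X = A \<union> B \<union> U"
  define S where "S = real (card A)"
  define b where "b = real (card B)"
  define N where "N = real (card X - 1)"
  define rk where "rk = (\<lambda>x. real (r x) / k)"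
  define g where "g = (\<lambda>x. (\<Sum>y\<in>B. core E \<epsilon> k \<tau>0 (c x) (hB y)) / card B)"
  define rest where "rest = j * \<beta> + (1 - b / l) ^ j"
  have UV: "fst z \<in> V" if "z \<in> U" for z using that by (auto simp: U_def dormant_stubs_def)
  have disj: "A \<inter> B = {}" "A \<inter> U = {}" "B \<inter> U = {}" using p(3,4) UV by blast+
  have finU: "finite U" using p(2) by (simp add: U_def finite_dormant_stubs)
  have finX: "finite X" using p(1) B finU by (simp add: X_def)
  have cX: "card X = card A + card B + card U"
    using p(1) B finU disj by (simp add: X_def card_Un_disjoint Int_Un_distrib2)
  have b_pos: "b > 0" using B by (simp add: b_def card_gt_0_iff)
  have A3: "card A \<ge> 3" "S \<ge> real s" "S \<ge> 3" using p(7) par by (auto simp: S_def)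
  have A0: "A \<noteq> {}" using A3(1) by auto
  have NX: "N = real (card X) - 1" using cX A3 by (simp add: N_def of_nat_diff)
  have N_eq: "N = S + b + real (card U) - 1" using cX by (simp add: NX S_def b_def)
  have N_ge: "N \<ge> n0 + 2 * real (Suc j)" "N \<le> l" using p(8,9) by (auto simp: NX X_def U_def)
  have N_pos: "N > 0" using N_ge par by (simp add: add_pos_nonneg)
  have bN: "b \<le> N" "b \<le> l" using N_eq A3 N_ge by auto
  have l_pos: "l > 0" using N_ge N_pos by simp
  have q01: "0 \<le> 1 - b / l" "1 - b / l \<le> 1" using bN l_pos b_pos by auto
  have beta0: "\<beta> \<ge> 0" using par by (simp add: beta)
  have rest0: "rest \<ge> 0" using beta0 q01 by (simp add: rest_def)
  have g01: "0 \<le> g x" for x by (auto simp: g_def intro!: divide_nonneg_nonneg sum_nonneg core_bounds)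
  have rk0: "0 \<le> rk x" for x by (simp add: rk_def)
  have evX: "even (card X)" using p(5) by (simp add: X_def U_def)
  have d2: "d (fst y) \<ge> 2" if "y \<in> U" for y using p(6) UV[OF that] by blast
  let ?L = "next_avg d A B (\<lambda>x y. core E \<epsilon> k \<tau>0 (c x) (hB y)) g 0"
  let ?P = "next_avg d A B (\<lambda>x y. rk x) rk (1 / k)"
  \<comment> \<open>The loss \<open>rest\<close> of the remaining \<open>j\<close> steps is charged
    only when \<open>y\<close> misses \<open>B\<close>. Its average carries the factor
    \<open>1 - b / N\<close>, which turns the power \<open>j\<close> of the failure term into
    \<open>Suc j\<close>.\<close>
  let ?M = "\<lambda>x y. ?P x y + \<tau> / \<epsilon> + (if y \<in> B then 0 else rest)"
  have main: "ennreal ((\<Sum>x\<in>A. \<Sum>y\<in>X-{x}. ?L x y) / (card A * N))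
    \<le> meet_prob d V A B h E (\<tau>0 + \<tau>) + ennreal ((\<Sum>x\<in>A. \<Sum>y\<in>X-{x}. ?M x y) / (card A * N) + 1 / (card A * \<epsilon>))"
  proof (rule meet_step_avg[OF E p(1) B(1) p(2) A0 _ p(3,4) evX N_def par(3)])
    show "X = A \<union> B \<union> dormant_stubs d V" by (simp add: X_def U_def)
  next
    fix x y assume x: "x \<in> A" and y: "y \<in> X - {x}"
    have dy: "y \<notin> A \<Longrightarrow> y \<notin> B \<Longrightarrow> real (d (fst y)) \<ge> 2" using d2[of y] y by (auto simp: X_def)
    show "0 \<le> ?L x y \<and> 0 \<le> ?M x y"
      using A3 S_def dy rest0 p(13) par
      by (auto simp: next_avg_def intro!: core_bounds g01 rk0 divide_nonneg_nonneg sum_nonneg add_nonneg_nonneg mult_nonneg_nonneg)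
  next
    fix x y t assume x: "x \<in> A" and y: "y \<in> X - {x}" and t: "0 \<le> (t::real)"
    have tt: "(\<tau> + t) / \<epsilon> = \<tau> / \<epsilon> + t / \<epsilon>" by (simp add: add_divide_distrib)
    consider (B) "y \<in> B" | (A) "y \<in> A" "y \<notin> B" | (U) "y \<in> U" "y \<notin> A" "y \<notin> B" using y X_def by blast
    then show "ennreal (?L x y) \<le> next_val d V A B h E (\<tau>0 + \<tau> + t) x y + ennreal (?M x y + t / \<epsilon>)"
    proof cases
      case B
      have hx: "h x + h y + 1 = c x + hB y + 1 + r x" using p(11)[OF x] p(12)[OF B] by simp
      have "ennreal (core E \<epsilon> k \<tau>0 (c x) (hB y)) \<le> indicator E (\<tau>0 + \<tau> + t, h x + h y + 1) + ennreal (rk x + \<tau> / \<epsilon> + t / \<epsilon>)"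
      proof (cases "r x \<le> k \<and> \<tau> + t \<le> \<epsilon>")
        case True
        then have "(\<tau>0 + (\<tau> + t), c x + hB y + 1 + r x) \<in> E" if "core E \<epsilon> k \<tau>0 (c x) (hB y) \<noteq> 0"
          using that p(13) t by (auto simp: core_def split: if_splits)
        then show ?thesis
          unfolding hx using core_bounds(2)[of E \<epsilon> k \<tau>0 "c x" "hB y"]
          by (cases "core E \<epsilon> k \<tau>0 (c x) (hB y) = 0") (auto simp: indicator_def add.assoc intro: add_increasing2)
      next
        case False
        have "core E \<epsilon> k \<tau>0 (c x) (hB y) \<le> 1" by (rule core_bounds)
        \<comment> \<open>If \<open>E\<close> can be left, then either more than \<open>k\<close>
          edges were added or more than \<open>\<epsilon>\<close> time elapsed, and the
          corresponding Markov term is at least one.\<close>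
        also have "1 \<le> rk x + \<tau> / \<epsilon> + t / \<epsilon>"
        proof (cases "r x \<le> k")
          case True
          then have "(\<tau> + t) / \<epsilon> \<ge> 1" using False par by simp
          then show ?thesis using rk0[of x] tt by simp
        next
          case False
          then have "rk x \<ge> 1" using par by (simp add: rk_def)
          moreover have "\<tau> / \<epsilon> \<ge> 0" "t / \<epsilon> \<ge> 0" using t p(13) par by auto
          ultimately show ?thesis by linarith
        qed
        finally show ?thesis by (intro order_trans[OF ennreal_leI add_increasing]) auto
      qed
      then show ?thesis using B by (simp add: next_avg_def next_val_def)
    next
      case A
      let ?A' = "A - {x, y}"
      have X': "?A' \<union> B \<union> U = X - {x, y}" using A x disj by (auto simp: X_def)
      have card': "card (X - {x, y}) = card X - 2" "card ?A' = card A - 2"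
        using finX x y A p(1) X_def by (auto simp: card_Diff_subset)
      have "ennreal ((\<Sum>x\<in>?A'. (\<Sum>y\<in>B. core E \<epsilon> k \<tau>0 (c x) (hB y)) / card B) / card ?A')
        \<le> meet_prob d V ?A' B h E (\<tau>0 + (\<tau> + t)) +
           ennreal ((\<Sum>x\<in>?A'. real (r x) / k) / card ?A' + (\<tau> + t) / \<epsilon> + j * \<beta> + (1 - card B / l) ^ j)"
      proof (rule Suc.IH)
        show "even (card (?A' \<union> B \<union> dormant_stubs d V))" using X' card' evX by (simp add: U_def)
        show "n0 + 2 * real j \<le> real (card (?A' \<union> B \<union> dormant_stubs d V)) - 1"
          using X' card' N_ge NX cX A3 by (simp add: U_def of_nat_diff)
        show "real (card (?A' \<union> B \<union> dormant_stubs d V)) - 1 \<le> l"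
          using X' card' N_ge NX cX A3 by (simp add: U_def of_nat_diff)
        show "s + 2 * j \<le> card ?A'" using card' p(7) by simp
      qed (use p t in auto)
      moreover have "card ?A' = card A - 2 \<and> real (card A - 2) = S - 2" using card' A3 by (simp add: S_def of_nat_diff)
      ultimately show ?thesis using A
        by (simp add: next_avg_def next_val_def g_def rk_def rest_def S_def b_def tt algebra_simps)
    next
      case U
      let ?v = "fst y"
      let ?N = "dormant_stubs d {?v}"
      let ?A' = "A - {x} \<union> (?N - {y})"
      let ?h = "\<lambda>s. if fst s = ?v then h x + 1 else h s"
      let ?c = "\<lambda>s. if fst s = ?v then c x else c s"
      let ?r = "\<lambda>s. if fst s = ?v then r x + 1 else r s"
      have vV: "?v \<in> V" by (rule UV[OF U(1)])
      have yN: "y \<in> ?N" using U(1) by (auto simp: U_def dormant_stubs_def)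
      have NU: "?N \<subseteq> U" using vV by (auto simp: U_def dormant_stubs_def)
      have dsplit: "dormant_stubs d (V - {?v}) = U - ?N" by (auto simp: U_def dormant_stubs_def)
      have AN: "A \<inter> ?N = {}" using NU disj by auto
      have X': "?A' \<union> B \<union> dormant_stubs d (V - {?v}) = X - {x, y}"
        unfolding dsplit using U x yN NU disj by (auto simp: X_def)
      have cN: "card ?N = d ?v" by (simp add: card_dormant_stubs)
      have finN: "finite ?N" by (simp add: finite_dormant_stubs)
      have dv: "d ?v \<ge> 2" by (rule d2[OF U(1)])
      have cardN: "card (?N - {y}) = d ?v - 1" using yN cN finN by simp
      have cardA: "card ?A' = card A - 1 + (d ?v - 1)"
        using AN x p(1) finN cardN by (subst card_Un_disjoint) auto
      have cardX: "card (X - {x, y}) = card X - 2" using finX x y X_def by (auto simp: card_Diff_subset)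
      have sumA: "(\<Sum>z\<in>?A'. f (if fst z = ?v then F else F' z)) = (\<Sum>z\<in>A-{x}. f (F' z)) + (real (d ?v) - 1) * f F"
        for f :: "'z \<Rightarrow> real" and F F'
      proof -
        have "(\<Sum>z\<in>?A'. f (if fst z = ?v then F else F' z))
           = (\<Sum>z\<in>A-{x}. f (if fst z = ?v then F else F' z)) + (\<Sum>z\<in>?N-{y}. f (if fst z = ?v then F else F' z))"
          using AN p(1) finN by (intro sum.union_disjoint) auto
        also have "(\<Sum>z\<in>A-{x}. f (if fst z = ?v then F else F' z)) = (\<Sum>z\<in>A-{x}. f (F' z))"
        proof (intro sum.cong refl)
          fix z assume "z \<in> A - {x}"
          then have "fst z \<noteq> ?v" using p(4)[of z] vV by auto
          then show "f (if fst z = ?v then F else F' z) = f (F' z)" by simp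
        qed
        also have "(\<Sum>z\<in>?N-{y}. f (if fst z = ?v then F else F' z)) = (\<Sum>z\<in>?N-{y}. f F)"
          by (intro sum.cong refl) (auto simp: dormant_stubs_def)
        finally show ?thesis using cardN dv by (simp add: of_nat_diff)
      qed
      have rA: "real (card ?A') = real (card A) + real (d ?v) - 2"
        using cardA A3 dv by (simp add: of_nat_diff)
      have "ennreal ((\<Sum>x\<in>?A'. (\<Sum>y\<in>B. core E \<epsilon> k \<tau>0 (?c x) (hB y)) / card B) / card ?A')
        \<le> meet_prob d (V - {?v}) ?A' B ?h E (\<tau>0 + (\<tau> + t)) +
           ennreal ((\<Sum>x\<in>?A'. real (?r x) / k) / card ?A' + (\<tau> + t) / \<epsilon> + j * \<beta> + (1 - card B / l) ^ j)"
      proof (rule Suc.IH)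
        show "even (card (?A' \<union> B \<union> dormant_stubs d (V - {?v})))" unfolding X' cardX using evX by simp
        show "n0 + 2 * real j \<le> real (card (?A' \<union> B \<union> dormant_stubs d (V - {?v}))) - 1"
          unfolding X' cardX using N_ge NX cX A3 by (simp add: of_nat_diff)
        show "real (card (?A' \<union> B \<union> dormant_stubs d (V - {?v}))) - 1 \<le> l"
          unfolding X' cardX using N_ge NX cX A3 by (simp add: of_nat_diff)
        show "s + 2 * j \<le> card ?A'" using cardA p(7) dv by simp
        show "?A' \<inter> B = {}" using disj NU by auto
        show "fst z \<notin> V - {?v}" if "z \<in> ?A' \<union> B" for z using that p(4)[of z] by (auto simp: dormant_stubs_def)
        show "(\<Sum>v\<in>V - {?v}. (real (d v))\<^sup>2) \<le> Qm"
          using p(2) by (intro order_trans[OF sum_mono2 p(10)]) auto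
        show "?h z = ?c z + ?r z" if "z \<in> ?A'" for z using that p(11)[OF x] p(11)[of z] by (auto simp: dormant_stubs_def)
        show "?h z = hB z" if "z \<in> B" for z using that p(4)[of z] vV p(12) by auto
      qed (use p t finN in auto)
      moreover have "(\<Sum>z\<in>?A'. (\<Sum>y\<in>B. core E \<epsilon> k \<tau>0 (?c z) (hB y)) / card B) = (\<Sum>z\<in>A-{x}. g z) + (real (d ?v) - 1) * g x"
        unfolding g_def by (rule sumA[of "\<lambda>a. (\<Sum>y\<in>B. core E \<epsilon> k \<tau>0 a (hB y)) / card B" "c x" c])
      moreover have "(\<Sum>z\<in>?A'. real (?r z) / k) = (\<Sum>z\<in>A-{x}. rk z) + (real (d ?v) - 1) * (rk x + 1 / k)"
        unfolding sumA[of "\<lambda>a. real a / k" "r x + 1" r] by (simp add: rk_def add_divide_distrib)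
      ultimately show ?thesis using U unfolding rA
        by (simp add: next_avg_def next_val_def rest_def b_def tt algebra_simps)
    qed
  qed
  have finUs: "finite A" "finite B" "finite U" using p(1) B finU by auto
  have L: "(\<Sum>x\<in>A. \<Sum>y\<in>X-{x}. ?L x y) = N * (\<Sum>x\<in>A. g x)"
  proof -
    have "(\<Sum>x\<in>A. \<Sum>y\<in>B. core E \<epsilon> k \<tau>0 (c x) (hB y)) = b * (\<Sum>x\<in>A. g x)"
      unfolding sum_distrib_left[of b g A] using b_pos by (intro sum.cong refl) (simp add: g_def b_def)
    then show ?thesis
      using sum_next_avg[of A B U d "\<lambda>x y. core E \<epsilon> k \<tau>0 (c x) (hB y)" g 0, OF finUs disj A3(1) d2]
      unfolding X_def N_eq by (simp add: S_def algebra_simps)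
  qed
  have P: "(\<Sum>x\<in>A. \<Sum>y\<in>X-{x}. ?P x y) \<le> N * (\<Sum>x\<in>A. rk x) + S * (Qm / (s * k))"
  proof -
    \<comment> \<open>The partner is picked by stubs and the label grows in proportion to the degree
      found there, so the mean growth is governed by the sum of the squared degrees.\<close>
    have "(\<Sum>y\<in>U. (real (d (fst y)) - 1) / (S + real (d (fst y)) - 2)) \<le> (\<Sum>y\<in>U. real (d (fst y)) / s)"
    proof (rule sum_mono)
      fix y assume yU: "y \<in> U"
      have "real (d (fst y)) \<ge> 2" using d2[OF yU] by linarith
      then show "(real (d (fst y)) - 1) / (S + real (d (fst y)) - 2) \<le> real (d (fst y)) / s"
        using A3 par by (intro frac_le) auto
    qed
    also have "\<dots> = (\<Sum>v\<in>V. (real (d v))\<^sup>2) / s"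
      unfolding U_def sum_dormant_stubs[OF p(2), of "\<lambda>v. real (d v) / s" d] by (simp add: power2_eq_square sum_divide_distrib)
    also have "\<dots> \<le> Qm / s" using p(10) by (intro divide_right_mono) auto
    finally have *: "(\<Sum>y\<in>U. (real (d (fst y)) - 1) / (S + real (d (fst y)) - 2)) \<le> Qm / s" .
    have "(\<Sum>x\<in>A. \<Sum>y\<in>X-{x}. ?P x y) = N * (\<Sum>x\<in>A. rk x)
       + 1 / k * S * (\<Sum>y\<in>U. (real (d (fst y)) - 1) / (S + real (d (fst y)) - 2))"
      using sum_next_avg[of A B U d "\<lambda>x y. rk x" rk "1 / k", OF finUs disj A3(1) d2]
      unfolding X_def N_eq by (simp add: S_def b_def sum_distrib_right[symmetric] algebra_simps)
    also have "\<dots> \<le> N * (\<Sum>x\<in>A. rk x) + 1 / k * S * (Qm / s)"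
      using * A3 by (intro add_left_mono mult_left_mono) auto
    finally show ?thesis by (simp add: mult_ac)
  qed
  have M: "(\<Sum>x\<in>A. \<Sum>y\<in>X-{x}. ?M x y) = (\<Sum>x\<in>A. \<Sum>y\<in>X-{x}. ?P x y) + S * (N * (\<tau> / \<epsilon>)) + S * ((N - b) * rest)"
  proof -
    have "(\<Sum>y\<in>X-{x}. ?M x y) = (\<Sum>y\<in>X-{x}. ?P x y) + N * (\<tau> / \<epsilon>) + (N - b) * rest" if x: "x \<in> A" for x
    proof -
      have xX: "x \<in> X" "x \<notin> B" using x disj by (auto simp: X_def)
      have c1: "real (card (X - {x})) = N" using xX finX by (simp add: N_def)
      have "(\<Sum>y\<in>X-{x}. if y \<in> B then 0 else rest) = (\<Sum>y\<in>(X-{x})-B. rest)"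
        using finX by (intro sum.mono_neutral_cong_right) auto
      also have "\<dots> = (N - b) * rest"
      proof -
        have "B \<subseteq> X - {x}" using xX by (auto simp: X_def)
        then have "card ((X - {x}) - B) = card (X - {x}) - card B" using B by (intro card_Diff_subset) auto
        moreover have "card B \<le> card (X - {x})" using \<open>B \<subseteq> X - {x}\<close> finX by (intro card_mono) auto
        ultimately show ?thesis using c1 by (simp add: b_def of_nat_diff)
      qed
      finally show ?thesis using c1 by (simp add: sum.distrib)
    qed
    then have "(\<Sum>x\<in>A. \<Sum>y\<in>X-{x}. ?M x y) = (\<Sum>x\<in>A. (\<Sum>y\<in>X-{x}. ?P x y) + N * (\<tau> / \<epsilon>) + (N - b) * rest)"
      by (intro sum.cong refl)
    also have "\<dots> = (\<Sum>x\<in>A. \<Sum>y\<in>X-{x}. ?P x y) + S * (N * (\<tau> / \<epsilon>)) + S * ((N - b) * rest)"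
      by (simp add: sum.distrib S_def)
    finally show ?thesis .
  qed
  have S_pos: "S > 0" using A3 by simp
  have "(\<Sum>x\<in>A. \<Sum>y\<in>X-{x}. ?M x y) / (S * N) + 1 / (S * \<epsilon>)
     \<le> (N * (\<Sum>x\<in>A. rk x) + S * (Qm / (s * k)) + S * (N * (\<tau> / \<epsilon>)) + S * ((N - b) * rest)) / (S * N) + 1 / (S * \<epsilon>)"
    unfolding M using P S_pos N_pos by (intro add_right_mono divide_right_mono) auto
  also have "\<dots> = (\<Sum>x\<in>A. rk x) / S + Qm / (s * k) / N + \<tau> / \<epsilon> + (1 - b / N) * rest + 1 / (S * \<epsilon>)"
    using S_pos N_pos by (simp add: add_divide_distrib diff_divide_distrib left_diff_distrib)
  also have "\<dots> \<le> (\<Sum>x\<in>A. rk x) / S + Qm / (s * k) / n0 + \<tau> / \<epsilon> + (j * \<beta> + (1 - b / l) ^ Suc j) + 1 / (s * \<epsilon>)"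
  proof (intro add_mono order_refl)
    show "Qm / (s * k) / N \<le> Qm / (s * k) / n0" using N_ge par by (intro divide_left_mono) auto
    have "1 - b / N \<le> 1 - b / l" using N_ge N_pos b_pos by (simp add: frac_le)
    then have "(1 - b / N) * rest \<le> (1 - b / l) * rest" using rest0 by (intro mult_right_mono)
    also have "\<dots> = (1 - b / l) * (j * \<beta>) + (1 - b / l) ^ Suc j" by (simp add: rest_def distrib_left)
    also have "\<dots> \<le> 1 * (j * \<beta>) + (1 - b / l) ^ Suc j"
      using q01 beta0 by (intro add_right_mono mult_right_mono) auto
    finally show "(1 - b / N) * rest \<le> j * \<beta> + (1 - b / l) ^ Suc j" by simp
    show "1 / (S * \<epsilon>) \<le> 1 / (s * \<epsilon>)" using A3 par by (intro frac_le mult_right_mono) auto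
  qed
  also have "\<dots> = (\<Sum>x\<in>A. rk x) / S + \<tau> / \<epsilon> + Suc j * \<beta> + (1 - b / l) ^ Suc j"
  proof -
    have "\<beta> = Qm / (s * k) / n0 + 1 / (s * \<epsilon>)" by (simp add: beta mult_ac)
    then show ?thesis by (simp add: distrib_right)
  qed
  finally have err: "(\<Sum>x\<in>A. \<Sum>y\<in>X-{x}. ?M x y) / (S * N) + 1 / (S * \<epsilon>)
     \<le> (\<Sum>x\<in>A. rk x) / S + \<tau> / \<epsilon> + Suc j * \<beta> + (1 - b / l) ^ Suc j" .
  have "(\<Sum>x\<in>A. \<Sum>y\<in>X-{x}. ?L x y) / (card A * N) = (\<Sum>x\<in>A. g x) / card A"
    unfolding L using N_pos by simp
  with main have "ennreal ((\<Sum>x\<in>A. g x) / card A) \<le> meet_prob d V A B h E (\<tau>0 + \<tau>)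
     + ennreal ((\<Sum>x\<in>A. \<Sum>y\<in>X-{x}. ?M x y) / (card A * N) + 1 / (card A * \<epsilon>))" by simp
  also have "\<dots> \<le> meet_prob d V A B h E (\<tau>0 + \<tau>) + ennreal ((\<Sum>x\<in>A. rk x) / S + \<tau> / \<epsilon> + Suc j * \<beta> + (1 - b / l) ^ Suc j)"
    using err by (intro add_left_mono ennreal_leI) (simp add: S_def)
  finally show ?case by (simp add: g_def rk_def S_def b_def)
qed

subsection \<open>Exploring with i.i.d. degrees\<close>

lemma sum_swap_scaled:
  fixes a b :: ennreal
  shows "(\<Sum>y\<in>Y. a * (b * (\<Sum>x\<in>A. f x y))) = b * (\<Sum>x\<in>A. \<Sum>y\<in>Y. a * f x y)"
proof -
  have "(\<Sum>y\<in>Y. a * (b * (\<Sum>x\<in>A. f x y))) = (\<Sum>y\<in>Y. \<Sum>x\<in>A. b * (a * f x y))"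
    by (simp add: sum_distrib_left mult_ac)
  also have "\<dots> = (\<Sum>x\<in>A. \<Sum>y\<in>Y. b * (a * f x y))" by (rule sum.swap)
  finally show ?thesis by (simp add: sum_distrib_left)
qed

text \<open>The idealised exploration of one cluster: \<open>S\<close> active stubs, time \<open>t\<close>, and the label \<open>a\<close> of a uniformly
  chosen active stub. A new vertex of degree \<open>k\<close> replaces one active stub by \<open>k - 1\<close> new ones, and the
  chosen stub is among these with probability \<open>(k - 1) / (S + k - 2)\<close>.\<close>

definition mix :: "nat \<Rightarrow> nat \<Rightarrow> (nat \<Rightarrow> ennreal) \<Rightarrow> nat \<Rightarrow> ennreal" where
  "mix S k f a = ennreal (1 - (real k - 1) / (real S + real k - 2)) * f a
     + ennreal ((real k - 1) / (real S + real k - 2)) * f (a + 1)"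

text \<open>The transition operator of the ideal chain, applied \<open>j\<close> times to the test
  function \<open>\<Gamma>\<close>. This backward form matches the one-step inequalities, which also
  act on functions of the current state.\<close>

primrec explore :: "nat pmf \<Rightarrow> nat \<Rightarrow> (nat \<Rightarrow> real \<Rightarrow> nat \<Rightarrow> ennreal) \<Rightarrow> nat \<Rightarrow> real \<Rightarrow> nat \<Rightarrow> ennreal" where
  "explore Fs 0 \<Gamma> = \<Gamma>"
| "explore Fs (Suc j) \<Gamma> = (\<lambda>S t a. \<integral>\<^sup>+k. expect_exp S (\<lambda>e. mix S k (explore Fs j \<Gamma> (S + k - 2) (t + e)) a) \<partial>measure_pmf Fs)"

text \<open>Degree sequences range over an uncountable discrete type. On the countable support of
  the law joint measurability holds, and with it Fubini's theorem.\<close>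

lemma nn_integral_count_space_set_pmf:
  "(\<integral>\<^sup>+d. f d \<partial>measure_pmf p) = (\<integral>\<^sup>+d. ennreal (pmf p d) * f d \<partial>count_space (set_pmf p))"
proof -
  have "(\<integral>\<^sup>+d. f d \<partial>measure_pmf p) = (\<integral>\<^sup>+d. ennreal (pmf p d) * f d \<partial>count_space UNIV)"
    by (rule nn_integral_measure_pmf)
  also have "\<dots> = (\<integral>\<^sup>+d. ennreal (pmf p d) * f d \<partial>count_space (set_pmf p))"
    by (subst nn_integral_count_space_indicator, simp, intro nn_integral_cong)
       (auto simp: indicator_def set_pmf_iff)
  finally show ?thesis .
qed

lemma borel_measurable_nn_integral_pmf:
  assumes "\<And>k. f k \<in> borel_measurable M"
  shows "(\<lambda>t. \<integral>\<^sup>+k. f k t \<partial>measure_pmf p) \<in> borel_measurable M"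
proof -
  let ?C = "count_space (set_pmf p)"
  interpret sigma_finite_measure ?C
    by (rule sigma_finite_measure_count_space_countable) simp
  have m: "(\<lambda>t. ennreal (pmf p k) * f k t) \<in> borel_measurable M" for k
    using assms[of k] by simp
  have "(\<lambda>(k, t). ennreal (pmf p k) * f k t) \<in> borel_measurable (?C \<Otimes>\<^sub>M M)"
    by (rule measurable_pair_measure_countable1) (simp_all add: m)
  then have "(\<lambda>(t, k). ennreal (pmf p k) * f k t) \<in> borel_measurable (M \<Otimes>\<^sub>M ?C)"
    by (subst (asm) measurable_pair_swap_iff) simp
  then show ?thesis unfolding nn_integral_count_space_set_pmf by (rule borel_measurable_nn_integral)
qed

lemma expect_exp_nn_integral_pmf:
  assumes "\<And>d. g d \<in> borel_measurable borel"
  shows "(\<integral>\<^sup>+d. expect_exp S (g d) \<partial>measure_pmf p) = expect_exp S (\<lambda>t. \<integral>\<^sup>+d. g d t \<partial>measure_pmf p)"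
proof -
  let ?C = "count_space (set_pmf p)"
  interpret C: sigma_finite_measure ?C
    by (rule sigma_finite_measure_count_space_countable) simp
  interpret pair_sigma_finite ?C lborel ..
  note conv = nn_integral_count_space_set_pmf
  note [measurable] = assms
  have m: "(\<lambda>(d, t). ennreal (pmf p d) * (ennreal (exponential_density (real S) t) * g d t)) \<in> borel_measurable (?C \<Otimes>\<^sub>M lborel)"
    by (rule measurable_pair_measure_countable1) auto
  have "(\<integral>\<^sup>+d. expect_exp S (g d) \<partial>measure_pmf p)
     = (\<integral>\<^sup>+d. \<integral>\<^sup>+t. ennreal (pmf p d) * (ennreal (exponential_density (real S) t) * g d t) \<partial>lborel \<partial>?C)"
    unfolding conv expect_exp_def by (intro nn_integral_cong, subst nn_integral_cmult) auto
  also have "\<dots> = (\<integral>\<^sup>+t. \<integral>\<^sup>+d. ennreal (pmf p d) * (ennreal (exponential_density (real S) t) * g d t) \<partial>?C \<partial>lborel)"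
    by (rule Fubini'[OF m, symmetric])
  also have "\<dots> = expect_exp S (\<lambda>t. \<integral>\<^sup>+d. g d t \<partial>measure_pmf p)"
    unfolding conv expect_exp_def
    by (intro nn_integral_cong, subst nn_integral_cmult[symmetric]) (auto simp: mult_ac)
  finally show ?thesis .
qed

lemma measurable_explore:
  assumes "\<And>S a. (\<lambda>t. \<Gamma> S t a) \<in> borel_measurable borel"
  shows "(\<lambda>t. explore Fs j \<Gamma> S t a) \<in> borel_measurable borel"
proof (induction j arbitrary: S a)
  case (Suc j)
  note [measurable] = Suc.IH
  have "(\<lambda>t. expect_exp S (\<lambda>e. mix S k (explore Fs j \<Gamma> (S + k - 2) (t + e)) a)) \<in> borel_measurable borel" for k
    unfolding mix_def by (intro borel_measurable_expect_exp) measurable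
  then show ?case by (simp add: borel_measurable_nn_integral_pmf)
qed (use assms in simp)

lemma measurable_explore_shift [measurable]:
  assumes "\<And>S a. (\<lambda>t. \<Gamma> S t a) \<in> borel_measurable borel"
  shows "(\<lambda>e. explore Fs j \<Gamma> S (t + e) a) \<in> borel_measurable borel"
    "(\<lambda>e. mix S' k (explore Fs j \<Gamma> S (t + e)) a) \<in> borel_measurable borel"
proof -
  show *: "(\<lambda>e. explore Fs j \<Gamma> S (t + e) a) \<in> borel_measurable borel" for a
    by (rule measurable_compose[OF _ measurable_explore[OF assms]]) simp
  show "(\<lambda>e. mix S' k (explore Fs j \<Gamma> S (t + e)) a) \<in> borel_measurable borel"
    unfolding mix_def using * by measurable
qed

lemma mix_mono: "(\<And>a. f a \<le> g a) \<Longrightarrow> mix S k f a \<le> mix S k g a"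
  unfolding mix_def by (intro add_mono mult_left_mono) auto

lemma explore_mono:
  assumes "\<And>S t a. \<Gamma> S t a \<le> \<Gamma>' S t a"
  shows "explore Fs j \<Gamma> S t a \<le> explore Fs j \<Gamma>' S t a"
proof (induction j arbitrary: S t a)
  case (Suc j)
  show ?case unfolding explore.simps
    by (intro nn_integral_mono expect_exp_mono mix_mono Suc)
qed (use assms in simp)

lemma explore_add:
  assumes m: "\<And>S a. (\<lambda>t. \<Gamma> S t a) \<in> borel_measurable borel" "\<And>S a. (\<lambda>t. \<Gamma>' S t a) \<in> borel_measurable borel"
  shows "explore Fs j (\<lambda>S t a. \<Gamma> S t a + \<Gamma>' S t a) S t a = explore Fs j \<Gamma> S t a + explore Fs j \<Gamma>' S t a"
proof (induction j arbitrary: S t a)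
  case (Suc j)
  have mx: "mix S k (\<lambda>a. f a + g a) a = mix S k f a + mix S k g a" for S k f g a
    by (simp add: mix_def distrib_left add_ac)
  show ?case unfolding explore.simps Suc.IH mx
    using measurable_explore_shift(2)[OF m(1)] measurable_explore_shift(2)[OF m(2)]
    by (simp add: expect_exp_add nn_integral_add)
qed simp

lemma explore_cmult:
  assumes m: "\<And>S a. (\<lambda>t. \<Gamma> S t a) \<in> borel_measurable borel"
  shows "explore Fs j (\<lambda>S t a. c * \<Gamma> S t a) S t a = c * explore Fs j \<Gamma> S t a"
proof (induction j arbitrary: S t a)
  case (Suc j)
  have mx: "mix S k (\<lambda>a. c * f a) a = c * mix S k f a" for S k f a
    by (simp add: mix_def distrib_left mult_ac)
  show ?case unfolding explore.simps Suc.IH mx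
    using measurable_explore_shift(2)[OF m]
    by (simp add: expect_exp_cmult nn_integral_cmult)
qed simp

lemma explore_zero: "explore Fs j (\<lambda>S t a. 0) S t a = 0"
  by (induction j arbitrary: S t a) (simp_all add: mix_def expect_exp_def)

lemma explore_sum:
  assumes m: "\<And>y S a. (\<lambda>t. \<Gamma> y S t a) \<in> borel_measurable borel" and fin: "finite Y"
  shows "explore Fs j (\<lambda>S t a. \<Sum>y\<in>Y. \<Gamma> y S t a) S t a = (\<Sum>y\<in>Y. explore Fs j (\<Gamma> y) S t a)"
  using fin
proof (induction Y)
  case (insert y Y)
  have m': "(\<lambda>t. \<Sum>y\<in>Y. \<Gamma> y S t a) \<in> borel_measurable borel" for S a
    using m by (intro borel_measurable_sum) auto
  have "explore Fs j (\<lambda>S t a. \<Sum>y\<in>insert y Y. \<Gamma> y S t a) S t a = explore Fs j (\<lambda>S t a. \<Gamma> y S t a + (\<Sum>y\<in>Y. \<Gamma> y S t a)) S t a"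
    using insert.hyps by simp
  then show ?case using insert explore_add[where \<Gamma>="\<Gamma> y", OF m m'] by simp
qed (simp add: explore_zero)

section \<open>Success probability averaged over the unrevealed degrees, with the parity
  correction\<close>

definition parity_adjust :: "nat \<Rightarrow> nat \<Rightarrow> nat set \<Rightarrow> (nat \<Rightarrow> nat) \<Rightarrow> nat \<Rightarrow> nat" where
  "parity_adjust z c V d = (if odd (c + (\<Sum>v\<in>V. d v)) then d(z := d z + 1) else d)"

text \<open>The unrevealed degrees are i.i.d.; the vertex \<open>z\<close>, which absorbs the parity
  correction, is kept out of the exploration. The indicator bounds the number of remaining stubs, so
  that every partner has a probability bounded below; the bound \<open>l\<close> drops by two with
  each revealed pair.\<close>

definition ann where
  "ann F z l V A B h E \<tau> = (\<integral>\<^sup>+d. indicator {d. card (A \<union> B \<union> dormant_stubs (parity_adjust z (card A + card B) V d) V) \<le> l} d *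
      meet_prob (parity_adjust z (card A + card B) V d) V A B h E \<tau> \<partial>measure_pmf (Pi_pmf V 0 (\<lambda>_. F)))"

lemma meet_prob_cong:
  assumes "dormant_stubs d V = dormant_stubs d' V"
  shows "meet_prob d V A B h E \<tau> = meet_prob d' V A B h E \<tau>"
  using assms by (simp add: meet_prob_def)

lemma ann_swap: "ann F z l V A B h E \<tau> = ann F z l V B A h E \<tau>"
  unfolding ann_def by (simp add: add.commute[of "card A"] Un_commute[of A] meet_prob_swap[of _ _ A])

lemma parity_adjust_even:
  assumes "finite V" "z \<in> V" shows "even (c + (\<Sum>v\<in>V. parity_adjust z c V d v))"
proof (cases "odd (c + (\<Sum>v\<in>V. d v))")
  case True
  have "(\<Sum>v\<in>V. (d(z := d z + 1)) v) = Suc (\<Sum>v\<in>V. d v)"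
    using assms by (simp add: sum.remove)
  then show ?thesis using True by (simp add: parity_adjust_def)
qed (simp add: parity_adjust_def)

lemma parity_adjust_ge: "d v \<le> parity_adjust z c V d v"
  by (simp add: parity_adjust_def)

lemma parity_adjust_other: "v \<noteq> z \<Longrightarrow> parity_adjust z c V d v = d v"
  by (simp add: parity_adjust_def)

lemma dormant_stubs_cong: "(\<And>v. v \<in> V \<Longrightarrow> d v = d' v) \<Longrightarrow> dormant_stubs d V = dormant_stubs d' V"
  by (auto simp: dormant_stubs_def)

lemma card_three:
  assumes "finite A" "finite B" "finite V" "A \<inter> B = {}" "\<And>s. s \<in> A \<union> B \<Longrightarrow> fst s \<notin> V"
  shows "card (A \<union> B \<union> dormant_stubs d V) = card A + card B + (\<Sum>v\<in>V. d v)"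
proof -
  have "(A \<union> B) \<inter> dormant_stubs d V = {}"
  proof (rule ccontr)
    assume "(A \<union> B) \<inter> dormant_stubs d V \<noteq> {}"
    then obtain s where "s \<in> A \<union> B" "s \<in> dormant_stubs d V" by blast
    moreover from this(2) have "fst s \<in> V" by (auto simp: dormant_stubs_def)
    ultimately show False using assms(5) by blast
  qed
  then show ?thesis
    using assms by (simp add: card_Un_disjoint finite_dormant_stubs card_dormant_stubs)
qed

lemma sum_ennreal_diff1:
  assumes "finite A" shows "(\<Sum>x\<in>A. \<Sum>z\<in>A-{x}. f z) = of_nat (card A - 1) * (\<Sum>z\<in>A. f z :: ennreal)"
proof -
  have "(\<Sum>x\<in>A. \<Sum>z\<in>A-{x}. f z) = (\<Sum>x\<in>A. \<Sum>z\<in>A. if z \<noteq> x then f z else 0)"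
    using assms by (intro sum.cong refl sum.mono_neutral_cong_left) auto
  also have "\<dots> = (\<Sum>z\<in>A. \<Sum>x\<in>A. if z \<noteq> x then f z else 0)" by (rule sum.swap)
  also have "\<dots> = (\<Sum>z\<in>A. \<Sum>x\<in>A-{z}. f z)"
    using assms by (intro sum.cong refl sum.mono_neutral_cong_right) auto
  also have "\<dots> = (\<Sum>z\<in>A. of_nat (card A - 1) * f z)" using assms by (intro sum.cong refl) simp
  finally show ?thesis by (simp add: sum_distrib_left)
qed

text \<open>For a uniform ringing stub \<open>x\<close>, a surviving old stub is again uniform,
  while a new stub has label \<open>h x + 1\<close>. Hence the label of one uniform active stub
  evolves as a chain of its own, and the other labels need not be remembered.\<close>

lemma sum_mix:
  assumes A: "finite A" "A \<noteq> {}" and k: "k \<ge> 2"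
  shows "(\<Sum>x\<in>A. ennreal (1 / real (card A + k - 2)) * ((\<Sum>z\<in>A-{x}. f (h z)) + of_nat (k - 1) * f (h x + 1)))
     = (\<Sum>x\<in>A. mix (card A) k f (h x))"
proof -
  define S where "S = card A"
  have S: "S \<ge> 1" using A by (simp add: S_def Suc_le_eq card_gt_0_iff)
  have e1: "ennreal (1 / real (S + k - 2)) * of_nat (S - 1) = ennreal (1 - (real k - 1) / (real S + real k - 2))"
    "ennreal (1 / real (S + k - 2)) * of_nat (k - 1) = ennreal ((real k - 1) / (real S + real k - 2))"
  proof -
    have r: "real (S + k - 2) = real S + real k - 2" "real (k - 1) = real k - 1" "real (S - 1) = real S - 1"
      using S k by (auto simp: of_nat_diff)
    show "ennreal (1 / real (S + k - 2)) * of_nat (k - 1) = ennreal ((real k - 1) / (real S + real k - 2))"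
      unfolding ennreal_of_nat_eq_real_of_nat r using k S by (simp add: ennreal_mult[symmetric])
    have "1 - (real k - 1) / (real S + real k - 2) = (real S - 1) / (real S + real k - 2)"
      using k S by (simp add: field_simps)
    then show "ennreal (1 / real (S + k - 2)) * of_nat (S - 1) = ennreal (1 - (real k - 1) / (real S + real k - 2))"
      unfolding ennreal_of_nat_eq_real_of_nat r using k S by (simp add: ennreal_mult[symmetric])
  qed
  have "(\<Sum>x\<in>A. ennreal (1 / real (S + k - 2)) * ((\<Sum>z\<in>A-{x}. f (h z)) + of_nat (k - 1) * f (h x + 1)))
     = ennreal (1 / real (S + k - 2)) * (of_nat (S - 1) * (\<Sum>z\<in>A. f (h z))) + ennreal (1 / real (S + k - 2)) * (of_nat (k - 1) * (\<Sum>x\<in>A. f (h x + 1)))"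
    using sum_ennreal_diff1[OF A(1), of "\<lambda>z. f (h z)"]
    by (simp add: sum_distrib_left[symmetric] sum.distrib distrib_left S_def)
  also have "\<dots> = (\<Sum>x\<in>A. mix S k f (h x))"
    unfolding mult.assoc[symmetric] e1 by (simp add: mix_def sum.distrib sum_distrib_left)
  finally show ?thesis by (simp add: S_def)
qed

definition size_biased :: "nat pmf \<Rightarrow> real \<Rightarrow> nat pmf \<Rightarrow> bool" where
  "size_biased F \<mu> Fs \<longleftrightarrow> 0 < \<mu> \<and> (\<forall>k. pmf Fs k = real k * pmf F k / \<mu>)"

lemma nn_integral_size_biased:
  assumes "size_biased F \<mu> Fs"
  shows "(\<integral>\<^sup>+k. of_nat k * g k \<partial>measure_pmf F) = ennreal \<mu> * (\<integral>\<^sup>+k. g k \<partial>measure_pmf Fs)"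
proof -
  have "ennreal \<mu> * (ennreal (pmf Fs k) * g k) = ennreal (pmf F k) * (of_nat k * g k)" for k
  proof -
    have "\<mu> * pmf Fs k = pmf F k * real k" using assms by (simp add: size_biased_def)
    then have "ennreal \<mu> * ennreal (pmf Fs k) = ennreal (pmf F k) * of_nat k"
      using assms by (simp add: size_biased_def ennreal_mult[symmetric] ennreal_of_nat_eq_real_of_nat)
    then show ?thesis by (simp add: mult.assoc[symmetric])
  qed
  then show ?thesis
    by (simp add: nn_integral_measure_pmf nn_integral_cmult[symmetric])
qed

lemma ann_measurable:
  assumes E: "E \<in> sets (borel \<Otimes>\<^sub>M count_space UNIV)"
  shows "(\<lambda>t. indicator Q d * meet_prob d' V A B h E (\<tau> + t)) \<in> borel_measurable borel"
  using measurable_compose[OF _ measurable_meet_prob[OF E], of "\<lambda>t. \<tau> + t" borel d' V A B h] by simp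

text \<open>The probability of picking a prescribed dormant vertex of degree \<open>k\<close> is at least \<open>k / L\<close>, whatever the
  degrees of the other dormant vertices; averaging over its unrevealed degree produces the size-biased law
  and the factor \<open>N0 * \<mu> / L\<close>.\<close>

lemma ann_step:
  assumes E: "E \<in> sets (borel \<Otimes>\<^sub>M count_space UNIV)"
    and fin: "finite A" "finite B" "finite V" and A0: "A \<noteq> {}"
    and disj: "A \<inter> B = {}" "\<And>s. s \<in> A \<union> B \<Longrightarrow> fst s \<notin> V"
    and z: "z \<in> V" and V0: "V0 \<subseteq> V - {z}" and l: "real (l + 2) \<le> L"
  shows "(\<Sum>v\<in>V0. \<integral>\<^sup>+k. (\<Sum>i<k. ennreal (1 / L) * (ennreal (1 / card A) * (\<Sum>x\<in>A. expect_exp (card A) (\<lambda>t.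
       ann F z l (V - {v}) (A - {x} \<union> ({v} \<times> {..<k} - {(v, i)})) B (\<lambda>s. if fst s = v then h x + 1 else h s) E (\<tau> + t))))) \<partial>measure_pmf F)
     \<le> ann F z (l + 2) V A B h E \<tau>"
proof -
  define c where "c = card A + card B"
  define X where "X = (\<lambda>d. A \<union> B \<union> dormant_stubs (parity_adjust z c V d) V)"
  define I where "I = (\<lambda>d. indicator {d. card (X d) \<le> l + 2} d :: ennreal)"
  let ?A = "\<lambda>x v i k. A - {x} \<union> ({v} \<times> {..<k} - {(v, i)})"
  let ?h = "\<lambda>x v s. if fst s = v then h x + 1 else h s"
  let ?G = "\<lambda>d v i x t. meet_prob (parity_adjust z c V d) (V - {v}) (?A x v i (d v)) B (?h x v) E (\<tau> + t)"
  have finV0: "finite V0" using V0 fin by (meson finite_Diff finite_subset)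
  have vz: "v \<noteq> z" "v \<in> V" if "v \<in> V0" for v using that V0 by auto
  have cX: "card (X d) = c + (\<Sum>v\<in>V. parity_adjust z c V d v)" for d
    using card_three[OF fin disj] by (simp add: X_def c_def)
  have A_pos: "card A > 0" using A0 fin by (simp add: card_gt_0_iff)
  have dv: "dormant_stubs (parity_adjust z c V d) {v} = {v} \<times> {..<d v}" if "v \<in> V0" for d v
    using vz(1)[OF that] by (auto simp: dormant_stubs_def parity_adjust_other)
  have mG: "?G d v i x \<in> borel_measurable borel" for d v i x
    by (rule measurable_compose[OF _ measurable_meet_prob[OF E]]) simp
  have pointwise: "(\<Sum>v\<in>V0. \<Sum>i<d v. ennreal (1 / L) * (ennreal (1 / card A) * (\<Sum>x\<in>A. expect_exp (card A) (\<lambda>t. I d * ?G d v i x t))))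
      \<le> I d * meet_prob (parity_adjust z c V d) V A B h E \<tau>" (is "?lhs \<le> _") for d
  proof (cases "card (X d) \<le> l + 2")
    case False
    then have "I d = 0" by (simp add: I_def)
    then show ?thesis using A_pos by (simp add: expect_exp_const)
  next
    case True
    then have I1: "I d = 1" by (simp add: I_def)
    let ?d = "parity_adjust z c V d"
    have finX: "finite (X d)" using fin finite_dormant_stubs by (simp add: X_def)
    let ?Y = "Sigma V0 (\<lambda>v. {..<d v})"
    have Y: "?Y \<subseteq> X d - {x}" if "x \<in> A" for x
    proof
      fix y assume y: "y \<in> ?Y"
      then obtain v i where vi: "y = (v, i)" "v \<in> V0" "i < d v" by auto
      then have "y \<in> dormant_stubs ?d V" using vz by (auto simp: dormant_stubs_def parity_adjust_other)
      moreover have "y \<noteq> x" using disj(2)[of x] that vi vz by auto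
      ultimately show "y \<in> X d - {x}" by (simp add: X_def)
    qed
    have nv: "next_val ?d V A B h E (\<tau> + t) x (v, i) = ?G d v i x t" if "v \<in> V0" "i < d v" "x \<in> A" for v i x t
    proof -
      have "(v, i) \<notin> A \<union> B" using disj(2)[of "(v, i)"] vz[OF that(1)] by auto
      then show ?thesis by (simp add: next_val_def dv[OF that(1)])
    qed
    \<comment> \<open>On the event in the indicator of \<open>ann\<close>, a prescribed partner has
      probability at least \<open>1 / L\<close>.\<close>
    have Ll: "1 / L \<le> 1 / real (card (X d) - 1)"
    proof -
      have "card A \<le> card (X d)" using finX by (intro card_mono) (auto simp: X_def)
      moreover have "even (card (X d))" unfolding cX by (rule parity_adjust_even[OF fin(3) z])
      then have "card (X d) \<noteq> 1" by (metis odd_one)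
      ultimately have "card (X d) - 1 > 0" using A_pos by linarith
      then show ?thesis using True l by (intro divide_left_mono) auto
    qed
    have "?lhs = (\<Sum>y\<in>?Y. ennreal (1 / L) * (ennreal (1 / card A) * (\<Sum>x\<in>A. expect_exp (card A) (\<lambda>t. next_val ?d V A B h E (\<tau> + t) x y))))"
      using finV0 by (subst sum.Sigma) (auto intro!: sum.cong simp: nv I1)
    also have "\<dots> = ennreal (1 / card A) * (\<Sum>x\<in>A. expect_exp (card A) (\<lambda>t. ennreal (1 / L) * (\<Sum>y\<in>?Y. next_val ?d V A B h E (\<tau> + t) x y)))"
    proof -
      have "expect_exp (card A) (\<lambda>t. ennreal (1 / L) * (\<Sum>y\<in>?Y. next_val ?d V A B h E (\<tau> + t) x y))
          = (\<Sum>y\<in>?Y. ennreal (1 / L) * expect_exp (card A) (\<lambda>t. next_val ?d V A B h E (\<tau> + t) x y))" for x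
        using borel_measurable_next_val[OF E]
        by (simp add: expect_exp_cmult expect_exp_sum borel_measurable_sum sum_distrib_left)
      then show ?thesis by (simp only: sum_swap_scaled)
    qed
    also have "\<dots> \<le> ennreal (1 / card A) * (\<Sum>x\<in>A. expect_exp (card A) (\<lambda>t. ennreal (1 / real (card (X d) - 1)) * (\<Sum>y\<in>X d-{x}. next_val ?d V A B h E (\<tau> + t) x y)))"
      using Ll Y finX by (intro mult_left_mono sum_mono expect_exp_mono mult_mono ennreal_leI sum_mono2) auto
    also have "\<dots> \<le> meet_prob ?d V A B h E \<tau>"
    proof (rule meet_step[OF E fin A0 _ disj])
      show "even (card (X d))" unfolding cX by (rule parity_adjust_even[OF fin(3) z])
    qed (simp add: X_def)
    finally show ?thesis by (simp add: I1)
  qed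
  have one: "(\<integral>\<^sup>+d. (\<Sum>i<d v. ennreal (1 / L) * (ennreal (1 / card A) * (\<Sum>x\<in>A. expect_exp (card A) (\<lambda>t. I d * ?G d v i x t)))) \<partial>measure_pmf (Pi_pmf V 0 (\<lambda>_. F)))
      = (\<integral>\<^sup>+k. (\<Sum>i<k. ennreal (1 / L) * (ennreal (1 / card A) * (\<Sum>x\<in>A. expect_exp (card A) (\<lambda>t.
         ann F z l (V - {v}) (?A x v i k) B (?h x v) E (\<tau> + t))))) \<partial>measure_pmf F)" if v: "v \<in> V0" for v
  proof -
    let ?P = "Pi_pmf (V - {v}) 0 (\<lambda>_. F)"
    have split: "Pi_pmf V 0 (\<lambda>_. F) = do {k \<leftarrow> F; d \<leftarrow> ?P; return_pmf (d(v := k))}"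
      using Pi_pmf_insert'[of "V - {v}" v 0 "\<lambda>_. F"] fin vz(2)[OF v] by (simp add: insert_absorb)
    have eq: "I (d(v := k)) * ?G (d(v := k)) v i x t =
       indicator {d. card (?A x v i k \<union> B \<union> dormant_stubs (parity_adjust z (card (?A x v i k) + card B) (V - {v}) d) (V - {v})) \<le> l} d *
       meet_prob (parity_adjust z (card (?A x v i k) + card B) (V - {v}) d) (V - {v}) (?A x v i k) B (?h x v) E (\<tau> + t)"
      if "i < k" "x \<in> A" for d k i x t
    proof -
      let ?c = "card (?A x v i k) + card B"
      have finN: "finite ({v} \<times> {..<k})" by simp
      have nv: "(v, b) \<notin> A" "(v, b) \<notin> B" for b using disj(2)[of "(v, b)"] vz(2)[OF v] by auto
      have disjN: "A \<inter> ({v} \<times> {..<k}) = {}" using nv by auto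
      have cN: "card ({v} \<times> {..<k} - {(v, i)}) = k - 1" using that by (simp add: card_Diff_singleton)
      have cA: "card (?A x v i k) = (card A - 1) + (k - 1)"
        using disjN fin that(2) cN by (subst card_Un_disjoint) auto
      then have cc: "?c + 2 = c + k" using A_pos that(1) by (simp add: c_def)
      have sV: "(\<Sum>u\<in>V. (d(v := k)) u) = k + (\<Sum>u\<in>V-{v}. d u)"
        using fin vz(2)[OF v] by (simp add: sum.remove)
      \<comment> \<open>Revealing a pair removes two stubs, so the correction at \<open>z\<close> is
        the same whether it is computed before or after the degree of \<open>v\<close> is moved into
        the cluster.\<close>
      have par: "odd (c + (\<Sum>u\<in>V. (d(v := k)) u)) \<longleftrightarrow> odd (?c + (\<Sum>u\<in>V-{v}. d u))"
        unfolding sV using cc by presburger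
      have agree: "parity_adjust z c V (d(v := k)) u = parity_adjust z ?c (V - {v}) d u" if "u \<noteq> v" for u
        using that par vz(1)[OF v] by (simp add: parity_adjust_def)
      have ds: "dormant_stubs (parity_adjust z c V (d(v := k))) (V - {v}) = dormant_stubs (parity_adjust z ?c (V - {v}) d) (V - {v})"
        by (rule dormant_stubs_cong) (auto intro: agree)
      have pv: "parity_adjust z c V (d(v := k)) v = k" using vz(1)[OF v] by (simp add: parity_adjust_other)
      have "card (X (d(v := k))) = c + (k + (\<Sum>u\<in>V-{v}. parity_adjust z ?c (V - {v}) d u))"
        unfolding cX using fin vz(2)[OF v] pv by (subst sum.remove[of V v]) (auto intro!: sum.cong simp: agree)
      moreover have "card (?A x v i k \<union> B \<union> dormant_stubs (parity_adjust z ?c (V - {v}) d) (V - {v}))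
         = ?c + (\<Sum>u\<in>V-{v}. parity_adjust z ?c (V - {v}) d u)"
      proof (rule card_three)
        show "?A x v i k \<inter> B = {}" using disj(1) nv by auto
        show "fst s \<notin> V - {v}" if "s \<in> ?A x v i k \<union> B" for s using that disj(2)[of s] by auto
      qed (use fin in auto)
      ultimately have "card (X (d(v := k))) \<le> l + 2 \<longleftrightarrow>
         card (?A x v i k \<union> B \<union> dormant_stubs (parity_adjust z ?c (V - {v}) d) (V - {v})) \<le> l"
        using cc by linarith
      then show ?thesis using meet_prob_cong[OF ds] by (simp add: I_def indicator_def)
    qed
    have m1: "(\<lambda>t. I d * ?G d' v i x t) \<in> borel_measurable borel" for d d' i x using mG by simp
    have "(\<integral>\<^sup>+d. (\<Sum>i<d v. ennreal (1 / L) * (ennreal (1 / card A) * (\<Sum>x\<in>A. expect_exp (card A) (\<lambda>t. I d * ?G d v i x t)))) \<partial>measure_pmf (Pi_pmf V 0 (\<lambda>_. F)))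
       = (\<integral>\<^sup>+k. \<integral>\<^sup>+d. (\<Sum>i<k. ennreal (1 / L) * (ennreal (1 / card A) * (\<Sum>x\<in>A. expect_exp (card A) (\<lambda>t. I (d(v := k)) * ?G (d(v := k)) v i x t)))) \<partial>measure_pmf ?P \<partial>measure_pmf F)"
      unfolding split by simp
    also have "\<dots> = (\<integral>\<^sup>+k. (\<Sum>i<k. ennreal (1 / L) * (ennreal (1 / card A) * (\<Sum>x\<in>A. \<integral>\<^sup>+d. expect_exp (card A) (\<lambda>t. I (d(v := k)) * ?G (d(v := k)) v i x t) \<partial>measure_pmf ?P))) \<partial>measure_pmf F)"
      by (simp add: nn_integral_sum nn_integral_cmult)
    also have "\<dots> = (\<integral>\<^sup>+k. (\<Sum>i<k. ennreal (1 / L) * (ennreal (1 / card A) * (\<Sum>x\<in>A. expect_exp (card A) (\<lambda>t. ann F z l (V - {v}) (?A x v i k) B (?h x v) E (\<tau> + t))))) \<partial>measure_pmf F)"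
    proof (intro nn_integral_cong sum.cong refl arg_cong2[where f="(*)"])
      fix k i :: nat and x assume ki: "i \<in> {..<k}" and x: "x \<in> A"
      have "(\<integral>\<^sup>+d. expect_exp (card A) (\<lambda>t. I (d(v := k)) * ?G (d(v := k)) v i x t) \<partial>measure_pmf ?P)
         = expect_exp (card A) (\<lambda>t. \<integral>\<^sup>+d. I (d(v := k)) * ?G (d(v := k)) v i x t \<partial>measure_pmf ?P)"
        by (rule expect_exp_nn_integral_pmf) (rule m1)
      also have "\<dots> = expect_exp (card A) (\<lambda>t. ann F z l (V - {v}) (?A x v i k) B (?h x v) E (\<tau> + t))"
        unfolding ann_def using eq[of i k x] ki x by (simp del: fun_upd_apply)
      finally show "(\<integral>\<^sup>+d. expect_exp (card A) (\<lambda>t. I (d(v := k)) * ?G (d(v := k)) v i x t) \<partial>measure_pmf ?P)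
         = expect_exp (card A) (\<lambda>t. ann F z l (V - {v}) (?A x v i k) B (?h x v) E (\<tau> + t))" .
    qed
    finally show ?thesis .
  qed
  have "(\<Sum>v\<in>V0. \<integral>\<^sup>+k. (\<Sum>i<k. ennreal (1 / L) * (ennreal (1 / card A) * (\<Sum>x\<in>A. expect_exp (card A) (\<lambda>t.
       ann F z l (V - {v}) (?A x v i k) B (?h x v) E (\<tau> + t))))) \<partial>measure_pmf F)
     = (\<integral>\<^sup>+d. (\<Sum>v\<in>V0. \<Sum>i<d v. ennreal (1 / L) * (ennreal (1 / card A) * (\<Sum>x\<in>A. expect_exp (card A) (\<lambda>t. I d * ?G d v i x t)))) \<partial>measure_pmf (Pi_pmf V 0 (\<lambda>_. F)))"
    by (subst nn_integral_sum) (auto intro!: sum.cong one[symmetric])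
  also have "\<dots> \<le> (\<integral>\<^sup>+d. I d * meet_prob (parity_adjust z c V d) V A B h E \<tau> \<partial>measure_pmf (Pi_pmf V 0 (\<lambda>_. F)))"
    by (intro nn_integral_mono pointwise)
  finally show ?thesis by (simp add: ann_def I_def X_def c_def)
qed

lemma fresh_cluster:
  fixes f :: "nat \<Rightarrow> ennreal"
  assumes A: "finite A" "x \<in> A" and v: "\<And>b. (v, b) \<notin> A" and k: "2 \<le> k" "i < k"
  shows "card (A - {x} \<union> ({v} \<times> {..<k} - {(v, i)})) = card A + k - 2"
    "(\<Sum>s\<in>A - {x} \<union> ({v} \<times> {..<k} - {(v, i)}). f (if fst s = v then h x + 1 else h s))
      = (\<Sum>s\<in>A-{x}. f (h s)) + of_nat (k - 1) * f (h x + 1)"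
proof -
  have cN: "card ({v} \<times> {..<k} - {(v, i)}) = k - 1" using k by (simp add: card_Diff_singleton)
  have dis: "(A - {x}) \<inter> ({v} \<times> {..<k} - {(v, i)}) = {}" using v by auto
  have A_pos: "card A > 0" using A by (auto simp: card_gt_0_iff)
  show "card (A - {x} \<union> ({v} \<times> {..<k} - {(v, i)})) = card A + k - 2"
    using A dis cN k A_pos by (subst card_Un_disjoint) auto
  have "(\<Sum>s\<in>A-{x}. f (if fst s = v then h x + 1 else h s)) = (\<Sum>s\<in>A-{x}. f (h s))"
  proof (intro sum.cong refl)
    fix s assume "s \<in> A - {x}"
    then have "fst s \<noteq> v" using v[of "snd s"] by auto
    then show "f (if fst s = v then h x + 1 else h s) = f (h s)" by simp
  qed
  moreover have "(\<Sum>s\<in>{v} \<times> {..<k} - {(v, i)}. f (if fst s = v then h x + 1 else h s)) = (\<Sum>s\<in>{v} \<times> {..<k} - {(v, i)}. f (h x + 1))"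
    by (intro sum.cong) auto
  ultimately show "(\<Sum>s\<in>A - {x} \<union> ({v} \<times> {..<k} - {(v, i)}). f (if fst s = v then h x + 1 else h s))
      = (\<Sum>s\<in>A-{x}. f (h s)) + of_nat (k - 1) * f (h x + 1)"
    using A dis cN by (subst sum.union_disjoint) auto
qed

lemma measurable_ann:
  assumes E: "E \<in> sets (borel \<Otimes>\<^sub>M count_space UNIV)"
  shows "(\<lambda>t. ann F z l V A B h E (\<tau> + t)) \<in> borel_measurable borel"
  unfolding ann_def by (rule borel_measurable_nn_integral_pmf[OF ann_measurable[OF E]])

text \<open>Iterates \<open>ann_step\<close>. Each step costs the factor
  \<open>real N0 * \<mu> / L\<close>, the total mass of the picks that are kept. The additive error
  of the base case is not multiplied, since it is averaged against masses of at most one.\<close>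

lemma explore_le_ann:
  assumes E: "E \<in> sets (borel \<Otimes>\<^sub>M count_space UNIV)" and B: "finite B"
    and sb: "size_biased F \<mu> Fs" and F2: "\<And>k. k \<in> set_pmf F \<Longrightarrow> 2 \<le> k"
    and mF: "(\<integral>\<^sup>+k. of_nat k \<partial>measure_pmf F) = ennreal \<mu>"
    and \<Gamma>: "\<And>S a. (\<lambda>t. \<Gamma> S t a) \<in> borel_measurable borel"
    and N: "N0 \<le> N1" and L: "L > 0" "real N0 * \<mu> \<le> L"
    and base: "\<And>A V h \<tau>. finite A \<Longrightarrow> A \<noteq> {} \<Longrightarrow> finite V \<Longrightarrow> A \<inter> B = {} \<Longrightarrow> (\<And>s. s \<in> A \<union> B \<Longrightarrow> fst s \<notin> V) \<Longrightarrow>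
       z \<in> V \<Longrightarrow> N1 \<le> card (V - {z}) \<Longrightarrow> card V \<le> n \<Longrightarrow> (\<And>y. y \<in> B \<Longrightarrow> h y = hB y) \<Longrightarrow>
       ennreal (1 / card A) * (\<Sum>x\<in>A. \<Gamma> (card A) \<tau> (h x)) \<le> ann F z l V A B h E \<tau> + err"
  shows "finite A \<Longrightarrow> A \<noteq> {} \<Longrightarrow> finite V \<Longrightarrow> A \<inter> B = {} \<Longrightarrow> (\<And>s. s \<in> A \<union> B \<Longrightarrow> fst s \<notin> V) \<Longrightarrow>
       z \<in> V \<Longrightarrow> N1 + j \<le> card (V - {z}) \<Longrightarrow> card V \<le> n \<Longrightarrow> (\<And>y. y \<in> B \<Longrightarrow> h y = hB y) \<Longrightarrow> real (l + 2 * j) \<le> L \<Longrightarrow>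
       ennreal (real N0 * \<mu> / L) ^ j * (ennreal (1 / card A) * (\<Sum>x\<in>A. explore Fs j \<Gamma> (card A) \<tau> (h x)))
         \<le> ann F z (l + 2 * j) V A B h E \<tau> + err"
proof (induction j arbitrary: A V h \<tau>)
  case 0
  then show ?case using base[of A V h \<tau>] by simp
next
  case (Suc j)
  note p = Suc.prems
  define \<gamma> where "\<gamma> = ennreal (real N0 * \<mu> / L)"
  have \<mu>0: "\<mu> > 0" using sb by (simp add: size_biased_def)
  have \<gamma>1: "\<gamma> \<le> 1" using L \<mu>0 by (simp add: \<gamma>_def)
  have A_pos: "card A > 0" using p(1,2) by (simp add: card_gt_0_iff)
  have "N0 \<le> card (V - {z})" using p(7) N by simp
  \<comment> \<open>The number of candidate vertices is the same at every step, and therefore so is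
    the factor \<open>\<gamma>\<close>.\<close>
  then obtain V0 where V0: "V0 \<subseteq> V - {z}" "card V0 = N0" "finite V0"
    by (rule obtain_subset_with_card_n)
  let ?A = "\<lambda>x v i k. A - {x} \<union> ({v} \<times> {..<k} - {(v, i)})"
  let ?h = "\<lambda>x v s. if fst s = v then h x + 1 else h s"
  let ?c = "ennreal (1 / L)" and ?a = "ennreal (1 / card A)"
  let ?M = "\<lambda>k. \<Sum>x\<in>A. expect_exp (card A) (\<lambda>t. mix (card A) k (explore Fs j \<Gamma> (card A + k - 2) (\<tau> + t)) (h x))"
  let ?W = "\<lambda>v k i. \<Sum>x\<in>A. expect_exp (card A) (\<lambda>t. ann F z (l + 2 * j) (V - {v}) (?A x v i k) B (?h x v) E (\<tau> + t))"
  have mx: "(\<lambda>t. mix (card A) k (explore Fs j \<Gamma> S (\<tau> + t)) a) \<in> borel_measurable borel" for k S a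
    by (rule measurable_explore_shift(2)[OF \<Gamma>])
  have inner: "\<gamma> ^ j * ?M k \<le> ?W v k i + of_nat (card A) * err"
    if v: "v \<in> V0" and k: "2 \<le> k" "i < k" for v k i
  proof -
    have vV: "v \<in> V" "v \<noteq> z" using v V0 by auto
    have nv: "(v, b) \<notin> A" "(v, b) \<notin> B" for b using p(5)[of "(v, b)"] vV by auto
    have IH: "\<gamma> ^ j * (ennreal (1 / real (card A + k - 2)) * ((\<Sum>s\<in>A-{x}. explore Fs j \<Gamma> (card A + k - 2) (\<tau> + t) (h s))
          + of_nat (k - 1) * explore Fs j \<Gamma> (card A + k - 2) (\<tau> + t) (h x + 1)))
        \<le> ann F z (l + 2 * j) (V - {v}) (?A x v i k) B (?h x v) E (\<tau> + t) + err" if x: "x \<in> A" for x t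
    proof -
      note fc = fresh_cluster[OF p(1) x nv(1) k]
      have cV: "card (V - {v} - {z}) = card (V - {z}) - 1"
        using vV p(3) by (simp add: card_Diff_singleton Diff_insert2[symmetric] insert_commute)
      have "\<gamma> ^ j * (ennreal (1 / card (?A x v i k)) * (\<Sum>s\<in>?A x v i k. explore Fs j \<Gamma> (card (?A x v i k)) (\<tau> + t) (?h x v s)))
         \<le> ann F z (l + 2 * j) (V - {v}) (?A x v i k) B (?h x v) E (\<tau> + t) + err"
        unfolding \<gamma>_def
      proof (rule Suc.IH)
        have "card (?A x v i k) > 0" unfolding fc(1) using A_pos k by simp
        then show "?A x v i k \<noteq> {}" by (metis card.empty less_numeral_extra(3))
        show "?A x v i k \<inter> B = {}" using p(4) nv by auto
        show "fst s \<notin> V - {v}" if "s \<in> ?A x v i k \<union> B" for s using that p(5)[of s] by auto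
        show "N1 + j \<le> card (V - {v} - {z})" unfolding cV using p(7) by simp
        show "card (V - {v}) \<le> n" using p(3,8) card_Diff1_le[of V v] by linarith
        show "?h x v y = hB y" if "y \<in> B" for y using that p(9) nv(2)[of "snd y"] by auto
      qed (use p vV in auto)
      then show ?thesis unfolding fc .
    qed
    have "\<gamma> ^ j * ?M k = expect_exp (card A) (\<lambda>t. \<gamma> ^ j * (\<Sum>x\<in>A. mix (card A) k (explore Fs j \<Gamma> (card A + k - 2) (\<tau> + t)) (h x)))"
      using mx by (simp add: expect_exp_cmult expect_exp_sum borel_measurable_sum)
    also have "\<dots> = expect_exp (card A) (\<lambda>t. \<Sum>x\<in>A. \<gamma> ^ j * (ennreal (1 / real (card A + k - 2)) * ((\<Sum>s\<in>A-{x}. explore Fs j \<Gamma> (card A + k - 2) (\<tau> + t) (h s))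
          + of_nat (k - 1) * explore Fs j \<Gamma> (card A + k - 2) (\<tau> + t) (h x + 1))))"
      unfolding sum_mix[OF p(1,2) k(1), symmetric] sum_distrib_left ..
    also have "\<dots> \<le> expect_exp (card A) (\<lambda>t. \<Sum>x\<in>A. ann F z (l + 2 * j) (V - {v}) (?A x v i k) B (?h x v) E (\<tau> + t) + err)"
      by (intro expect_exp_mono sum_mono IH)
    also have "\<dots> = ?W v k i + of_nat (card A) * err"
      using measurable_ann[OF E] A_pos by (simp add: expect_exp_sum expect_exp_add expect_exp_const sum.distrib)
    finally show ?thesis .
  qed
  have aA: "?a * of_nat (card A) = 1"
    using A_pos by (simp add: ennreal_of_nat_eq_real_of_nat ennreal_mult[symmetric])
  \<comment> \<open>Each of \<open>N0\<close> vertices is entered through one of its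
    \<open>k\<close> stubs with weight \<open>1 / L\<close>; averaged over the degree law this is
    the size-biased law with total mass \<open>\<gamma>\<close>.\<close>
  have mass: "(\<Sum>v\<in>V0. \<integral>\<^sup>+k. of_nat k * (?c * w k) \<partial>measure_pmf F) = \<gamma> * (\<integral>\<^sup>+k. w k \<partial>measure_pmf Fs)" for w :: "nat \<Rightarrow> ennreal"
  proof -
    have "(\<Sum>v\<in>V0. \<integral>\<^sup>+k. of_nat k * (?c * w k) \<partial>measure_pmf F) = of_nat N0 * (ennreal \<mu> * (?c * (\<integral>\<^sup>+k. w k \<partial>measure_pmf Fs)))"
      unfolding nn_integral_size_biased[OF sb] using V0(2) by (simp add: nn_integral_cmult)
    also have "\<dots> = \<gamma> * (\<integral>\<^sup>+k. w k \<partial>measure_pmf Fs)"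
      using \<mu>0 L by (simp add: \<gamma>_def mult.assoc[symmetric] ennreal_of_nat_eq_real_of_nat ennreal_mult[symmetric])
    finally show ?thesis .
  qed
  have Fae: "AE k in measure_pmf F. 2 \<le> k" using F2 by (simp add: AE_measure_pmf_iff)
  have "\<gamma> ^ Suc j * (?a * (\<Sum>x\<in>A. explore Fs (Suc j) \<Gamma> (card A) \<tau> (h x)))
     = \<gamma> * (\<integral>\<^sup>+k. ?a * (\<gamma> ^ j * ?M k) \<partial>measure_pmf Fs)"
    by (simp add: nn_integral_cmult nn_integral_sum mult_ac)
  also have "\<dots> = (\<Sum>v\<in>V0. \<integral>\<^sup>+k. of_nat k * (?c * (?a * (\<gamma> ^ j * ?M k))) \<partial>measure_pmf F)"
    by (rule mass[symmetric])
  also have "\<dots> \<le> (\<Sum>v\<in>V0. \<integral>\<^sup>+k. (\<Sum>i<k. ?c * (?a * ?W v k i)) + of_nat k * (?c * err) \<partial>measure_pmf F)"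
  proof (intro sum_mono nn_integral_mono_AE)
    fix v assume v: "v \<in> V0"
    show "AE k in measure_pmf F. of_nat k * (?c * (?a * (\<gamma> ^ j * ?M k))) \<le> (\<Sum>i<k. ?c * (?a * ?W v k i)) + of_nat k * (?c * err)"
      using Fae
    proof eventually_elim
      case (elim k)
      have "of_nat k * (?c * (?a * (\<gamma> ^ j * ?M k))) = (\<Sum>i<k. ?c * (?a * (\<gamma> ^ j * ?M k)))" by simp
      also have "\<dots> \<le> (\<Sum>i<k. ?c * (?a * (?W v k i + of_nat (card A) * err)))"
        by (intro sum_mono mult_left_mono inner[OF v elim]) auto
      also have "\<dots> = (\<Sum>i<k. ?c * (?a * ?W v k i)) + of_nat k * (?c * err)"
        using aA by (simp add: distrib_left sum.distrib mult.assoc[symmetric])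
      finally show ?case .
    qed
  qed
  also have "\<dots> = (\<Sum>v\<in>V0. \<integral>\<^sup>+k. (\<Sum>i<k. ?c * (?a * ?W v k i)) \<partial>measure_pmf F) + \<gamma> * (\<integral>\<^sup>+k. err \<partial>measure_pmf Fs)"
    unfolding mass[of "\<lambda>_. err", symmetric] by (simp add: nn_integral_add sum.distrib)
  also have "\<dots> \<le> ann F z (l + 2 * j + 2) V A B h E \<tau> + 1 * err"
  proof (rule add_mono)
    show "(\<Sum>v\<in>V0. \<integral>\<^sup>+k. (\<Sum>i<k. ?c * (?a * ?W v k i)) \<partial>measure_pmf F) \<le> ann F z (l + 2 * j + 2) V A B h E \<tau>"
      by (rule ann_step[OF E p(1) B p(3) p(2) p(4) p(5) p(6) V0(1)]) (use p(10) in auto)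
    show "\<gamma> * (\<integral>\<^sup>+k. err \<partial>measure_pmf Fs) \<le> 1 * err"
      using \<gamma>1 by (intro mult_mono) (auto simp: measure_pmf.emeasure_space_1)
  qed
  finally show ?case by (simp add: \<gamma>_def)
qed

section \<open>Both ideal phases, followed by the late phase\<close>

definition window :: "nat \<Rightarrow> nat \<Rightarrow> nat \<Rightarrow> ennreal" where
  "window s0 K S = (if s0 \<le> S \<and> S \<le> K then 1 else 0)"

text \<open>The reward at the end of the ideal phases: both cluster sizes lie in the window and
  \<open>E\<close> holds robustly. The size \<open>S1\<close> and label \<open>b\<close> belong to
  the cluster grown first, \<open>S\<close> and \<open>a\<close> to the second.\<close>

definition terminal where
  "terminal E \<epsilon> k s0 K S1 b S \<tau> a = window s0 K S1 * window s0 K S * ennreal (core E \<epsilon> k \<tau> a b)"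

text \<open>On regular degree sequences \<open>meet_late\<close> applies with no elapsed time and no
  added edges; the others cost \<open>pb\<close>. The parity correction adds one stub, whence
  \<open>2 * K + 1\<close> for two clusters and this stub. It at most doubles a degree, whence the
  factor \<open>4\<close> on the squares. The reserve \<open>s + 2 * M\<close> keeps at least
  \<open>s\<close> active stubs during \<open>M\<close> steps.\<close>

lemma terminal_le_ann:
  assumes E: "E \<in> sets (borel \<Otimes>\<^sub>M count_space UNIV)"
    and par: "s \<ge> 1" "k \<ge> 1" "\<epsilon> > 0" "n0 > 0" "Qm \<ge> 0" "s + 2 * M \<le> s0" "n0 + 2 * real M \<le> real N1" "s0 \<le> l"
    and F2: "\<And>k. k \<in> set_pmf F \<Longrightarrow> 2 \<le> k"
    and bad: "\<And>V :: nat set. finite V \<Longrightarrow> card V \<le> n \<Longrightarrow>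
      measure (measure_pmf (Pi_pmf V 0 (\<lambda>_. F))) {d. \<not> (2 * K + 1 + (\<Sum>v\<in>V. d v) \<le> l \<and> 4 * (\<Sum>v\<in>V. (real (d v))\<^sup>2) \<le> Qm)} \<le> pb"
    and fin: "finite A" "finite B" "finite V" "A \<noteq> {}" "B \<noteq> {}"
    and disj: "A \<inter> B = {}" "\<And>s. s \<in> A \<union> B \<Longrightarrow> fst s \<notin> V"
    and z: "z \<in> V" "N1 \<le> card (V - {z})" "card V \<le> n" and hB: "\<And>y. y \<in> B \<Longrightarrow> h y = hB y"
    and err: "err = pb + M * (Qm / (n0 * real s * real k) + 1 / (real s * \<epsilon>)) + (1 - s0 / l) ^ M"
  shows "ennreal (1 / card A) * (\<Sum>x\<in>A. ennreal (1 / card B) * (\<Sum>y\<in>B. terminal E \<epsilon> k s0 K (card B) (hB y) (card A) \<tau> (h x)))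
     \<le> ann F z l V A B h E \<tau> + ennreal err"
proof (cases "s0 \<le> card A \<and> card A \<le> K \<and> s0 \<le> card B \<and> card B \<le> K")
  case False
  then have "terminal E \<epsilon> k s0 K (card B) (hB y) (card A) \<tau> (h x) = 0" for x y
    by (auto simp: terminal_def window_def)
  then show ?thesis by simp
next
  case True
  let ?p = "Pi_pmf V 0 (\<lambda>_. F)"
  define c where "c = card A + card B"
  define err3 where "err3 = M * (Qm / (n0 * real s * real k) + 1 / (real s * \<epsilon>)) + (1 - s0 / l) ^ M"
  define g where "g = (\<Sum>x\<in>A. (\<Sum>y\<in>B. core E \<epsilon> k \<tau> (h x) (hB y)) / card B) / card A"
  define X where "X = (\<lambda>d. A \<union> B \<union> dormant_stubs (parity_adjust z c V d) V)"
  define good where "good = {d. 2 * K + 1 + (\<Sum>v\<in>V. d v) \<le> l \<and> 4 * (\<Sum>v\<in>V. (real (d v))\<^sup>2) \<le> Qm}"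
  have A_pos: "card A > 0" and B_pos: "card B > 0" using fin by (auto simp: card_gt_0_iff)
  have core0: "0 \<le> (\<Sum>y\<in>B. core E \<epsilon> k \<tau> (h x) (hB y))" for x by (intro sum_nonneg core_bounds)
  have g0: "0 \<le> g" unfolding g_def by (intro divide_nonneg_nonneg sum_nonneg core_bounds) auto
  have g1: "g \<le> 1"
  proof -
    have "(\<Sum>y\<in>B. core E \<epsilon> k \<tau> (h x) (hB y)) / card B \<le> 1" for x
      using sum_mono[of B "\<lambda>y. core E \<epsilon> k \<tau> (h x) (hB y)" "\<lambda>_. 1"] core_bounds B_pos by (simp add: divide_le_eq_1)
    then have "(\<Sum>x\<in>A. (\<Sum>y\<in>B. core E \<epsilon> k \<tau> (h x) (hB y)) / card B) \<le> (\<Sum>x\<in>A. 1)" by (intro sum_mono)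
    then show ?thesis using A_pos by (simp add: g_def divide_le_eq_1)
  qed
  have lhs: "ennreal (1 / card A) * (\<Sum>x\<in>A. ennreal (1 / card B) * (\<Sum>y\<in>B. terminal E \<epsilon> k s0 K (card B) (hB y) (card A) \<tau> (h x))) = ennreal g"
  proof -
    have "ennreal (1 / card B) * (\<Sum>y\<in>B. terminal E \<epsilon> k s0 K (card B) (hB y) (card A) \<tau> (h x))
       = ennreal ((\<Sum>y\<in>B. core E \<epsilon> k \<tau> (h x) (hB y)) / card B)" for x
    proof -
      have "(\<Sum>y\<in>B. terminal E \<epsilon> k s0 K (card B) (hB y) (card A) \<tau> (h x)) = ennreal (\<Sum>y\<in>B. core E \<epsilon> k \<tau> (h x) (hB y))"
        using True core_bounds by (simp add: terminal_def window_def sum_ennreal)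
      then show ?thesis using ennreal_mult[of "1 / card B", OF _ core0[of x]] by simp
    qed
    moreover have "(\<Sum>x\<in>A. ennreal ((\<Sum>y\<in>B. core E \<epsilon> k \<tau> (h x) (hB y)) / card B)) = ennreal (\<Sum>x\<in>A. (\<Sum>y\<in>B. core E \<epsilon> k \<tau> (h x) (hB y)) / card B)"
      using core0 by (intro sum_ennreal divide_nonneg_nonneg) auto
    ultimately show ?thesis
      using ennreal_mult[of "1 / card A" "\<Sum>x\<in>A. (\<Sum>y\<in>B. core E \<epsilon> k \<tau> (h x) (hB y)) / card B"] core0
      by (simp add: g_def sum_nonneg)
  qed
  have cX: "card (X d) = c + (\<Sum>v\<in>V. parity_adjust z c V d v)" for d
    using card_three[OF fin(1-3) disj] by (simp add: X_def c_def)
  have V1: "card V \<ge> 1" using z fin by (simp add: Suc_le_eq card_gt_0_iff) blast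
  have late: "ennreal g \<le> meet_prob (parity_adjust z c V d) V A B h E \<tau> + ennreal err3 \<and> card (X d) \<le> l"
    if d: "d \<in> set_pmf ?p" "d \<in> good" for d
  proof -
    let ?d = "parity_adjust z c V d"
    have d2: "d v \<ge> 2" if "v \<in> V" for v using d(1) that F2 fin by (auto simp: set_Pi_pmf PiE_dflt_def)
    have d2': "?d v \<ge> 2" if "v \<in> V" for v using d2[OF that] parity_adjust_ge[of d v z c V] by linarith
    have dle: "?d v \<le> d v + 1" for v by (simp add: parity_adjust_def)
    have "(\<Sum>v\<in>V. ?d v) \<le> (\<Sum>v\<in>V. d v) + 1"
    proof -
      have "(\<Sum>v\<in>V. (d(z := d z + 1)) v) = Suc (\<Sum>v\<in>V. d v)" using fin z by (simp add: sum.remove)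
      then show ?thesis by (simp add: parity_adjust_def)
    qed
    then have Xl: "card (X d) \<le> l" unfolding cX using True d(2) by (simp add: c_def good_def)
    have cA: "c \<ge> 2" using A_pos B_pos by (simp add: c_def)
    have "(\<Sum>v\<in>V. 2) \<le> (\<Sum>v\<in>V. ?d v)" by (intro sum_mono d2')
    then have X_ge: "card (X d) \<ge> 2 * card V + 2" unfolding cX using cA by simp
    have "card (V - {z}) \<le> card V" using fin by (intro card_mono) auto
    then have X_n0: "real (card (X d)) - 1 \<ge> n0 + 2 * real M" using X_ge par(7) z by linarith
    have l_pos: "real l > 0" using X_ge Xl by linarith
    have "(\<Sum>v\<in>V. (real (?d v))\<^sup>2) \<le> (\<Sum>v\<in>V. 4 * (real (d v))\<^sup>2)"
    proof (rule sum_mono)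
      fix v assume "v \<in> V"
      have "real (?d v) \<le> 2 * real (d v)" using dle[of v] d2[OF \<open>v \<in> V\<close>] by linarith
      then have "(real (?d v))\<^sup>2 \<le> (2 * real (d v))\<^sup>2" by (intro power_mono) auto
      then show "(real (?d v))\<^sup>2 \<le> 4 * (real (d v))\<^sup>2" by simp
    qed
    also have "\<dots> \<le> Qm" using d(2) by (simp add: good_def sum_distrib_left)
    finally have Q: "(\<Sum>v\<in>V. (real (?d v))\<^sup>2) \<le> Qm" .
    have "ennreal ((\<Sum>x\<in>A. (\<Sum>y\<in>B. core E \<epsilon> k \<tau> (h x) (hB y)) / card B) / card A)
      \<le> meet_prob ?d V A B h E (\<tau> + 0) + ennreal ((\<Sum>x\<in>A. real (0::nat) / k) / card A + 0 / \<epsilon>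
          + M * (Qm / (n0 * real s * real k) + 1 / (real s * \<epsilon>)) + (1 - card B / real l) ^ M)"
    proof (rule meet_late[OF E par(1-5) fin(2) fin(5) refl fin(1) fin(3) disj])
      show "even (card (A \<union> B \<union> dormant_stubs ?d V))"
        using cX[of d] parity_adjust_even[OF fin(3) z(1), of c d] by (simp add: X_def)
      show "real (card (A \<union> B \<union> dormant_stubs ?d V)) - 1 \<le> real l" using Xl by (simp add: X_def)
      show "n0 + 2 * real M \<le> real (card (A \<union> B \<union> dormant_stubs ?d V)) - 1" using X_n0 by (simp add: X_def)
    qed (use True par d2' Q hB in auto)
    also have "\<dots> \<le> meet_prob ?d V A B h E \<tau> + ennreal err3"
    proof -
      have "card B \<le> card (X d)" using fin finite_dormant_stubs by (intro card_mono) (auto simp: X_def)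
      then have "0 \<le> 1 - card B / real l" "1 - card B / real l \<le> 1 - s0 / real l"
        using Xl l_pos True by (auto simp: divide_right_mono)
      then have "(1 - card B / real l) ^ M \<le> (1 - s0 / real l) ^ M" by (intro power_mono) auto
      then show ?thesis by (auto simp: err3_def intro!: add_left_mono ennreal_leI)
    qed
    finally show ?thesis using Xl by (simp add: g_def)
  qed
  have "0 \<le> 1 - real s0 / real l" using par(8) by (cases "l = 0") auto
  then have e0: "err3 \<ge> 0" using par by (simp add: err3_def)
  have P: "measure (measure_pmf ?p) (- good) \<le> pb"
    using bad[OF fin(3) z(3)] by (simp add: good_def Collect_neg_eq[symmetric])
    have pb0: "pb \<ge> 0" using P measure_nonneg[of "measure_pmf ?p" "- good"] by linarith
    have "ennreal g = (\<integral>\<^sup>+d. ennreal g \<partial>measure_pmf ?p)" by (simp add: measure_pmf.emeasure_space_1)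
    also have "\<dots> \<le> (\<integral>\<^sup>+d. (indicator {d. card (X d) \<le> l} d * meet_prob (parity_adjust z c V d) V A B h E \<tau> + ennreal err3) + indicator (- good) d \<partial>measure_pmf ?p)"
    proof (rule nn_integral_mono_AE, unfold AE_measure_pmf_iff, intro ballI)
      fix d assume d: "d \<in> set_pmf ?p"
      show "ennreal g \<le> (indicator {d. card (X d) \<le> l} d * meet_prob (parity_adjust z c V d) V A B h E \<tau> + ennreal err3) + indicator (- good) d"
      proof (cases "d \<in> good")
        case True
        then show ?thesis using late[OF d True] by simp
      next
        case False
        have "ennreal g \<le> 1" using g1 by simp
        then show ?thesis using False by (simp add: add_increasing)
      qed
    qed
    also have "\<dots> = ann F z l V A B h E \<tau> + ennreal err3 + emeasure (measure_pmf ?p) (- good)"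
      by (simp add: nn_integral_add ann_def X_def c_def measure_pmf.emeasure_space_1)
    also have "\<dots> \<le> ann F z l V A B h E \<tau> + ennreal err3 + ennreal pb"
      using P by (intro add_left_mono) (simp add: measure_pmf.emeasure_eq_measure ennreal_leI)
    also have "\<dots> = ann F z l V A B h E \<tau> + ennreal err"
      using e0 pb0 by (simp add: err err3_def add.assoc ennreal_plus[symmetric] add.commute del: ennreal_plus)
    finally show ?thesis using lhs by simp
qed

lemma measurable_terminal:
  assumes "\<And>a b. (\<lambda>\<tau>. core E \<epsilon> k \<tau> a b) \<in> borel_measurable borel"
  shows "(\<lambda>\<tau>. terminal E \<epsilon> k s0 K S1 b S \<tau> a) \<in> borel_measurable borel"
  using assms unfolding terminal_def by measurable

lemma two_phase:
  assumes E: "E \<in> sets (borel \<Otimes>\<^sub>M count_space UNIV)"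
    and cm: "\<And>a b. (\<lambda>\<tau>. core E \<epsilon> k \<tau> a b) \<in> borel_measurable borel"
    and par: "s \<ge> 1" "k \<ge> 1" "\<epsilon> > 0" "n0 > 0" "Qm \<ge> 0" "s + 2 * M \<le> s0" "n0 + 2 * real M \<le> real N1" "s0 \<le> l"
    and F2: "\<And>k. k \<in> set_pmf F \<Longrightarrow> 2 \<le> k"
    and sb: "size_biased F \<mu> Fs" and mF: "(\<integral>\<^sup>+k. of_nat k \<partial>measure_pmf F) = ennreal \<mu>"
    and bad: "\<And>V :: nat set. finite V \<Longrightarrow> card V \<le> n \<Longrightarrow>
      measure (measure_pmf (Pi_pmf V 0 (\<lambda>_. F))) {d. \<not> (2 * K + 1 + (\<Sum>v\<in>V. d v) \<le> l \<and> 4 * (\<Sum>v\<in>V. (real (d v))\<^sup>2) \<le> Qm)} \<le> pb"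
    and err: "err = pb + M * (Qm / (n0 * real s * real k) + 1 / (real s * \<epsilon>)) + (1 - s0 / l) ^ M"
    and N: "N0 \<le> N1" "N1 + 2 * m + 3 \<le> n" and L: "real N0 * \<mu> \<le> L" "real (l + 4 * m) \<le> L" "L > 0"
    and d: "d0 \<ge> 1" "d1 \<ge> 1"
  shows "ennreal (real N0 * \<mu> / L) ^ m * (ennreal (real N0 * \<mu> / L) ^ m *
      explore Fs m (\<lambda>S1 t a. explore Fs m (terminal E \<epsilon> k s0 K S1 a) d1 t 0) d0 0 0)
    \<le> ann F (n - 1) (l + 4 * m) {2..<n} ({0} \<times> {..<d0}) ({1} \<times> {..<d1}) (\<lambda>_. 0) E 0 + ennreal err"
proof -
  let ?\<gamma> = "ennreal (real N0 * \<mu> / L)"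
  let ?A0 = "{0} \<times> {..<d0} :: stub set" and ?A1 = "{1} \<times> {..<d1} :: stub set"
  let ?z = "n - 1"
  let ?T = "\<lambda>S1 b. terminal E \<epsilon> k s0 K S1 b"
  note mt = measurable_terminal[OF cm]
  have cA: "card ?A0 = d0" "card ?A1 = d1" by simp_all
  have A0: "finite ?A0" "?A0 \<noteq> {}" and A1: "finite ?A1" "?A1 \<noteq> {}" using d by (auto simp: lessThan_empty_iff)
  have phase2: "?\<gamma> ^ m * (ennreal (1 / card B) * (\<Sum>y\<in>B. explore Fs m (?T (card B) (h y)) d1 \<tau> 0))
      \<le> ann F ?z (l + 2 * m) V B ?A1 h E \<tau> + ennreal err"
    if B: "finite B" "B \<noteq> {}" and V: "finite V" "?z \<in> V" "N1 + m \<le> card (V - {?z})" "card V \<le> n"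
      and disj: "B \<inter> ?A1 = {}" "\<And>s. s \<in> B \<union> ?A1 \<Longrightarrow> fst s \<notin> V" and h: "\<And>y. y \<in> ?A1 \<Longrightarrow> h y = 0" for B V h \<tau>
  proof -
    let ?\<Gamma> = "\<lambda>S \<tau> a. ennreal (1 / card B) * (\<Sum>y\<in>B. ?T (card B) (h y) S \<tau> a)"
    have "?\<gamma> ^ m * (ennreal (1 / card ?A1) * (\<Sum>x\<in>?A1. explore Fs m ?\<Gamma> (card ?A1) \<tau> (h x)))
      \<le> ann F ?z (l + 2 * m) V ?A1 B h E \<tau> + ennreal err"
    proof (rule explore_le_ann[OF E B(1) sb F2 mF _ N(1) L(3) L(1), where n=n and hB=h])
      show "(\<lambda>t. ?\<Gamma> S t a) \<in> borel_measurable borel" for S a using mt by simp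
      show "ennreal (1 / card A) * (\<Sum>x\<in>A. ennreal (1 / card B) * (\<Sum>y\<in>B. ?T (card B) (h y) (card A) \<tau> (h' x)))
          \<le> ann F ?z l V A B h' E \<tau> + ennreal err"
        if "finite A" "A \<noteq> {}" "finite V" "A \<inter> B = {}" "\<And>s. s \<in> A \<union> B \<Longrightarrow> fst s \<notin> V" "?z \<in> V"
          "N1 \<le> card (V - {?z})" "card V \<le> n" "\<And>y. y \<in> B \<Longrightarrow> h' y = h y" for A V h' \<tau>
        by (rule terminal_le_ann[OF E par F2 bad that(1) B(1) that(3,2) B(2) that(4,5,6,7,8,9) err])
      show "?A1 \<inter> B = {}" "\<And>s. s \<in> ?A1 \<union> B \<Longrightarrow> fst s \<notin> V" using disj by auto
    qed (use A1 V L(2) in auto)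
    moreover have "explore Fs m ?\<Gamma> d1 \<tau> 0 = ennreal (1 / card B) * (\<Sum>y\<in>B. explore Fs m (?T (card B) (h y)) d1 \<tau> 0)"
    proof -
      have "(\<lambda>t. \<Sum>y\<in>B. ?T (card B) (h y) S t a) \<in> borel_measurable borel" for S a
        using mt by (intro borel_measurable_sum)
      then show ?thesis using explore_cmult[where \<Gamma>="\<lambda>S t a. \<Sum>y\<in>B. ?T (card B) (h y) S t a"]
          explore_sum[where \<Gamma>="\<lambda>y. ?T (card B) (h y)", OF mt B(1)] by simp
    qed
    moreover have "(\<Sum>x\<in>?A1. explore Fs m ?\<Gamma> (card ?A1) \<tau> (h x)) = (\<Sum>x\<in>?A1. explore Fs m ?\<Gamma> d1 \<tau> 0)"
      using h by (intro sum.cong refl) (simp only: cA)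
    moreover have "ennreal (1 / card ?A1) * (\<Sum>x\<in>?A1. c) = c" for c
      using d by (simp add: mult.assoc[symmetric] ennreal_of_nat_eq_real_of_nat ennreal_mult[symmetric])
    moreover have "ann F ?z (l + 2 * m) V B ?A1 h E \<tau> = ann F ?z (l + 2 * m) V ?A1 B h E \<tau>"
      by (rule ann_swap)
    ultimately show ?thesis by simp
  qed
  let ?\<Gamma>1 = "\<lambda>S1 \<tau> a. ?\<gamma> ^ m * explore Fs m (?T S1 a) d1 \<tau> 0"
  have "?\<gamma> ^ m * (ennreal (1 / card ?A0) * (\<Sum>x\<in>?A0. explore Fs m ?\<Gamma>1 (card ?A0) 0 ((\<lambda>_. 0) x)))
      \<le> ann F ?z (l + 2 * m + 2 * m) {2..<n} ?A0 ?A1 (\<lambda>_. 0) E 0 + ennreal err"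
  proof (rule explore_le_ann[OF E A1(1) sb F2 mF _ _ L(3) L(1), where n=n and hB="\<lambda>_. 0" and ?N1.0="N1 + m"])
    show "(\<lambda>t. ?\<Gamma>1 S t a) \<in> borel_measurable borel" for S a using measurable_explore[OF mt] by simp
    show "ennreal (1 / card A) * (\<Sum>x\<in>A. ?\<Gamma>1 (card A) \<tau> (h x)) \<le> ann F ?z (l + 2 * m) V A ?A1 h E \<tau> + ennreal err"
      if "finite A" "A \<noteq> {}" "finite V" "A \<inter> ?A1 = {}" "\<And>s. s \<in> A \<union> ?A1 \<Longrightarrow> fst s \<notin> V" "?z \<in> V"
        "N1 + m \<le> card (V - {?z})" "card V \<le> n" "\<And>y. y \<in> ?A1 \<Longrightarrow> h y = 0" for A V h \<tau>
    proof -
      have "ennreal (1 / card A) * (\<Sum>x\<in>A. ?\<Gamma>1 (card A) \<tau> (h x)) = ?\<gamma> ^ m * (ennreal (1 / card A) * (\<Sum>x\<in>A. explore Fs m (?T (card A) (h x)) d1 \<tau> 0))"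
        by (simp add: sum_distrib_left[symmetric] mult_ac)
      also have "\<dots> \<le> ann F ?z (l + 2 * m) V A ?A1 h E \<tau> + ennreal err"
        by (rule phase2) (use that in auto)
      finally show ?thesis .
    qed
  qed (use A0 N L(2) in auto)
  moreover have "(\<Sum>x\<in>?A0. explore Fs m ?\<Gamma>1 (card ?A0) 0 ((\<lambda>_. 0) x)) = (\<Sum>x\<in>?A0. explore Fs m ?\<Gamma>1 d0 0 0)"
    by (simp only: cA)
  moreover have "ennreal (1 / card ?A0) * (\<Sum>x\<in>?A0. c) = c" for c
    using d by (simp add: mult.assoc[symmetric] ennreal_of_nat_eq_real_of_nat ennreal_mult[symmetric])
  moreover have "explore Fs m ?\<Gamma>1 d0 0 0 = ?\<gamma> ^ m * explore Fs m (\<lambda>S1 t a. explore Fs m (?T S1 a) d1 t 0) d0 0 0"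
    using explore_cmult[where \<Gamma>="\<lambda>S1 t a. explore Fs m (?T S1 a) d1 t 0"] measurable_explore[OF mt] by simp
  ultimately show ?thesis by (simp add: add.commute)
qed

subsection \<open>Measurability of the weight and the hopcount\<close>

lemma is_path_cong:
  assumes "\<And>s. s \<in> S \<Longrightarrow> p s = q s"
  shows "is_path S p u ps v \<longleftrightarrow> is_path S q u ps v"
  using assms by (induction ps arbitrary: u) auto

lemma path_weight_cong:
  assumes "\<And>s. s \<in> S \<Longrightarrow> p s = q s" "is_path S p u ps v"
  shows "path_weight p w ps = path_weight q w ps"
  using assms(2)
  by (induction ps arbitrary: u) (auto simp: path_weight_def edge_weight_def assms(1))

lemma CM_cong:
  assumes d: "\<And>i. i < n \<Longrightarrow> d i = d' i" and p: "\<And>s. s \<in> stubs n d \<Longrightarrow> p s = p' s"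
  shows "CM_connected n ((d, p), w) = CM_connected n ((d', p'), w)"
    "CM_W n ((d, p), w) = CM_W n ((d', p'), w)" "CM_H n ((d, p), w) = CM_H n ((d', p'), w)"
proof -
  have S: "stubs n d = stubs n d'" using d by (auto simp: stubs_def)
  have path: "is_path (stubs n d) p 0 ps 1 \<longleftrightarrow> is_path (stubs n d') p' 0 ps 1" for ps
    using is_path_cong[OF p, of "stubs n d"] by (simp add: S)
  have wt: "path_weight p w ps = path_weight p' w ps" if "is_path (stubs n d') p' 0 ps 1" for ps
    using path_weight_cong[of "stubs n d" p p' 0 ps 1 w] p path that by blast
  show "CM_connected n ((d, p), w) = CM_connected n ((d', p'), w)"
    unfolding CM_connected_def prod.case path ..
  show W: "CM_W n ((d, p), w) = CM_W n ((d', p'), w)"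
    unfolding CM_W_def prod.case path using wt by (intro arg_cong[where f=Inf]) (auto, metis)
  have "(\<exists>ps. is_path (stubs n d) p 0 ps 1 \<and> length ps = k \<and> path_weight p w ps = x)
     \<longleftrightarrow> (\<exists>ps. is_path (stubs n d') p' 0 ps 1 \<and> length ps = k \<and> path_weight p' w ps = x)" for k x
    unfolding path using wt by metis
  then show "CM_H n ((d, p), w) = CM_H n ((d', p'), w)" by (simp add: CM_H_def W)
qed

text \<open>The graph enters only through finitely many values, hence through a countable code; this is what makes
  the functionals jointly measurable although graphs range over an uncountable discrete space.\<close>

definition graph_code :: "nat \<Rightarrow> (nat \<Rightarrow> nat) \<times> (stub \<Rightarrow> stub) \<Rightarrow> nat list \<times> (stub \<times> stub) list" where
  "graph_code n g = (map (fst g) [0..<n],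
     map (\<lambda>s. (s, snd g s)) (concat (map (\<lambda>v. map (Pair v) [0..<fst g v]) [0..<n])))"

definition graph_decode :: "nat list \<times> (stub \<times> stub) list \<Rightarrow> (nat \<Rightarrow> nat) \<times> (stub \<Rightarrow> stub)" where
  "graph_decode c = (\<lambda>i. if i < length (fst c) then fst c ! i else 0,
     \<lambda>s. case map_of (snd c) s of None \<Rightarrow> s | Some t \<Rightarrow> t)"

lemma CM_decode:
  "CM_connected n (g, w) = CM_connected n (graph_decode (graph_code n g), w)"
  "CM_W n (g, w) = CM_W n (graph_decode (graph_code n g), w)"
  "CM_H n (g, w) = CM_H n (graph_decode (graph_code n g), w)"
proof -
  obtain d p where g: "g = (d, p)" by (cases g)
  obtain d' p' where g': "graph_decode (graph_code n g) = (d', p')" by (cases "graph_decode (graph_code n g)")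
  have d': "d i = d' i" if "i < n" for i
    using that g' by (auto simp: g graph_decode_def graph_code_def)
  have p': "p s = p' s" if "s \<in> stubs n d" for s
  proof -
    have "set (concat (map (\<lambda>v. map (Pair v) [0..<d v]) [0..<n])) = stubs n d"
      by (auto simp: stubs_def image_iff)
    with that have "s \<in> set (concat (map (\<lambda>v. map (Pair v) [0..<d v]) [0..<n]))" by simp
    then have "map_of (snd (graph_code n (d, p))) s = Some (p s)"
      by (simp only: graph_code_def fst_conv snd_conv map_of_map_restrict restrict_map_def if_True o_apply)
    moreover have "p' = snd (graph_decode (graph_code n (d, p)))" using g' by (simp add: g)
    ultimately show ?thesis by (simp add: graph_decode_def)
  qed
  note * = CM_cong[OF d' p']
  show "CM_connected n (g, w) = CM_connected n (graph_decode (graph_code n g), w)"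
    "CM_W n (g, w) = CM_W n (graph_decode (graph_code n g), w)"
    "CM_H n (g, w) = CM_H n (graph_decode (graph_code n g), w)"
    unfolding g' unfolding g by (rule *; assumption)+
qed

lemma measurable_CM_FPP:
  assumes dec: "\<And>g w. f (g, w) = f (graph_decode (graph_code n g), w)"
    and f: "\<And>g. (\<lambda>w. f (g, w)) \<in> measurable EW N"
  shows "f \<in> measurable (CM_FPP F n) N"
proof -
  have 1: "(\<lambda>(c, w). f (graph_decode c, w)) \<in> measurable (count_space UNIV \<Otimes>\<^sub>M EW) N"
    by (rule measurable_pair_measure_countable1) (use f in auto)
  have 2: "(\<lambda>z. (graph_code n (fst z), snd z)) \<in> measurable (CM_FPP F n) (count_space UNIV \<Otimes>\<^sub>M EW)"
    unfolding CM_FPP_def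
    by (intro measurable_Pair measurable_compose[OF measurable_fst] measurable_snd) simp
  have "(\<lambda>z. f (graph_decode (graph_code n (fst z)), snd z)) \<in> measurable (CM_FPP F n) N"
    using measurable_compose[OF 2 1] by simp
  moreover have "(\<lambda>z. f (graph_decode (graph_code n (fst z)), snd z)) = f"
    by (rule ext) (metis dec prod.collapse)
  ultimately show ?thesis by simp
qed

text \<open>The sample space contains negative weights, with which the path weights may be unbounded
  below. There \<open>Inf\<close> takes one fixed default value, so the event \<open>Inf < a\<close>
  splits into two measurable cases.\<close>

lemma borel_measurable_Inf_image:
  fixes f :: "'i::countable \<Rightarrow> 'a \<Rightarrow> real"
  assumes [measurable]: "\<And>i. f i \<in> borel_measurable M"
  shows "(\<lambda>w. Inf ((\<lambda>i. f i w) ` I)) \<in> borel_measurable M"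
proof (cases "I = {}")
  case False
  \<comment> \<open>The default of \<open>Inf\<close>: for a set unbounded below, the reflected set
    has no upper bound, so the defining predicate of its supremum is constantly false.\<close>
  define c0 :: real where "c0 = - (LEAST z. False)"
  let ?b = "\<lambda>w. \<exists>N::nat. \<forall>i. i \<in> I \<longrightarrow> - real N \<le> f i w"
  have bdd: "?b w \<longleftrightarrow> bdd_below ((\<lambda>i. f i w) ` I)" for w
  proof
    assume "bdd_below ((\<lambda>i. f i w) ` I)"
    then obtain m where m: "\<And>i. i \<in> I \<Longrightarrow> m \<le> f i w" by (auto simp: bdd_below_def)
    obtain N :: nat where "- m \<le> real N" using real_arch_simple by blast
    then show "?b w" using m by (intro exI[of _ N]) force
  qed (auto simp: bdd_below_def)
  have unb: "Inf X = c0" if "\<not> bdd_below X" for X :: "real set"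
  proof -
    have "(\<forall>x\<in>uminus ` X. x \<le> z) = False" for z
    proof -
      have "\<not> (\<forall>x\<in>X. - z \<le> x)" using that unfolding bdd_below_def by blast
      then show ?thesis by (auto simp: minus_le_iff)
    qed
    note eq = this
    show ?thesis unfolding Inf_real_def Sup_real_def c0_def by (simp only: eq)
  qed
  have "Inf ((\<lambda>i. f i w) ` I) < a \<longleftrightarrow> (if ?b w then \<exists>i. i \<in> I \<and> f i w < a else c0 < a)" for w a
    using cInf_less_iff[of "(\<lambda>i. f i w) ` I" a] False unb bdd by auto
  then show ?thesis by (intro borel_measurableI_less) (simp add: pred_def[symmetric])
qed simp

lemma measurable_path_weight [measurable]: "(\<lambda>w. path_weight p w ps) \<in> borel_measurable EW"
  unfolding path_weight_def by (induction ps) simp_all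

lemma measurable_CM_W: "CM_W n \<in> borel_measurable (CM_FPP F n)"
proof (rule measurable_CM_FPP[OF CM_decode(2)])
  fix g :: "(nat \<Rightarrow> nat) \<times> (stub \<Rightarrow> stub)"
  obtain d p where g: "g = (d, p)" by (cases g)
  have "CM_W n (g, w) = Inf ((\<lambda>ps. path_weight p w ps) ` {ps. is_path (stubs n d) p 0 ps 1})" for w
    unfolding CM_W_def g prod.case by (intro arg_cong[where f=Inf]) auto
  then show "(\<lambda>w. CM_W n (g, w)) \<in> borel_measurable EW"
    by (simp add: borel_measurable_Inf_image)
qed

lemma measurable_CM_H: "CM_H n \<in> measurable (CM_FPP F n) (count_space UNIV)"
proof (rule measurable_CM_FPP[OF CM_decode(3)])
  fix g :: "(nat \<Rightarrow> nat) \<times> (stub \<Rightarrow> stub)"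
  obtain d p where g: "g = (d, p)" by (cases g)
  have "CM_W n (g, w) = Inf ((\<lambda>ps. path_weight p w ps) ` {ps. is_path (stubs n d) p 0 ps 1})" for w
    unfolding CM_W_def g prod.case by (intro arg_cong[where f=Inf]) auto
  then have W: "(\<lambda>w. CM_W n (g, w)) \<in> borel_measurable EW"
    by (simp add: borel_measurable_Inf_image)
  have "(\<lambda>w. LEAST k. \<exists>ps. is_path (stubs n d) p 0 ps 1 \<and> length ps = k \<and> path_weight p w ps = CM_W n (g, w)) \<in> measurable EW (count_space UNIV)"
  proof (rule measurable_Least)
    fix k
    have "Measurable.pred EW (\<lambda>w. path_weight p w ps = CM_W n (g, w))" for ps
      unfolding pred_def by (rule borel_measurable_eq[OF measurable_path_weight W])
    then show "Measurable.pred EW (\<lambda>w. \<exists>ps. is_path (stubs n d) p 0 ps 1 \<and> length ps = k \<and> path_weight p w ps = CM_W n (g, w))"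
      by (intro pred_intros_countable(2) pred_intros_conj1')
  qed
  then show "(\<lambda>w. CM_H n (g, w)) \<in> measurable EW (count_space UNIV)"
    unfolding CM_H_def g prod.case .
qed

lemma measurable_CM_connected: "Measurable.pred (CM_FPP F n) (CM_connected n)"
proof (rule measurable_CM_FPP[OF CM_decode(1)])
  fix g :: "(nat \<Rightarrow> nat) \<times> (stub \<Rightarrow> stub)"
  obtain d p where g: "g = (d, p)" by (cases g)
  show "(\<lambda>w. CM_connected n (g, w)) \<in> measurable EW (count_space UNIV)"
    unfolding CM_connected_def g prod.case by simp
qed

definition CM_event where
  "CM_event F n E = {\<omega> \<in> space (CM_FPP F n). CM_connected n \<omega> \<and> (CM_W n \<omega>, CM_H n \<omega>) \<in> E}"

lemma sets_CM_event:
  assumes "E \<in> sets (borel \<Otimes>\<^sub>M count_space UNIV)"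
  shows "CM_event F n E \<in> sets (CM_FPP F n)"
proof -
  note [measurable] = measurable_CM_W measurable_CM_H measurable_CM_connected
  have [measurable]: "(\<lambda>\<omega>. (CM_W n \<omega>, CM_H n \<omega>)) \<in> measurable (CM_FPP F n) (borel \<Otimes>\<^sub>M count_space UNIV)"
    by measurable
  have "Measurable.pred (CM_FPP F n) (\<lambda>\<omega>. CM_connected n \<omega> \<and> (CM_W n \<omega>, CM_H n \<omega>) \<in> E)"
    using assms by measurable
  then show ?thesis by (simp add: CM_event_def pred_def)
qed

section \<open>Transfer of lower bounds to the configuration model\<close>

lemma meet_prob_le_graph:
  assumes E: "E \<in> sets (borel \<Otimes>\<^sub>M count_space UNIV)" and n: "n \<ge> 3"
    and ev: "even (card (stubs n d))"
  shows "meet_prob d {2..<n} (dormant_stubs d {0}) (dormant_stubs d {1}) (\<lambda>_. 0) E 0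
    \<le> (\<integral>\<^sup>+p. \<integral>\<^sup>+w. indicator (CM_event F n E) ((d, p), w) \<partial>EW \<partial>measure_pmf (pmf_of_set (pairings (stubs n d))))"
proof -
  have S: "dormant_stubs d {0} \<union> dormant_stubs d {1} \<union> dormant_stubs d {2..<n} = stubs n d"
    using n by (auto simp: dormant_stubs_def stubs_def)
  have finS: "finite (stubs n d)" unfolding S[symmetric] by (simp add: finite_dormant_stubs)
  note fp = finite_pairings[OF finS] and cp = card_pairings_pos[OF finS ev]
  have ne: "pairings (stubs n d) \<noteq> {}" using cp by auto
  have "meet_prob d {2..<n} (dormant_stubs d {0}) (dormant_stubs d {1}) (\<lambda>_. 0) E 0
     = (\<Sum>p\<in>pairings (stubs n d). \<integral>\<^sup>+w. indicator {w. opt_in E 0 p (edge_weight p w) (dormant_stubs d {0}) (dormant_stubs d {2..<n}) (dormant_stubs d {1}) (\<lambda>_. 0)} w \<partial>EW)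
        / of_nat (card (pairings (stubs n d)))"
    unfolding meet_prob_def S using cp
    by (simp add: divide_ennreal_def ennreal_of_nat_eq_real_of_nat inverse_ennreal inverse_eq_divide mult.commute)
  also have "\<dots> \<le> (\<Sum>p\<in>pairings (stubs n d). \<integral>\<^sup>+w. indicator (CM_event F n E) ((d, p), w) \<partial>EW) / of_nat (card (pairings (stubs n d)))"
  proof (intro divide_right_mono_ennreal sum_mono nn_integral_mono_AE)
    fix p assume p: "p \<in> pairings (stubs n d)"
    show "AE w in EW. indicator {w. opt_in E 0 p (edge_weight p w) (dormant_stubs d {0}) (dormant_stubs d {2..<n}) (dormant_stubs d {1}) (\<lambda>_. 0)} w
        \<le> (indicator (CM_event F n E) ((d, p), w) :: ennreal)"
      using AE_EW_nonneg
    proof eventually_elim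
      case (elim w)
      show ?case
      proof (cases "opt_in E 0 p (edge_weight p w) (dormant_stubs d {0}) (dormant_stubs d {2..<n}) (dormant_stubs d {1}) (\<lambda>_. 0)")
        case True
        then obtain t k where o: "opt p (edge_weight p w) (dormant_stubs d {0}) (dormant_stubs d {2..<n}) (dormant_stubs d {1}) (\<lambda>_. 0) t k"
          and "(t, k) \<in> E" by (auto simp: opt_in_def)
        moreover have "w s \<ge> 0" for s using elim by blast
        ultimately have "((d, p), w) \<in> CM_event F n E"
          using opt_imp_CM[OF p _ _ o] n by (auto simp: CM_event_def CM_FPP_def space_pair_measure)
        then show ?thesis by (simp add: indicator_def)
      qed simp
    qed
  qed
  also have "\<dots> = (\<integral>\<^sup>+p. \<integral>\<^sup>+w. indicator (CM_event F n E) ((d, p), w) \<partial>EW \<partial>measure_pmf (pmf_of_set (pairings (stubs n d))))"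
    using fp ne by (subst nn_integral_pmf_of_set) auto
  finally show ?thesis .
qed

lemma card_stubs: "card (stubs n d) = (\<Sum>i<n. d i)"
proof -
  have "stubs n d = dormant_stubs d {..<n}" by (auto simp: stubs_def dormant_stubs_def)
  then show ?thesis by (simp add: card_dormant_stubs)
qed

lemma adjust_degrees_even: "n > 0 \<Longrightarrow> even (card (stubs n (adjust_degrees n D)))"
proof -
  assume "n > 0"
  moreover have "adjust_degrees n D = parity_adjust (n - 1) 0 {..<n} D"
    unfolding adjust_degrees_def parity_adjust_def add_0 ..
  ultimately show ?thesis using parity_adjust_even[of "{..<n}" "n - 1" 0 D] by (simp add: card_stubs)
qed

text \<open>The degrees of the two end points are drawn separately and form the initial clusters.
  For \<open>n \<ge> 3\<close> the vertex \<open>n - 1\<close> that absorbs the parity is not an end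
  point, so \<open>adjust_degrees\<close> agrees with \<open>parity_adjust\<close> on the dormant
  vertices. Dropping the indicator gives the inequality.\<close>

lemma ann_le_CM:
  assumes E: "E \<in> sets (borel \<Otimes>\<^sub>M count_space UNIV)" and n: "n \<ge> 3"
  shows "(\<integral>\<^sup>+d0. \<integral>\<^sup>+d1. ann F (n - 1) l {2..<n} ({0} \<times> {..<d0}) ({1} \<times> {..<d1}) (\<lambda>_. 0) E 0 \<partial>measure_pmf F \<partial>measure_pmf F)
    \<le> emeasure (CM_FPP F n) (CM_event F n E)"
proof -
  interpret W: prob_space EW by (rule prob_space_EW)
  have set: "CM_event F n E \<in> sets (measure_pmf (CM_graph F n) \<Otimes>\<^sub>M EW)"
    using sets_CM_event[OF E] by (simp add: CM_FPP_def)
  let ?G = "\<lambda>D. meet_prob (adjust_degrees n D) {2..<n} (dormant_stubs (adjust_degrees n D) {0}) (dormant_stubs (adjust_degrees n D) {1}) (\<lambda>_. 0) E 0"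
  have step1: "emeasure (CM_FPP F n) (CM_event F n E) = (\<integral>\<^sup>+g. \<integral>\<^sup>+w. indicator (CM_event F n E) (g, w) \<partial>EW \<partial>measure_pmf (CM_graph F n))"
    unfolding CM_FPP_def by (rule W.emeasure_pair_measure[OF set])
  have step2: "(\<integral>\<^sup>+g. \<integral>\<^sup>+w. indicator (CM_event F n E) (g, w) \<partial>EW \<partial>measure_pmf (CM_graph F n)) = (\<integral>\<^sup>+D. \<integral>\<^sup>+p. \<integral>\<^sup>+w. indicator (CM_event F n E) ((adjust_degrees n D, p), w) \<partial>EW
       \<partial>measure_pmf (pmf_of_set (pairings (stubs n (adjust_degrees n D)))) \<partial>measure_pmf (Pi_pmf {..<n} 0 (\<lambda>_. F)))"
    unfolding CM_graph_def by simp
  have step3: "(\<integral>\<^sup>+D. ?G D \<partial>measure_pmf (Pi_pmf {..<n} 0 (\<lambda>_. F)))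
     \<le> (\<integral>\<^sup>+D. \<integral>\<^sup>+p. \<integral>\<^sup>+w. indicator (CM_event F n E) ((adjust_degrees n D, p), w) \<partial>EW
       \<partial>measure_pmf (pmf_of_set (pairings (stubs n (adjust_degrees n D)))) \<partial>measure_pmf (Pi_pmf {..<n} 0 (\<lambda>_. F)))"
    using n by (intro nn_integral_mono meet_prob_le_graph[OF E] adjust_degrees_even) auto
  have step4: "(\<integral>\<^sup>+D. ?G D \<partial>measure_pmf (Pi_pmf {..<n} 0 (\<lambda>_. F)))
     = (\<integral>\<^sup>+d0. \<integral>\<^sup>+d1. \<integral>\<^sup>+D. ?G (D(1 := d1, 0 := d0)) \<partial>measure_pmf (Pi_pmf {2..<n} 0 (\<lambda>_. F)) \<partial>measure_pmf F \<partial>measure_pmf F)"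
  proof -
    have eq: "{..<n} = insert 0 (insert 1 {2..<n})" using n by auto
    show ?thesis unfolding eq
      by (subst Pi_pmf_insert') (simp_all add: Pi_pmf_insert')
  qed
  have step5: "(\<integral>\<^sup>+d0. \<integral>\<^sup>+d1. ann F (n - 1) l {2..<n} ({0} \<times> {..<d0}) ({1} \<times> {..<d1}) (\<lambda>_. 0) E 0 \<partial>measure_pmf F \<partial>measure_pmf F)
     \<le> (\<integral>\<^sup>+d0. \<integral>\<^sup>+d1. \<integral>\<^sup>+D. ?G (D(1 := d1, 0 := d0)) \<partial>measure_pmf (Pi_pmf {2..<n} 0 (\<lambda>_. F)) \<partial>measure_pmf F \<partial>measure_pmf F)"
  proof (intro nn_integral_mono)
    fix d0 d1
    show "ann F (n - 1) l {2..<n} ({0} \<times> {..<d0}) ({1} \<times> {..<d1}) (\<lambda>_. 0) E 0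
      \<le> (\<integral>\<^sup>+D. ?G (D(1 := d1, 0 := d0)) \<partial>measure_pmf (Pi_pmf {2..<n} 0 (\<lambda>_. F)))"
      unfolding ann_def
    proof (intro nn_integral_mono)
      fix D :: "nat \<Rightarrow> nat"
      let ?c = "card ({0} \<times> {..<d0} :: stub set) + card ({1} \<times> {..<d1} :: stub set)"
      let ?D = "D(1 := d1, 0 := d0)"
      have c: "?c = d0 + d1" by simp
      have "{..<n} = insert 0 (insert 1 {2..<n})" using n by auto
      then have sum: "(\<Sum>i<n. ?D i) = d0 + (d1 + (\<Sum>i\<in>{2..<n}. D i))" by simp
      have adj: "adjust_degrees n ?D i = parity_adjust (n - 1) ?c {2..<n} D i" if "i \<in> {2..<n}" for i
        unfolding c adjust_degrees_def parity_adjust_def sum add.assoc using that by auto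
      have adj01: "adjust_degrees n ?D 0 = d0" "adjust_degrees n ?D 1 = d1"
        using n by (auto simp: adjust_degrees_def)
      have ds: "dormant_stubs (adjust_degrees n ?D) {2..<n} = dormant_stubs (parity_adjust (n - 1) ?c {2..<n} D) {2..<n}"
        by (rule dormant_stubs_cong) (rule adj)
      have ds0: "dormant_stubs (adjust_degrees n ?D) {0} = {0} \<times> {..<d0}" "dormant_stubs (adjust_degrees n ?D) {1} = {1} \<times> {..<d1}"
        using adj01 by (auto simp: dormant_stubs_def)
      have "meet_prob (parity_adjust (n - 1) ?c {2..<n} D) {2..<n} ({0} \<times> {..<d0}) ({1} \<times> {..<d1}) (\<lambda>_. 0) E 0 = ?G ?D"
        unfolding ds0 by (rule meet_prob_cong[OF ds[symmetric]])
      then show "indicator {d. card ({0} \<times> {..<d0} \<union> {1} \<times> {..<d1} \<union> dormant_stubs (parity_adjust (n - 1) ?c {2..<n} d) {2..<n}) \<le> l} D *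
          meet_prob (parity_adjust (n - 1) ?c {2..<n} D) {2..<n} ({0} \<times> {..<d0}) ({1} \<times> {..<d1}) (\<lambda>_. 0) E 0 \<le> ?G ?D"
        by (simp add: indicator_def)
    qed
  qed
  show ?thesis using order_trans[OF step5 step3[unfolded step4]] unfolding step1 step2 .
qed

subsection \<open>Tails of the degree distribution and of its size-biased version\<close>

text \<open>Mean value theorem; dividing by \<open>e\<close> covers both signs of the exponent,
  which are needed below and above the truncation level.\<close>

lemma powr_diff_ge:
  fixes e x :: real
  assumes "e < 1" "e \<noteq> 0" "x > 1"
  shows "x powr (e - 1) \<le> (x powr e - (x - 1) powr e) / e"
proof -
  have "\<exists>z. x - 1 < z \<and> z < x \<and> x powr e - (x - 1) powr e = (x - (x - 1)) * (e * z powr (e - 1))"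
    using assms by (intro MVT2) (auto intro!: derivative_eq_intros)
  then obtain z where z: "x - 1 < z" "z < x" "x powr e - (x - 1) powr e = e * z powr (e - 1)" by auto
  have "x powr (e - 1) \<le> z powr (e - 1)" using z assms by (intro powr_mono2') auto
  then show ?thesis using z assms by simp
qed

lemma sum_powr_le:
  fixes e :: real
  assumes "e < 1" "e \<noteq> 0" "1 \<le> a" "a \<le> n"
  shows "(\<Sum>i=a..n. real i powr (e - 1)) \<le> real a powr (e - 1) + (real n powr e - real a powr e) / e"
  using assms(4)
proof (induction n rule: dec_induct)
  case (step n)
  have "real (Suc n) powr (e - 1) \<le> (real (Suc n) powr e - real n powr e) / e"
    using powr_diff_ge[of e "real (Suc n)"] assms step by simp
  moreover have "(\<Sum>i=a..Suc n. real i powr (e - 1)) = (\<Sum>i=a..n. real i powr (e - 1)) + real (Suc n) powr (e - 1)"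
    using step by simp
  moreover have "(real n powr e - real a powr e) / e + (real (Suc n) powr e - real n powr e) / e = (real (Suc n) powr e - real a powr e) / e"
    by (simp add: diff_divide_distrib)
  ultimately show ?case using step.IH by linarith
qed simp

locale heavy_tail =
  fixes F :: "nat pmf" and \<tau> c1 c2 :: real
  assumes F2: "\<forall>k::nat. k < 2 \<longrightarrow> pmf F k = 0"
    and \<tau>: "2 < \<tau>" "\<tau> < 3" and c: "0 < c1" "c1 \<le> c2"
    and tail: "\<forall>x::real. x \<ge> 1 \<longrightarrow>
           c1 * x powr (-(\<tau> - 1)) \<le> measure_pmf.prob F {k. real k > x} \<and>
           measure_pmf.prob F {k. real k > x} \<le> c2 * x powr (-(\<tau> - 1))"
begin

lemma F_ge2: "k \<in> set_pmf F \<Longrightarrow> 2 \<le> k"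
  using F2 by (metis not_less set_pmf_iff)

text \<open>Collects the constants of the layer sums in \<open>truncated_moment\<close>: the layer
  \<open>i = 0\<close>, the layers below the truncation level, where the increment is at most
  \<open>3 * i\<close>, and the layers above it.\<close>

definition trunc_const where
  "trunc_const = 1 + 3 * c2 * (1 + 1 / (3 - \<tau>)) + c2 * (1 + 1 / (\<tau> - 2))"

lemma trunc_const_pos: "trunc_const > 0"
  unfolding trunc_const_def using c \<tau> by (intro add_pos_nonneg) (auto intro!: mult_nonneg_nonneg add_nonneg_nonneg)

text \<open>Summation by layers: the integrand is a sum of increments, each weighted by a tail
  probability. Layers below \<open>K\<close> contribute terms of order
  \<open>i powr (2 - \<tau>)\<close>, those above \<open>K * i powr (1 - \<tau>)\<close>, and both
  sums have order \<open>K powr (3 - \<tau>)\<close>. This moment controls the degree sums, the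
  squared degrees and the growth of the clusters alike.\<close>

lemma truncated_moment:
  assumes K: "K \<ge> 1"
  shows "(\<integral>\<^sup>+k. ennreal (real k * min (real k) (real K)) \<partial>measure_pmf F) \<le> ennreal (trunc_const * real K powr (3 - \<tau>))"
proof -
  define inc where "inc = (\<lambda>i. if i < K then 2 * real i + 1 else real K)"
  have inc0: "inc i \<ge> 0" for i by (simp add: inc_def)
  have layer: "real k * min (real k) (real K) = (\<Sum>i<k. inc i)" for k
  proof (induction k)
    case (Suc k)
    have "real (Suc k) * min (real (Suc k)) (real K) = real k * min (real k) (real K) + inc k"
      by (auto simp: inc_def min_def algebra_simps)
    then show ?case using Suc by simp
  qed simp
  have "ennreal (real k * min (real k) (real K)) = (\<Sum>i. ennreal (inc i) * indicator {k. i < k} k)" for k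
  proof -
    have "(\<Sum>i. ennreal (inc i) * indicator {k. i < k} k) = (\<Sum>i<k. ennreal (inc i) * indicator {k. i < k} k)"
      by (intro suminf_finite) auto
    then show ?thesis using inc0 by (simp add: layer sum_ennreal)
  qed
  then have "(\<integral>\<^sup>+k. ennreal (real k * min (real k) (real K)) \<partial>measure_pmf F) = (\<Sum>i. ennreal (inc i) * emeasure (measure_pmf F) {k. i < k})"
    by (simp add: nn_integral_suminf nn_integral_cmult)
  also have "\<dots> = (\<Sum>i. ennreal (inc i * measure_pmf.prob F {k. i < k}))"
    using inc0 by (simp add: measure_pmf.emeasure_eq_measure ennreal_mult)
  also have "\<dots> \<le> ennreal (trunc_const * real K powr (3 - \<tau>))"
  proof (rule suminf_le_const[OF summableI])
    fix n
    have q: "measure_pmf.prob F {k. i < k} \<le> c2 * real i powr (1 - \<tau>)" if "i \<ge> 1" for i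
      using tail[rule_format, of "real i"] that by simp
    have "(\<Sum>i<n. inc i * measure_pmf.prob F {k. i < k}) \<le> (\<Sum>i<Suc (K + n). inc i * measure_pmf.prob F {k. i < k})"
      using inc0 by (intro sum_mono2) auto
    also have "\<dots> = inc 0 * measure_pmf.prob F {k. 0 < k} + (\<Sum>i=1..K+n. inc i * measure_pmf.prob F {k. i < k})"
      by (simp add: lessThan_Suc_atMost atMost_atLeast0 sum.atLeast_Suc_atMost)
    also have "\<dots> \<le> 1 + (\<Sum>i=1..K+n. (if i < K then 3 * c2 * real i powr (2 - \<tau>) else c2 * real K * real i powr (1 - \<tau>)))"
    proof (intro add_mono sum_mono)
      show "inc 0 * measure_pmf.prob F {k. 0 < k} \<le> 1" using K by (simp add: inc_def)
      fix i assume i: "i \<in> {1..K+n}"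
      have "inc i * measure_pmf.prob F {k. i < k} \<le> inc i * (c2 * real i powr (1 - \<tau>))"
        using q[of i] i inc0 by (intro mult_left_mono) auto
      also have "\<dots> \<le> (if i < K then 3 * c2 * real i powr (2 - \<tau>) else c2 * real K * real i powr (1 - \<tau>))"
      proof (cases "i < K")
        case True
        have "real i powr (2 - \<tau>) = real i * real i powr (1 - \<tau>)"
          using i by (simp add: powr_mult_base)
        moreover have "(2 * real i + 1) * (c2 * real i powr (1 - \<tau>)) \<le> (3 * real i) * (c2 * real i powr (1 - \<tau>))"
          using i c by (intro mult_right_mono) auto
        ultimately show ?thesis using True by (simp add: inc_def mult_ac)
      qed (simp add: inc_def mult_ac)
      finally show "inc i * measure_pmf.prob F {k. i < k} \<le> (if i < K then 3 * c2 * real i powr (2 - \<tau>) else c2 * real K * real i powr (1 - \<tau>))" .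
    qed
    also have "(\<Sum>i=1..K+n. (if i < K then 3 * c2 * real i powr (2 - \<tau>) else c2 * real K * real i powr (1 - \<tau>)))
      \<le> (\<Sum>i=1..K. 3 * c2 * real i powr (2 - \<tau>)) + (\<Sum>i=K..K+n. c2 * real K * real i powr (1 - \<tau>))"
    proof -
      have "(\<Sum>i=1..K+n. (if i < K then 3 * c2 * real i powr (2 - \<tau>) else c2 * real K * real i powr (1 - \<tau>)))
        = (\<Sum>i\<in>{1..<K}. 3 * c2 * real i powr (2 - \<tau>)) + (\<Sum>i=K..K+n. c2 * real K * real i powr (1 - \<tau>))"
      proof -
        have "{1..K+n} = {1..<K} \<union> {K..K+n}" using K by auto
        moreover have "{1..<K} \<inter> {K..K+n} = {}" by auto
        ultimately show ?thesis by (simp add: sum.union_disjoint)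
      qed
      also have "(\<Sum>i\<in>{1..<K}. 3 * c2 * real i powr (2 - \<tau>)) \<le> (\<Sum>i=1..K. 3 * c2 * real i powr (2 - \<tau>))"
        using c by (intro sum_mono2) auto
      finally show ?thesis by simp
    qed
    also have "(\<Sum>i=1..K. 3 * c2 * real i powr (2 - \<tau>)) \<le> 3 * c2 * (1 + 1 / (3 - \<tau>)) * real K powr (3 - \<tau>)"
    proof -
      have "(\<Sum>i=1..K. real i powr (3 - \<tau> - 1)) \<le> real 1 powr (3 - \<tau> - 1) + (real K powr (3 - \<tau>) - real 1 powr (3 - \<tau>)) / (3 - \<tau>)"
        using \<tau> K by (intro sum_powr_le) auto
      also have "\<dots> \<le> 1 + real K powr (3 - \<tau>) / (3 - \<tau>)" using \<tau> by (simp add: divide_right_mono)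
      also have "\<dots> \<le> (1 + 1 / (3 - \<tau>)) * real K powr (3 - \<tau>)"
        using ge_one_powr_ge_zero[of "real K" "3 - \<tau>"] K \<tau> by (simp add: distrib_right)
      finally have "(\<Sum>i=1..K. real i powr (2 - \<tau>)) \<le> (1 + 1 / (3 - \<tau>)) * real K powr (3 - \<tau>)" by simp
      then have "3 * c2 * (\<Sum>i=1..K. real i powr (2 - \<tau>)) \<le> 3 * c2 * ((1 + 1 / (3 - \<tau>)) * real K powr (3 - \<tau>))"
        using c by (intro mult_left_mono) auto
      then show ?thesis by (simp only: sum_distrib_left mult.assoc)
    qed
    also have "(\<Sum>i=K..K+n. c2 * real K * real i powr (1 - \<tau>)) \<le> c2 * (1 + 1 / (\<tau> - 2)) * real K powr (3 - \<tau>)"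
    proof -
      have "(\<Sum>i=K..K+n. real i powr (2 - \<tau> - 1)) \<le> real K powr (2 - \<tau> - 1) + (real (K + n) powr (2 - \<tau>) - real K powr (2 - \<tau>)) / (2 - \<tau>)"
        using \<tau> K by (intro sum_powr_le) auto
      also have "\<dots> = real K powr (1 - \<tau>) + (real K powr (2 - \<tau>) - real (K + n) powr (2 - \<tau>)) / (\<tau> - 2)"
      proof -
        have "(a - b) / (2 - \<tau>) = (b - a) / (\<tau> - 2)" for a b
          by (metis minus_diff_eq minus_divide_divide)
        then show ?thesis by simp
      qed
      also have "\<dots> \<le> real K powr (1 - \<tau>) + real K powr (2 - \<tau>) / (\<tau> - 2)"
        using \<tau> by (intro add_left_mono divide_right_mono) auto
      also have "real K powr (1 - \<tau>) \<le> real K powr (2 - \<tau>)" using K by (intro powr_mono) auto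
      finally have "(\<Sum>i=K..K+n. real i powr (1 - \<tau>)) \<le> (1 + 1 / (\<tau> - 2)) * real K powr (2 - \<tau>)"
        by (simp add: distrib_right)
      then have "c2 * real K * (\<Sum>i=K..K+n. real i powr (1 - \<tau>)) \<le> c2 * real K * ((1 + 1 / (\<tau> - 2)) * real K powr (2 - \<tau>))"
        using c by (intro mult_left_mono) auto
      moreover have "c2 * (1 + 1 / (\<tau> - 2)) * real K powr (3 - \<tau>) = c2 * real K * ((1 + 1 / (\<tau> - 2)) * real K powr (2 - \<tau>))"
        using K powr_mult_base[of "real K" "2 - \<tau>"] by simp
      ultimately show ?thesis by (simp only: sum_distrib_left mult.assoc)
    qed
    also have "1 + (3 * c2 * (1 + 1 / (3 - \<tau>)) * real K powr (3 - \<tau>) + c2 * (1 + 1 / (\<tau> - 2)) * real K powr (3 - \<tau>)) \<le> trunc_const * real K powr (3 - \<tau>)"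
      using ge_one_powr_ge_zero[of "real K" "3 - \<tau>"] K \<tau> by (simp add: trunc_const_def distrib_right)
    finally show "(\<Sum>i<n. ennreal (inc i * measure_pmf.prob F {k. i < k})) \<le> ennreal (trunc_const * real K powr (3 - \<tau>))"
      using inc0 by (simp add: sum_ennreal ennreal_leI)
  qed
  finally show ?thesis .
qed

definition \<mu> :: real where "\<mu> = enn2real (\<integral>\<^sup>+k. of_nat k \<partial>measure_pmf F)"

text \<open>Truncation at level one leaves the mean itself, which is therefore finite.\<close>

lemma mean_F: "(\<integral>\<^sup>+k. of_nat k \<partial>measure_pmf F) = ennreal \<mu>"
proof -
  have "(\<integral>\<^sup>+k. of_nat k \<partial>measure_pmf F) \<le> (\<integral>\<^sup>+k. ennreal (real k * min (real k) (real 1)) \<partial>measure_pmf F)"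
  proof (rule nn_integral_mono)
    fix k :: nat
    show "of_nat k \<le> ennreal (real k * min (real k) (real 1))"
      by (cases k) (simp_all add: ennreal_of_nat_eq_real_of_nat)
  qed
  also have "\<dots> < \<infinity>" using truncated_moment[of 1] by (simp add: order_le_less_trans)
  finally show ?thesis by (simp add: \<mu>_def)
qed

lemma \<mu>_ge2: "\<mu> \<ge> 2"
proof -
  have "(\<integral>\<^sup>+k. 2 \<partial>measure_pmf F) \<le> (\<integral>\<^sup>+k. of_nat k \<partial>measure_pmf F)"
  proof (rule nn_integral_mono_AE, unfold AE_measure_pmf_iff, intro ballI)
    fix k assume "k \<in> set_pmf F"
    then show "(2::ennreal) \<le> of_nat k" using of_nat_mono[OF F_ge2[of k], where 'a=ennreal] by simp
  qed
  then have "ennreal 2 \<le> ennreal \<mu>" by (simp add: mean_F measure_pmf.emeasure_space_1)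
  then show ?thesis by (simp add: ennreal_le_iff2)
qed

definition Fs :: "nat pmf" where "Fs = embed_pmf (\<lambda>k. real k * pmf F k / \<mu>)"

lemma Fs: "size_biased F \<mu> Fs"
proof -
  have "(\<integral>\<^sup>+k. ennreal (real k * pmf F k / \<mu>) \<partial>count_space UNIV) = 1"
  proof -
    have "(\<integral>\<^sup>+k. ennreal (real k * pmf F k / \<mu>) \<partial>count_space UNIV) = (\<integral>\<^sup>+k. ennreal (1 / \<mu>) * (ennreal (pmf F k) * of_nat k) \<partial>count_space UNIV)"
      using \<mu>_ge2 by (intro nn_integral_cong) (simp add: ennreal_of_nat_eq_real_of_nat ennreal_mult[symmetric] mult_ac)
    also have "\<dots> = ennreal (1 / \<mu>) * (\<integral>\<^sup>+k. of_nat k \<partial>measure_pmf F)"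
      by (simp add: nn_integral_cmult nn_integral_measure_pmf)
    also have "\<dots> = 1" using \<mu>_ge2 by (simp add: mean_F ennreal_mult[symmetric])
    finally show ?thesis .
  qed
  then have "pmf Fs k = real k * pmf F k / \<mu>" for k
    unfolding Fs_def using \<mu>_ge2 by (intro pmf_embed_pmf) auto
  then show ?thesis using \<mu>_ge2 by (simp add: size_biased_def)
qed

lemma Fs_ge2: "k \<in> set_pmf Fs \<Longrightarrow> 2 \<le> k"
  using Fs F_ge2 by (auto simp: size_biased_def set_pmf_iff)

text \<open>On \<open>k > x\<close> the size bias is at least \<open>x / \<mu>\<close>, so the tail
  exponent drops by one to \<open>\<tau> - 2\<close>, which is below one.\<close>

lemma Fs_tail:
  assumes "x \<ge> 1"
  shows "c1 / \<mu> * x powr (2 - \<tau>) \<le> measure_pmf.prob Fs {k. real k > x}"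
proof -
  have "ennreal (x * measure_pmf.prob F {k. real k > x}) = (\<integral>\<^sup>+k. ennreal x * indicator {k. real k > x} k \<partial>measure_pmf F)"
    using assms by (simp add: nn_integral_cmult ennreal_mult measure_pmf.emeasure_eq_measure)
  also have "\<dots> \<le> (\<integral>\<^sup>+k. of_nat k * indicator {k. real k > x} k \<partial>measure_pmf F)"
    by (intro nn_integral_mono) (auto simp: indicator_def ennreal_of_nat_eq_real_of_nat ennreal_leI)
  also have "\<dots> = ennreal \<mu> * ennreal (measure_pmf.prob Fs {k. real k > x})"
    unfolding nn_integral_size_biased[OF Fs] by (simp add: measure_pmf.emeasure_eq_measure)
  finally have "x * measure_pmf.prob F {k. real k > x} \<le> \<mu> * measure_pmf.prob Fs {k. real k > x}"
    using \<mu>_ge2 by (simp add: ennreal_mult[symmetric] ennreal_le_iff)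
  moreover have "x * (c1 * x powr (1 - \<tau>)) \<le> x * measure_pmf.prob F {k. real k > x}"
    using tail assms by (intro mult_left_mono) auto
  moreover have "x * (c1 * x powr (1 - \<tau>)) = c1 * x powr (2 - \<tau>)"
    using assms powr_mult_base[of x "1 - \<tau>"] by simp
  ultimately have "c1 * x powr (2 - \<tau>) \<le> \<mu> * measure_pmf.prob Fs {k. real k > x}" by linarith
  then show ?thesis using \<mu>_ge2 by (simp add: pos_divide_le_eq mult.commute)
qed

lemma Fs_truncated:
  assumes "K \<ge> 1"
  shows "(\<integral>\<^sup>+k. ennreal (min (real k) (real K)) \<partial>measure_pmf Fs) \<le> ennreal (trunc_const / \<mu> * real K powr (3 - \<tau>))"
proof -
  have "ennreal \<mu> * (\<integral>\<^sup>+k. ennreal (min (real k) (real K)) \<partial>measure_pmf Fs) = (\<integral>\<^sup>+k. ennreal (real k * min (real k) (real K)) \<partial>measure_pmf F)"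
    unfolding nn_integral_size_biased[OF Fs, symmetric]
    by (simp add: ennreal_of_nat_eq_real_of_nat ennreal_mult)
  also have "\<dots> \<le> ennreal (trunc_const * real K powr (3 - \<tau>))" by (rule truncated_moment[OF assms])
  finally have "ennreal (1 / \<mu>) * (ennreal \<mu> * (\<integral>\<^sup>+k. ennreal (min (real k) (real K)) \<partial>measure_pmf Fs)) \<le> ennreal (1 / \<mu>) * ennreal (trunc_const * real K powr (3 - \<tau>))"
    by (intro mult_left_mono) auto
  then show ?thesis using \<mu>_ge2 trunc_const_pos
    by (simp add: mult.assoc[symmetric] ennreal_mult[symmetric])
qed

subsection \<open>Growth of the idealised exploration\<close>

lemma mix_const: "S \<ge> 1 \<Longrightarrow> k \<ge> 2 \<Longrightarrow> mix S k (\<lambda>_. c) a = c"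
proof -
  assume S: "S \<ge> 1" and k: "k \<ge> 2"
  let ?b = "(real k - 1) / (real S + real k - 2)"
  have "0 \<le> ?b" "?b \<le> 1" using S k by (auto simp: field_simps)
  then have "ennreal (1 - ?b) + ennreal ?b = 1" by (simp flip: ennreal_plus)
  then show ?thesis by (simp add: mix_def distrib_right[symmetric])
qed

lemma AE_Fs: "AE k in measure_pmf Fs. 2 \<le> k"
  using Fs_ge2 by (simp add: AE_measure_pmf_iff)

text \<open>A supersolution principle: \<open>G\<close> dominates the reward and does not increase
  under one step of the chain of sizes and times. As \<open>G\<close> ignores the label, mixing
  leaves it unchanged.\<close>

lemma explore_bound:
  assumes "\<And>S t a. S \<ge> 1 \<Longrightarrow> t \<ge> 0 \<Longrightarrow> \<Gamma> S t a \<le> G 0 S t"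
    and "\<And>j S t. S \<ge> 1 \<Longrightarrow> t \<ge> 0 \<Longrightarrow> (\<integral>\<^sup>+k. expect_exp S (\<lambda>e. G j (S + k - 2) (t + e)) \<partial>measure_pmf Fs) \<le> G (Suc j) S t"
    and "S \<ge> 1" "t \<ge> 0"
  shows "explore Fs j \<Gamma> S t a \<le> G j S t"
  using assms(3,4)
proof (induction j arbitrary: S t a)
  case (Suc j)
  have "explore Fs (Suc j) \<Gamma> S t a \<le> (\<integral>\<^sup>+k. expect_exp S (\<lambda>e. G j (S + k - 2) (t + e)) \<partial>measure_pmf Fs)"
    unfolding explore.simps
  proof (rule nn_integral_mono_AE)
    show "AE k in measure_pmf Fs. expect_exp S (\<lambda>e. mix S k (explore Fs j \<Gamma> (S + k - 2) (t + e)) a) \<le> expect_exp S (\<lambda>e. G j (S + k - 2) (t + e))"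
      using AE_Fs
    proof eventually_elim
      case (elim k)
      show ?case
      proof (rule expect_exp_mono)
        fix e :: real assume "e \<ge> 0"
        have "mix S k (explore Fs j \<Gamma> (S + k - 2) (t + e)) a \<le> mix S k (\<lambda>_. G j (S + k - 2) (t + e)) a"
          using Suc.prems elim \<open>e \<ge> 0\<close> by (intro mix_mono Suc.IH) auto
        then show "mix S k (explore Fs j \<Gamma> (S + k - 2) (t + e)) a \<le> G j (S + k - 2) (t + e)"
          using mix_const Suc.prems elim by simp
      qed
    qed
  qed
  also have "\<dots> \<le> G (Suc j) S t" using assms(2) Suc.prems by blast
  finally show ?case .
qed (use assms(1) in simp)

lemma explore_const_le: "S \<ge> 1 \<Longrightarrow> t \<ge> 0 \<Longrightarrow> explore Fs j (\<lambda>_ _ _. c) S t a \<le> c"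
  by (rule explore_bound[where G="\<lambda>_ _ _. c"]) (auto simp: expect_exp_const measure_pmf.emeasure_space_1)

lemma explore_const: "S \<ge> 1 \<Longrightarrow> explore Fs j (\<lambda>_ _ _. c) S t a = c"
proof (induction j arbitrary: S t a)
  case (Suc j)
  have "explore Fs (Suc j) (\<lambda>_ _ _. c) S t a = (\<integral>\<^sup>+k. c \<partial>measure_pmf Fs)"
    unfolding explore.simps
  proof (rule nn_integral_cong_AE)
    show "AE k in measure_pmf Fs. expect_exp S (\<lambda>e. mix S k (explore Fs j (\<lambda>_ _ _. c) (S + k - 2) (t + e)) a) = c"
      using AE_Fs
    proof eventually_elim
      case (elim k)
      have "explore Fs j (\<lambda>_ _ _. c) (S + k - 2) (t + e) = (\<lambda>_. c)" for e
        using Suc elim by (intro ext Suc.IH) auto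
      then show ?case using Suc.prems elim by (simp add: mix_const expect_exp_const)
    qed
  qed
  then show ?case by (simp add: measure_pmf.emeasure_space_1)
qed simp

text \<open>All increments \<open>k - 2\<close> must be at most \<open>y\<close> for the number of active stubs to stay at most \<open>y\<close>.\<close>

lemma explore_small:
  assumes "S \<ge> 1" "t \<ge> 0"
  shows "explore Fs j (\<lambda>S _ _. if real S \<le> y then 1 else 0) S t a \<le> ennreal (measure_pmf.prob Fs {k. real k \<le> y + 1}) ^ j"
proof -
  let ?\<rho> = "emeasure (measure_pmf Fs) {k. real k \<le> y + 1}"
  have "explore Fs j (\<lambda>S _ _. if real S \<le> y then 1 else 0) S t a \<le> (\<lambda>j S t. if real S \<le> y then ?\<rho> ^ j else 0) j S t"
  proof (rule explore_bound)
    fix j S and t :: real assume S: "S \<ge> (1::nat)" and t: "t \<ge> 0"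
    have "(\<integral>\<^sup>+k. expect_exp S (\<lambda>e. if real (S + k - 2) \<le> y then ?\<rho> ^ j else 0) \<partial>measure_pmf Fs)
       \<le> (\<integral>\<^sup>+k. (if real S \<le> y then ?\<rho> ^ j else 0) * indicator {k. real k \<le> y + 1} k \<partial>measure_pmf Fs)"
    proof (rule nn_integral_mono_AE)
      show "AE k in measure_pmf Fs. expect_exp S (\<lambda>e. if real (S + k - 2) \<le> y then ?\<rho> ^ j else 0) \<le> (if real S \<le> y then ?\<rho> ^ j else 0) * indicator {k. real k \<le> y + 1} k"
        using AE_Fs
      proof eventually_elim
        case (elim k)
        have "real (S + k - 2) = real S + real k - 2" using S elim by (simp add: of_nat_diff)
        moreover have "real k \<ge> 2" "real S \<ge> 1" using S elim by auto
        ultimately show ?case using S by (auto simp: expect_exp_const)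
      qed
    qed
    also have "\<dots> = (if real S \<le> y then ?\<rho> ^ Suc j else 0)" by (subst nn_integral_cmult) (simp_all add: mult.commute)
    finally show "(\<integral>\<^sup>+k. expect_exp S (\<lambda>e. if real (S + k - 2) \<le> y then ?\<rho> ^ j else 0) \<partial>measure_pmf Fs) \<le> (if real S \<le> y then ?\<rho> ^ Suc j else 0)" .
  qed (use assms in auto)
  also have "\<dots> \<le> ?\<rho> ^ j" by simp
  finally show ?thesis by (simp add: measure_pmf.emeasure_eq_measure)
qed

lemma small_prob_le_exp:
  assumes "y \<ge> 0"
  shows "measure_pmf.prob Fs {k. real k \<le> y + 1} ^ j \<le> exp (- (real j * (c1 / \<mu> * (y + 1) powr (2 - \<tau>))))"
proof -
  have "measure_pmf.prob Fs {k. real k \<le> y + 1} = 1 - measure_pmf.prob Fs {k. real k > y + 1}"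
    using measure_pmf.prob_compl[of "{k. real k > y + 1}" Fs] by (simp add: Collect_neg_eq[symmetric] Compl_eq_Diff_UNIV[symmetric] not_less)
  also have "\<dots> \<le> 1 - c1 / \<mu> * (y + 1) powr (2 - \<tau>)" using Fs_tail[of "y + 1"] assms by simp
  also have "\<dots> \<le> exp (- (c1 / \<mu> * (y + 1) powr (2 - \<tau>)))"
    using exp_ge_add_one_self[of "- (c1 / \<mu> * (y + 1) powr (2 - \<tau>))"] by simp
  finally have "measure_pmf.prob Fs {k. real k \<le> y + 1} ^ j \<le> exp (- (c1 / \<mu> * (y + 1) powr (2 - \<tau>))) ^ j"
    by (intro power_mono) auto
  then show ?thesis by (simp add: exp_of_nat_mult[symmetric])
qed

text \<open>Markov's inequality for the size truncated at \<open>K\<close>, whose mean increment is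
  at most the truncated mean of the size-biased law. Truncation is forced, since that law has
  infinite mean.\<close>

lemma explore_large:
  assumes "S \<ge> 1" "t \<ge> 0" "K \<ge> 1"
  shows "explore Fs j (\<lambda>S _ _. if S > K then 1 else 0) S t a \<le> ennreal ((real S + real j * (trunc_const / \<mu> * real K powr (3 - \<tau>))) / real K)"
proof -
  define c where "c = trunc_const / \<mu> * real K powr (3 - \<tau>)"
  have c0: "c \<ge> 0" using trunc_const_pos \<mu>_ge2 by (simp add: c_def)
  have "explore Fs j (\<lambda>S _ _. if S > K then 1 else 0) S t a \<le> (\<lambda>j S t. ennreal ((min (real S) (real K) + real j * c) / real K)) j S t"
  proof (rule explore_bound)
    fix j S and t :: real assume S: "S \<ge> (1::nat)" and t: "t \<ge> 0"
    have "(\<integral>\<^sup>+k. expect_exp S (\<lambda>e. ennreal ((min (real (S + k - 2)) (real K) + real j * c) / real K)) \<partial>measure_pmf Fs)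
       \<le> (\<integral>\<^sup>+k. ennreal ((min (real S) (real K) + real j * c) / real K) + ennreal (1 / real K) * ennreal (min (real k) (real K)) \<partial>measure_pmf Fs)"
    proof (rule nn_integral_mono)
      fix k
      have "min (real (S + k - 2)) (real K) \<le> min (real S) (real K) + min (real k) (real K)" by (auto simp: min_def)
      then have "(min (real (S + k - 2)) (real K) + real j * c) / real K \<le> (min (real S) (real K) + real j * c + min (real k) (real K)) / real K"
        by (intro divide_right_mono) auto
      then have "(min (real (S + k - 2)) (real K) + real j * c) / real K \<le> (min (real S) (real K) + real j * c) / real K + 1 / real K * min (real k) (real K)"
        by (simp add: add_divide_distrib)
      then show "expect_exp S (\<lambda>e. ennreal ((min (real (S + k - 2)) (real K) + real j * c) / real K))
         \<le> ennreal ((min (real S) (real K) + real j * c) / real K) + ennreal (1 / real K) * ennreal (min (real k) (real K))"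
        using S c0 by (simp add: expect_exp_const ennreal_mult[symmetric] flip: ennreal_plus)
    qed
    also have "\<dots> = ennreal ((min (real S) (real K) + real j * c) / real K) + ennreal (1 / real K) * (\<integral>\<^sup>+k. ennreal (min (real k) (real K)) \<partial>measure_pmf Fs)"
      by (simp add: nn_integral_add nn_integral_cmult measure_pmf.emeasure_space_1)
    also have "\<dots> \<le> ennreal ((min (real S) (real K) + real j * c) / real K) + ennreal (1 / real K) * ennreal c"
      unfolding c_def using Fs_truncated[OF assms(3)] by (intro add_left_mono mult_left_mono) auto
    also have "\<dots> = ennreal ((min (real S) (real K) + real (Suc j) * c) / real K)"
      using c0 by (simp add: ennreal_mult[symmetric] add_divide_distrib distrib_right flip: ennreal_plus)
    finally show "(\<integral>\<^sup>+k. expect_exp S (\<lambda>e. ennreal ((min (real (S + k - 2)) (real K) + real j * c) / real K)) \<partial>measure_pmf Fs)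
      \<le> ennreal ((min (real S) (real K) + real (Suc j) * c) / real K)" .
  qed (use assms in auto)
  also have "\<dots> \<le> ennreal ((real S + real j * c) / real K)"
    by (intro ennreal_leI divide_right_mono) auto
  finally show ?thesis by (simp add: c_def)
qed

text \<open>The exponent \<open>2 / (\<tau> - 1)\<close> lies strictly between \<open>1\<close> and \<open>1 / (\<tau> - 2)\<close>.\<close>

definition inv_bound :: "nat \<Rightarrow> real" where
  "inv_bound i = real i powr (- (2 / (\<tau> - 1))) + exp (- (real i * (c1 / \<mu> * (real i powr (2 / (\<tau> - 1)) + 1) powr (2 - \<tau>))))"

text \<open>Sizes are split at \<open>y = real i powr (2 / (\<tau> - 1))\<close>. Above,
  \<open>1 / S\<close> is at most \<open>1 / y\<close>; below, the probability of so small a cluster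
  is exponentially small in a power of \<open>i\<close>.\<close>

lemma explore_inverse:
  assumes "S \<ge> 1" "t \<ge> 0" "i \<ge> 1"
  shows "explore Fs i (\<lambda>S _ _. ennreal (1 / real S)) S t a \<le> ennreal (inv_bound i)"
proof -
  define y where "y = real i powr (2 / (\<tau> - 1))"
  have y: "y > 0" using assms by (simp add: y_def)
  have "explore Fs i (\<lambda>S _ _. ennreal (1 / real S)) S t a \<le> explore Fs i (\<lambda>S _ _. ennreal (1 / y) + (if real S \<le> y then 1 else 0)) S t a"
  proof (rule explore_mono)
    fix S :: nat and t :: real and a :: nat
    show "ennreal (1 / real S) \<le> ennreal (1 / y) + (if real S \<le> y then 1 else 0)"
    proof (cases "real S \<le> y")
      case True
      have "ennreal (1 / real S) \<le> 1" by (cases "S = 0") auto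
      then show ?thesis using True by (simp add: add_increasing)
    next
      case False
      then have "1 / real S \<le> 1 / y" using y by (intro divide_left_mono) auto
      then show ?thesis using False by (simp add: ennreal_leI)
    qed
  qed
  also have "\<dots> = explore Fs i (\<lambda>_ _ _. ennreal (1 / y)) S t a + explore Fs i (\<lambda>S _ _. if real S \<le> y then 1 else 0) S t a"
    by (rule explore_add) auto
  also have "\<dots> \<le> ennreal (1 / y) + ennreal (measure_pmf.prob Fs {k. real k \<le> y + 1}) ^ i"
    using assms by (intro add_mono explore_small explore_const_le)
  also have "\<dots> \<le> ennreal (1 / y) + ennreal (exp (- (real i * (c1 / \<mu> * (y + 1) powr (2 - \<tau>)))))"
    using small_prob_le_exp[of y i] y by (intro add_left_mono) (simp add: ennreal_power ennreal_leI)
  also have "\<dots> = ennreal (inv_bound i)"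
    using y by (simp add: inv_bound_def y_def powr_minus_divide flip: ennreal_plus)
  finally show ?thesis .
qed

end

context heavy_tail
begin

subsection \<open>The limit of the weight\<close>

text \<open>The chain of sizes alone, with times and labels integrated out.\<close>

primrec grow :: "nat \<Rightarrow> (nat \<Rightarrow> ennreal) \<Rightarrow> nat \<Rightarrow> ennreal" where
  "grow 0 f = f"
| "grow (Suc j) f = (\<lambda>S. \<integral>\<^sup>+k. grow j f (S + k - 2) \<partial>measure_pmf Fs)"

lemma explore_grow: "S \<ge> 1 \<Longrightarrow> explore Fs j (\<lambda>S _ _. f S) S t a = grow j f S"
proof (induction j arbitrary: S t a)
  case (Suc j)
  show ?case unfolding explore.simps grow.simps
  proof (rule nn_integral_cong_AE)
    show "AE k in measure_pmf Fs. expect_exp S (\<lambda>e. mix S k (explore Fs j (\<lambda>S _ _. f S) (S + k - 2) (t + e)) a) = grow j f (S + k - 2)"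
      using AE_Fs
    proof eventually_elim
      case (elim k)
      have "explore Fs j (\<lambda>S _ _. f S) (S + k - 2) (t + e) = (\<lambda>_. grow j f (S + k - 2))" for e
        using Suc elim by (intro ext Suc.IH) auto
      then show ?case using Suc.prems elim by (simp add: mix_const expect_exp_const)
    qed
  qed
qed simp

lemma grow_inverse: "S \<ge> 1 \<Longrightarrow> i \<ge> 1 \<Longrightarrow> grow i (\<lambda>S. ennreal (1 / real S)) S \<le> ennreal (inv_bound i)"
  using explore_inverse[of S 0 i 0] by (simp add: explore_grow)

lemma explore_mono_pos:
  assumes "\<And>S t a. S \<ge> 1 \<Longrightarrow> t \<ge> 0 \<Longrightarrow> \<Gamma> S t a \<le> \<Gamma>' S t a"
  shows "S \<ge> 1 \<Longrightarrow> t \<ge> 0 \<Longrightarrow> explore Fs j \<Gamma> S t a \<le> explore Fs j \<Gamma>' S t a"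
proof (induction j arbitrary: S t a)
  case (Suc j)
  show ?case unfolding explore.simps
  proof (rule nn_integral_mono_AE)
    show "AE k in measure_pmf Fs. expect_exp S (\<lambda>e. mix S k (explore Fs j \<Gamma> (S + k - 2) (t + e)) a)
       \<le> expect_exp S (\<lambda>e. mix S k (explore Fs j \<Gamma>' (S + k - 2) (t + e)) a)"
      using AE_Fs by eventually_elim (use Suc.prems in \<open>intro expect_exp_mono mix_mono Suc.IH; simp\<close>)
  qed
qed (use assms in simp)

lemma inv_bound_nonneg: "inv_bound i \<ge> 0"
  by (simp add: inv_bound_def)

lemma summable_inv_bound: "summable inv_bound"
proof -
  define e where "e = 2 / (\<tau> - 1)"
  define c where "c = c1 / \<mu> * 2 powr (2 - \<tau>)"
  \<comment> \<open>The exponent of \<open>i * i powr (e * (2 - \<tau>))\<close>, positive because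
    \<open>\<tau> < 3\<close>.\<close>
  define \<delta> where "\<delta> = (3 - \<tau>) / (\<tau> - 1)"
  have e: "e > 1" and \<delta>: "\<delta> > 0" using \<tau> by (auto simp: e_def \<delta>_def)
  have c0: "c > 0" using c \<mu>_ge2 by (simp add: c_def)
  have "summable (\<lambda>i. real i powr (- e))"
    using e by (simp add: summable_real_powr_iff)
  moreover have "summable (\<lambda>i. exp (- (real i * (c1 / \<mu> * (real i powr e + 1) powr (2 - \<tau>)))))"
  proof (rule summable_comparison_test_ev)
    have "eventually (\<lambda>x::real. exp (- (c * x powr \<delta>)) \<le> x powr (- 2)) at_top"
      using c0 \<delta> by real_asymp
    then have "eventually (\<lambda>i. exp (- (c * real i powr \<delta>)) \<le> real i powr (- 2)) sequentially"
      by (rule eventually_compose_filterlim[OF _ filterlim_real_sequentially])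
    then show "eventually (\<lambda>i. norm (exp (- (real i * (c1 / \<mu> * (real i powr e + 1) powr (2 - \<tau>))))) \<le> real i powr (- 2)) sequentially"
      using eventually_ge_at_top[of 1]
    proof eventually_elim
      case (elim i)
      have "real i powr e + 1 \<le> 2 * real i powr e" using ge_one_powr_ge_zero[of "real i" e] elim e by simp
      then have "(2 * real i powr e) powr (2 - \<tau>) \<le> (real i powr e + 1) powr (2 - \<tau>)"
        using \<tau> by (intro powr_mono2') (auto intro: add_nonneg_pos)
      moreover have "(2 * real i powr e) powr (2 - \<tau>) = 2 powr (2 - \<tau>) * real i powr (e * (2 - \<tau>))"
        by (simp add: powr_mult powr_powr)
      ultimately have "real i * (c1 / \<mu> * (2 powr (2 - \<tau>) * real i powr (e * (2 - \<tau>)))) \<le> real i * (c1 / \<mu> * (real i powr e + 1) powr (2 - \<tau>))"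
        using c \<mu>_ge2 by (intro mult_left_mono) auto
      moreover have "real i * (c1 / \<mu> * (2 powr (2 - \<tau>) * real i powr (e * (2 - \<tau>)))) = c * real i powr \<delta>"
      proof -
        have "1 + e * (2 - \<tau>) = \<delta>" using \<tau> by (simp add: e_def \<delta>_def field_simps)
        then have "real i * real i powr (e * (2 - \<tau>)) = real i powr \<delta>"
          using elim powr_mult_base[of "real i" "e * (2 - \<tau>)"] by simp
        then show ?thesis by (simp add: c_def mult_ac)
      qed
      ultimately have "exp (- (real i * (c1 / \<mu> * (real i powr e + 1) powr (2 - \<tau>)))) \<le> exp (- (c * real i powr \<delta>))" by simp
      then show ?case unfolding real_norm_def abs_exp_cancel using elim(1) by (rule order_trans)
    qed
    show "summable (\<lambda>i. real i powr (- 2))" by (simp add: summable_real_powr_iff)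
  qed
  ultimately have "summable (\<lambda>i. real i powr (- e) + exp (- (real i * (c1 / \<mu> * (real i powr e + 1) powr (2 - \<tau>)))))"
    by (rule summable_add)
  then show ?thesis by (simp add: inv_bound_def[abs_def] e_def)
qed

text \<open>Bounds the sum of the means of \<open>1 / S\<close> over all steps, and thus the mean
  duration of an exploration of any length from any positive initial size. The summand
  \<open>1\<close> covers the first step.\<close>

definition time_const :: real where "time_const = 1 + (\<Sum>i. inv_bound i)"

lemma time_const_pos: "time_const \<ge> 1"
  unfolding time_const_def using suminf_nonneg[OF summable_inv_bound inv_bound_nonneg] by simp

lemma sum_grow_inverse:
  assumes "S \<ge> 1"
  shows "(\<Sum>i<j. grow i (\<lambda>S. ennreal (1 / real S)) S) \<le> ennreal time_const"
proof -
  have "grow i (\<lambda>S. ennreal (1 / real S)) S \<le> ennreal ((if i = 0 then 1 else 0) + inv_bound i)" for i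
  proof (cases "i = 0")
    case True
    have "1 / real S \<le> 1 + inv_bound 0" using assms inv_bound_nonneg[of 0] by (simp add: add_increasing2 divide_le_eq_1)
    then show ?thesis using True by (simp add: ennreal_leI)
  qed (use grow_inverse[OF assms, of i] in simp)
  then have "(\<Sum>i<j. grow i (\<lambda>S. ennreal (1 / real S)) S) \<le> (\<Sum>i<j. ennreal ((if i = 0 then 1 else 0) + inv_bound i))"
    by (intro sum_mono)
  also have "\<dots> = ennreal (\<Sum>i<j. (if i = 0 then 1 else 0) + inv_bound i)"
    using inv_bound_nonneg by (intro sum_ennreal) (simp add: add_nonneg_nonneg)
  also have "\<dots> \<le> ennreal time_const"
  proof (rule ennreal_leI)
    have "(\<Sum>i<j. (if i = 0 then 1 else 0) + inv_bound i) = (\<Sum>i<j. if i = 0 then 1 else 0) + (\<Sum>i<j. inv_bound i)"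
      by (rule sum.distrib)
    moreover have "(\<Sum>i<j. if i = 0 then 1 else 0 :: real) \<le> 1" by (cases j) (auto simp: sum.delta)
    moreover have "(\<Sum>i<j. inv_bound i) \<le> (\<Sum>i. inv_bound i)"
      by (intro sum_le_suminf summable_inv_bound inv_bound_nonneg) auto
    ultimately show "(\<Sum>i<j. (if i = 0 then 1 else 0) + inv_bound i) \<le> time_const" by (simp add: time_const_def)
  qed
  finally show ?thesis .
qed

text \<open>Step \<open>i\<close> lasts on average the mean of \<open>1 / S\<close> after
  \<open>i\<close> steps, and these means have a bounded sum; the supersolution is the time spent
  plus the expected time to come.\<close>

lemma explore_time:
  assumes "S \<ge> 1" "t \<ge> 0"
  shows "explore Fs j (\<lambda>_ t _. ennreal t) S t a \<le> ennreal (t + time_const)"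
proof -
  let ?r = "\<lambda>j S. \<Sum>i<j. grow i (\<lambda>S. ennreal (1 / real S)) S"
  have "explore Fs j (\<lambda>_ t _. ennreal t) S t a \<le> (\<lambda>j S t. ennreal t + ?r j S) j S t"
  proof (rule explore_bound)
    fix j S and t :: real assume S: "S \<ge> (1::nat)" and t: "t \<ge> 0"
    have "expect_exp S (\<lambda>e. ennreal (t + e) + ?r j (S + k - 2)) \<le> ennreal t + ennreal (1 / real S) + ?r j (S + k - 2)" for k
    proof -
      have "expect_exp S (\<lambda>e. ennreal (t + e) + ?r j (S + k - 2)) = expect_exp S (\<lambda>e. (ennreal t + ennreal (e / 1)) + ?r j (S + k - 2))"
        using t by (intro expect_exp_cong) simp
      also have "\<dots> = ennreal t + expect_exp S (\<lambda>e. ennreal (e / 1)) + ?r j (S + k - 2)"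
        using S by (simp add: expect_exp_add expect_exp_const)
      also have "\<dots> \<le> ennreal t + ennreal (1 / (real S * 1)) + ?r j (S + k - 2)"
        using S by (intro add_mono order_refl expect_exp_ident) auto
      finally show ?thesis by simp
    qed
    then have "(\<integral>\<^sup>+k. expect_exp S (\<lambda>e. ennreal (t + e) + ?r j (S + k - 2)) \<partial>measure_pmf Fs)
      \<le> (\<integral>\<^sup>+k. ennreal t + ennreal (1 / real S) + ?r j (S + k - 2) \<partial>measure_pmf Fs)"
      by (intro nn_integral_mono)
    also have "\<dots> = ennreal t + ennreal (1 / real S) + (\<Sum>i<j. grow (Suc i) (\<lambda>S. ennreal (1 / real S)) S)"
      by (simp add: nn_integral_add nn_integral_sum measure_pmf.emeasure_space_1)
    also have "\<dots> = ennreal t + ?r (Suc j) S"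
      by (simp add: sum.lessThan_Suc_shift add.assoc del: grow.simps(2) sum.lessThan_Suc)
    finally show "(\<integral>\<^sup>+k. expect_exp S (\<lambda>e. ennreal (t + e) + ?r j (S + k - 2)) \<partial>measure_pmf Fs) \<le> ennreal t + ?r (Suc j) S" .
  qed (use assms in auto)
  also have "\<dots> \<le> ennreal t + ennreal time_const" using assms by (intro add_left_mono sum_grow_inverse)
  finally show ?thesis using assms time_const_pos by simp
qed

text \<open>The law of the total duration of two explorations of \<open>m\<close> steps with
  independent initial degrees, as a functional; the second clock starts where the first
  stops.\<close>

definition time_law :: "nat \<Rightarrow> (real \<Rightarrow> ennreal) \<Rightarrow> ennreal" where
  "time_law m f = (\<integral>\<^sup>+d0. \<integral>\<^sup>+d1. explore Fs m (\<lambda>_ t _. explore Fs m (\<lambda>_ t _. f t) d1 t 0) d0 0 0 \<partial>measure_pmf F \<partial>measure_pmf F)"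

lemma AE_F: "AE k in measure_pmf F. 2 \<le> k"
  using F_ge2 by (simp add: AE_measure_pmf_iff)

lemma F_integral_mono2:
  assumes "\<And>d0 d1. d0 \<ge> 2 \<Longrightarrow> d1 \<ge> 2 \<Longrightarrow> f d0 d1 \<le> g d0 d1"
  shows "(\<integral>\<^sup>+d0. \<integral>\<^sup>+d1. f d0 d1 \<partial>measure_pmf F \<partial>measure_pmf F) \<le> (\<integral>\<^sup>+d0. \<integral>\<^sup>+d1. g d0 d1 \<partial>measure_pmf F \<partial>measure_pmf F)"
proof (rule nn_integral_mono_AE)
  show "AE d0 in measure_pmf F. (\<integral>\<^sup>+d1. f d0 d1 \<partial>measure_pmf F) \<le> (\<integral>\<^sup>+d1. g d0 d1 \<partial>measure_pmf F)"
    using AE_F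
  proof eventually_elim
    case (elim d0)
    show ?case by (rule nn_integral_mono_AE) (use AE_F in eventually_elim, rule assms, use elim in auto)
  qed
qed

lemma time_law_mono: "(\<And>t. t \<ge> 0 \<Longrightarrow> f t \<le> g t) \<Longrightarrow> time_law m f \<le> time_law m g"
  unfolding time_law_def by (intro F_integral_mono2 explore_mono_pos) auto

lemma time_law_const: "time_law m (\<lambda>_. c) = c"
proof -
  have "time_law m (\<lambda>_. c) = (\<integral>\<^sup>+d0. \<integral>\<^sup>+d1. c \<partial>measure_pmf F \<partial>measure_pmf F)"
    unfolding time_law_def
  proof (rule antisym)
    show "(\<integral>\<^sup>+d0. \<integral>\<^sup>+d1. explore Fs m (\<lambda>_ t _. explore Fs m (\<lambda>_ t _. c) d1 t 0) d0 0 0 \<partial>measure_pmf F \<partial>measure_pmf F)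
        \<le> (\<integral>\<^sup>+d0. \<integral>\<^sup>+d1. c \<partial>measure_pmf F \<partial>measure_pmf F)"
      by (rule F_integral_mono2) (simp add: explore_const)
    show "(\<integral>\<^sup>+d0. \<integral>\<^sup>+d1. c \<partial>measure_pmf F \<partial>measure_pmf F)
        \<le> (\<integral>\<^sup>+d0. \<integral>\<^sup>+d1. explore Fs m (\<lambda>_ t _. explore Fs m (\<lambda>_ t _. c) d1 t 0) d0 0 0 \<partial>measure_pmf F \<partial>measure_pmf F)"
      by (rule F_integral_mono2) (simp add: explore_const)
  qed
  then show ?thesis by (simp add: measure_pmf.emeasure_space_1)
qed

lemma time_law_add:
  assumes [measurable]: "f \<in> borel_measurable borel" "g \<in> borel_measurable borel"
  shows "time_law m (\<lambda>t. f t + g t) = time_law m f + time_law m g"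
proof -
  have m: "(\<lambda>t. explore Fs m (\<lambda>_ t _. f t) d1 t 0) \<in> borel_measurable borel" if "f \<in> borel_measurable borel" for d1 f
    by (rule measurable_explore) (use that in simp)
  show ?thesis unfolding time_law_def
    by (simp add: explore_add m assms nn_integral_add)
qed

text \<open>A further step can only add time, so the value of a decreasing test function decreases
  with the number of steps. This monotonicity yields a limit law without identifying it.\<close>

lemma explore_Suc_le:
  assumes mono: "\<And>t t'. 0 \<le> t \<Longrightarrow> t \<le> t' \<Longrightarrow> f t' \<le> f t"
  shows "S \<ge> 1 \<Longrightarrow> t \<ge> 0 \<Longrightarrow> explore Fs (Suc j) (\<lambda>_ t _. f t) S t a \<le> explore Fs j (\<lambda>_ t _. f t) S t a"
proof (induction j arbitrary: S t a)
  case 0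
  have "explore Fs (Suc 0) (\<lambda>_ t _. f t) S t a \<le> (\<integral>\<^sup>+k. expect_exp S (\<lambda>e. f t) \<partial>measure_pmf Fs)"
    unfolding explore.simps
  proof (rule nn_integral_mono_AE)
    show "AE k in measure_pmf Fs. expect_exp S (\<lambda>e. mix S k (\<lambda>_. f (t + e)) a) \<le> expect_exp S (\<lambda>e. f t)"
      using AE_Fs by eventually_elim (use 0 in \<open>intro expect_exp_mono; simp add: mix_const mono\<close>)
  qed
  then show ?case using 0 by (simp add: expect_exp_const measure_pmf.emeasure_space_1)
next
  case (Suc j)
  have "(\<integral>\<^sup>+k. expect_exp S (\<lambda>e. mix S k (explore Fs (Suc j) (\<lambda>_ t _. f t) (S + k - 2) (t + e)) a) \<partial>measure_pmf Fs)
     \<le> (\<integral>\<^sup>+k. expect_exp S (\<lambda>e. mix S k (explore Fs j (\<lambda>_ t _. f t) (S + k - 2) (t + e)) a) \<partial>measure_pmf Fs)"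
  proof (rule nn_integral_mono_AE)
    show "AE k in measure_pmf Fs. expect_exp S (\<lambda>e. mix S k (explore Fs (Suc j) (\<lambda>_ t _. f t) (S + k - 2) (t + e)) a)
       \<le> expect_exp S (\<lambda>e. mix S k (explore Fs j (\<lambda>_ t _. f t) (S + k - 2) (t + e)) a)"
      using AE_Fs
    proof eventually_elim
      case (elim k)
      show ?case using Suc.prems elim by (intro expect_exp_mono mix_mono Suc.IH) auto
    qed
  qed
  then show ?case by (simp only: explore.simps(2))
qed

lemma explore_antimono_time:
  assumes mono: "\<And>t t'. 0 \<le> t \<Longrightarrow> t \<le> t' \<Longrightarrow> f t' \<le> (f t :: ennreal)"
  shows "0 \<le> t \<Longrightarrow> t \<le> t' \<Longrightarrow> explore Fs j (\<lambda>_ t _. f t) S t' a \<le> explore Fs j (\<lambda>_ t _. f t) S t a"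
proof (induction j arbitrary: S t t' a)
  case (Suc j)
  show ?case unfolding explore.simps
    using Suc.prems by (intro nn_integral_mono expect_exp_mono mix_mono Suc.IH) auto
qed (use mono in simp)

lemma time_law_Suc_le:
  assumes mono: "\<And>t t'. 0 \<le> t \<Longrightarrow> t \<le> t' \<Longrightarrow> f t' \<le> f t"
  shows "time_law (Suc m) f \<le> time_law m f"
  unfolding time_law_def
proof (rule F_integral_mono2)
  fix d0 d1 :: nat assume d: "d0 \<ge> 2" "d1 \<ge> 2"
  have "explore Fs (Suc m) (\<lambda>_ t _. explore Fs (Suc m) (\<lambda>_ t _. f t) d1 t 0) d0 0 0
     \<le> explore Fs (Suc m) (\<lambda>_ t _. explore Fs m (\<lambda>_ t _. f t) d1 t 0) d0 0 0"
    using d by (intro explore_mono_pos explore_Suc_le[OF mono]) auto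
  also have "\<dots> \<le> explore Fs m (\<lambda>_ t _. explore Fs m (\<lambda>_ t _. f t) d1 t 0) d0 0 0"
    using d by (intro explore_Suc_le[where f="\<lambda>t. explore Fs m (\<lambda>_ t _. f t) d1 t 0"] explore_antimono_time[OF mono]) auto
  finally show "explore Fs (Suc m) (\<lambda>_ t _. explore Fs (Suc m) (\<lambda>_ t _. f t) d1 t 0) d0 0 0
     \<le> explore Fs m (\<lambda>_ t _. explore Fs m (\<lambda>_ t _. f t) d1 t 0) d0 0 0" .
qed

text \<open>The bound is uniform in \<open>m\<close>; by Markov's inequality no mass escapes to
  infinity.\<close>

lemma time_law_mean: "time_law m ennreal \<le> ennreal (2 * time_const)"
proof -
  have "time_law m ennreal \<le> (\<integral>\<^sup>+d0. \<integral>\<^sup>+d1. ennreal (2 * time_const) \<partial>measure_pmf F \<partial>measure_pmf F)"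
    unfolding time_law_def
  proof (rule F_integral_mono2)
    fix d0 d1 :: nat assume d: "d0 \<ge> 2" "d1 \<ge> 2"
    have "explore Fs m (\<lambda>_ t _. explore Fs m (\<lambda>_ t _. ennreal t) d1 t 0) d0 0 0
       \<le> explore Fs m (\<lambda>_ t _. ennreal t + ennreal time_const) d0 0 0"
    proof (rule explore_mono_pos)
      fix t :: real assume "t \<ge> 0"
      then show "explore Fs m (\<lambda>_ t _. ennreal t) d1 t 0 \<le> ennreal t + ennreal time_const"
        using explore_time[of d1 t m 0] d time_const_pos by simp
    qed (use d in auto)
    also have "\<dots> = explore Fs m (\<lambda>_ t _. ennreal t) d0 0 0 + explore Fs m (\<lambda>_ t _. ennreal time_const) d0 0 0"
      by (rule explore_add) auto
    also have "\<dots> \<le> ennreal (0 + time_const) + ennreal time_const"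
      using d by (intro add_mono explore_time explore_const_le) auto
    also have "\<dots> = ennreal (2 * time_const)" using time_const_pos by (simp flip: ennreal_plus)
    finally show "explore Fs m (\<lambda>_ t _. explore Fs m (\<lambda>_ t _. ennreal t) d1 t 0) d0 0 0 \<le> ennreal (2 * time_const)" .
  qed
  then show ?thesis by (simp add: measure_pmf.emeasure_space_1)
qed

definition time_cdf :: "nat \<Rightarrow> real \<Rightarrow> real" where
  "time_cdf m x = enn2real (time_law m (indicator {..x}))"

lemma time_law_le_1: "time_law m (indicator X) \<le> 1"
  using time_law_mono[of "indicator X" "\<lambda>_. 1" m] time_law_const[of m 1] by (simp add: indicator_def)

lemma time_cdf_ennreal: "time_law m (indicator {..x}) = ennreal (time_cdf m x)"
  unfolding time_cdf_def using time_law_le_1[of m "{..x}"]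
  by (intro ennreal_enn2real[symmetric]) (auto intro: order_le_less_trans)

lemma time_cdf_compl: "time_law m (indicator {x<..}) = ennreal (1 - time_cdf m x)"
proof -
  have "(\<lambda>t. indicator {..x} t + indicator {x<..} t) = (\<lambda>_. 1 :: ennreal)"
    by (rule ext) (auto simp: indicator_def)
  then have "time_law m (indicator {..x}) + time_law m (indicator {x<..}) = 1"
    using time_law_add[of "indicator {..x}" "indicator {x<..}" m] time_law_const[of m 1] by simp
  then have sum: "ennreal (time_cdf m x) + time_law m (indicator {x<..}) = 1"
    by (simp add: time_cdf_ennreal)
  obtain r where r: "r \<ge> 0" "time_law m (indicator {x<..}) = ennreal r"
    using time_law_le_1[of m "{x<..}"] by (cases "time_law m (indicator {x<..})") (auto simp: top_unique)
  have "time_cdf m x \<ge> 0" by (simp add: time_cdf_def)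
  then have "ennreal (time_cdf m x + r) = 1" using sum r by simp
  then have "time_cdf m x + r = 1" by simp
  then show ?thesis using r by (metis add_diff_cancel_left')
qed

lemma time_cdf_bounds: "0 \<le> time_cdf m x" "time_cdf m x \<le> 1"
  using enn2real_mono[OF time_law_le_1[of m "{..x}"]] by (auto simp: time_cdf_def)

lemma time_cdf_mono: "x \<le> y \<Longrightarrow> time_cdf m x \<le> time_cdf m y"
  unfolding time_cdf_def
  by (intro enn2real_mono time_law_mono order_le_less_trans[OF time_law_le_1]) (auto simp: indicator_def)

lemma time_cdf_antimono: "time_cdf (Suc m) x \<le> time_cdf m x"
  unfolding time_cdf_def
  by (intro enn2real_mono time_law_Suc_le order_le_less_trans[OF time_law_le_1]) (auto simp: indicator_def)

lemma time_cdf_neg: "x < 0 \<Longrightarrow> time_cdf m x = 0"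
  using time_law_mono[of "indicator {..x}" "\<lambda>_. 0" m] time_law_const[of m 0] by (simp add: time_cdf_def indicator_def)

lemma time_cdf_ge: "x > 0 \<Longrightarrow> 1 - 2 * time_const / x \<le> time_cdf m x"
proof -
  assume x: "x > 0"
  have "ennreal x * time_law m (indicator {x<..}) \<le> time_law m ennreal"
  proof -
    have "ennreal x * time_law m (indicator {x<..}) = time_law m (\<lambda>t. ennreal x * indicator {x<..} t)"
    proof -
      have "(\<lambda>t. explore Fs m (\<lambda>_ t _. indicator {x<..} t) d1 t 0) \<in> borel_measurable borel" for d1
        by (rule measurable_explore) simp
      then show ?thesis unfolding time_law_def
        by (simp add: explore_cmult nn_integral_cmult)
    qed
    also have "\<dots> \<le> time_law m ennreal"
      using x by (intro time_law_mono) (auto simp: indicator_def ennreal_leI)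
    finally show ?thesis .
  qed
  also have "\<dots> \<le> ennreal (2 * time_const)" by (rule time_law_mean)
  finally have "x * (1 - time_cdf m x) \<le> 2 * time_const"
    using x time_cdf_bounds[of m x] time_const_pos
    by (simp add: time_cdf_compl ennreal_mult[symmetric] ennreal_le_iff)
  then have "1 - time_cdf m x \<le> 2 * time_const / x" using x by (simp add: field_simps)
  then show ?thesis by simp
qed

text \<open>The decreasing distribution functions converge pointwise to some \<open>G\<close>. Its
  right limits \<open>H\<close> are right-continuous by construction and define the law
  \<open>V\<close>; the inequalities between \<open>G\<close> and \<open>H\<close> are enough for
  convergence at continuity points of \<open>H\<close>.\<close>

lemma time_limit:
  obtains V G where "real_distribution V" "\<And>x. (\<lambda>m. time_cdf m x) \<longlonglongrightarrow> G x"
    "\<And>x. G x \<le> cdf V x" "\<And>x y. x < y \<Longrightarrow> cdf V x \<le> G y"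
proof -
  define G where "G = (\<lambda>x. lim (\<lambda>m. time_cdf m x))"
  have lim: "(\<lambda>m. time_cdf m x) \<longlonglongrightarrow> G x" for x
  proof -
    have "decseq (\<lambda>m. time_cdf m x)" by (intro decseq_SucI time_cdf_antimono)
    then have "convergent (\<lambda>m. time_cdf m x)"
      using decseq_convergent[of "\<lambda>m. time_cdf m x" 0] time_cdf_bounds by (metis convergentI)
    then show ?thesis by (simp add: G_def convergent_LIMSEQ_iff)
  qed
  have Gmono: "G x \<le> G y" if "x \<le> y" for x y
    using that by (intro LIMSEQ_le[OF lim lim]) (auto intro: time_cdf_mono)
  have G01: "0 \<le> G x" "G x \<le> 1" for x
    by (rule LIMSEQ_le_const[OF lim], use time_cdf_bounds in blast)
       (rule LIMSEQ_le_const2[OF lim], use time_cdf_bounds in blast)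
  have Gneg: "G x = 0" if "x < 0" for x
    using lim[of x] time_cdf_neg[OF that] by (simp add: LIMSEQ_const_iff)
  have Gge: "1 - 2 * time_const / x \<le> G x" if "x > 0" for x
    by (rule LIMSEQ_le_const[OF lim]) (use time_cdf_ge[OF that] in blast)
  define H where "H = (\<lambda>x. Inf (G ` {x<..}))"
  have bdd: "bdd_below (G ` X)" for X using G01 by (auto simp: bdd_below_def)
  have ne: "G ` {x<..} \<noteq> {}" for x using gt_ex[of x] by auto
  have HG: "H x \<le> G y" if "x < y" for x y
    unfolding H_def using that by (intro cInf_lower bdd) auto
  have GH: "G x \<le> H x" for x
    unfolding H_def using Gmono by (intro cInf_greatest ne) auto
  have Hmono: "H x \<le> H y" if "x \<le> y" for x y
    unfolding H_def using that by (intro cInf_superset_mono ne bdd) auto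
  have rc: "continuous (at_right a) H" for a
    unfolding continuous_within
  proof (rule order_tendstoI)
    fix l assume "l < H a"
    then show "eventually (\<lambda>x. l < H x) (at_right a)"
      using Hmono by (auto intro!: eventually_at_rightI[of a "a + 1"] order_less_le_trans[of l "H a"])
  next
    fix u assume "H a < u"
    then obtain y where y: "a < y" "G y < u"
      unfolding H_def using cInf_lessD[OF ne] by fastforce
    then show "eventually (\<lambda>x. H x < u) (at_right a)"
      using HG by (auto intro!: eventually_at_rightI[of a y] order_le_less_trans[of _ "G y" u])
  qed
  have bot: "(H \<longlongrightarrow> 0) at_bot"
  proof (rule tendsto_eventually)
    have "H x = 0" if "x < -1" for x
      using HG[of x "x / 2"] GH[of x] G01[of x] Gneg[of "x / 2"] that by simp
    then show "eventually (\<lambda>x. H x = 0) at_bot"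
      unfolding eventually_at_bot_dense by blast
  qed
  have top: "(H \<longlongrightarrow> 1) at_top"
  proof (rule tendsto_sandwich)
    show "eventually (\<lambda>x. 1 - 2 * time_const / x \<le> H x) at_top"
      using eventually_gt_at_top[of 0] by eventually_elim (rule order_trans[OF Gge GH])
    show "eventually (\<lambda>x. H x \<le> 1) at_top"
      using HG G01 by (intro always_eventually allI) (meson gt_ex order_trans)
    show "((\<lambda>x. 1 - 2 * time_const / x) \<longlongrightarrow> 1) at_top" by real_asymp
  qed simp
  have V: "real_distribution (interval_measure H)"
    by (intro real_distribution_interval_measure Hmono rc bot top)
  have cdfV: "cdf (interval_measure H) = H"
    by (intro cdf_interval_measure Hmono rc bot)
  show ?thesis using V lim GH HG by (intro that[of "interval_measure H" G]) (auto simp: cdfV)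
qed

end

subsection \<open>Exchangeability and records\<close>

lemma nn_integral_pmf_swap:
  "(\<integral>\<^sup>+x. \<integral>\<^sup>+y. f x y \<partial>measure_pmf q \<partial>measure_pmf p) = (\<integral>\<^sup>+y. \<integral>\<^sup>+x. f x y \<partial>measure_pmf p \<partial>measure_pmf q)"
proof -
  have "(\<integral>\<^sup>+x. \<integral>\<^sup>+y. f x y \<partial>measure_pmf q \<partial>measure_pmf p)
      = (\<integral>\<^sup>+z. (\<lambda>(x, y). f x y) z \<partial>measure_pmf (p \<bind> (\<lambda>x. q \<bind> (\<lambda>y. return_pmf (x, y)))))" by simp
  also have "\<dots> = (\<integral>\<^sup>+z. (\<lambda>(x, y). f x y) z \<partial>measure_pmf (q \<bind> (\<lambda>y. p \<bind> (\<lambda>x. return_pmf (x, y)))))"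
    by (subst bind_commute_pmf) simp
  finally show ?thesis by simp
qed

primrec sum_law :: "nat pmf \<Rightarrow> nat \<Rightarrow> nat pmf" where
  "sum_law X 0 = return_pmf 0"
| "sum_law X (Suc m) = sum_law X m \<bind> (\<lambda>s. X \<bind> (\<lambda>x. return_pmf (s + x)))"

text \<open>Given the sum of \<open>m + 1\<close> i.i.d. variables, all summands have the same
  conditional mean, so the first \<open>m\<close> together are worth \<open>m\<close> times the last
  one.\<close>

lemma sum_law_exchange:
  "(\<integral>\<^sup>+s. \<integral>\<^sup>+x. of_nat s * g (s + x) \<partial>measure_pmf X \<partial>measure_pmf (sum_law X m))
     = of_nat m * (\<integral>\<^sup>+s. \<integral>\<^sup>+x. of_nat x * g (s + x) \<partial>measure_pmf X \<partial>measure_pmf (sum_law X m))"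
proof (induction m arbitrary: g)
  case (Suc m)
  let ?s = "sum_law X m"
  have "(\<integral>\<^sup>+s. \<integral>\<^sup>+x. of_nat s * g (s + x) \<partial>measure_pmf X \<partial>measure_pmf (sum_law X (Suc m)))
     = (\<integral>\<^sup>+s. \<integral>\<^sup>+x'. \<integral>\<^sup>+x. of_nat (s + x') * g (s + x' + x) \<partial>measure_pmf X \<partial>measure_pmf X \<partial>measure_pmf ?s)" by simp
  also have "\<dots> = (\<integral>\<^sup>+s. \<integral>\<^sup>+x'. \<integral>\<^sup>+x. of_nat s * g (s + x + x') \<partial>measure_pmf X \<partial>measure_pmf X \<partial>measure_pmf ?s)
     + (\<integral>\<^sup>+s. \<integral>\<^sup>+x'. \<integral>\<^sup>+x. of_nat x' * g (s + x' + x) \<partial>measure_pmf X \<partial>measure_pmf X \<partial>measure_pmf ?s)"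
    by (simp add: distrib_right nn_integral_add add_ac)
  also have "(\<integral>\<^sup>+s. \<integral>\<^sup>+x'. \<integral>\<^sup>+x. of_nat s * g (s + x + x') \<partial>measure_pmf X \<partial>measure_pmf X \<partial>measure_pmf ?s)
     = (\<integral>\<^sup>+x'. \<integral>\<^sup>+s. \<integral>\<^sup>+x. of_nat s * g (s + x + x') \<partial>measure_pmf X \<partial>measure_pmf ?s \<partial>measure_pmf X)"
    by (rule nn_integral_pmf_swap)
  also have "\<dots> = (\<integral>\<^sup>+x'. of_nat m * (\<integral>\<^sup>+s. \<integral>\<^sup>+x. of_nat x * g (s + x + x') \<partial>measure_pmf X \<partial>measure_pmf ?s) \<partial>measure_pmf X)"
  proof (rule nn_integral_cong)
    fix x' show "(\<integral>\<^sup>+s. \<integral>\<^sup>+x. of_nat s * g (s + x + x') \<partial>measure_pmf X \<partial>measure_pmf ?s)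
        = of_nat m * (\<integral>\<^sup>+s. \<integral>\<^sup>+x. of_nat x * g (s + x + x') \<partial>measure_pmf X \<partial>measure_pmf ?s)"
      using Suc.IH[of "\<lambda>u. g (u + x')"] .
  qed
  also have "\<dots> = of_nat m * (\<integral>\<^sup>+x'. \<integral>\<^sup>+s. \<integral>\<^sup>+x. of_nat x * g (s + x + x') \<partial>measure_pmf X \<partial>measure_pmf ?s \<partial>measure_pmf X)"
    by (simp add: nn_integral_cmult)
  also have "(\<integral>\<^sup>+x'. \<integral>\<^sup>+s. \<integral>\<^sup>+x. of_nat x * g (s + x + x') \<partial>measure_pmf X \<partial>measure_pmf ?s \<partial>measure_pmf X)
     = (\<integral>\<^sup>+s. \<integral>\<^sup>+x'. \<integral>\<^sup>+x. of_nat x * g (s + x + x') \<partial>measure_pmf X \<partial>measure_pmf X \<partial>measure_pmf ?s)"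
    by (rule nn_integral_pmf_swap)
  also have "\<dots> = (\<integral>\<^sup>+s. \<integral>\<^sup>+x'. \<integral>\<^sup>+x. of_nat x * g (s + x' + x) \<partial>measure_pmf X \<partial>measure_pmf X \<partial>measure_pmf ?s)"
    by (simp add: add_ac)
  also have "(\<integral>\<^sup>+s. \<integral>\<^sup>+x'. \<integral>\<^sup>+x. of_nat x' * g (s + x' + x) \<partial>measure_pmf X \<partial>measure_pmf X \<partial>measure_pmf ?s)
     = (\<integral>\<^sup>+s. \<integral>\<^sup>+x'. \<integral>\<^sup>+x. of_nat x * g (s + x' + x) \<partial>measure_pmf X \<partial>measure_pmf X \<partial>measure_pmf ?s)"
    by (subst (2) nn_integral_pmf_swap) (simp add: add_ac)
  finally show ?case by (simp add: distrib_right add.commute)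
qed simp

text \<open>The proportion of the last summand in the total. The value for a vanishing total is what
  the mean share would be, so that \<open>share_exchange\<close> holds there too.\<close>

definition share :: "nat \<Rightarrow> nat \<Rightarrow> nat \<Rightarrow> real" where
  "share m s x = (if s + x = 0 then 1 / real (Suc m) else real x / real (s + x))"

lemma share_bounds: "0 \<le> share m s x" "share m s x \<le> 1"
  by (auto simp: share_def)

text \<open>Given the total, the mean share of the last of \<open>m + 1\<close> summands is
  \<open>1 / (m + 1)\<close>. An indicator whose success probability is this share is therefore
  independent of the total; iterating this gives independent indicators.\<close>

lemma share_exchange:
  shows "(\<integral>\<^sup>+s. \<integral>\<^sup>+x. ennreal (share m s x) * f (s + x) \<partial>measure_pmf X \<partial>measure_pmf (sum_law X m))
      = ennreal (1 / real (Suc m)) * (\<integral>\<^sup>+u. f u \<partial>measure_pmf (sum_law X (Suc m)))" (is ?A)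
    and "(\<integral>\<^sup>+s. \<integral>\<^sup>+x. ennreal (1 - share m s x) * f (s + x) \<partial>measure_pmf X \<partial>measure_pmf (sum_law X m))
      = ennreal (1 - 1 / real (Suc m)) * (\<integral>\<^sup>+u. f u \<partial>measure_pmf (sum_law X (Suc m)))" (is ?B)
proof -
  let ?P = "\<lambda>h. \<integral>\<^sup>+s. \<integral>\<^sup>+x. h s x \<partial>measure_pmf X \<partial>measure_pmf (sum_law X m)"
  define g where "g = (\<lambda>u::nat. if u = 0 then 0 else ennreal (1 / real u) * f u)"
  define f0 where "f0 = (\<lambda>u::nat. if u = 0 then f 0 else 0)"
  define a where "a = ?P (\<lambda>s x. of_nat x * g (s + x))"
  have add: "?P (\<lambda>s x. h s x + h' s x) = ?P h + ?P h'" for h h' by (simp add: nn_integral_add)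
  have cm: "?P (\<lambda>s x. c * h s x) = c * ?P h" for c h by (simp add: nn_integral_cmult)
  have g: "of_nat u * g u = (if u = 0 then 0 else f u)" for u
    by (auto simp: g_def mult.assoc[symmetric] ennreal_of_nat_eq_real_of_nat ennreal_mult[symmetric])
  have sp: "ennreal (real i / real u) * f u = of_nat i * g u" if "u \<noteq> 0" for i u
  proof -
    have "ennreal (real i / real u) = of_nat i * ennreal (1 / real u)"
      by (simp add: ennreal_of_nat_eq_real_of_nat ennreal_mult[symmetric])
    then show ?thesis using that by (simp add: g_def mult.assoc)
  qed
  have tot: "?P (\<lambda>s x. f (s + x)) = of_nat (Suc m) * a + ?P (\<lambda>s x. f0 (s + x))"
  proof -
    have "f (s + x) = of_nat s * g (s + x) + of_nat x * g (s + x) + f0 (s + x)" for s x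
      using g[of "s + x"] by (cases "s + x = 0") (auto simp: f0_def distrib_right[symmetric])
    then have "?P (\<lambda>s x. f (s + x)) = ?P (\<lambda>s x. of_nat s * g (s + x)) + a + ?P (\<lambda>s x. f0 (s + x))"
      by (simp add: nn_integral_add a_def)
    also have "?P (\<lambda>s x. of_nat s * g (s + x)) = of_nat m * a" unfolding a_def by (rule sum_law_exchange)
    finally show ?thesis by (simp add: distrib_right add_ac)
  qed
  have e1: "ennreal (1 / real (Suc m)) * of_nat (Suc m) = 1"
    by (simp add: ennreal_of_nat_eq_real_of_nat ennreal_mult[symmetric] del: of_nat_Suc)
  have e2: "ennreal (1 - 1 / real (Suc m)) * of_nat (Suc m) = of_nat m"
  proof -
    have r: "(1 - 1 / real (Suc m)) * real (Suc m) = real m" by (simp add: left_diff_distrib)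
    have "ennreal (1 - 1 / real (Suc m)) * ennreal (real (Suc m)) = ennreal ((1 - 1 / real (Suc m)) * real (Suc m))"
      by (rule ennreal_mult[symmetric]) auto
    then show ?thesis unfolding r by (simp only: ennreal_of_nat_eq_real_of_nat)
  qed
  have "ennreal (share m s x) * f (s + x) = of_nat x * g (s + x) + ennreal (1 / real (Suc m)) * f0 (s + x)" for s x
    using sp[of "s + x" x] by (cases "s + x = 0") (auto simp: share_def f0_def g_def)
  then have "?P (\<lambda>s x. ennreal (share m s x) * f (s + x)) = a + ennreal (1 / real (Suc m)) * ?P (\<lambda>s x. f0 (s + x))"
    by (simp only: add cm a_def)
  also have "\<dots> = ennreal (1 / real (Suc m)) * ?P (\<lambda>s x. f (s + x))"
    unfolding tot distrib_left mult.assoc[symmetric] e1 by simp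
  finally show ?A by simp
  have "ennreal (1 - share m s x) * f (s + x) = of_nat s * g (s + x) + ennreal (1 - 1 / real (Suc m)) * f0 (s + x)" for s x
  proof (cases "s + x = 0")
    case False
    have "real (s + x) \<noteq> 0" using False by (simp only: of_nat_eq_0_iff not_False_eq_True)
    then have "1 - real x / real (s + x) = (real (s + x) - real x) / real (s + x)"
      by (simp add: diff_divide_distrib del: of_nat_add)
    then have "1 - share m s x = real s / real (s + x)" using False by (auto simp: share_def)
    then show ?thesis using sp[OF False, of s] False by (auto simp: f0_def)
  qed (auto simp: share_def f0_def g_def)
  then have "?P (\<lambda>s x. ennreal (1 - share m s x) * f (s + x)) = of_nat m * a + ennreal (1 - 1 / real (Suc m)) * ?P (\<lambda>s x. f0 (s + x))"
    by (simp only: add cm a_def sum_law_exchange)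
  also have "\<dots> = ennreal (1 - 1 / real (Suc m)) * ?P (\<lambda>s x. f (s + x))"
    unfolding tot distrib_left mult.assoc[symmetric] e2 by simp
  finally show ?B by simp
qed

text \<open>The law of the number of records of a uniform random permutation of \<open>m\<close>
  elements: a sum of independent indicators with probabilities
  \<open>1, 1/2, ..., 1/m\<close>.\<close>

primrec records :: "nat \<Rightarrow> nat pmf" where
  "records 0 = return_pmf 0"
| "records (Suc m) = records m \<bind> (\<lambda>r. bernoulli_pmf (1 / real (Suc m)) \<bind> (\<lambda>b. return_pmf (r + of_bool b)))"

text \<open>The maximal coupling of two Bernoulli variables: the one with the smaller parameter is a
  thinning of the other, so they differ with probability \<open>\<bar>p - q\<bar>\<close>.\<close>

definition couple :: "real \<Rightarrow> real \<Rightarrow> (bool \<times> bool) pmf" where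
  "couple p q = (if q \<le> p then bernoulli_pmf p \<bind> (\<lambda>b. bernoulli_pmf (q / p) \<bind> (\<lambda>c. return_pmf (b, b \<and> c)))
     else bernoulli_pmf q \<bind> (\<lambda>b. bernoulli_pmf (p / q) \<bind> (\<lambda>c. return_pmf (b \<and> c, b))))"

lemma couple_marginals:
  assumes "0 \<le> p" "p \<le> 1" "0 \<le> q" "q \<le> 1"
  shows "(\<integral>\<^sup>+z. f (fst z) \<partial>measure_pmf (couple p q)) = ennreal p * f True + ennreal (1 - p) * f False" (is ?A)
    "(\<integral>\<^sup>+z. f (snd z) \<partial>measure_pmf (couple p q)) = ennreal q * f True + ennreal (1 - q) * f False" (is ?B)
    "(\<integral>\<^sup>+z. of_bool (fst z \<noteq> snd z) \<partial>measure_pmf (couple p q)) = ennreal \<bar>p - q\<bar>" (is ?C)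
proof -
  have half: "(\<integral>\<^sup>+b. \<integral>\<^sup>+c. h b (b \<and> c) \<partial>measure_pmf (bernoulli_pmf (v / u)) \<partial>measure_pmf (bernoulli_pmf u))
      = ennreal v * h True True + ennreal (u - v) * h True False + ennreal (1 - u) * h False False"
    if "0 \<le> v" "v \<le> u" "u \<le> 1" for u v and h :: "bool \<Rightarrow> bool \<Rightarrow> ennreal"
  proof (cases "u = 0")
    case True
    then show ?thesis using that by simp
  next
    case False
    then have u: "u > 0" using that by simp
    have "v / u \<le> 1" "0 \<le> v / u" using that u by auto
    then have "(\<integral>\<^sup>+b. \<integral>\<^sup>+c. h b (b \<and> c) \<partial>measure_pmf (bernoulli_pmf (v / u)) \<partial>measure_pmf (bernoulli_pmf u))
      = (h True True * ennreal (v / u) + h True False * ennreal (1 - v / u)) * ennreal u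
        + (h False False * ennreal (v / u) + h False False * ennreal (1 - v / u)) * ennreal (1 - u)"
      using that u by simp
    also have "(h True True * ennreal (v / u) + h True False * ennreal (1 - v / u)) * ennreal u = ennreal v * h True True + ennreal (u - v) * h True False"
    proof -
      have "ennreal (v / u) * ennreal u = ennreal v" "ennreal (1 - v / u) * ennreal u = ennreal (u - v)"
        using that u \<open>v / u \<le> 1\<close> by (simp_all add: ennreal_mult[symmetric] left_diff_distrib)
      then show ?thesis by (simp only: distrib_right mult.assoc) (simp only: mult.commute)
    qed
    also have "h False False * ennreal (v / u) + h False False * ennreal (1 - v / u) = h False False"
      using that u \<open>v / u \<le> 1\<close> by (simp add: distrib_left[symmetric] flip: ennreal_plus)
    finally show ?thesis by (simp add: mult.commute)
  qed
  have sp: "ennreal v + ennreal (u - v) = ennreal u" "ennreal (u - v) + ennreal (1 - u) = ennreal (1 - v)"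
    if "0 \<le> v" "v \<le> u" "u \<le> 1" for u v using that by (auto simp flip: ennreal_plus)
  show ?A
  proof (cases "q \<le> p")
    case True
    then show ?thesis using half[of q p "\<lambda>a b. f a"] sp[of q p] assms
      by (simp add: couple_def distrib_right[symmetric])
  next
    case False
    then show ?thesis using half[of p q "\<lambda>a b. f b"] sp[of p q] assms
      by (simp add: couple_def distrib_right[symmetric] add.assoc)
  qed
  show ?B
  proof (cases "q \<le> p")
    case True
    then show ?thesis using half[of q p "\<lambda>a b. f b"] sp[of q p] assms
      by (simp add: couple_def distrib_right[symmetric] add.assoc)
  next
    case False
    then show ?thesis using half[of p q "\<lambda>a b. f a"] sp[of p q] assms
      by (simp add: couple_def distrib_right[symmetric])
  qed
  show ?C
    using half[of q p "\<lambda>a b. of_bool (a \<noteq> b)"] half[of p q "\<lambda>a b. of_bool (b \<noteq> a)"] assms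
    by (cases "q \<le> p") (auto simp: couple_def)
qed

definition two_records :: "nat \<Rightarrow> nat pmf" where
  "two_records m = records m \<bind> (\<lambda>r. records m \<bind> (\<lambda>r'. return_pmf (r + r')))"

section \<open>Coupling of the labels with records\<close>

context heavy_tail
begin

definition X :: "nat pmf" where "X = map_pmf (\<lambda>k. k - 2) Fs"

text \<open>The probability in \<open>mix\<close> that a uniform stub is new, in terms of the
  increment \<open>x = k - 2\<close>. Apart from the one in the numerator and the initial size in
  the denominator it is a share.\<close>

definition pick_prob :: "nat \<Rightarrow> nat \<Rightarrow> real" where
  "pick_prob S x = (real x + 1) / (real S + real x)"

text \<open>The labels of the exploration started with \<open>S0\<close> active stubs (first component), coupled with the number
  of records (second component); the third component is the increase of the number of active stubs.\<close>

primrec joint :: "nat \<Rightarrow> nat \<Rightarrow> (nat \<times> nat \<times> nat) pmf" where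
  "joint S0 0 = return_pmf (0, 0, 0)"
| "joint S0 (Suc m) = joint S0 m \<bind> (\<lambda>(a, r, s). X \<bind> (\<lambda>x. couple (pick_prob (S0 + s) x) (share m s x) \<bind> (\<lambda>(b, c).
      return_pmf (a + of_bool b, r + of_bool c, s + x))))"

lemma pick_prob_bounds: "S \<ge> 1 \<Longrightarrow> 0 \<le> pick_prob S x" "S \<ge> 1 \<Longrightarrow> pick_prob S x \<le> 1"
  by (auto simp: pick_prob_def)

text \<open>\<open>explore\<close> peels off the first step and \<open>joint\<close> appends the
  last one; this reconciles the two recursions.\<close>

lemma explore_last: "explore Fs (Suc j) \<Gamma> = explore Fs j (explore Fs (Suc 0) \<Gamma>)"
proof (induction j)
  case (Suc j)
  show ?case unfolding explore.simps(2)[of Fs "Suc j"] Suc.IH by simp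
qed simp

lemma explore_cong_pos:
  assumes "\<And>S t a. S \<ge> 1 \<Longrightarrow> t \<ge> 0 \<Longrightarrow> \<Gamma> S t a = \<Gamma>' S t a" "S \<ge> 1" "t \<ge> 0"
  shows "explore Fs j \<Gamma> S t a = explore Fs j \<Gamma>' S t a"
  using assms by (intro antisym explore_mono_pos) auto

lemma explore_joint:
  assumes S0: "S0 \<ge> 1" and t: "t \<ge> 0"
  shows "explore Fs m (\<lambda>S _ a. g S a) S0 t 0 = (\<integral>\<^sup>+z. g (S0 + snd (snd z)) (fst z) \<partial>measure_pmf (joint S0 m))"
proof (induction m arbitrary: g)
  case (Suc m)
  define g' where "g' = (\<lambda>S a. \<integral>\<^sup>+x. ennreal (1 - pick_prob S x) * g (S + x) a + ennreal (pick_prob S x) * g (S + x) (a + 1) \<partial>measure_pmf X)"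
  have g': "explore Fs (Suc 0) (\<lambda>S _ a. g S a) S t a = g' S a" if "S \<ge> 1" for S t a
  proof -
    have "g' S a = (\<integral>\<^sup>+k. mix S k (g (S + k - 2)) a \<partial>measure_pmf Fs)"
      unfolding g'_def X_def nn_integral_map_pmf
    proof (rule nn_integral_cong_AE)
      show "AE k in measure_pmf Fs. ennreal (1 - pick_prob S (k - 2)) * g (S + (k - 2)) a + ennreal (pick_prob S (k - 2)) * g (S + (k - 2)) (a + 1) = mix S k (g (S + k - 2)) a"
        using AE_Fs
      proof eventually_elim
        case (elim k)
        then have "pick_prob S (k - 2) = (real k - 1) / (real S + real k - 2)"
          by (simp add: pick_prob_def of_nat_diff)
        moreover have "S + (k - 2) = S + k - 2" using elim by simp
        ultimately show ?case by (simp add: mix_def)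
      qed
    qed
    then show ?thesis using that by (simp add: expect_exp_const)
  qed
  have "explore Fs (Suc m) (\<lambda>S _ a. g S a) S0 t 0 = explore Fs m (\<lambda>S _ a. g' S a) S0 t 0"
  proof (subst explore_last, rule explore_cong_pos)
    fix S t a assume "(1::nat) \<le> S"
    then show "explore Fs (Suc 0) (\<lambda>S _ a. g S a) S t a = g' S a" by (rule g')
  qed (use S0 t in auto)
  also have "\<dots> = (\<integral>\<^sup>+z. g' (S0 + snd (snd z)) (fst z) \<partial>measure_pmf (joint S0 m))" by (rule Suc.IH)
  also have "\<dots> = (\<integral>\<^sup>+z. g (S0 + snd (snd z)) (fst z) \<partial>measure_pmf (joint S0 (Suc m)))"
  proof -
    have "(\<integral>\<^sup>+w. g (S0 + (s + x)) (a + of_bool (fst w)) \<partial>measure_pmf (couple (pick_prob (S0 + s) x) (share m s x)))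
       = ennreal (1 - pick_prob (S0 + s) x) * g (S0 + s + x) a + ennreal (pick_prob (S0 + s) x) * g (S0 + s + x) (a + 1)" for s x a
      using couple_marginals(1)[of "pick_prob (S0 + s) x" "share m s x" "\<lambda>b. g (S0 + (s + x)) (a + of_bool b)"]
        pick_prob_bounds[of "S0 + s" x] share_bounds[of m s x] S0 by (simp add: add_ac)
    then show ?thesis by (simp add: g'_def split_beta)
  qed
  finally show ?case .
qed simp

text \<open>The number of records is independent of the current size. The product form is what makes
  the induction work: by \<open>share_exchange\<close> the next indicator is independent of the next
  total.\<close>

lemma joint_records:
  assumes S0: "S0 \<ge> 1"
  shows "(\<integral>\<^sup>+z. f (fst (snd z)) (snd (snd z)) \<partial>measure_pmf (joint S0 m))
     = (\<integral>\<^sup>+r. \<integral>\<^sup>+s. f r s \<partial>measure_pmf (sum_law X m) \<partial>measure_pmf (records m))"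
proof (induction m arbitrary: f)
  case (Suc m)
  let ?q = "share m"
  let ?f' = "\<lambda>r s. \<integral>\<^sup>+x. ennreal (?q s x) * f (r + 1) (s + x) + ennreal (1 - ?q s x) * f r (s + x) \<partial>measure_pmf X"
  have "(\<integral>\<^sup>+w. f (r + of_bool (snd w)) (s + x) \<partial>measure_pmf (couple (pick_prob (S0 + s) x) (?q s x)))
       = ennreal (?q s x) * f (r + 1) (s + x) + ennreal (1 - ?q s x) * f r (s + x)" for s x r
    using couple_marginals(2)[of "pick_prob (S0 + s) x" "?q s x" "\<lambda>b. f (r + of_bool b) (s + x)"]
      pick_prob_bounds[of "S0 + s" x] share_bounds[of m s x] S0 by simp
  then have "(\<integral>\<^sup>+z. f (fst (snd z)) (snd (snd z)) \<partial>measure_pmf (joint S0 (Suc m))) = (\<integral>\<^sup>+z. ?f' (fst (snd z)) (snd (snd z)) \<partial>measure_pmf (joint S0 m))"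
    by (simp add: split_beta)
  also have "\<dots> = (\<integral>\<^sup>+r. \<integral>\<^sup>+s. ?f' r s \<partial>measure_pmf (sum_law X m) \<partial>measure_pmf (records m))" by (rule Suc.IH)
  also have "\<dots> = (\<integral>\<^sup>+r. ennreal (1 / real (Suc m)) * (\<integral>\<^sup>+u. f (r + 1) u \<partial>measure_pmf (sum_law X (Suc m)))
      + ennreal (1 - 1 / real (Suc m)) * (\<integral>\<^sup>+u. f r u \<partial>measure_pmf (sum_law X (Suc m))) \<partial>measure_pmf (records m))"
    unfolding share_exchange[symmetric] by (simp add: nn_integral_add)
  also have "\<dots> = (\<integral>\<^sup>+r. \<integral>\<^sup>+s. f r s \<partial>measure_pmf (sum_law X (Suc m)) \<partial>measure_pmf (records (Suc m)))"
    by (simp add: mult.commute del: sum_law.simps of_nat_Suc)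
  finally show ?case .
qed simp

text \<open>The two success probabilities differ by \<open>(1 - S0 * x / T) / (S0 + T)\<close> with
  \<open>T = s + x\<close>, hence by at most \<open>1 + S0\<close> over the current size. The means
  of the inverse sizes are summable, so label and record count stay at bounded mean
  distance.\<close>

lemma joint_distance:
  assumes S0: "S0 \<ge> 1"
  shows "(\<integral>\<^sup>+z. ennreal \<bar>real (fst z) - real (fst (snd z))\<bar> \<partial>measure_pmf (joint S0 m))
     \<le> ennreal ((1 + real S0) * (\<Sum>i<m. inv_bound (Suc i)))"
proof (induction m)
  case (Suc m)
  have pq: "\<bar>pick_prob (S0 + s) x - share m s x\<bar> \<le> (1 + real S0) * (1 / real (S0 + (s + x)))" for s x
  proof (cases "s + x = 0")
    case True
    have "\<bar>pick_prob (S0 + s) x - share m s x\<bar> \<le> 1"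
      using pick_prob_bounds[of "S0 + s" x] share_bounds[of m s x] S0 by (auto simp: abs_le_iff)
    also have "1 \<le> (1 + real S0) * (1 / real (S0 + (s + x)))" using True S0 by simp
    finally show ?thesis .
  next
    case False
    define T where "T = real (s + x)"
    have T: "T > 0" "real x \<le> T" using False by (auto simp: T_def)
    have S: "real S0 + T > 0" using T by simp
    have eq: "pick_prob (S0 + s) x - share m s x = (1 - real S0 * (real x / T)) / (real S0 + T)"
    proof -
      have *: "pick_prob (S0 + s) x = (real x + 1) / (real S0 + T)" "share m s x = real x / T"
        using False by (auto simp: pick_prob_def share_def T_def add_ac)
      show ?thesis unfolding * using S T by (simp add: field_simps)
    qed
    have "\<bar>1 - real S0 * (real x / T)\<bar> \<le> 1 + real S0"
    proof -
      have "0 \<le> real x / T" "real x / T \<le> 1" using T by auto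
      then have "0 \<le> real S0 * (real x / T)" "real S0 * (real x / T) \<le> real S0 * 1"
        by (intro mult_nonneg_nonneg mult_left_mono; simp)+
      then show ?thesis by linarith
    qed
    then have "\<bar>pick_prob (S0 + s) x - share m s x\<bar> \<le> (1 + real S0) / (real S0 + T)"
      unfolding eq abs_divide using S by (intro frac_le) auto
    then show ?thesis by (simp add: T_def)
  qed
  have step: "(\<integral>\<^sup>+w. ennreal \<bar>real (a + of_bool (fst w)) - real (r + of_bool (snd w))\<bar> \<partial>measure_pmf (couple (pick_prob (S0 + s) x) (share m s x)))
      \<le> ennreal \<bar>real a - real r\<bar> + ennreal (1 + real S0) * ennreal (1 / real (S0 + (s + x)))" for a r s x
  proof -
    have "(\<integral>\<^sup>+w. ennreal \<bar>real (a + of_bool (fst w)) - real (r + of_bool (snd w))\<bar> \<partial>measure_pmf (couple (pick_prob (S0 + s) x) (share m s x)))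
      \<le> (\<integral>\<^sup>+w. ennreal \<bar>real a - real r\<bar> + of_bool (fst w \<noteq> snd w) \<partial>measure_pmf (couple (pick_prob (S0 + s) x) (share m s x)))"
    proof (rule nn_integral_mono)
      fix w :: "bool \<times> bool"
      have "ennreal \<bar>real (a + of_bool (fst w)) - real (r + of_bool (snd w))\<bar> \<le> ennreal (\<bar>real a - real r\<bar> + of_bool (fst w \<noteq> snd w))"
        by (rule ennreal_leI) (cases "fst w"; cases "snd w"; simp; linarith)
      then show "ennreal \<bar>real (a + of_bool (fst w)) - real (r + of_bool (snd w))\<bar> \<le> ennreal \<bar>real a - real r\<bar> + of_bool (fst w \<noteq> snd w)"
        by (cases "fst w \<noteq> snd w") simp_all
    qed
    also have "\<dots> = ennreal \<bar>real a - real r\<bar> + ennreal \<bar>pick_prob (S0 + s) x - share m s x\<bar>"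
      using couple_marginals(3)[of "pick_prob (S0 + s) x" "share m s x"] pick_prob_bounds[of "S0 + s" x] share_bounds[of m s x] S0
      by (simp add: nn_integral_add measure_pmf.emeasure_space_1)
    also have "\<dots> \<le> ennreal \<bar>real a - real r\<bar> + ennreal (1 + real S0) * ennreal (1 / real (S0 + (s + x)))"
    proof (rule add_left_mono)
      show "ennreal \<bar>pick_prob (S0 + s) x - share m s x\<bar> \<le> ennreal (1 + real S0) * ennreal (1 / real (S0 + (s + x)))"
        by (rule ord_le_eq_trans[OF ennreal_leI[OF pq] ennreal_mult]) auto
    qed
    finally show ?thesis .
  qed
  have "(\<integral>\<^sup>+z. ennreal \<bar>real (fst z) - real (fst (snd z))\<bar> \<partial>measure_pmf (joint S0 (Suc m)))
     \<le> (\<integral>\<^sup>+z. \<integral>\<^sup>+x. ennreal \<bar>real (fst z) - real (fst (snd z))\<bar> + ennreal (1 + real S0) * ennreal (1 / real (S0 + (snd (snd z) + x))) \<partial>measure_pmf X \<partial>measure_pmf (joint S0 m))"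
    by (simp add: split_beta del: of_nat_add ennreal_plus) (intro nn_integral_mono step)
  also have "\<dots> = (\<integral>\<^sup>+z. ennreal \<bar>real (fst z) - real (fst (snd z))\<bar> \<partial>measure_pmf (joint S0 m))
     + ennreal (1 + real S0) * (\<integral>\<^sup>+z. \<integral>\<^sup>+x. ennreal (1 / real (S0 + (snd (snd z) + x))) \<partial>measure_pmf X \<partial>measure_pmf (joint S0 m))"
    by (simp add: nn_integral_add nn_integral_cmult measure_pmf.emeasure_space_1)
  also have "\<dots> \<le> ennreal ((1 + real S0) * (\<Sum>i<m. inv_bound (Suc i))) + ennreal (1 + real S0) * ennreal (inv_bound (Suc m))"
  proof (intro add_mono Suc.IH mult_left_mono)
    have "(\<integral>\<^sup>+z. \<integral>\<^sup>+x. ennreal (1 / real (S0 + (snd (snd z) + x))) \<partial>measure_pmf X \<partial>measure_pmf (joint S0 m))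
       = (\<integral>\<^sup>+z. ennreal (1 / real (S0 + snd (snd z))) \<partial>measure_pmf (joint S0 (Suc m)))"
      by (simp add: split_beta measure_pmf.emeasure_space_1)
    also have "\<dots> = explore Fs (Suc m) (\<lambda>S _ _. ennreal (1 / real S)) S0 0 0"
      using explore_joint[OF S0, of 0 "Suc m" "\<lambda>S _. ennreal (1 / real S)"] by simp
    also have "\<dots> \<le> ennreal (inv_bound (Suc m))" using S0 by (intro explore_inverse) auto
    finally show "(\<integral>\<^sup>+z. \<integral>\<^sup>+x. ennreal (1 / real (S0 + (snd (snd z) + x))) \<partial>measure_pmf X \<partial>measure_pmf (joint S0 m)) \<le> ennreal (inv_bound (Suc m))" .
  qed simp
  also have "ennreal ((1 + real S0) * (\<Sum>i<m. inv_bound (Suc i))) + ennreal (1 + real S0) * ennreal (inv_bound (Suc m))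
     = ennreal ((1 + real S0) * (\<Sum>i<Suc m. inv_bound (Suc i)))"
    using inv_bound_nonneg by (simp add: ennreal_mult[symmetric] distrib_left sum_nonneg flip: ennreal_plus)
  finally show ?case .
qed simp

lemma joint_distance_const:
  assumes "S0 \<ge> 1"
  shows "(\<integral>\<^sup>+z. ennreal \<bar>real (fst z) - real (fst (snd z))\<bar> \<partial>measure_pmf (joint S0 m)) \<le> ennreal ((1 + real S0) * time_const)"
proof -
  have "(\<Sum>i<m. inv_bound (Suc i)) \<le> (\<Sum>i<Suc m. inv_bound i)"
    unfolding sum.lessThan_Suc_shift using inv_bound_nonneg[of 0] by simp
  also have "\<dots> \<le> (\<Sum>i. inv_bound i)"
    by (intro sum_le_suminf summable_inv_bound inv_bound_nonneg) auto
  finally have "(\<Sum>i<m. inv_bound (Suc i)) \<le> time_const" by (simp add: time_const_def)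
  then show ?thesis
    by (intro order_trans[OF joint_distance[OF assms]] ennreal_leI mult_left_mono) auto
qed

definition hop_law :: "nat \<Rightarrow> (nat \<Rightarrow> ennreal) \<Rightarrow> ennreal" where
  "hop_law m f = (\<integral>\<^sup>+d0. \<integral>\<^sup>+d1. explore Fs m (\<lambda>_ t a. explore Fs m (\<lambda>_ _ b. f (a + b)) d1 t 0) d0 0 0 \<partial>measure_pmf F \<partial>measure_pmf F)"

text \<open>The bound \<open>le\<close> lets \<open>g\<close> replace \<open>f\<close> at a cost
  linear in the distance, measured in units of \<open>w\<close>. For each cluster the mean distance
  is at most \<open>(1 + d) * time_const\<close>; averaging over the two initial degrees gives the
  constant.\<close>

lemma hop_law_records:
  assumes le: "\<And>r h :: nat. f r \<le> g h + ennreal (\<bar>real h - real r\<bar> / w)" and w: "w > 0"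
  shows "(\<integral>\<^sup>+r. f r \<partial>measure_pmf (two_records m)) \<le> hop_law m g + ennreal (2 * (1 + \<mu>) * time_const / w)"
proof -
  have tc: "time_const \<ge> 0" using time_const_pos by simp
  have bound: "(\<integral>\<^sup>+r. f r \<partial>measure_pmf (two_records m)) \<le> explore Fs m (\<lambda>_ t a. explore Fs m (\<lambda>_ _ b. g (a + b)) d1 t 0) d0 0 0
       + (ennreal (time_const / w) * (of_nat (1 + d0) + of_nat (1 + d1)))"
    if d: "d0 \<ge> 2" "d1 \<ge> 2" for d0 d1
  proof -
    let ?J0 = "joint d0 m" and ?J1 = "joint d1 m"
    have dist: "(\<integral>\<^sup>+z. ennreal (\<bar>real (fst z) - real (fst (snd z))\<bar> / w) \<partial>measure_pmf (joint d m)) \<le> ennreal (time_const / w) * of_nat (1 + d)" if "d \<ge> 2" for d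
    proof -
      have "(\<integral>\<^sup>+z. ennreal (\<bar>real (fst z) - real (fst (snd z))\<bar> / w) \<partial>measure_pmf (joint d m))
        = ennreal (1 / w) * (\<integral>\<^sup>+z. ennreal \<bar>real (fst z) - real (fst (snd z))\<bar> \<partial>measure_pmf (joint d m))"
        using w by (subst nn_integral_cmult[symmetric]) (auto simp: ennreal_mult[symmetric])
      also have "\<dots> \<le> ennreal (1 / w) * ennreal ((1 + real d) * time_const)"
        using that by (intro mult_left_mono joint_distance_const) auto
      also have "\<dots> = ennreal (time_const / w) * of_nat (1 + d)"
        unfolding ennreal_of_nat_eq_real_of_nat using w tc by (simp add: ennreal_mult[symmetric] mult.commute del: ennreal_plus)
      finally show ?thesis .
    qed
    have "(\<integral>\<^sup>+r. f r \<partial>measure_pmf (two_records m)) = (\<integral>\<^sup>+z. \<integral>\<^sup>+z'. f (fst (snd z) + fst (snd z')) \<partial>measure_pmf ?J1 \<partial>measure_pmf ?J0)"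
    proof -
      have "(\<integral>\<^sup>+z'. f (r + fst (snd z')) \<partial>measure_pmf ?J1) = (\<integral>\<^sup>+r'. f (r + r') \<partial>measure_pmf (records m))" for r
        using joint_records[of d1 m "\<lambda>r' _. f (r + r')"] d by (simp add: measure_pmf.emeasure_space_1)
      moreover have "(\<integral>\<^sup>+z. (\<integral>\<^sup>+r'. f (fst (snd z) + r') \<partial>measure_pmf (records m)) \<partial>measure_pmf ?J0)
          = (\<integral>\<^sup>+r. \<integral>\<^sup>+r'. f (r + r') \<partial>measure_pmf (records m) \<partial>measure_pmf (records m))"
        using joint_records[of d0 m "\<lambda>r _. \<integral>\<^sup>+r'. f (r + r') \<partial>measure_pmf (records m)"] d by (simp add: measure_pmf.emeasure_space_1)
      ultimately show ?thesis by (simp add: two_records_def)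
    qed
    also have "\<dots> \<le> (\<integral>\<^sup>+z. \<integral>\<^sup>+z'. g (fst z + fst z') + (ennreal (\<bar>real (fst z) - real (fst (snd z))\<bar> / w) + ennreal (\<bar>real (fst z') - real (fst (snd z'))\<bar> / w)) \<partial>measure_pmf ?J1 \<partial>measure_pmf ?J0)"
    proof (intro nn_integral_mono)
      fix z z' :: "nat \<times> nat \<times> nat"
      have "\<bar>real (fst z + fst z') - real (fst (snd z) + fst (snd z'))\<bar> / w \<le> \<bar>real (fst z) - real (fst (snd z))\<bar> / w + \<bar>real (fst z') - real (fst (snd z'))\<bar> / w"
        unfolding add_divide_distrib[symmetric] using w by (intro divide_right_mono) auto
      then have "ennreal (\<bar>real (fst z + fst z') - real (fst (snd z) + fst (snd z'))\<bar> / w) \<le> ennreal (\<bar>real (fst z) - real (fst (snd z))\<bar> / w) + ennreal (\<bar>real (fst z') - real (fst (snd z'))\<bar> / w)"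
        using w by (simp add: ennreal_leI flip: ennreal_plus)
      then show "f (fst (snd z) + fst (snd z')) \<le> g (fst z + fst z') + (ennreal (\<bar>real (fst z) - real (fst (snd z))\<bar> / w) + ennreal (\<bar>real (fst z') - real (fst (snd z'))\<bar> / w))"
        using le[of "fst (snd z) + fst (snd z')" "fst z + fst z'"] by (meson add_left_mono order_trans)
    qed
    also have "\<dots> = (\<integral>\<^sup>+z. \<integral>\<^sup>+z'. g (fst z + fst z') \<partial>measure_pmf ?J1 \<partial>measure_pmf ?J0)
        + ((\<integral>\<^sup>+z. ennreal (\<bar>real (fst z) - real (fst (snd z))\<bar> / w) \<partial>measure_pmf ?J0) + (\<integral>\<^sup>+z'. ennreal (\<bar>real (fst z') - real (fst (snd z'))\<bar> / w) \<partial>measure_pmf ?J1))"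
      by (simp add: nn_integral_add measure_pmf.emeasure_space_1)
    also have "\<dots> \<le> (\<integral>\<^sup>+z. \<integral>\<^sup>+z'. g (fst z + fst z') \<partial>measure_pmf ?J1 \<partial>measure_pmf ?J0) + (ennreal (time_const / w) * of_nat (1 + d0) + ennreal (time_const / w) * of_nat (1 + d1))"
      by (intro add_left_mono add_mono dist d)
    also have "(\<integral>\<^sup>+z. \<integral>\<^sup>+z'. g (fst z + fst z') \<partial>measure_pmf ?J1 \<partial>measure_pmf ?J0) = explore Fs m (\<lambda>_ t a. explore Fs m (\<lambda>_ _ b. g (a + b)) d1 t 0) d0 0 0"
    proof -
      have "explore Fs m (\<lambda>_ t a. explore Fs m (\<lambda>_ _ b. g (a + b)) d1 t 0) d0 0 0
         = explore Fs m (\<lambda>_ t a. \<integral>\<^sup>+z'. g (a + fst z') \<partial>measure_pmf ?J1) d0 0 0"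
        using d explore_joint[of d1 _ m "\<lambda>_ b. g (_ + b)"] by (intro explore_cong_pos) (auto intro: explore_joint)
      also have "\<dots> = (\<integral>\<^sup>+z. \<integral>\<^sup>+z'. g (fst z + fst z') \<partial>measure_pmf ?J1 \<partial>measure_pmf ?J0)"
        using d explore_joint[of d0 0 m "\<lambda>_ a. \<integral>\<^sup>+z'. g (a + fst z') \<partial>measure_pmf ?J1"] by simp
      finally show ?thesis ..
    qed
    finally show ?thesis by (simp add: distrib_left)
  qed
  have "(\<integral>\<^sup>+r. f r \<partial>measure_pmf (two_records m)) = (\<integral>\<^sup>+d0. \<integral>\<^sup>+d1. (\<integral>\<^sup>+r. f r \<partial>measure_pmf (two_records m)) \<partial>measure_pmf F \<partial>measure_pmf F)"
    by (simp add: measure_pmf.emeasure_space_1)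
  also have "\<dots> \<le> (\<integral>\<^sup>+d0. \<integral>\<^sup>+d1. explore Fs m (\<lambda>_ t a. explore Fs m (\<lambda>_ _ b. g (a + b)) d1 t 0) d0 0 0
       + (ennreal (time_const / w) * (of_nat (1 + d0) + of_nat (1 + d1))) \<partial>measure_pmf F \<partial>measure_pmf F)"
    by (rule F_integral_mono2) (rule bound)
  also have "\<dots> = hop_law m g + ennreal (time_const / w) * ((1 + ennreal \<mu>) + (1 + ennreal \<mu>))"
    by (simp add: nn_integral_add nn_integral_cmult hop_law_def measure_pmf.emeasure_space_1 mean_F del: ennreal_plus)
  also have "ennreal (time_const / w) * ((1 + ennreal \<mu>) + (1 + ennreal \<mu>)) = ennreal (2 * (1 + \<mu>) * time_const / w)"
  proof -
    have "1 + ennreal \<mu> = ennreal (1 + \<mu>)" using \<mu>_ge2 by simp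
    then have eq: "(1 + ennreal \<mu>) + (1 + ennreal \<mu>) = ennreal (2 * (1 + \<mu>))" using \<mu>_ge2 by (simp flip: ennreal_plus)
    show ?thesis unfolding eq using \<mu>_ge2 w tc by (subst ennreal_mult[symmetric]) (auto simp: mult_ac)
  qed
  finally show ?thesis .
qed

end

subsection \<open>The central limit theorem for records\<close>

lemma set_records: "set_pmf (records m) \<subseteq> {..m}"
proof (induction m)
  case (Suc m)
  show ?case
  proof
    fix x assume "x \<in> set_pmf (records (Suc m))"
    then obtain r b where r: "r \<in> set_pmf (records m)" "x = r + of_bool b" by (auto simp del: of_nat_Suc)
    then have "r \<le> m" using Suc by auto
    then show "x \<in> {..Suc m}" using r by (cases b) auto
  qed
qed simp

definition records_cf :: "nat \<Rightarrow> real \<Rightarrow> complex" where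
  "records_cf m \<theta> = measure_pmf.expectation (records m) (\<lambda>r. iexp (\<theta> * real r))"

lemma records_cf_sum: "records_cf m \<theta> = (\<Sum>r\<le>m. pmf (records m) r *\<^sub>R iexp (\<theta> * real r))"
  unfolding records_cf_def using set_records by (intro integral_measure_pmf) auto

lemma records_cf_Suc: "records_cf (Suc m) \<theta> = records_cf m \<theta> * (1 + (iexp \<theta> - 1) / of_nat (Suc m))"
proof -
  let ?p = "1 / real (Suc m)"
  let ?f = "\<lambda>r. bernoulli_pmf ?p \<bind> (\<lambda>b. return_pmf (r + of_bool b))"
  have inner: "measure_pmf.expectation (?f r) (\<lambda>r. iexp (\<theta> * real r)) = iexp (\<theta> * real r) * (1 + (iexp \<theta> - 1) / of_nat (Suc m))" for r
  proof -
    have "?f r = map_pmf (\<lambda>b. r + of_bool b) (bernoulli_pmf ?p)" by (simp add: map_pmf_def)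
    then have "measure_pmf.expectation (?f r) (\<lambda>r. iexp (\<theta> * real r)) = measure_pmf.expectation (bernoulli_pmf ?p) (\<lambda>b. iexp (\<theta> * real (r + of_bool b)))"
      by (simp del: of_nat_add)
    also have "\<dots> = (\<Sum>b\<in>UNIV. pmf (bernoulli_pmf ?p) b *\<^sub>R iexp (\<theta> * real (r + of_bool b)))"
      by (intro integral_measure_pmf) auto
    also have "\<dots> = ?p *\<^sub>R iexp (\<theta> * real (r + 1)) + (1 - ?p) *\<^sub>R iexp (\<theta> * real r)"
      by (simp add: UNIV_bool add_ac)
    also have "iexp (\<theta> * real (r + 1)) = iexp (\<theta> * real r) * iexp \<theta>"
      by (simp add: exp_add[symmetric] distrib_left add.commute)
    also have "?p *\<^sub>R (iexp (\<theta> * real r) * iexp \<theta>) + (1 - ?p) *\<^sub>R iexp (\<theta> * real r)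
       = iexp (\<theta> * real r) * (1 + (iexp \<theta> - 1) / of_nat (Suc m))"
    proof -
      have "complex_of_real ?p = 1 / of_nat (Suc m)" by (simp del: of_nat_Suc)
      then show ?thesis by (simp add: scaleR_conv_of_real ring_distribs diff_divide_distrib del: of_nat_Suc)
    qed
    finally show ?thesis .
  qed
  have fin: "finite (set_pmf (?f r))" for r by (simp del: of_nat_Suc)
  have "records_cf (Suc m) \<theta> = (\<Sum>r\<le>m. pmf (records m) r *\<^sub>R measure_pmf.expectation (?f r) (\<lambda>r. iexp (\<theta> * real r)))"
    unfolding records_cf_def records.simps by (rule pmf_expectation_bind) (use fin set_records in auto)
  also have "\<dots> = records_cf m \<theta> * (1 + (iexp \<theta> - 1) / of_nat (Suc m))"
    unfolding inner records_cf_sum sum_distrib_right by (simp only: mult_scaleR_left)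
  finally show ?thesis .
qed

lemma records_cf_prod: "records_cf m \<theta> = (\<Prod>i<m. 1 + (iexp \<theta> - 1) / of_nat (Suc i))"
proof (induction m)
  case 0
  show ?case by (simp add: records_cf_def)
qed (simp add: records_cf_Suc del: of_nat_Suc)

lemma two_records_cf:
  "measure_pmf.expectation (two_records m) (\<lambda>r. iexp (\<theta> * real r)) = (records_cf m \<theta>)\<^sup>2"
proof -
  let ?f = "\<lambda>r. records m \<bind> (\<lambda>r'. return_pmf (r + r'))"
  have f: "?f r = map_pmf (\<lambda>r'. r + r') (records m)" for r by (simp add: map_pmf_def)
  have finr: "finite (set_pmf (records m))" using set_records by (rule finite_subset) simp
  have inner: "measure_pmf.expectation (?f r) (\<lambda>r. iexp (\<theta> * real r)) = iexp (\<theta> * real r) * records_cf m \<theta>" for r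
  proof -
    have "measure_pmf.expectation (?f r) (\<lambda>r. iexp (\<theta> * real r)) = measure_pmf.expectation (records m) (\<lambda>r'. iexp (\<theta> * real (r + r')))"
      unfolding f by (simp del: of_nat_add)
    also have "\<dots> = (\<Sum>r'\<le>m. pmf (records m) r' *\<^sub>R iexp (\<theta> * real (r + r')))"
      using set_records by (intro integral_measure_pmf) auto
    also have "\<dots> = iexp (\<theta> * real r) * records_cf m \<theta>"
      unfolding records_cf_sum sum_distrib_left
      by (intro sum.cong refl) (simp add: distrib_left exp_add)
    finally show ?thesis .
  qed
  have "measure_pmf.expectation (two_records m) (\<lambda>r. iexp (\<theta> * real r))
      = (\<Sum>r\<le>m. pmf (records m) r *\<^sub>R measure_pmf.expectation (?f r) (\<lambda>r. iexp (\<theta> * real r)))"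
    unfolding two_records_def by (rule pmf_expectation_bind) (use finr set_records f in auto)
  also have "\<dots> = records_cf m \<theta> * records_cf m \<theta>"
    unfolding inner by (subst (2) records_cf_sum) (simp add: sum_distrib_right)
  finally show ?thesis by (simp add: power2_eq_square)
qed

lemma exp_linear_approx:
  fixes w :: complex
  shows "norm ((1 + w) - exp w) \<le> exp \<bar>Re w\<bar> * (norm w)\<^sup>2"
  using Taylor_exp[of w 1] by (simp add: norm_minus_commute power2_eq_square)

text \<open>The sum of the squared success probabilities of all record indicators; it bounds the
  error of a Poisson approximation.\<close>

definition basel :: real where "basel = (\<Sum>i. 1 / real (Suc i) ^ 2)"

text \<open>Poisson approximation: each factor \<open>1 + \<zeta> / i\<close> is replaced by
  \<open>exp (\<zeta> / i)\<close> with an error quadratic in \<open>\<zeta> / i\<close>. All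
  factors lie in the closed unit disc, so the errors add up.\<close>

lemma records_cf_approx:
  "norm (records_cf m \<theta> - exp ((iexp \<theta> - 1) * of_real (harm m))) \<le> exp 2 * \<bar>\<theta>\<bar>\<^sup>2 * basel"
    "norm (records_cf m \<theta>) \<le> 1" "norm (exp ((iexp \<theta> - 1) * of_real (harm m))) \<le> 1"
proof -
  define \<zeta> where "\<zeta> = iexp \<theta> - 1"
  have \<zeta>: "norm \<zeta> \<le> \<bar>\<theta>\<bar>" using iexp_approx1[of \<theta> 0] by (simp add: \<zeta>_def)
  have \<zeta>2: "norm \<zeta> \<le> 2" using norm_triangle_ineq4[of "iexp \<theta>" 1] by (simp add: \<zeta>_def)
  have Re: "Re \<zeta> \<le> 0" by (simp add: \<zeta>_def Re_exp)
  have f1: "norm (1 + \<zeta> / of_nat (Suc i)) \<le> 1" for i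
  proof -
    have "1 + \<zeta> / of_nat (Suc i) = of_real (1 - 1 / real (Suc i)) + of_real (1 / real (Suc i)) * iexp \<theta>"
      by (simp add: \<zeta>_def diff_divide_distrib del: of_nat_Suc)
    then have "norm (1 + \<zeta> / of_nat (Suc i)) \<le> norm (complex_of_real (1 - 1 / real (Suc i))) + norm (complex_of_real (1 / real (Suc i)) * iexp \<theta>)"
      by (simp only: norm_triangle_ineq)
    also have "\<dots> = 1" by (simp add: norm_mult del: of_nat_Suc of_real_diff of_real_divide)
    finally show ?thesis .
  qed
  have f2: "norm (exp (\<zeta> / of_nat (Suc i))) \<le> 1" for i
    using Re by (simp add: Re_divide_of_nat divide_nonpos_pos del: of_nat_Suc)
  have f3: "norm ((1 + \<zeta> / of_nat (Suc i)) - exp (\<zeta> / of_nat (Suc i))) \<le> exp 2 * \<bar>\<theta>\<bar>\<^sup>2 * (1 / real (Suc i) ^ 2)" for i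
  proof -
    let ?w = "\<zeta> / of_nat (Suc i)"
    have nw: "norm ?w = norm \<zeta> / real (Suc i)" by (simp add: norm_divide del: of_nat_Suc)
    have "norm ?w \<le> norm \<zeta>" unfolding nw by (simp add: divide_le_eq mult_le_cancel_left1 flip: One_nat_def)
    then have "\<bar>Re ?w\<bar> \<le> 2" using abs_Re_le_cmod[of ?w] \<zeta>2 by linarith
    have "norm ((1 + ?w) - exp ?w) \<le> exp \<bar>Re ?w\<bar> * (norm ?w)\<^sup>2" by (rule exp_linear_approx)
    also have "\<dots> \<le> exp 2 * (\<bar>\<theta>\<bar> / real (Suc i))\<^sup>2"
      unfolding nw using \<open>\<bar>Re ?w\<bar> \<le> 2\<close> \<zeta> by (intro mult_mono power_mono divide_right_mono) auto
    finally show ?thesis by (simp add: power_divide del: of_nat_Suc)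
  qed
  have sm: "summable (\<lambda>i. 1 / real (Suc i) ^ 2)"
    using inverse_squares_sums by (auto simp: sums_iff)
  have prod: "exp (\<zeta> * of_real (harm m)) = (\<Prod>i<m. exp (\<zeta> / of_nat (Suc i)))"
  proof -
    have "\<zeta> * of_real (harm m) = (\<Sum>i<m. \<zeta> / of_nat (Suc i))"
      unfolding harm_def by (simp add: sum_distrib_left sum.atLeast1_atMost_eq field_simps del: of_nat_Suc)
    then show ?thesis by (simp add: exp_sum del: of_nat_Suc)
  qed
  have "norm (records_cf m \<theta> - exp (\<zeta> * of_real (harm m)))
     \<le> (\<Sum>i<m. norm ((1 + \<zeta> / of_nat (Suc i)) - exp (\<zeta> / of_nat (Suc i))))"
    unfolding records_cf_prod prod \<zeta>_def[symmetric] by (rule norm_prod_diff) (use f1 f2 in auto)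
  also have "\<dots> \<le> (\<Sum>i<m. exp 2 * \<bar>\<theta>\<bar>\<^sup>2 * (1 / real (Suc i) ^ 2))" by (intro sum_mono f3)
  also have "\<dots> = exp 2 * \<bar>\<theta>\<bar>\<^sup>2 * (\<Sum>i<m. 1 / real (Suc i) ^ 2)" by (simp only: sum_distrib_left)
  also have "\<dots> \<le> exp 2 * \<bar>\<theta>\<bar>\<^sup>2 * basel"
    unfolding basel_def using sm by (intro mult_left_mono sum_le_suminf) auto
  finally show "norm (records_cf m \<theta> - exp ((iexp \<theta> - 1) * of_real (harm m))) \<le> exp 2 * \<bar>\<theta>\<bar>\<^sup>2 * basel"
    by (simp add: \<zeta>_def)
  show "norm (records_cf m \<theta>) \<le> 1"
    unfolding records_cf_prod \<zeta>_def[symmetric] prod_norm[symmetric] by (rule prod_le_1) (use f1 in auto)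
  show "norm (exp ((iexp \<theta> - 1) * of_real (harm m))) \<le> 1"
    using Re harm_nonneg[where 'a=real, of m] by (simp add: \<zeta>_def[symmetric] mult_nonpos_nonneg)
qed

text \<open>Second-order expansion of the exponential at argument \<open>t / \<sigma> m\<close>,
  multiplied by \<open>(\<sigma> m)\<^sup>2\<close>. Replacing the harmonic number by the logarithm
  changes a factor by a bounded amount against one that tends to zero.\<close>

lemma records_exponent:
  fixes t :: real
  defines "\<sigma> \<equiv> (\<lambda>m::nat. sqrt (2 * ln (real m)))"
  shows "(\<lambda>m. 2 * ((iexp (t / \<sigma> m) - 1) * of_real (harm m)) - \<i> * of_real (t / \<sigma> m * (2 * ln (real m)))) \<longlonglongrightarrow> of_real (- (t\<^sup>2) / 2)"
proof -
  define \<theta> where "\<theta> = (\<lambda>m::nat. t / \<sigma> m)"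
  have \<sigma>: "filterlim \<sigma> at_top sequentially" unfolding \<sigma>_def by real_asymp
  have \<theta>: "\<theta> \<longlonglongrightarrow> 0" unfolding \<theta>_def using tendsto_divide_0[OF tendsto_const filterlim_at_top_imp_at_infinity[OF \<sigma>]] .
  have \<zeta>: "(\<lambda>m. iexp (\<theta> m) - 1) \<longlonglongrightarrow> 0"
  proof (rule Lim_null_comparison)
    show "eventually (\<lambda>m. norm (iexp (\<theta> m) - 1) \<le> \<bar>\<theta> m\<bar>) sequentially"
      using iexp_approx1[of "\<theta> _" 0] by (intro always_eventually allI) simp
    show "(\<lambda>m. \<bar>\<theta> m\<bar>) \<longlonglongrightarrow> 0" using tendsto_rabs_zero[OF \<theta>] .
  qed
  have h: "(\<lambda>m. complex_of_real (harm m - ln (real m))) \<longlonglongrightarrow> of_real euler_mascheroni"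
    using euler_mascheroni_LIMSEQ by (intro tendsto_of_real)
  have 1: "(\<lambda>m. 2 * (iexp (\<theta> m) - 1) * of_real (harm m - ln (real m))) \<longlonglongrightarrow> 2 * 0 * of_real euler_mascheroni"
    by (intro tendsto_mult tendsto_const \<zeta> h)
  have 2: "(\<lambda>m. of_real ((\<sigma> m)\<^sup>2) * (iexp (\<theta> m) - (1 + \<i> * of_real (\<theta> m) - of_real ((\<theta> m)\<^sup>2) / 2))) \<longlonglongrightarrow> 0"
  proof (rule Lim_null_comparison)
    show "(\<lambda>m. \<bar>t\<bar> ^ 3 / \<sigma> m) \<longlonglongrightarrow> 0"
      using tendsto_divide_0[OF tendsto_const filterlim_at_top_imp_at_infinity[OF \<sigma>]] .
    show "eventually (\<lambda>m. norm (of_real ((\<sigma> m)\<^sup>2) * (iexp (\<theta> m) - (1 + \<i> * of_real (\<theta> m) - of_real ((\<theta> m)\<^sup>2) / 2))) \<le> \<bar>t\<bar> ^ 3 / \<sigma> m) sequentially"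
      using filterlim_at_top_dense[THEN iffD1, OF \<sigma>, rule_format, of 0]
    proof eventually_elim
      case (elim m)
      have "norm (iexp (\<theta> m) - (\<Sum>k\<le>2. (\<i> * of_real (\<theta> m)) ^ k / fact k)) \<le> \<bar>\<theta> m\<bar> ^ Suc 2 / fact (Suc 2)"
        by (rule iexp_approx1)
      moreover have "(\<Sum>k\<le>2. (\<i> * of_real (\<theta> m)) ^ k / fact k) = 1 + \<i> * of_real (\<theta> m) - of_real ((\<theta> m)\<^sup>2) / 2"
        proof -
        have set: "{..2::nat} = {0, 1, 2}" by auto
        show ?thesis unfolding set by (simp add: power_mult_distrib fact_2)
      qed
      moreover have "\<bar>\<theta> m\<bar> ^ Suc 2 / fact (Suc 2) \<le> \<bar>\<theta> m\<bar> ^ 3" 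
      proof -
        have "\<bar>\<theta> m\<bar> ^ Suc 2 / fact (Suc 2) \<le> \<bar>\<theta> m\<bar> ^ Suc 2 / 1" by (intro divide_left_mono fact_ge_1) auto
        then show ?thesis by (simp only: div_by_1 Suc_numeral semiring_norm)
      qed
      ultimately have "norm (iexp (\<theta> m) - (1 + \<i> * of_real (\<theta> m) - of_real ((\<theta> m)\<^sup>2) / 2)) \<le> \<bar>\<theta> m\<bar> ^ 3" by simp
      then have "norm (of_real ((\<sigma> m)\<^sup>2) * (iexp (\<theta> m) - (1 + \<i> * of_real (\<theta> m) - of_real ((\<theta> m)\<^sup>2) / 2))) \<le> (\<sigma> m)\<^sup>2 * \<bar>\<theta> m\<bar> ^ 3"
        unfolding norm_mult by (intro mult_mono) (auto simp: norm_power)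
      also have "\<dots> = \<bar>t\<bar> ^ 3 / \<sigma> m"
        using elim by (simp add: \<theta>_def power_divide field_simps power2_eq_square power3_eq_cube)
      finally show ?case .
    qed
  qed
  have "(\<lambda>m. 2 * (iexp (\<theta> m) - 1) * of_real (harm m - ln (real m))
     + of_real ((\<sigma> m)\<^sup>2) * (iexp (\<theta> m) - (1 + \<i> * of_real (\<theta> m) - of_real ((\<theta> m)\<^sup>2) / 2)) + of_real (- (t\<^sup>2) / 2))
     \<longlonglongrightarrow> 2 * 0 * of_real euler_mascheroni + 0 + of_real (- (t\<^sup>2) / 2)"
    by (intro tendsto_add 1 2 tendsto_const)
  moreover have "eventually (\<lambda>m. 2 * (iexp (\<theta> m) - 1) * of_real (harm m - ln (real m))
     + of_real ((\<sigma> m)\<^sup>2) * (iexp (\<theta> m) - (1 + \<i> * of_real (\<theta> m) - of_real ((\<theta> m)\<^sup>2) / 2)) + of_real (- (t\<^sup>2) / 2)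
     = 2 * ((iexp (t / \<sigma> m) - 1) * of_real (harm m)) - \<i> * of_real (t / \<sigma> m * (2 * ln (real m)))) sequentially"
    using eventually_ge_at_top[of 2]
  proof eventually_elim
    case (elim m)
    define z where "z = iexp (\<theta> m)"
    define l where "l = ln (real m)"
    have l: "l > 0" using elim by (simp add: l_def)
    have s2: "(\<sigma> m)\<^sup>2 = 2 * l" "\<sigma> m > 0" using l by (auto simp: \<sigma>_def l_def)
    have "(\<sigma> m)\<^sup>2 * (\<theta> m)\<^sup>2 = t\<^sup>2" using s2(2) by (simp add: \<theta>_def power_divide)
    then have st: "complex_of_real ((\<sigma> m)\<^sup>2) * (of_real ((\<theta> m)\<^sup>2) / 2) = of_real (t\<^sup>2) / 2"
      by (metis of_real_mult times_divide_eq_right)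
    have expand0: "of_real ((\<sigma> m)\<^sup>2) * (z - (1 + \<i> * of_real (\<theta> m) - of_real ((\<theta> m)\<^sup>2) / 2))
      = of_real ((\<sigma> m)\<^sup>2) * (z - 1 - \<i> * of_real (\<theta> m)) + of_real (t\<^sup>2) / 2"
      unfolding st[symmetric] by (simp add: algebra_simps)
    have \<sigma>l: "of_real ((\<sigma> m)\<^sup>2) = 2 * complex_of_real l" unfolding s2 by simp
    have expand: "of_real ((\<sigma> m)\<^sup>2) * (z - (1 + \<i> * of_real (\<theta> m) - of_real ((\<theta> m)\<^sup>2) / 2))
      = 2 * complex_of_real l * (z - 1 - \<i> * of_real (\<theta> m)) + of_real (t\<^sup>2) / 2"
      using expand0 \<sigma>l by (simp only:)
    have \<theta>m: "t / \<sigma> m = \<theta> m" by (simp add: \<theta>_def)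
    show ?case
      unfolding \<theta>m z_def[symmetric] l_def[symmetric] expand by (simp add: algebra_simps)
  qed
  ultimately show ?thesis by (auto elim: Lim_transform_eventually)
qed

text \<open>The two record counts are independent and nearly Poisson with mean \<open>ln m\<close>
  each, so centring and variance are both \<open>2 * ln m\<close>. Convergence of characteristic
  functions suffices by Levy's theorem.\<close>

theorem records_clt:
  "weak_conv_m (\<lambda>m. distr (measure_pmf (two_records m)) borel (\<lambda>r. (real r - 2 * ln (real m)) / sqrt (2 * ln (real m))))
     std_normal_distribution"
proof (rule levy_continuity)
  show "real_distribution (distr (measure_pmf (two_records m)) borel (\<lambda>r. (real r - 2 * ln (real m)) / sqrt (2 * ln (real m))))" for m
    by (rule prob_space.real_distribution_distr) (auto intro: prob_space_measure_pmf)
  show "real_distribution std_normal_distribution" by (rule real_dist_normal_dist)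
next
  fix t :: real
  define \<sigma> where "\<sigma> = (\<lambda>m::nat. sqrt (2 * ln (real m)))"
  define \<theta> where "\<theta> = (\<lambda>m::nat. t / \<sigma> m)"
  define h where "h = (\<lambda>m::nat. (iexp (\<theta> m) - 1) * of_real (harm m))"
  define c where "c = (\<lambda>m::nat. iexp (- (\<theta> m * (2 * ln (real m)))))"
  have \<sigma>: "filterlim \<sigma> at_top sequentially" unfolding \<sigma>_def by real_asymp
  have \<theta>: "\<theta> \<longlonglongrightarrow> 0" unfolding \<theta>_def using tendsto_divide_0[OF tendsto_const filterlim_at_top_imp_at_infinity[OF \<sigma>]] .
  have char: "char (distr (measure_pmf (two_records m)) borel (\<lambda>r. (real r - 2 * ln (real m)) / \<sigma> m)) t
     = c m * (records_cf m (\<theta> m))\<^sup>2" for m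
  proof -
    have "char (distr (measure_pmf (two_records m)) borel (\<lambda>r. (real r - 2 * ln (real m)) / \<sigma> m)) t
      = measure_pmf.expectation (two_records m) (\<lambda>r. iexp (t * ((real r - 2 * ln (real m)) / \<sigma> m)))"
      unfolding char_def by (subst integral_distr) auto
    also have "\<dots> = measure_pmf.expectation (two_records m) (\<lambda>r. c m * iexp (\<theta> m * real r))"
    proof (rule Bochner_Integration.integral_cong[OF refl])
      fix r
      have "t * ((real r - 2 * ln (real m)) / \<sigma> m) = - (\<theta> m * (2 * ln (real m))) + \<theta> m * real r"
        by (simp add: \<theta>_def diff_divide_distrib algebra_simps)
      then show "iexp (t * ((real r - 2 * ln (real m)) / \<sigma> m)) = c m * iexp (\<theta> m * real r)"
        unfolding c_def by (simp only: of_real_add distrib_left exp_add)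
    qed
    also have "\<dots> = c m * (records_cf m (\<theta> m))\<^sup>2" by (simp only: integral_mult_right_zero two_records_cf)
    finally show ?thesis .
  qed
  have c1: "norm (c m) = 1" for m by (simp add: c_def)
  have "(\<lambda>m. c m * (records_cf m (\<theta> m))\<^sup>2 - c m * (exp (h m))\<^sup>2) \<longlonglongrightarrow> 0"
  proof (rule Lim_null_comparison)
    show "eventually (\<lambda>m. norm (c m * (records_cf m (\<theta> m))\<^sup>2 - c m * (exp (h m))\<^sup>2) \<le> 2 * (exp 2 * \<bar>\<theta> m\<bar>\<^sup>2 * basel)) sequentially"
    proof (intro always_eventually allI)
      fix m :: nat
      have hm: "(iexp (\<theta> m) - 1) * of_real (harm m) = h m" by (simp add: h_def)
      note ap = records_cf_approx[where m = m and \<theta> = "\<theta> m", unfolded hm]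
      have "c m * (records_cf m (\<theta> m))\<^sup>2 - c m * (exp (h m))\<^sup>2 = c m * ((records_cf m (\<theta> m) - exp (h m)) * (records_cf m (\<theta> m) + exp (h m)))"
        by (simp add: algebra_simps power2_eq_square)
      then have "norm (c m * (records_cf m (\<theta> m))\<^sup>2 - c m * (exp (h m))\<^sup>2) = norm (records_cf m (\<theta> m) - exp (h m)) * norm (records_cf m (\<theta> m) + exp (h m))"
        by (simp add: norm_mult c1)
      also have "\<dots> \<le> (exp 2 * \<bar>\<theta> m\<bar>\<^sup>2 * basel) * 2"
      proof (intro mult_mono)
        show "norm (records_cf m (\<theta> m) + exp (h m)) \<le> 2"
          using norm_triangle_ineq[of "records_cf m (\<theta> m)" "exp (h m)"] ap(2,3) by linarith
        show "0 \<le> exp 2 * \<bar>\<theta> m\<bar>\<^sup>2 * basel" using ap(1) norm_ge_zero order_trans by blast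
      qed (use ap in auto)
      finally show "norm (c m * (records_cf m (\<theta> m))\<^sup>2 - c m * (exp (h m))\<^sup>2) \<le> 2 * (exp 2 * \<bar>\<theta> m\<bar>\<^sup>2 * basel)" by simp
    qed
    have "(\<lambda>m. 2 * (exp 2 * \<bar>\<theta> m\<bar>\<^sup>2 * basel)) \<longlonglongrightarrow> 2 * (exp 2 * \<bar>0\<bar>\<^sup>2 * basel)"
      by (intro tendsto_intros \<theta>)
    then show "(\<lambda>m. 2 * (exp 2 * \<bar>\<theta> m\<bar>\<^sup>2 * basel)) \<longlonglongrightarrow> 0" by simp
  qed
  moreover have "(\<lambda>m. c m * (exp (h m))\<^sup>2) \<longlonglongrightarrow> exp (of_real (- (t\<^sup>2) / 2))"
  proof -
    have "(\<lambda>m. exp (2 * h m - \<i> * of_real (\<theta> m * (2 * ln (real m))))) \<longlonglongrightarrow> exp (of_real (- (t\<^sup>2) / 2))"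
      unfolding h_def \<theta>_def \<sigma>_def by (intro tendsto_exp records_exponent)
    moreover have "exp (2 * h m - \<i> * of_real (\<theta> m * (2 * ln (real m)))) = c m * (exp (h m))\<^sup>2" for m
      by (simp add: c_def exp_diff exp_minus exp_double divide_inverse)
    ultimately show ?thesis by simp
  qed
  ultimately have "(\<lambda>m. c m * (records_cf m (\<theta> m))\<^sup>2) \<longlonglongrightarrow> 0 + exp (of_real (- (t\<^sup>2) / 2))"
    using tendsto_add by fastforce
  then show "(\<lambda>m. char (distr (measure_pmf (two_records m)) borel (\<lambda>r. (real r - 2 * ln (real m)) / sqrt (2 * ln (real m)))) t) \<longlonglongrightarrow> char std_normal_distribution t"
    unfolding char[unfolded \<sigma>_def] \<sigma>_def char_std_normal_distribution by (simp only: add_0 exp_of_real)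
qed

subsection \<open>Degree sums\<close>

context heavy_tail begin

text \<open>For \<open>0 \<le> x \<le> 1\<close> one has
  \<open>exp x \<le> 1 + x + x\<^sup>2\<close>. With \<open>x = min k K / K\<close> the linear term
  gives \<open>\<mu> / K\<close> and the quadratic one the truncated moment divided by the square of
  \<open>K\<close>.\<close>

lemma exp_truncated_moment:
  assumes K: "K \<ge> 1"
  shows "(\<integral>\<^sup>+k. ennreal (exp (min (real k) (real K) / real K)) \<partial>measure_pmf F)
    \<le> ennreal (exp (\<mu> / K + trunc_const * real K powr (1 - \<tau>)))"
proof -
  have tp: "trunc_const > 0" by (rule trunc_const_pos)
  have "exp (min (real k) (real K) / real K) \<le> 1 + (1 / K * real k + 1 / (real K)\<^sup>2 * (real k * min (real k) (real K)))" for k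
  proof -
    let ?x = "min (real k) (real K) / real K"
    have "exp ?x \<le> 1 + ?x + ?x\<^sup>2" using K by (intro exp_bound) (auto simp: divide_le_eq)
    moreover have "?x \<le> 1 / K * real k" using K by (simp add: divide_right_mono)
    moreover have "?x\<^sup>2 \<le> 1 / (real K)\<^sup>2 * (real k * min (real k) (real K))"
      using K by (simp add: power2_eq_square divide_right_mono mult_right_mono)
    ultimately show ?thesis by linarith
  qed
  then have "(\<integral>\<^sup>+k. ennreal (exp (min (real k) (real K) / real K)) \<partial>measure_pmf F)
     \<le> (\<integral>\<^sup>+k. ennreal (1 + (1 / K * real k + 1 / (real K)\<^sup>2 * (real k * min (real k) (real K)))) \<partial>measure_pmf F)"
    by (intro nn_integral_mono ennreal_leI)
  also have "\<dots> = (\<integral>\<^sup>+k. 1 + (ennreal (1 / K) * of_nat k + ennreal (1 / (real K)\<^sup>2) * ennreal (real k * min (real k) (real K))) \<partial>measure_pmf F)"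
  proof (intro nn_integral_cong)
    fix k :: nat
    have "ennreal (1 + (1 / K * real k + 1 / (real K)\<^sup>2 * (real k * min (real k) (real K))))
      = ennreal 1 + (ennreal (1 / K * real k) + ennreal (1 / (real K)\<^sup>2 * (real k * min (real k) (real K))))"
      by (subst ennreal_plus, simp, simp, subst ennreal_plus) auto
    then show "ennreal (1 + (1 / K * real k + 1 / (real K)\<^sup>2 * (real k * min (real k) (real K))))
      = 1 + (ennreal (1 / K) * of_nat k + ennreal (1 / (real K)\<^sup>2) * ennreal (real k * min (real k) (real K)))"
      unfolding ennreal_of_nat_eq_real_of_nat by (simp add: ennreal_mult[symmetric])
  qed
  also have "\<dots> = 1 + (ennreal (1 / K) * ennreal \<mu> + ennreal (1 / (real K)\<^sup>2) * (\<integral>\<^sup>+k. ennreal (real k * min (real k) (real K)) \<partial>measure_pmf F))"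
    by (simp add: nn_integral_add nn_integral_cmult mean_F measure_pmf.emeasure_space_1)
  also have "\<dots> \<le> 1 + (ennreal (1 / K) * ennreal \<mu> + ennreal (1 / (real K)\<^sup>2) * ennreal (trunc_const * real K powr (3 - \<tau>)))"
    by (intro add_left_mono mult_left_mono truncated_moment K) auto
  also have "\<dots> = ennreal (1 + (\<mu> / K + 1 / (real K)\<^sup>2 * (trunc_const * real K powr (3 - \<tau>))))"
  proof -
    have "ennreal (1 + (\<mu> / K + 1 / (real K)\<^sup>2 * (trunc_const * real K powr (3 - \<tau>))))
      = ennreal 1 + (ennreal (\<mu> / K) + ennreal (1 / (real K)\<^sup>2 * (trunc_const * real K powr (3 - \<tau>))))"
      using tp \<mu>_ge2 by (subst ennreal_plus, simp, simp, subst ennreal_plus) auto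
    then show ?thesis using tp \<mu>_ge2 by (simp add: ennreal_mult[symmetric])
  qed
  also have "1 / (real K)\<^sup>2 * (trunc_const * real K powr (3 - \<tau>)) = trunc_const * real K powr (1 - \<tau>)"
  proof -
    have "real K powr (3 - \<tau>) = real K powr (1 - \<tau>) * (real K)\<^sup>2"
      using K by (simp add: powr_add[symmetric] flip: powr_numeral)
    then show ?thesis using K by simp
  qed
  also have "ennreal (1 + (\<mu> / K + trunc_const * real K powr (1 - \<tau>))) \<le> ennreal (exp (\<mu> / K + trunc_const * real K powr (1 - \<tau>)))"
    by (intro ennreal_leI) (use exp_ge_add_one_self in auto)
  finally show ?thesis .
qed

text \<open>Chernoff's bound at rate \<open>1 / K\<close>, the largest rate at which the truncated
  summands have a harmless exponential moment.\<close>

lemma degree_sum_tail: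
  fixes V :: "nat set"
  assumes V: "finite V" "card V \<le> n" and K: "K \<ge> 1"
  shows "measure (measure_pmf (Pi_pmf V 0 (\<lambda>_. F))) {d. real n * \<mu> + t < (\<Sum>v\<in>V. min (real (d v)) (real K))}
     \<le> exp (- (t / K) + real n * (trunc_const * real K powr (1 - \<tau>)))"
proof -
  let ?P = "measure_pmf (Pi_pmf V 0 (\<lambda>_. F))"
  let ?y = "\<mu> / K + trunc_const * real K powr (1 - \<tau>)"
  let ?a = "real n * \<mu> + t"
  have y: "?y \<ge> 0" using trunc_const_pos \<mu>_ge2 by simp
  have "emeasure ?P {d. ?a < (\<Sum>v\<in>V. min (real (d v)) (real K))} = (\<integral>\<^sup>+d. indicator {d. ?a < (\<Sum>v\<in>V. min (real (d v)) (real K))} d \<partial>?P)"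
    by simp
  also have "\<dots> \<le> (\<integral>\<^sup>+d. ennreal (exp (- (?a / K))) * (\<Prod>v\<in>V. ennreal (exp (min (real (d v)) (real K) / K))) \<partial>?P)"
  proof (intro nn_integral_mono)
    fix d :: "nat \<Rightarrow> nat"
    have "indicator {d. ?a < (\<Sum>v\<in>V. min (real (d v)) (real K))} d \<le> exp (((\<Sum>v\<in>V. min (real (d v)) (real K)) - ?a) / K)"
      using K by (auto simp: indicator_def)
    also have "\<dots> = exp (- (?a / K)) * (\<Prod>v\<in>V. exp (min (real (d v)) (real K) / K))"
    proof -
      have "((\<Sum>v\<in>V. min (real (d v)) (real K)) - ?a) / K = - (?a / K) + (\<Sum>v\<in>V. min (real (d v)) (real K) / K)"
        by (simp add: diff_divide_distrib sum_divide_distrib)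
      then show ?thesis by (simp only: exp_add exp_sum[OF V(1)])
    qed
    finally have "indicator {d. ?a < (\<Sum>v\<in>V. min (real (d v)) (real K))} d \<le> exp (- (?a / K)) * (\<Prod>v\<in>V. exp (min (real (d v)) (real K) / K))" .
    then have "ennreal (indicator {d. ?a < (\<Sum>v\<in>V. min (real (d v)) (real K))} d) \<le> ennreal (exp (- (?a / K))) * (\<Prod>v\<in>V. ennreal (exp (min (real (d v)) (real K) / K)))"
      by (simp add: prod_ennreal ennreal_mult[symmetric] prod_nonneg ennreal_leI)
    then show "indicator {d. ?a < (\<Sum>v\<in>V. min (real (d v)) (real K))} d \<le> ennreal (exp (- (?a / K))) * (\<Prod>v\<in>V. ennreal (exp (min (real (d v)) (real K) / K)))"
      by (simp add: ennreal_indicator)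
  qed
  also have "\<dots> = ennreal (exp (- (?a / K))) * (\<Prod>v\<in>V. \<integral>\<^sup>+k. ennreal (exp (min (real k) (real K) / K)) \<partial>measure_pmf F)"
    by (subst nn_integral_cmult) (use nn_integral_prod_Pi_pmf[OF V(1), of 0 "\<lambda>_. F" "\<lambda>_ k. ennreal (exp (min (real k) (real K) / K))"] in simp_all)
  also have "\<dots> \<le> ennreal (exp (- (?a / K))) * (\<Prod>v\<in>V. ennreal (exp ?y))"
    by (intro mult_left_mono prod_mono_ennreal exp_truncated_moment K) auto
  also have "\<dots> = ennreal (exp (- (?a / K)) * exp (real (card V) * ?y))"
    by (simp add: ennreal_power ennreal_mult[symmetric] exp_of_nat_mult)
  also have "\<dots> \<le> ennreal (exp (- (?a / K)) * exp (real n * ?y))"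
    using V y by (intro ennreal_leI mult_left_mono iffD2[OF exp_le_cancel_iff] mult_right_mono) auto
  also have "exp (- (?a / K)) * exp (real n * ?y) = exp (- (t / K) + real n * (trunc_const * real K powr (1 - \<tau>)))"
    unfolding exp_add[symmetric] by (rule arg_cong[where f=exp]) (simp add: add_divide_distrib distrib_left)
  finally show ?thesis by (simp add: measure_pmf.emeasure_eq_measure)
qed

lemma degree_squares_tail:
  fixes V :: "nat set"
  assumes V: "finite V" "card V \<le> n" and K: "K \<ge> 1" and Q: "Q > 0"
  shows "measure (measure_pmf (Pi_pmf V 0 (\<lambda>_. F))) {d. Q < (\<Sum>v\<in>V. real (d v) * min (real (d v)) (real K))}
     \<le> real n * (trunc_const * real K powr (3 - \<tau>)) / Q"
proof -
  let ?P = "measure_pmf (Pi_pmf V 0 (\<lambda>_. F))"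
  let ?f = "\<lambda>k. real k * min (real k) (real K)"
  have "emeasure ?P {d. Q < (\<Sum>v\<in>V. ?f (d v))} = (\<integral>\<^sup>+d. indicator {d. Q < (\<Sum>v\<in>V. ?f (d v))} d \<partial>?P)"
    by simp
  also have "\<dots> \<le> (\<integral>\<^sup>+d. (\<Sum>v\<in>V. ennreal (1 / Q) * ennreal (?f (d v))) \<partial>?P)"
  proof (intro nn_integral_mono)
    fix d :: "nat \<Rightarrow> nat"
    have "indicator {d. Q < (\<Sum>v\<in>V. ?f (d v))} d \<le> (\<Sum>v\<in>V. 1 / Q * ?f (d v))"
      unfolding sum_distrib_left[symmetric] using Q
      by (auto simp: indicator_def le_divide_eq intro!: divide_nonneg_pos sum_nonneg simp del: sum_divide_distrib)
    then have "ennreal (indicator {d. Q < (\<Sum>v\<in>V. ?f (d v))} d) \<le> (\<Sum>v\<in>V. ennreal (1 / Q) * ennreal (?f (d v)))"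
      using Q by (simp add: ennreal_mult[symmetric] sum_ennreal ennreal_leI)
    then show "indicator {d. Q < (\<Sum>v\<in>V. ?f (d v))} d \<le> (\<Sum>v\<in>V. ennreal (1 / Q) * ennreal (?f (d v)))"
      by (simp add: ennreal_indicator)
  qed
  also have "\<dots> = (\<Sum>v\<in>V. ennreal (1 / Q) * (\<integral>\<^sup>+d. ennreal (?f (d v)) \<partial>?P))"
    by (simp add: nn_integral_sum nn_integral_cmult)
  also have "\<dots> = (\<Sum>v\<in>V. ennreal (1 / Q) * (\<integral>\<^sup>+k. ennreal (?f k) \<partial>measure_pmf F))"
  proof (intro sum.cong refl arg_cong2[where f="(*)"])
    fix v assume "v \<in> V"
    then have "measure_pmf F = measure_pmf (map_pmf (\<lambda>d. d v) (Pi_pmf V 0 (\<lambda>_. F)))"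
      using Pi_pmf_component[OF V(1), of v "0::nat" "\<lambda>_. F"] by simp
    then show "(\<integral>\<^sup>+d. ennreal (?f (d v)) \<partial>?P) = (\<integral>\<^sup>+k. ennreal (?f k) \<partial>measure_pmf F)" by simp
  qed
  also have "\<dots> \<le> (\<Sum>v\<in>V. ennreal (1 / Q) * ennreal (trunc_const * real K powr (3 - \<tau>)))"
    by (intro sum_mono mult_left_mono truncated_moment K) auto
  also have "\<dots> = ennreal (real (card V) * (trunc_const * real K powr (3 - \<tau>)) / Q)"
    using Q trunc_const_pos by (simp add: ennreal_of_nat_eq_real_of_nat ennreal_mult[symmetric])
  also have "\<dots> \<le> ennreal (real n * (trunc_const * real K powr (3 - \<tau>)) / Q)"
    using Q trunc_const_pos V by (intro ennreal_leI divide_right_mono mult_right_mono) auto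
  finally show ?thesis using Q trunc_const_pos by (simp add: measure_pmf.emeasure_eq_measure)
qed

lemma degree_max_tail:
  fixes V :: "nat set"
  assumes V: "finite V" "card V \<le> n" and K: "K \<ge> 1"
  shows "measure (measure_pmf (Pi_pmf V 0 (\<lambda>_. F))) {d. \<exists>v\<in>V. d v > K} \<le> real n * (c2 * real K powr (1 - \<tau>))"
proof -
  let ?P = "measure_pmf (Pi_pmf V 0 (\<lambda>_. F))"
  have "measure ?P {d. \<exists>v\<in>V. d v > K} = measure ?P (\<Union>v\<in>V. {d. d v > K})"
    by (rule arg_cong[where f="measure ?P"]) auto
  also have "\<dots> \<le> (\<Sum>v\<in>V. measure ?P {d. d v > K})"
    using V by (intro measure_pmf.finite_measure_subadditive_finite) auto
  also have "\<dots> \<le> (\<Sum>v\<in>V. c2 * real K powr (1 - \<tau>))"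
  proof (intro sum_mono)
    fix v assume "v \<in> V"
    then have "measure_pmf F = measure_pmf (map_pmf (\<lambda>d. d v) (Pi_pmf V 0 (\<lambda>_. F)))"
      using Pi_pmf_component[OF V(1), of v "0::nat" "\<lambda>_. F"] by simp
    then have "measure ?P {d. d v > K} = measure_pmf.prob F {k. real k > real K}" by (simp add: vimage_def)
    also have "\<dots> \<le> c2 * real K powr (- (\<tau> - 1))" using tail[rule_format, of "real K"] K by simp
    finally show "measure ?P {d. d v > K} \<le> c2 * real K powr (1 - \<tau>)" by simp
  qed
  also have "\<dots> \<le> real n * (c2 * real K powr (1 - \<tau>))"
    using V c by (simp add: mult_right_mono)
  finally show ?thesis .
qed

text \<open>A degree above \<open>K\<close>, a truncated sum above its mean by more than
  \<open>t\<close>, or too large a truncated sum of squares. The level \<open>Q / 4\<close> leaves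
  room for the factor \<open>4\<close> caused by the parity correction.\<close>

definition degree_error :: "nat \<Rightarrow> nat \<Rightarrow> real \<Rightarrow> real \<Rightarrow> real" where
  "degree_error n K t Q = real n * (c2 * real K powr (1 - \<tau>)) + exp (- (t / K) + real n * (trunc_const * real K powr (1 - \<tau>)))
     + real n * (trunc_const * real K powr (3 - \<tau>)) / (Q / 4)"

lemma degrees_regular:
  fixes V :: "nat set"
  assumes V: "finite V" "card V \<le> n" and K2: "K2 \<ge> 1" and Q: "Q > 0" and l: "real n * \<mu> + t + 2 * real K + 1 \<le> real l"
  shows "measure (measure_pmf (Pi_pmf V 0 (\<lambda>_. F))) {d. \<not> (2 * K + 1 + (\<Sum>v\<in>V. d v) \<le> l \<and> 4 * (\<Sum>v\<in>V. (real (d v))\<^sup>2) \<le> Q)}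
     \<le> degree_error n K2 t Q"
proof -
  let ?P = "measure_pmf (Pi_pmf V 0 (\<lambda>_. F))"
  let ?A = "{d. \<exists>v\<in>V. d v > K2}" and ?B = "{d. real n * \<mu> + t < (\<Sum>v\<in>V. min (real (d v)) (real K2))}"
    and ?C = "{d. Q / 4 < (\<Sum>v\<in>V. real (d v) * min (real (d v)) (real K2))}"
  have "{d. \<not> (2 * K + 1 + (\<Sum>v\<in>V. d v) \<le> l \<and> 4 * (\<Sum>v\<in>V. (real (d v))\<^sup>2) \<le> Q)} \<subseteq> (?A \<union> ?B) \<union> ?C"
  proof (rule ccontr)
    assume "\<not> ?thesis"
    then obtain d where d: "\<not> (2 * K + 1 + (\<Sum>v\<in>V. d v) \<le> l \<and> 4 * (\<Sum>v\<in>V. (real (d v))\<^sup>2) \<le> Q)"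
      "d \<notin> ?A" "d \<notin> ?B" "d \<notin> ?C" by blast
    have mn: "min (real (d v)) (real K2) = real (d v)" if "v \<in> V" for v using d(2) that by force
    have "(\<Sum>v\<in>V. min (real (d v)) (real K2)) = real (\<Sum>v\<in>V. d v)" using mn by simp
    then have "real (\<Sum>v\<in>V. d v) \<le> real n * \<mu> + t" using d(3) by simp
    then have "real (2 * K + 1 + (\<Sum>v\<in>V. d v)) \<le> real l" using l by (simp del: of_nat_sum)
    then have 1: "2 * K + 1 + (\<Sum>v\<in>V. d v) \<le> l" by (simp only: of_nat_le_iff)
    have "(\<Sum>v\<in>V. real (d v) * min (real (d v)) (real K2)) = (\<Sum>v\<in>V. (real (d v))\<^sup>2)"
      by (intro sum.cong refl) (simp add: mn power2_eq_square)
    then have "4 * (\<Sum>v\<in>V. (real (d v))\<^sup>2) \<le> Q" using d(4) by simp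
    with 1 d(1) show False by blast
  qed
  then have "measure ?P {d. \<not> (2 * K + 1 + (\<Sum>v\<in>V. d v) \<le> l \<and> 4 * (\<Sum>v\<in>V. (real (d v))\<^sup>2) \<le> Q)} \<le> measure ?P ((?A \<union> ?B) \<union> ?C)"
    by (intro measure_pmf.finite_measure_mono) auto
  also have "\<dots> \<le> (measure ?P ?A + measure ?P ?B) + measure ?P ?C"
    by (intro order_trans[OF measure_Un_le] add_right_mono measure_Un_le) auto
  also have "\<dots> \<le> degree_error n K2 t Q"
    unfolding degree_error_def using Q
    by (intro add_mono degree_max_tail degree_sum_tail degree_squares_tail V K2) auto
  finally show ?thesis .
qed

subsection \<open>Comparison with the ideal exploration\<close>

definition core_law :: "(real \<times> nat) set \<Rightarrow> real \<Rightarrow> nat \<Rightarrow> nat \<Rightarrow> ennreal" where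
  "core_law E \<epsilon> k m = (\<integral>\<^sup>+d0. \<integral>\<^sup>+d1. explore Fs m (\<lambda>_ t b. explore Fs m (\<lambda>_ t a. ennreal (core E \<epsilon> k t a b)) d1 t 0) d0 0 0
     \<partial>measure_pmf F \<partial>measure_pmf F)"

text \<open>The first term bounds the probability that a cluster stays at or below \<open>s0\<close>
  active stubs, the second that it exceeds \<open>K\<close>; here \<open>\<mu>\<close> is the mean
  initial degree.\<close>

definition size_error :: "nat \<Rightarrow> nat \<Rightarrow> nat \<Rightarrow> real" where
  "size_error m s0 K = exp (- (real m * (c1 / \<mu> * (real s0 + 1) powr (2 - \<tau>)))) + (\<mu> + real m * (trunc_const / \<mu> * real K powr (3 - \<tau>))) / real K"

lemma core_le_terminal:
  assumes cm: "\<And>a b. (\<lambda>\<tau>. core E \<epsilon> k \<tau> a b) \<in> borel_measurable borel" and K: "K \<ge> 1"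
  shows "core_law E \<epsilon> k m \<le> (\<integral>\<^sup>+d0. \<integral>\<^sup>+d1. explore Fs m (\<lambda>S1 t b. explore Fs m (terminal E \<epsilon> k s0 K S1 b) d1 t 0) d0 0 0
     \<partial>measure_pmf F \<partial>measure_pmf F) + ennreal (2 * size_error m s0 K)"
proof -
  define bad :: "nat \<Rightarrow> ennreal" where "bad = (\<lambda>S. (if real S \<le> real s0 then 1 else 0) + (if S > K then 1 else 0))"
  define e where "e = exp (- (real m * (c1 / \<mu> * (real s0 + 1) powr (2 - \<tau>))))"
  define q where "q = real m * (trunc_const / \<mu> * real K powr (3 - \<tau>))"
  have q: "q \<ge> 0" using trunc_const_pos \<mu>_ge2 by (simp add: q_def)
  define \<beta> where "\<beta> = (\<lambda>d::nat. ennreal e + (ennreal (1 / K) * of_nat d + ennreal (q / K)))"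
  note mt = measurable_terminal[OF cm]
  have bad: "explore Fs m (\<lambda>S _ _. bad S) d t a \<le> \<beta> d" if "d \<ge> 2" "t \<ge> 0" for d t a
  proof -
    have "explore Fs m (\<lambda>S _ _. bad S) d t a = explore Fs m (\<lambda>S _ _. if real S \<le> real s0 then 1 else 0) d t a + explore Fs m (\<lambda>S _ _. if S > K then 1 else 0) d t a"
      unfolding bad_def by (rule explore_add) auto
    also have "\<dots> \<le> ennreal e + ennreal ((real d + q) / K)"
    proof (rule add_mono)
      have "explore Fs m (\<lambda>S _ _. if real S \<le> real s0 then 1 else 0) d t a \<le> ennreal (measure_pmf.prob Fs {k. real k \<le> real s0 + 1}) ^ m"
        using that by (intro explore_small) auto
      also have "\<dots> = ennreal (measure_pmf.prob Fs {k. real k \<le> real s0 + 1} ^ m)" by (simp add: ennreal_power)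
      also have "\<dots> \<le> ennreal e" unfolding e_def by (intro ennreal_leI small_prob_le_exp) auto
      finally show "explore Fs m (\<lambda>S _ _. if real S \<le> real s0 then 1 else 0) d t a \<le> ennreal e" .
      show "explore Fs m (\<lambda>S _ _. if S > K then 1 else 0) d t a \<le> ennreal ((real d + q) / K)"
        unfolding q_def using that K by (intro explore_large) auto
    qed
    also have "ennreal ((real d + q) / K) = ennreal (1 / K) * of_nat d + ennreal (q / K)"
      unfolding ennreal_of_nat_eq_real_of_nat using q by (simp add: ennreal_mult[symmetric] add_divide_distrib)
    finally show ?thesis by (simp add: \<beta>_def)
  qed
  have pt: "ennreal (core E \<epsilon> k t a b) \<le> terminal E \<epsilon> k s0 K S1 b S t a + (bad S1 + bad S)" for t a b S1 S
  proof (cases "s0 \<le> S1 \<and> S1 \<le> K \<and> s0 \<le> S \<and> S \<le> K")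
    case True
    then show ?thesis by (simp add: terminal_def window_def)
  next
    case False
    then have "bad S1 \<ge> 1 \<or> bad S \<ge> 1" by (auto simp: bad_def)
    then have "1 \<le> bad S1 + bad S" using add_increasing add_increasing2 zero_le by metis
    then show ?thesis using core_bounds(2)[of E \<epsilon> k t a b]
      by (metis add_increasing ennreal_le_1 order_trans zero_le)
  qed
  let ?T = "\<lambda>d1 S1 t b. explore Fs m (terminal E \<epsilon> k s0 K S1 b) d1 t 0"
  have inner: "explore Fs m (\<lambda>_ t a. ennreal (core E \<epsilon> k t a b)) d1 t 0 \<le> ?T d1 S1 t b + (bad S1 + \<beta> d1)"
    if "d1 \<ge> 2" "t \<ge> 0" for d1 t b S1
  proof -
    have "explore Fs m (\<lambda>_ t a. ennreal (core E \<epsilon> k t a b)) d1 t 0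
      \<le> explore Fs m (\<lambda>S t a. terminal E \<epsilon> k s0 K S1 b S t a + (bad S1 + bad S)) d1 t 0"
      by (rule explore_mono) (rule pt)
    also have "\<dots> = ?T d1 S1 t b + explore Fs m (\<lambda>S t a. bad S1 + bad S) d1 t 0"
      using mt by (intro explore_add) auto
    also have "explore Fs m (\<lambda>S t a. bad S1 + bad S) d1 t 0 = explore Fs m (\<lambda>S t a. bad S1) d1 t 0 + explore Fs m (\<lambda>S t a. bad S) d1 t 0"
      by (rule explore_add) auto
    also have "?T d1 S1 t b + (explore Fs m (\<lambda>S t a. bad S1) d1 t 0 + explore Fs m (\<lambda>S t a. bad S) d1 t 0) \<le> ?T d1 S1 t b + (bad S1 + \<beta> d1)"
      using that by (intro add_left_mono add_mono bad explore_const_le) auto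
    finally show ?thesis .
  qed
  have outer: "explore Fs m (\<lambda>_ t b. explore Fs m (\<lambda>_ t a. ennreal (core E \<epsilon> k t a b)) d1 t 0) d0 0 0
     \<le> explore Fs m (\<lambda>S1 t b. ?T d1 S1 t b) d0 0 0 + (\<beta> d0 + \<beta> d1)" if d: "d0 \<ge> 2" "d1 \<ge> 2" for d0 d1
  proof -
    have "explore Fs m (\<lambda>_ t b. explore Fs m (\<lambda>_ t a. ennreal (core E \<epsilon> k t a b)) d1 t 0) d0 0 0
      \<le> explore Fs m (\<lambda>S1 t b. ?T d1 S1 t b + (bad S1 + \<beta> d1)) d0 0 0"
      using d inner by (intro explore_mono_pos) auto
    also have "\<dots> = explore Fs m (\<lambda>S1 t b. ?T d1 S1 t b) d0 0 0 + explore Fs m (\<lambda>S1 _ _. bad S1 + \<beta> d1) d0 0 0"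
      by (rule explore_add) (use measurable_explore[OF mt] in auto)
    also have "explore Fs m (\<lambda>S1 _ _. bad S1 + \<beta> d1) d0 0 0 = explore Fs m (\<lambda>S _ _. bad S) d0 0 0 + explore Fs m (\<lambda>_ _ _. \<beta> d1) d0 0 0"
      by (rule explore_add) auto
    also have "explore Fs m (\<lambda>S1 t b. ?T d1 S1 t b) d0 0 0 + (explore Fs m (\<lambda>S _ _. bad S) d0 0 0 + explore Fs m (\<lambda>_ _ _. \<beta> d1) d0 0 0)
       \<le> explore Fs m (\<lambda>S1 t b. ?T d1 S1 t b) d0 0 0 + (\<beta> d0 + \<beta> d1)"
      using d by (intro add_left_mono add_mono bad explore_const_le) auto
    finally show ?thesis .
  qed
  have "core_law E \<epsilon> k m \<le> (\<integral>\<^sup>+d0. \<integral>\<^sup>+d1. explore Fs m (\<lambda>S1 t b. ?T d1 S1 t b) d0 0 0 + (\<beta> d0 + \<beta> d1) \<partial>measure_pmf F \<partial>measure_pmf F)"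
    unfolding core_law_def by (rule F_integral_mono2) (rule outer)
  also have "\<dots> = (\<integral>\<^sup>+d0. \<integral>\<^sup>+d1. explore Fs m (\<lambda>S1 t b. ?T d1 S1 t b) d0 0 0 \<partial>measure_pmf F \<partial>measure_pmf F)
      + ((\<integral>\<^sup>+d. \<beta> d \<partial>measure_pmf F) + (\<integral>\<^sup>+d. \<beta> d \<partial>measure_pmf F))"
    by (simp add: nn_integral_add measure_pmf.emeasure_space_1)
  also have "(\<integral>\<^sup>+d. \<beta> d \<partial>measure_pmf F) = ennreal e + (ennreal (1 / K) * ennreal \<mu> + ennreal (q / K))"
    unfolding \<beta>_def by (simp add: nn_integral_add nn_integral_cmult mean_F measure_pmf.emeasure_space_1)
  also have "\<dots> = ennreal (size_error m s0 K)"
  proof -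
    have "ennreal (1 / K) * ennreal \<mu> = ennreal (\<mu> / K)" using \<mu>_ge2 by (simp add: ennreal_mult[symmetric])
    moreover have "e \<ge> 0" by (simp add: e_def)
    moreover have "size_error m s0 K = e + (\<mu> / K + q / K)" by (simp add: size_error_def e_def q_def add_divide_distrib)
    ultimately show ?thesis using q \<mu>_ge2 by (simp flip: ennreal_plus)
  qed
  also have "ennreal (size_error m s0 K) + ennreal (size_error m s0 K) = ennreal (2 * size_error m s0 K)"
    using q \<mu>_ge2 by (simp add: size_error_def q_def flip: ennreal_plus)
  finally show ?thesis .
qed

text \<open>The sources of loss are the mass missing in \<open>2 * m\<close> picks, irregular
  degrees, too many edges or too much time in the late phase, its failure to collide, and a size
  outside the window for either cluster.\<close>

definition total_error where
  "total_error n m s s0 K K2 l M k \<epsilon> t Q =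
     2 * real m * (1 - real (n - 2 * m - 3) * \<mu> / real (l + 4 * m))
     + (degree_error n K2 t Q + real M * (Q / (real n / 4 * real s * real k) + 1 / (real s * \<epsilon>)) + (1 - real s0 / real l) ^ M)
     + 2 * size_error m s0 K"

lemma core_law_le_CM:
  assumes E: "E \<in> sets (borel \<Otimes>\<^sub>M count_space UNIV)"
    and cm: "\<And>a b. (\<lambda>\<tau>. core E \<epsilon> k \<tau> a b) \<in> borel_measurable borel"
    and par: "s \<ge> 1" "k \<ge> 1" "\<epsilon> > 0" "Q > 0" "s + 2 * M \<le> s0" "real n / 4 + 2 * real M \<le> real (n - 2 * m - 3)" "s0 \<le> l"
      "K \<ge> 1" "K2 \<ge> 1" "t \<ge> 0" "real n * \<mu> + t + 2 * real K + 1 \<le> real l" "2 * m + 3 \<le> n"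
  shows "core_law E \<epsilon> k m \<le> emeasure (CM_FPP F n) (CM_event F n E) + ennreal (total_error n m s s0 K K2 l M k \<epsilon> t Q)"
proof -
  define N where "N = n - 2 * m - 3"
  define \<gamma> where "\<gamma> = real N * \<mu> / real (l + 4 * m)"
  define err where "err = degree_error n K2 t Q + real M * (Q / (real n / 4 * real s * real k) + 1 / (real s * \<epsilon>)) + (1 - real s0 / real l) ^ M"
  define y where "y = (\<integral>\<^sup>+d0. \<integral>\<^sup>+d1. explore Fs m (\<lambda>S1 t b. explore Fs m (terminal E \<epsilon> k s0 K S1 b) d1 t 0) d0 0 0
     \<partial>measure_pmf F \<partial>measure_pmf F)"
  let ?p = "emeasure (CM_FPP F n) (CM_event F n E)"
  have tc: "trunc_const > 0" by (rule trunc_const_pos)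
  have l: "real l > 0" using par \<mu>_ge2 by (smt (verit) mult_nonneg_nonneg of_nat_0_le_iff)
  have L: "real N * \<mu> \<le> real (l + 4 * m)"
  proof -
    have "real N * \<mu> \<le> real n * \<mu>" using \<mu>_ge2 by (intro mult_right_mono) (auto simp: N_def)
    also have "\<dots> \<le> real l" using par(10,11) by linarith
    finally show ?thesis by simp
  qed
  have \<gamma>: "0 \<le> \<gamma>" "\<gamma> \<le> 1" using L l \<mu>_ge2 by (auto simp: \<gamma>_def divide_le_eq)
  have err0: "err \<ge> 0"
  proof -
    have "degree_error n K2 t Q \<ge> 0" using par tc c by (simp add: degree_error_def)
    moreover have "real M * (Q / (real n / 4 * real s * real k) + 1 / (real s * \<epsilon>)) \<ge> 0" using par by simp
    moreover have "(1 - real s0 / real l) ^ M \<ge> 0" using par(7) l by (intro zero_le_power) (simp add: divide_le_eq)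
    ultimately show ?thesis by (simp add: err_def)
  qed
  have phases: "ennreal \<gamma> ^ m * (ennreal \<gamma> ^ m *
      explore Fs m (\<lambda>S1 t a. explore Fs m (terminal E \<epsilon> k s0 K S1 a) d1 t 0) d0 0 0)
    \<le> ann F (n - 1) (l + 4 * m) {2..<n} ({0} \<times> {..<d0}) ({1} \<times> {..<d1}) (\<lambda>_. 0) E 0 + ennreal err"
    if "d0 \<ge> 2" "d1 \<ge> 2" for d0 d1
    unfolding \<gamma>_def
  proof (rule two_phase[OF E cm, where ?N1.0=N and ?n0.0="real n / 4" and n=n and M=M and s=s and Qm=Q and pb="degree_error n K2 t Q"])
    show "measure (measure_pmf (Pi_pmf V 0 (\<lambda>_. F))) {d. \<not> (2 * K + 1 + (\<Sum>v\<in>V. d v) \<le> l \<and> 4 * (\<Sum>v\<in>V. (real (d v))\<^sup>2) \<le> Q)} \<le> degree_error n K2 t Q"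
      if "finite V" "card V \<le> n" for V :: "nat set"
      by (rule degrees_regular[OF that par(9,4,11)])
    show "err = degree_error n K2 t Q + real M * (Q / (real n / 4 * real s * real k) + 1 / (real s * \<epsilon>)) + (1 - real s0 / real l) ^ M"
      by (fact err_def)
  qed (use par that L l F_ge2 Fs mean_F in \<open>auto simp: N_def\<close>)
  have "ennreal \<gamma> ^ m * (ennreal \<gamma> ^ m * y)
    = (\<integral>\<^sup>+d0. \<integral>\<^sup>+d1. ennreal \<gamma> ^ m * (ennreal \<gamma> ^ m *
      explore Fs m (\<lambda>S1 t a. explore Fs m (terminal E \<epsilon> k s0 K S1 a) d1 t 0) d0 0 0) \<partial>measure_pmf F \<partial>measure_pmf F)"
    unfolding y_def by (simp add: nn_integral_cmult)
  also have "\<dots> \<le> (\<integral>\<^sup>+d0. \<integral>\<^sup>+d1. ann F (n - 1) (l + 4 * m) {2..<n} ({0} \<times> {..<d0}) ({1} \<times> {..<d1}) (\<lambda>_. 0) E 0 + ennreal err \<partial>measure_pmf F \<partial>measure_pmf F)"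
    by (rule F_integral_mono2) (rule phases)
  also have "\<dots> = (\<integral>\<^sup>+d0. \<integral>\<^sup>+d1. ann F (n - 1) (l + 4 * m) {2..<n} ({0} \<times> {..<d0}) ({1} \<times> {..<d1}) (\<lambda>_. 0) E 0 \<partial>measure_pmf F \<partial>measure_pmf F) + ennreal err"
    by (simp add: nn_integral_add measure_pmf.emeasure_space_1)
  also have "\<dots> \<le> ?p + ennreal err"
    using par by (intro add_right_mono ann_le_CM[OF E]) auto
  finally have main: "ennreal \<gamma> ^ m * (ennreal \<gamma> ^ m * y) \<le> ?p + ennreal err" .
  have y1: "y \<le> 1"
  proof -
    have "y \<le> (\<integral>\<^sup>+d0. \<integral>\<^sup>+d1. 1 \<partial>measure_pmf F \<partial>measure_pmf F)"
      unfolding y_def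
    proof (rule F_integral_mono2)
      fix d0 d1 :: nat assume d: "d0 \<ge> 2" "d1 \<ge> 2"
      have "explore Fs m (\<lambda>S1 t b. explore Fs m (terminal E \<epsilon> k s0 K S1 b) d1 t 0) d0 0 0
        \<le> explore Fs m (\<lambda>_ t b. explore Fs m (\<lambda>_ t a. 1) d1 t 0) d0 0 0"
        by (intro explore_mono) (simp add: core_bounds terminal_def window_def)
      also have "\<dots> \<le> 1" using d by (simp add: explore_const)
      finally show "explore Fs m (\<lambda>S1 t b. explore Fs m (terminal E \<epsilon> k s0 K S1 b) d1 t 0) d0 0 0 \<le> 1" .
    qed
    then show ?thesis by (simp add: measure_pmf.emeasure_space_1)
  qed
  define g where "g = \<gamma> ^ (2 * m)"
  have g: "0 \<le> g" "g \<le> 1" using \<gamma> by (auto simp: g_def power_le_one)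
  have "1 - g \<le> 2 * real m * (1 - \<gamma>)"
    using Bernoulli_inequality[of "\<gamma> - 1" "2 * m"] \<gamma> by (simp add: g_def algebra_simps)
  \<comment> \<open>Splitting \<open>y \<le> 1\<close> turns the multiplicative loss
    \<open>g\<close> into an additive one, bounded by Bernoulli's inequality, without division by
    \<open>g\<close>.\<close>
  have "y = ennreal g * y + ennreal (1 - g) * y"
    using g by (simp add: distrib_right[symmetric] flip: ennreal_plus)
  also have "\<dots> \<le> (?p + ennreal err) + ennreal (2 * real m * (1 - \<gamma>)) * 1"
  proof (intro add_mono mult_mono)
    have "ennreal g * y = ennreal \<gamma> ^ m * (ennreal \<gamma> ^ m * y)"
      using \<gamma> by (simp add: g_def mult_2 power_add ennreal_mult ennreal_power mult.assoc)
    then show "ennreal g * y \<le> ?p + ennreal err" using main by simp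
  qed (use \<open>1 - g \<le> _\<close> y1 in \<open>auto intro: ennreal_leI\<close>)
  finally have y: "y \<le> (?p + ennreal err) + ennreal (2 * real m * (1 - \<gamma>))" by simp
  have se: "size_error m s0 K \<ge> 0" using tc \<mu>_ge2 by (simp add: size_error_def)
  have "core_law E \<epsilon> k m \<le> y + ennreal (2 * size_error m s0 K)"
    unfolding y_def by (rule core_le_terminal[OF cm par(8)])
  also have "\<dots> \<le> ((?p + ennreal err) + ennreal (2 * real m * (1 - \<gamma>))) + ennreal (2 * size_error m s0 K)"
    using y by (rule add_right_mono)
  also have "\<dots> = ?p + ((ennreal err + ennreal (2 * real m * (1 - \<gamma>))) + ennreal (2 * size_error m s0 K))"
    by (simp add: add.assoc)
  also have "(ennreal err + ennreal (2 * real m * (1 - \<gamma>))) + ennreal (2 * size_error m s0 K)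
     = ennreal (err + 2 * real m * (1 - \<gamma>) + 2 * size_error m s0 K)"
    using err0 \<gamma> se by (simp flip: ennreal_plus)
  also have "err + 2 * real m * (1 - \<gamma>) + 2 * size_error m s0 K = total_error n m s s0 K K2 l M k \<epsilon> t Q"
    by (simp add: total_error_def err_def \<gamma>_def N_def)
  finally show ?thesis .
qed

end

subsection \<open>Choice of the parameters\<close>

context heavy_tail begin

text \<open>The growth exponent: after \<open>j\<close> steps a cluster has about
  \<open>j powr inv_gap\<close> active stubs.\<close>

definition inv_gap :: real where "inv_gap = 1 / (\<tau> - 2)"

lemma inv_gap: "inv_gap > 0" "inv_gap * (\<tau> - 2) = 1" using \<tau> by (auto simp: inv_gap_def)

text \<open>With \<open>b = n powr (1 / (\<tau> - 1))\<close>, the order of the largest degree, and \<open>\<omega>\<close> a small power of \<open>ln n\<close>, this is the monomial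
  \<open>b powr x * \<omega> powr y\<close>; in particular \<open>mon (\<tau> - 1) 0 n = n\<close>.\<close>

definition mon :: "real \<Rightarrow> real \<Rightarrow> nat \<Rightarrow> real" where
  "mon x y n = real n powr (x / (\<tau> - 1)) * ln (real n) powr (y / (12 + 12 * inv_gap))"

lemma mon_mult: "mon x y n * mon x' y' n = mon (x + x') (y + y') n"
  by (simp add: mon_def add_divide_distrib powr_add)

lemma mon_divide: "mon x y n / mon x' y' n = mon (x - x') (y - y') n"
  by (simp add: mon_def diff_divide_distrib powr_diff)

lemma mon_powr: "mon x y n powr z = mon (x * z) (y * z) n"
  by (simp add: mon_def powr_mult powr_powr)

lemma mon_n: "n \<ge> 3 \<Longrightarrow> mon (\<tau> - 1) 0 n = real n"
  using \<tau> by (simp add: mon_def)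

lemma mon_00: "n \<ge> 3 \<Longrightarrow> mon 0 0 n = 1"
  by (simp add: mon_def)

lemma mon_pos: "n \<ge> 3 \<Longrightarrow> mon x y n > 0"
  by (simp add: mon_def)

lemma mon_nonneg: "mon x y n \<ge> 0"
  by (simp add: mon_def)

lemma mon_lim:
  assumes "x < 0 \<or> x = 0 \<and> y < 0"
  shows "mon x y \<longlonglongrightarrow> 0"
proof -
  define c where "c = y / (12 + 12 * inv_gap)"
  have c: "c < 0 \<longleftrightarrow> y < 0" using inv_gap by (simp add: c_def divide_less_0_iff)
  define a where "a = x / (\<tau> - 1)"
  from assms show ?thesis
  proof
    assume "x < 0"
    then have "a < 0" using \<tau> by (simp add: a_def divide_less_0_iff)
    then have "(\<lambda>n. real n powr a * ln (real n) powr c) \<longlonglongrightarrow> 0" by real_asymp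
    then show ?thesis by (simp add: mon_def[abs_def] a_def c_def)
  next
    assume *: "x = 0 \<and> y < 0"
    then have "c < 0" using c by simp
    then have "(\<lambda>n. ln (real n) powr c) \<longlonglongrightarrow> 0" by real_asymp
    moreover have "eventually (\<lambda>n. ln (real n) powr c = mon x y n) sequentially"
      using eventually_ge_at_top[of 3] by eventually_elim (use * in \<open>simp add: mon_def c_def\<close>)
    ultimately show ?thesis by (rule Lim_transform_eventually)
  qed
qed

lemma mon_less:
  assumes "x < x' \<or> x = x' \<and> y < y'" "c > 0"
  shows "eventually (\<lambda>n. mon x y n \<le> c * mon x' y' n) sequentially"
proof -
  have "mon (x - x') (y - y') \<longlonglongrightarrow> 0" by (rule mon_lim) (use assms in auto)
  then have "eventually (\<lambda>n. mon (x - x') (y - y') n < c) sequentially" using assms(2) order_tendstoD(2) by blast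
  with eventually_ge_at_top[of 3] show ?thesis
  proof eventually_elim
    case (elim n)
    have "mon x y n = mon (x - x') (y - y') n * mon x' y' n" by (simp add: mon_mult)
    also have "\<dots> \<le> c * mon x' y' n" using elim by (intro mult_right_mono mon_nonneg) auto
    finally show ?case .
  qed
qed

lemma mon_at_top:
  assumes "0 < x \<or> x = 0 \<and> 0 < y"
  shows "filterlim (mon x y) at_top sequentially"
proof -
  have "filterlim (\<lambda>n. inverse (mon (- x) (- y) n)) at_top sequentially"
  proof (rule filterlim_inverse_at_top[OF mon_lim])
    show "eventually (\<lambda>n. 0 < mon (- x) (- y) n) sequentially"
      using eventually_ge_at_top[of 3] by eventually_elim (rule mon_pos)
  qed (use assms in auto)
  then show ?thesis by (simp add: mon_def[abs_def] powr_minus)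
qed

text \<open>Since \<open>b powr (\<tau> - 1) = n\<close>, the order
  \<open>b powr (\<tau> - 2)\<close> equals \<open>n / b\<close>. The factor
  \<open>1 / \<omega>\<close> makes the thinning loss vanish and brings typical cluster sizes to
  \<open>b / \<omega> powr inv_gap\<close>, strictly between the window ends \<open>s0_par\<close>
  and \<open>K_par\<close>.\<close>

definition "m_par n = nat \<lfloor>mon (\<tau> - 2) (- 1) n\<rfloor>"
definition "s0_par n = nat \<lceil>mon 1 (- 2 * inv_gap) n\<rceil>"
definition "K_par n = nat \<lceil>mon 1 0 n\<rceil>"
text \<open>Slightly above the order of the largest degree, and slightly below the margin of order
  \<open>b * \<omega> powr (1/2)\<close> in \<open>l_par\<close>, so that the Chernoff bound for the
  degree sum tends to zero.\<close>

definition "K2_par n = nat \<lceil>mon 1 (1/4) n\<rceil>"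
definition "l_par n = nat \<lceil>real n * \<mu> + mon 1 (1/2) n\<rceil>"
text \<open>Chosen such that \<open>M * s0 / n\<close> is of order \<open>\<omega> powr 2\<close>:
  with that many attempts, each hitting the other cluster with probability at least about
  \<open>s0 / l\<close>, the clusters collide with high probability.\<close>

definition "M_par n = nat \<lceil>mon (\<tau> - 2) (2 + 2 * inv_gap) n\<rceil>"
text \<open>Chosen such that the mean number of edges added in the late phase is of order
  \<open>k / \<omega>\<close>. The denominator in \<open>mon\<close> is three times this exponent,
  so that \<open>k\<close> is of order \<open>ln n powr (1/3)\<close> and negligible against the
  square root of \<open>ln n\<close>.\<close>

definition "k_par n = nat \<lceil>mon 0 (4 + 4 * inv_gap) n\<rceil>"

lemma nat_ceiling_bounds:
  fixes x :: real
  assumes "x \<ge> 1"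
  shows "x \<le> real (nat \<lceil>x\<rceil>)" "real (nat \<lceil>x\<rceil>) \<le> x + 1" "real (nat \<lceil>x\<rceil>) \<le> 2 * x"
  using assms by linarith+

lemma mon_ge1: "0 < x \<or> x = 0 \<and> 0 < y \<Longrightarrow> eventually (\<lambda>n. mon x y n \<ge> 1) sequentially"
  using mon_at_top[of x y] by (auto simp: filterlim_at_top)

lemma par_bounds:
  "eventually (\<lambda>n. n \<ge> 3 \<and> mon (\<tau> - 2) (- 1) n / 2 \<le> real (m_par n) \<and> real (m_par n) \<le> mon (\<tau> - 2) (- 1) n
     \<and> mon (\<tau> - 2) (- 1) n \<ge> 1
     \<and> mon 1 (- 2 * inv_gap) n \<le> real (s0_par n) \<and> real (s0_par n) + 1 \<le> 3 * mon 1 (- 2 * inv_gap) n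
     \<and> mon 1 (- 2 * inv_gap) n / 4 \<le> real (s0_par n div 2)) sequentially"
  "eventually (\<lambda>n. mon 1 0 n \<ge> 1 \<and> mon 1 0 n \<le> real (K_par n) \<and> real (K_par n) \<le> 2 * mon 1 0 n
     \<and> mon 1 (1/4) n \<le> real (K2_par n) \<and> real (K2_par n) \<le> 2 * mon 1 (1/4) n
     \<and> real n * \<mu> + mon 1 (1/2) n \<le> real (l_par n) \<and> real (l_par n) \<le> real n * \<mu> + mon 1 (1/2) n + 1
     \<and> mon (\<tau> - 2) (2 + 2 * inv_gap) n \<le> real (M_par n) \<and> real (M_par n) \<le> 2 * mon (\<tau> - 2) (2 + 2 * inv_gap) n
     \<and> mon 0 (4 + 4 * inv_gap) n \<le> real (k_par n) \<and> real (k_par n) \<le> 2 * mon 0 (4 + 4 * inv_gap) n) sequentially"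
proof -
  have p: "\<tau> - 2 > 0" "inv_gap > 0" using \<tau> inv_gap by auto
  have "eventually (\<lambda>n. mon (\<tau> - 2) (- 1) n \<ge> 2) sequentially" "eventually (\<lambda>n. mon 1 (- 2 * inv_gap) n \<ge> 4) sequentially"
    using mon_at_top p by (auto simp: filterlim_at_top)
  with eventually_ge_at_top[of 3] show "eventually (\<lambda>n. n \<ge> 3 \<and> mon (\<tau> - 2) (- 1) n / 2 \<le> real (m_par n) \<and> real (m_par n) \<le> mon (\<tau> - 2) (- 1) n
     \<and> mon (\<tau> - 2) (- 1) n \<ge> 1
     \<and> mon 1 (- 2 * inv_gap) n \<le> real (s0_par n) \<and> real (s0_par n) + 1 \<le> 3 * mon 1 (- 2 * inv_gap) n
     \<and> mon 1 (- 2 * inv_gap) n / 4 \<le> real (s0_par n div 2)) sequentially"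
  proof eventually_elim
    case (elim n)
    have "mon (\<tau> - 2) (- 1) n / 2 \<le> real (m_par n)" "real (m_par n) \<le> mon (\<tau> - 2) (- 1) n"
      using elim(2) unfolding m_par_def by linarith+
    moreover have s0: "mon 1 (- 2 * inv_gap) n \<le> real (s0_par n)" "real (s0_par n) \<le> mon 1 (- 2 * inv_gap) n + 1"
      using elim(3) unfolding s0_par_def by linarith+
    moreover have "real (s0_par n div 2) \<ge> real (s0_par n) / 2 - 1 / 2" by linarith
    ultimately show ?case using elim by linarith
  qed
  have 1: "eventually (\<lambda>n. mon 1 0 n \<ge> 1) sequentially" "eventually (\<lambda>n. mon 1 (1/4) n \<ge> 1) sequentially"
    "eventually (\<lambda>n. mon 1 (1/2) n \<ge> 1) sequentially" "eventually (\<lambda>n. mon (\<tau> - 2) (2 + 2 * inv_gap) n \<ge> 1) sequentially"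
    "eventually (\<lambda>n. mon 0 (4 + 4 * inv_gap) n \<ge> 1) sequentially"
    by (rule mon_ge1; use p in simp)+
  then show "eventually (\<lambda>n. mon 1 0 n \<ge> 1 \<and> mon 1 0 n \<le> real (K_par n) \<and> real (K_par n) \<le> 2 * mon 1 0 n
     \<and> mon 1 (1/4) n \<le> real (K2_par n) \<and> real (K2_par n) \<le> 2 * mon 1 (1/4) n
     \<and> real n * \<mu> + mon 1 (1/2) n \<le> real (l_par n) \<and> real (l_par n) \<le> real n * \<mu> + mon 1 (1/2) n + 1
     \<and> mon (\<tau> - 2) (2 + 2 * inv_gap) n \<le> real (M_par n) \<and> real (M_par n) \<le> 2 * mon (\<tau> - 2) (2 + 2 * inv_gap) n
     \<and> mon 0 (4 + 4 * inv_gap) n \<le> real (k_par n) \<and> real (k_par n) \<le> 2 * mon 0 (4 + 4 * inv_gap) n) sequentially"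
  proof eventually_elim
    case (elim n)
    have "real n * \<mu> + mon 1 (1/2) n \<ge> 1" using elim(3) \<mu>_ge2 by (simp add: add_increasing)
    then show ?case
      unfolding K_par_def K2_par_def l_par_def M_par_def k_par_def using elim
      by (intro conjI nat_ceiling_bounds)
  qed
qed

lemma par_conditions:
  "eventually (\<lambda>n. s0_par n div 2 \<ge> 1 \<and> k_par n \<ge> 1 \<and> mon 0 (- 1) n > 0 \<and> mon 2 1 n > 0 \<and> s0_par n div 2 + 2 * M_par n \<le> s0_par n
     \<and> real n / 4 + 2 * real (M_par n) \<le> real (n - 2 * m_par n - 3) \<and> s0_par n \<le> l_par n \<and> K_par n \<ge> 1 \<and> K2_par n \<ge> 1
     \<and> mon 1 (1/2) n / 4 \<ge> 0 \<and> real n * \<mu> + mon 1 (1/2) n / 4 + 2 * real (K_par n) + 1 \<le> real (l_par n) \<and> 2 * m_par n + 3 \<le> n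
     \<and> real (l_par n) \<le> 2 * \<mu> * mon (\<tau> - 1) 0 n) sequentially"
proof -
  have p: "\<tau> - 2 > 0" "\<tau> < 3" "inv_gap > 0" using \<tau> inv_gap by auto
  have 1: "eventually (\<lambda>n. mon (\<tau> - 2) (2 + 2 * inv_gap) n \<le> (1/8) * mon 1 (- 2 * inv_gap) n) sequentially"
    "eventually (\<lambda>n. mon (\<tau> - 2) (2 + 2 * inv_gap) n \<le> (1/32) * mon (\<tau> - 1) 0 n) sequentially"
    "eventually (\<lambda>n. mon (\<tau> - 2) (- 1) n \<le> (1/32) * mon (\<tau> - 1) 0 n) sequentially"
    "eventually (\<lambda>n. mon 1 (- 2 * inv_gap) n \<le> (1/3) * mon (\<tau> - 1) 0 n) sequentially"
    "eventually (\<lambda>n. mon 1 0 n \<le> (1/10) * mon 1 (1/2) n) sequentially"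
    "eventually (\<lambda>n. mon 1 (1/2) n \<le> 1 * mon (\<tau> - 1) 0 n) sequentially"
    by (rule mon_less; use p in simp)+
  moreover have "eventually (\<lambda>n. mon 1 (- 2 * inv_gap) n \<ge> 4) sequentially"
    using mon_at_top[of 1 "- 2 * inv_gap"] by (auto simp: filterlim_at_top)
  moreover have "eventually (\<lambda>n. mon 1 (1/4) n \<ge> 1) sequentially" "eventually (\<lambda>n. mon 0 (4 + 4 * inv_gap) n \<ge> 1) sequentially"
    by (rule mon_ge1; use p in simp)+
  ultimately show ?thesis using par_bounds
  proof eventually_elim
    case (elim n)
    note pb = elim(10,11)
    have n: "n \<ge> 3" using pb by blast
    have \<mu>n: "real n \<le> real n * \<mu>" "real n * 2 \<le> real n * \<mu>" using \<mu>_ge2 by (auto simp: mult_le_cancel_left1 intro!: mult_left_mono)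
    note mn = mon_n[OF n]
    have M4: "4 * M_par n \<le> s0_par n"
    proof -
      have "4 * real (M_par n) \<le> real (s0_par n)" using elim(1) pb by linarith
      then show ?thesis by linarith
    qed
    have m3: "2 * m_par n + 3 \<le> n"
    proof -
      have "2 * real (m_par n) + 3 \<le> real n" using elim(3) pb mn by linarith
      then show ?thesis by linarith
    qed
    have "real (n - 2 * m_par n - 3) = real n - 2 * real (m_par n) - 3" using m3 by (simp add: of_nat_diff)
    moreover have "real n / 4 + 2 * real (M_par n) \<le> real n - 2 * real (m_par n) - 3"
      using elim(2,3) pb mn by linarith
    moreover have "s0_par n \<le> l_par n"
    proof -
      have "real (s0_par n) \<le> real (l_par n)" using elim(4) pb mn \<mu>n mon_nonneg[of 1 "1/2" n] by linarith
      then show ?thesis by linarith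
    qed
    moreover have "real n * \<mu> + mon 1 (1/2) n / 4 + 2 * real (K_par n) + 1 \<le> real (l_par n)"
      using elim(5) pb by linarith
    moreover have "real (l_par n) \<le> 2 * \<mu> * mon (\<tau> - 1) 0 n"
    proof -
      have "real n \<ge> 3" using n by simp
      moreover have "mon 1 (1/2) n \<le> real n" using elim(6) mn by simp
      moreover have "real (l_par n) \<le> real n * \<mu> + mon 1 (1/2) n + 1" using pb by blast
      ultimately have "real (l_par n) \<le> 2 * (real n * \<mu>)" using \<mu>n by linarith
      then show ?thesis using mn by (simp add: mult_ac)
    qed
    moreover have "real (K_par n) \<ge> 1" "real (K2_par n) \<ge> 1" "real (k_par n) \<ge> 1" "real (s0_par n div 2) \<ge> 1"
      using elim(7,8,9) pb by linarith+
    ultimately show ?case using M4 m3 mon_pos[OF n] mon_nonneg by auto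
  qed
qed

text \<open>Half of \<open>s0\<close> is the reserve consumed in the late phase. The delay is
  \<open>\<epsilon> = 1 / \<omega>\<close>, a quarter of the margin in \<open>l_par\<close> goes to
  the degree sum and the rest covers the clusters, and the squared degrees are bounded at level
  \<open>b powr 2 * \<omega>\<close>.\<close>

definition "\<delta>_par n = total_error n (m_par n) (s0_par n div 2) (s0_par n) (K_par n) (K2_par n) (l_par n) (M_par n) (k_par n)
   (mon 0 (- 1) n) (mon 1 (1/2) n / 4) (mon 2 1 n)"

lemma mon_exp_lim:
  assumes "y > 0" "c > 0"
  shows "(\<lambda>n. exp (- (c * mon 0 y n) )) \<longlonglongrightarrow> 0"
proof -
  have "filterlim (\<lambda>n. c * mon 0 y n) at_top sequentially"
    by (rule filterlim_tendsto_pos_mult_at_top[OF tendsto_const assms(2) mon_at_top]) (use assms in auto)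
  then show ?thesis
    by (intro filterlim_compose[OF exp_at_bot]) (simp add: filterlim_uminus_at_bot)
qed

lemma degree_error_lim: "(\<lambda>n. degree_error n (K2_par n) (mon 1 (1/2) n / 4) (mon 2 1 n)) \<longlonglongrightarrow> 0"
proof -
  let ?f = "\<lambda>n. c2 * mon 0 ((1 - \<tau>) / 4) n + exp (- (1/8 * mon 0 (1/4) n)) * exp (trunc_const * mon 0 ((1 - \<tau>) / 4) n)
     + 4 * trunc_const * 2 powr (3 - \<tau>) * mon 0 ((3 - \<tau>) / 4 - 1) n"
  have tc: "trunc_const > 0" by (rule trunc_const_pos)
  have c2: "c2 > 0" using c by simp
  show ?thesis
  proof (rule tendsto_sandwich[of "\<lambda>_. 0" _ _ ?f])
    show "eventually (\<lambda>n. 0 \<le> degree_error n (K2_par n) (mon 1 (1/2) n / 4) (mon 2 1 n)) sequentially"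
      using tc c2 by (intro always_eventually allI) (simp add: degree_error_def mon_nonneg)
    show "eventually (\<lambda>n. degree_error n (K2_par n) (mon 1 (1/2) n / 4) (mon 2 1 n) \<le> ?f n) sequentially"
      using par_bounds
    proof eventually_elim
      case (elim n)
      have n: "n \<ge> 3" using elim by blast
      have pos: "mon 1 (1/4) n > 0" "mon 2 1 n > 0" using mon_pos[OF n] by auto
      have K: "mon 1 (1/4) n \<le> real (K2_par n)" "real (K2_par n) \<le> 2 * mon 1 (1/4) n" using elim by auto
      have "real (K2_par n) powr (1 - \<tau>) \<le> mon 1 (1/4) n powr (1 - \<tau>)"
        using K pos \<tau> by (intro powr_mono2') auto
      then have "real n * real (K2_par n) powr (1 - \<tau>) \<le> mon (\<tau> - 1) 0 n * mon 1 (1/4) n powr (1 - \<tau>)"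
        unfolding mon_n[OF n] by (intro mult_left_mono) auto
      also have "\<dots> = mon 0 ((1 - \<tau>) / 4) n" by (simp add: mon_powr mon_mult)
      finally have a: "real n * real (K2_par n) powr (1 - \<tau>) \<le> mon 0 ((1 - \<tau>) / 4) n" .
      have "mon 1 (1/2) n / 4 / (2 * mon 1 (1/4) n) \<le> mon 1 (1/2) n / 4 / real (K2_par n)"
        using K pos by (intro divide_left_mono mult_pos_pos) (auto simp: mon_nonneg)
      moreover have "mon 1 (1/2) n / 4 / (2 * mon 1 (1/4) n) = 1/8 * (mon 1 (1/2) n / mon 1 (1/4) n)" by simp
      moreover have "mon 1 (1/2) n / mon 1 (1/4) n = mon 0 (1/4) n" by (simp add: mon_divide)
      ultimately have b: "1/8 * mon 0 (1/4) n \<le> mon 1 (1/2) n / 4 / real (K2_par n)" by simp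
      have "real (K2_par n) powr (3 - \<tau>) \<le> (2 * mon 1 (1/4) n) powr (3 - \<tau>)"
        using K \<tau> by (intro powr_mono2) auto
      then have "real n * real (K2_par n) powr (3 - \<tau>) \<le> mon (\<tau> - 1) 0 n * (2 * mon 1 (1/4) n) powr (3 - \<tau>)"
        unfolding mon_n[OF n] by (intro mult_left_mono) auto
      also have "\<dots> = 2 powr (3 - \<tau>) * (mon (\<tau> - 1) 0 n * mon 1 (1/4) n powr (3 - \<tau>))"
        using pos by (simp add: powr_mult)
      also have "mon (\<tau> - 1) 0 n * mon 1 (1/4) n powr (3 - \<tau>) = mon 2 ((3 - \<tau>) / 4) n" by (simp add: mon_powr mon_mult)
      finally have "real n * real (K2_par n) powr (3 - \<tau>) / mon 2 1 n \<le> 2 powr (3 - \<tau>) * mon 2 ((3 - \<tau>) / 4) n / mon 2 1 n"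
        using pos by (intro divide_right_mono) auto
      also have "\<dots> = 2 powr (3 - \<tau>) * (mon 2 ((3 - \<tau>) / 4) n / mon 2 1 n)" by simp
      also have "mon 2 ((3 - \<tau>) / 4) n / mon 2 1 n = mon 0 ((3 - \<tau>) / 4 - 1) n" by (simp add: mon_divide)
      finally have d: "real n * real (K2_par n) powr (3 - \<tau>) / mon 2 1 n \<le> 2 powr (3 - \<tau>) * mon 0 ((3 - \<tau>) / 4 - 1) n" .
      have "degree_error n (K2_par n) (mon 1 (1/2) n / 4) (mon 2 1 n)
        = c2 * (real n * real (K2_par n) powr (1 - \<tau>)) + exp (- (mon 1 (1/2) n / 4 / real (K2_par n)) + trunc_const * (real n * real (K2_par n) powr (1 - \<tau>)))
         + 4 * trunc_const * (real n * real (K2_par n) powr (3 - \<tau>) / mon 2 1 n)"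
        by (simp add: degree_error_def mult_ac)
      also have "\<dots> \<le> c2 * mon 0 ((1 - \<tau>) / 4) n + exp (- (1/8 * mon 0 (1/4) n) + trunc_const * mon 0 ((1 - \<tau>) / 4) n)
         + 4 * trunc_const * (2 powr (3 - \<tau>) * mon 0 ((3 - \<tau>) / 4 - 1) n)"
        using a b d tc c2 by (intro add_mono mult_left_mono iffD2[OF exp_le_cancel_iff]) auto
      finally show ?case unfolding exp_add by (simp only: mult.assoc)
    qed
    have l1: "mon 0 ((1 - \<tau>) / 4) \<longlonglongrightarrow> 0" "mon 0 ((3 - \<tau>) / 4 - 1) \<longlonglongrightarrow> 0" using \<tau> by (auto intro!: mon_lim)
    have "?f \<longlonglongrightarrow> c2 * 0 + 0 * exp (trunc_const * 0) + 4 * trunc_const * 2 powr (3 - \<tau>) * 0"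
      by (intro tendsto_intros l1 mon_exp_lim) auto
    then show "?f \<longlonglongrightarrow> 0" by simp
  qed simp
qed

text \<open>The exponent \<open>m * s0 powr (2 - \<tau>)\<close> has order \<open>\<omega>\<close>,
  and \<open>m * K powr (3 - \<tau>) / K\<close> has order \<open>1 / \<omega>\<close>.\<close>

lemma size_error_lim: "(\<lambda>n. size_error (m_par n) (s0_par n) (K_par n)) \<longlonglongrightarrow> 0"
proof -
  define a where "a = c1 / \<mu> * 3 powr (2 - \<tau>) / 2"
  have a: "a > 0" using c \<mu>_ge2 by (simp add: a_def)
  have tc: "trunc_const / \<mu> > 0" using trunc_const_pos \<mu>_ge2 by simp
  let ?f = "\<lambda>n. exp (- (a * mon 0 1 n)) + (\<mu> * mon (- 1) 0 n + trunc_const / \<mu> * 2 powr (3 - \<tau>) * mon 0 (- 1) n)"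
  show ?thesis
  proof (rule tendsto_sandwich[of "\<lambda>_. 0" _ _ ?f])
    show "eventually (\<lambda>n. 0 \<le> size_error (m_par n) (s0_par n) (K_par n)) sequentially"
      using trunc_const_pos \<mu>_ge2 by (intro always_eventually allI) (simp add: size_error_def)
    show "eventually (\<lambda>n. size_error (m_par n) (s0_par n) (K_par n) \<le> ?f n) sequentially"
      using par_bounds
    proof eventually_elim
      case (elim n)
      have n: "n \<ge> 3" using elim by blast
      let ?u = "mon (\<tau> - 2) (- 1) n" and ?v = "mon 1 (- 2 * inv_gap) n"
      have pos: "?v > 0" "mon 1 0 n > 0" using mon_pos[OF n] by auto
      have e1: "- 2 * inv_gap * (2 - \<tau>) = 2" using inv_gap(2) by (simp add: algebra_simps)
      have "(3 * ?v) powr (2 - \<tau>) \<le> (real (s0_par n) + 1) powr (2 - \<tau>)"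
        using elim \<tau> by (intro powr_mono2') auto
      then have "?u / 2 * (3 * ?v) powr (2 - \<tau>) \<le> real (m_par n) * (real (s0_par n) + 1) powr (2 - \<tau>)"
        using elim mon_nonneg by (intro mult_mono) auto
      moreover have "?u / 2 * (3 * ?v) powr (2 - \<tau>) = 3 powr (2 - \<tau>) / 2 * (?u * ?v powr (2 - \<tau>))"
        using pos by (simp add: powr_mult)
      moreover have "?u * ?v powr (2 - \<tau>) = mon 0 1 n" unfolding mon_powr e1 mon_mult by simp
      ultimately have "3 powr (2 - \<tau>) / 2 * mon 0 1 n \<le> real (m_par n) * (real (s0_par n) + 1) powr (2 - \<tau>)" by (simp only:)
      then have "c1 / \<mu> * (3 powr (2 - \<tau>) / 2 * mon 0 1 n) \<le> c1 / \<mu> * (real (m_par n) * (real (s0_par n) + 1) powr (2 - \<tau>))"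
        using c \<mu>_ge2 by (intro mult_left_mono) auto
      then have 1: "a * mon 0 1 n \<le> real (m_par n) * (c1 / \<mu> * (real (s0_par n) + 1) powr (2 - \<tau>))"
        by (simp add: a_def mult_ac)
      have "real (K_par n) powr (3 - \<tau>) \<le> (2 * mon 1 0 n) powr (3 - \<tau>)"
        using elim \<tau> by (intro powr_mono2) auto
      then have "real (m_par n) * (trunc_const / \<mu> * real (K_par n) powr (3 - \<tau>)) \<le> ?u * (trunc_const / \<mu> * (2 * mon 1 0 n) powr (3 - \<tau>))"
        using elim trunc_const_pos \<mu>_ge2 mon_nonneg by (intro mult_mono mult_left_mono) auto
      also have "\<dots> = trunc_const / \<mu> * 2 powr (3 - \<tau>) * (?u * mon 1 0 n powr (3 - \<tau>))"
        using pos by (simp add: powr_mult)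
      also have "?u * mon 1 0 n powr (3 - \<tau>) = mon 1 (- 1) n" by (simp add: mon_powr mon_mult)
      finally have "(\<mu> + real (m_par n) * (trunc_const / \<mu> * real (K_par n) powr (3 - \<tau>))) / real (K_par n)
         \<le> (\<mu> + trunc_const / \<mu> * 2 powr (3 - \<tau>) * mon 1 (- 1) n) / mon 1 0 n"
        using elim pos trunc_const_pos \<mu>_ge2 mon_nonneg by (intro frac_le) auto
      also have "\<dots> = \<mu> * (mon 0 0 n / mon 1 0 n) + trunc_const / \<mu> * 2 powr (3 - \<tau>) * (mon 1 (- 1) n / mon 1 0 n)"
        by (simp add: add_divide_distrib mon_00[OF n])
      also have "\<dots> = \<mu> * mon (- 1) 0 n + trunc_const / \<mu> * 2 powr (3 - \<tau>) * mon 0 (- 1) n"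
        by (simp add: mon_divide)
      finally show ?case unfolding size_error_def
        using 1 by (intro add_mono iffD2[OF exp_le_cancel_iff]) auto
    qed
    have "?f \<longlonglongrightarrow> 0 + (\<mu> * 0 + trunc_const / \<mu> * 2 powr (3 - \<tau>) * 0)"
      by (intro tendsto_intros mon_exp_lim a mon_lim) auto
    then show "?f \<longlonglongrightarrow> 0" by simp
  qed simp
qed

text \<open>The missing mass per pick is at most of order
  \<open>(b * \<omega> powr (1/2) + m) / n\<close>. Multiplied by \<open>m\<close> this is of order
  \<open>\<omega> powr (-1/2)\<close> plus a negative power of \<open>n\<close> up to
  logarithms.\<close>

lemma thinning_error_lim: "(\<lambda>n. 2 * real (m_par n) * (1 - real (n - 2 * m_par n - 3) * \<mu> / real (l_par n + 4 * m_par n))) \<longlonglongrightarrow> 0"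
proof -
  let ?f = "\<lambda>n. 2 * mon 0 (- (1/2)) n + (10 + 10 * \<mu>) * mon (\<tau> - 3) (- 2) n"
  show ?thesis
  proof (rule tendsto_sandwich[of "\<lambda>_. 0" _ _ ?f])
    show "eventually (\<lambda>n. 2 * real (m_par n) * (1 - real (n - 2 * m_par n - 3) * \<mu> / real (l_par n + 4 * m_par n)) \<le> ?f n) sequentially"
      using par_bounds par_conditions
    proof eventually_elim
      case (elim n)
      let ?u = "mon (\<tau> - 2) (- 1) n"
      have n: "n \<ge> 3" using elim by blast
      have N: "real (n - 2 * m_par n - 3) = real n - 2 * real (m_par n) - 3" using elim by (simp add: of_nat_diff)
      let ?L = "real (l_par n + 4 * m_par n)"
      have u: "real (m_par n) \<le> ?u" "1 \<le> ?u" using elim by auto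
      have nL: "real n \<le> ?L"
      proof -
        have "real n * 1 \<le> real n * \<mu>" using \<mu>_ge2 by (intro mult_left_mono) auto
        moreover have "real n * \<mu> + mon 1 (1/2) n \<le> real (l_par n)" using elim by blast
        ultimately have "real n \<le> real (l_par n)" using mon_nonneg[of 1 "1/2" n] by linarith
        then show ?thesis by simp
      qed
      have L: "?L > 0" using nL n by linarith
      have um: "real (m_par n) * \<mu> \<le> ?u * \<mu>" "\<mu> \<le> ?u * \<mu>" using u \<mu>_ge2 by (auto intro: mult_right_mono)
      have "?L - real (n - 2 * m_par n - 3) * \<mu> = (real (l_par n) - real n * \<mu>) + 4 * real (m_par n) + 2 * (real (m_par n) * \<mu>) + 3 * \<mu>"
        unfolding N by (simp add: algebra_simps)
      also have "\<dots> \<le> mon 1 (1/2) n + (5 + 5 * \<mu>) * ?u"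
      proof -
        have "real (l_par n) \<le> real n * \<mu> + mon 1 (1/2) n + 1" using elim by blast
        moreover have "(5 + 5 * \<mu>) * ?u = 5 * ?u + 5 * (?u * \<mu>)" by (simp add: algebra_simps)
        ultimately show ?thesis using u um by linarith
      qed
      finally have d: "?L - real (n - 2 * m_par n - 3) * \<mu> \<le> mon 1 (1/2) n + (5 + 5 * \<mu>) * ?u" .
      have "1 - real (n - 2 * m_par n - 3) * \<mu> / ?L = (?L - real (n - 2 * m_par n - 3) * \<mu>) / ?L"
        using L by (simp add: diff_divide_distrib)
      also have "\<dots> \<le> (mon 1 (1/2) n + (5 + 5 * \<mu>) * ?u) / real n"
        using d nL n mon_nonneg u \<mu>_ge2 by (intro frac_le) auto
      finally have "2 * real (m_par n) * (1 - real (n - 2 * m_par n - 3) * \<mu> / ?L) \<le> 2 * ?u * ((mon 1 (1/2) n + (5 + 5 * \<mu>) * ?u) / real n)"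
        using u n mon_nonneg \<mu>_ge2 by (intro order_trans[OF mult_left_mono mult_right_mono]) auto
      also have "\<dots> = 2 * (?u * mon 1 (1/2) n / mon (\<tau> - 1) 0 n) + (10 + 10 * \<mu>) * (?u * ?u / mon (\<tau> - 1) 0 n)"
        unfolding mon_n[OF n] by (simp add: algebra_simps add_divide_distrib)
      also have "\<dots> = ?f n" unfolding mon_mult mon_divide by simp
      finally show ?case .
    qed
    show "eventually (\<lambda>n. 0 \<le> 2 * real (m_par n) * (1 - real (n - 2 * m_par n - 3) * \<mu> / real (l_par n + 4 * m_par n))) sequentially"
      using par_bounds par_conditions
    proof eventually_elim
      case (elim n)
      have "real (n - 2 * m_par n - 3) * \<mu> \<le> real n * \<mu>" using \<mu>_ge2 by (intro mult_right_mono) auto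
      also have "\<dots> \<le> real (l_par n)" using elim mon_nonneg[of 1 "1/2" n] by linarith
      finally have "real (n - 2 * m_par n - 3) * \<mu> / real (l_par n + 4 * m_par n) \<le> 1" by (intro divide_le_eq_1[THEN iffD2]) auto
      then show ?case by simp
    qed
    have "?f \<longlonglongrightarrow> 2 * 0 + (10 + 10 * \<mu>) * 0" using \<tau> by (intro tendsto_intros mon_lim) auto
    then show "?f \<longlonglongrightarrow> 0" by simp
  qed simp
qed

text \<open>The three terms are the added edges, of order \<open>1 / \<omega>\<close>; the delay,
  \<open>b powr (\<tau> - 3)\<close> up to powers of \<open>\<omega>\<close>; and the failure to
  collide, exponentially small in \<open>\<omega> powr 2\<close>.\<close>

lemma meeting_error_lim:
  "(\<lambda>n. real (M_par n) * (mon 2 1 n / (real n / 4 * real (s0_par n div 2) * real (k_par n)) + 1 / (real (s0_par n div 2) * mon 0 (- 1) n))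
     + (1 - real (s0_par n) / real (l_par n)) ^ M_par n) \<longlonglongrightarrow> 0"
proof -
  let ?g = inv_gap
  let ?f = "\<lambda>n. 32 * mon 0 (- 1) n + 8 * mon (\<tau> - 3) (3 + 4 * ?g) n + exp (- (1 / (2 * \<mu>) * mon 0 2 n))"
  show ?thesis
  proof (rule tendsto_sandwich[of "\<lambda>_. 0" _ _ ?f])
    show "eventually (\<lambda>n. 0 \<le> real (M_par n) * (mon 2 1 n / (real n / 4 * real (s0_par n div 2) * real (k_par n)) + 1 / (real (s0_par n div 2) * mon 0 (- 1) n))
     + (1 - real (s0_par n) / real (l_par n)) ^ M_par n) sequentially"
      using par_conditions
    proof eventually_elim
      case (elim n)
      have "real (s0_par n) / real (l_par n) \<le> 1" using elim by (intro divide_le_eq_1[THEN iffD2]) auto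
      then show ?case using mon_nonneg by simp
    qed
    show "eventually (\<lambda>n. real (M_par n) * (mon 2 1 n / (real n / 4 * real (s0_par n div 2) * real (k_par n)) + 1 / (real (s0_par n div 2) * mon 0 (- 1) n))
     + (1 - real (s0_par n) / real (l_par n)) ^ M_par n \<le> ?f n) sequentially"
      using par_bounds par_conditions
    proof eventually_elim
      case (elim n)
      have n: "n \<ge> 3" using elim by blast
      let ?M = "2 * mon (\<tau> - 2) (2 + 2 * ?g) n" and ?s = "mon 1 (- 2 * ?g) n / 4" and ?k = "mon 0 (4 + 4 * ?g) n"
      note pos = mon_pos[OF n]
      have M: "real (M_par n) \<le> ?M" "mon (\<tau> - 2) (2 + 2 * ?g) n \<le> real (M_par n)" using elim by auto
      have s: "?s \<le> real (s0_par n div 2)" and k: "?k \<le> real (k_par n)" using elim by auto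
      have "0 < ?s" "0 < ?k" using pos by auto
      then have sk: "real (s0_par n div 2) > 0" "real (k_par n) > 0" using s k by linarith+
      have "real n / 4 * ?s * ?k \<le> real n / 4 * real (s0_par n div 2) * real (k_par n)"
        using s k pos n by (intro mult_mono) (auto intro: less_imp_le)
      then have "mon 2 1 n / (real n / 4 * real (s0_par n div 2) * real (k_par n)) \<le> mon 2 1 n / (real n / 4 * ?s * ?k)"
        using pos n sk by (intro divide_left_mono mult_pos_pos) (auto intro: less_imp_le simp del: of_nat_0_less_iff)
      moreover have "1 / (real (s0_par n div 2) * mon 0 (- 1) n) \<le> 1 / (?s * mon 0 (- 1) n)"
        using pos s sk by (intro divide_left_mono mult_right_mono mult_pos_pos) (auto intro: less_imp_le simp del: of_nat_0_less_iff)
      ultimately have "real (M_par n) * (mon 2 1 n / (real n / 4 * real (s0_par n div 2) * real (k_par n)) + 1 / (real (s0_par n div 2) * mon 0 (- 1) n))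
         \<le> ?M * (mon 2 1 n / (real n / 4 * ?s * ?k) + 1 / (?s * mon 0 (- 1) n))"
        using M pos by (intro mult_mono add_mono) (auto intro!: add_nonneg_nonneg divide_nonneg_nonneg mult_nonneg_nonneg less_imp_le[OF pos])
      also have "\<dots> = 32 * (mon (\<tau> - 2) (2 + 2 * ?g) n * mon 2 1 n / (mon (\<tau> - 1) 0 n * mon 1 (- 2 * ?g) n * ?k))
          + 8 * (mon (\<tau> - 2) (2 + 2 * ?g) n * mon 0 0 n / (mon 1 (- 2 * ?g) n * mon 0 (- 1) n))"
        unfolding mon_n[OF n] mon_00[OF n] by (simp add: field_simps)
      also have "\<dots> = 32 * mon 0 (- 1) n + 8 * mon (\<tau> - 3) (3 + 4 * ?g) n"
        unfolding mon_mult mon_divide by (simp add: algebra_simps)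
      finally have 1: "real (M_par n) * (mon 2 1 n / (real n / 4 * real (s0_par n div 2) * real (k_par n)) + 1 / (real (s0_par n div 2) * mon 0 (- 1) n))
        \<le> 32 * mon 0 (- 1) n + 8 * mon (\<tau> - 3) (3 + 4 * ?g) n" .
      have l: "real (l_par n) > 0" "s0_par n \<le> l_par n" "real (l_par n) \<le> 2 * \<mu> * mon (\<tau> - 1) 0 n"
        using elim by auto
      have "(1 - real (s0_par n) / real (l_par n)) ^ M_par n \<le> exp (- (real (s0_par n) / real (l_par n))) ^ M_par n"
      proof (rule power_mono)
        show "1 - real (s0_par n) / real (l_par n) \<le> exp (- (real (s0_par n) / real (l_par n)))"
          using exp_ge_add_one_self[of "- (real (s0_par n) / real (l_par n))"] by simp
      qed (use l in \<open>simp add: divide_le_eq\<close>)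
      also have "\<dots> = exp (- (real (M_par n) * real (s0_par n) / real (l_par n)))"
        by (simp add: exp_of_nat_mult[symmetric])
      also have "\<dots> \<le> exp (- (1 / (2 * \<mu>) * mon 0 2 n))"
      proof -
        have "mon (\<tau> - 2) (2 + 2 * ?g) n * mon 1 (- 2 * ?g) n / (2 * \<mu> * mon (\<tau> - 1) 0 n) \<le> real (M_par n) * real (s0_par n) / real (l_par n)"
          using M l elim pos by (intro frac_le mult_mono) (auto intro: less_imp_le)
        moreover have "mon (\<tau> - 2) (2 + 2 * ?g) n * mon 1 (- 2 * ?g) n / (2 * \<mu> * mon (\<tau> - 1) 0 n)
           = 1 / (2 * \<mu>) * (mon (\<tau> - 2) (2 + 2 * ?g) n * mon 1 (- 2 * ?g) n / mon (\<tau> - 1) 0 n)" by simp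
        moreover have "mon (\<tau> - 2) (2 + 2 * ?g) n * mon 1 (- 2 * ?g) n / mon (\<tau> - 1) 0 n = mon 0 2 n"
          unfolding mon_mult mon_divide by simp
        ultimately show ?thesis by (simp only: neg_le_iff_le exp_le_cancel_iff)
      qed
      finally show ?case using 1 by linarith
    qed
    have "?f \<longlonglongrightarrow> 32 * 0 + 8 * 0 + 0" using \<tau> \<mu>_ge2 by (intro tendsto_intros mon_lim mon_exp_lim) auto
    then show "?f \<longlonglongrightarrow> 0" by simp
  qed simp
qed

lemma \<delta>_par_lim: "\<delta>_par \<longlonglongrightarrow> 0"
proof -
  have "(\<lambda>n. 2 * real (m_par n) * (1 - real (n - 2 * m_par n - 3) * \<mu> / real (l_par n + 4 * m_par n))
     + (degree_error n (K2_par n) (mon 1 (1/2) n / 4) (mon 2 1 n)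
       + (real (M_par n) * (mon 2 1 n / (real n / 4 * real (s0_par n div 2) * real (k_par n)) + 1 / (real (s0_par n div 2) * mon 0 (- 1) n))
     + (1 - real (s0_par n) / real (l_par n)) ^ M_par n)) + 2 * size_error (m_par n) (s0_par n) (K_par n)) \<longlonglongrightarrow> 0 + (0 + 0) + 2 * 0"
    by (intro tendsto_add tendsto_mult tendsto_const thinning_error_lim degree_error_lim meeting_error_lim size_error_lim)
  then show ?thesis by (simp add: \<delta>_par_def[abs_def] total_error_def add.assoc)
qed

text \<open>The threshold for \<open>n\<close> is common to all \<open>E\<close>, because the events
  about the number of edges move with \<open>n\<close>.\<close>

lemma comparison:
  "eventually (\<lambda>n. \<forall>E. E \<in> sets (borel \<Otimes>\<^sub>M count_space UNIV) \<longrightarrow>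
     (\<forall>a b. (\<lambda>\<tau>. core E (mon 0 (- 1) n) (k_par n) \<tau> a b) \<in> borel_measurable borel) \<longrightarrow>
     core_law E (mon 0 (- 1) n) (k_par n) (m_par n) \<le> emeasure (CM_FPP F n) (CM_event F n E) + ennreal (\<delta>_par n)) sequentially"
  using par_conditions
proof eventually_elim
  case (elim n)
  show ?case unfolding \<delta>_par_def
    by (intro allI impI core_law_le_CM) (use elim in auto)
qed

lemma m_par_at_top: "filterlim m_par at_top sequentially"
proof -
  have "filterlim (\<lambda>n. mon (\<tau> - 2) (- 1) n / 2) at_top sequentially"
    using filterlim_tendsto_pos_mult_at_top[OF tendsto_const[of "1 / 2"] _ mon_at_top[of "\<tau> - 2" "- 1"]] \<tau> by simp
  then have "filterlim (\<lambda>n. real (m_par n)) at_top sequentially"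
    by (rule filterlim_at_top_mono) (use par_bounds(1) in eventually_elim, blast)
  then show ?thesis by (simp add: filterlim_sequentially_iff_filterlim_real)
qed

lemma k_par_lim: "(\<lambda>n. real (k_par n) / sqrt (ln (real n))) \<longlonglongrightarrow> 0"
proof (rule tendsto_sandwich[of "\<lambda>_. 0"])
  show "(\<lambda>n. 2 * (ln (real n) powr (1 / 3) / sqrt (ln (real n)))) \<longlonglongrightarrow> 0" by real_asymp
  show "eventually (\<lambda>n. real (k_par n) / sqrt (ln (real n)) \<le> 2 * (ln (real n) powr (1 / 3) / sqrt (ln (real n)))) sequentially"
    using par_bounds
  proof eventually_elim
    case (elim n)
    have e: "(4 + 4 * inv_gap) / (12 + 12 * inv_gap) = 1 / 3" using inv_gap by (simp add: field_simps)
    have "real (k_par n) \<le> 2 * ln (real n) powr (1 / 3)" using elim by (simp add: mon_def e)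
    then show ?case using elim by (simp add: divide_right_mono)
  qed
  show "eventually (\<lambda>n. 0 \<le> real (k_par n) / sqrt (ln (real n))) sequentially"
    using eventually_ge_at_top[of 3] by eventually_elim simp
qed simp

text \<open>The power of \<open>ln n\<close> in \<open>m_par\<close> contributes only a multiple of
  \<open>ln (ln n)\<close> to the logarithm, and rounding at most \<open>ln 2\<close>.\<close>

lemma m_par_log: "(\<lambda>n. (2 * ln (real (m_par n)) - (2 * (\<tau> - 2) / (\<tau> - 1)) * ln (real n)) / sqrt (ln (real n))) \<longlonglongrightarrow> 0"
proof (rule Lim_null_comparison)
  define c where "c = 1 / (12 + 12 * inv_gap)"
  have c: "c > 0" using inv_gap by (simp add: c_def)
  show "(\<lambda>n. (2 * c * ln (ln (real n)) + 2 * ln 2) / sqrt (ln (real n))) \<longlonglongrightarrow> 0" by real_asymp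
  show "eventually (\<lambda>n. norm ((2 * ln (real (m_par n)) - (2 * (\<tau> - 2) / (\<tau> - 1)) * ln (real n)) / sqrt (ln (real n)))
     \<le> (2 * c * ln (ln (real n)) + 2 * ln 2) / sqrt (ln (real n))) sequentially"
    using par_bounds
  proof eventually_elim
    case (elim n)
    let ?u = "mon (\<tau> - 2) (- 1) n"
    have n: "n \<ge> 3" using elim by blast
    have ln: "ln (real n) \<ge> 1"
    proof -
      have "exp 1 \<le> real n" using e_less_272 n by linarith
      then show ?thesis using n by (simp add: ln_ge_iff)
    qed
    define A where "A = (\<tau> - 2) / (\<tau> - 1) * ln (real n)"
    have "ln ?u = A - c * ln (ln (real n))"
      using ln n unfolding A_def by (simp add: mon_def c_def ln_mult ln_powr)
    moreover have "ln (?u / 2) \<le> ln (real (m_par n))" "ln (real (m_par n)) \<le> ln ?u"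
      using elim mon_pos[OF n, of "\<tau> - 2" "- 1"] by (auto intro!: ln_mono)
    moreover have "ln (?u / 2) = ln ?u - ln 2" using mon_pos[OF n, of "\<tau> - 2" "- 1"] by (simp add: ln_div)
    moreover have "c * ln (ln (real n)) \<ge> 0" using c ln by (intro mult_nonneg_nonneg) auto
    moreover have "2 * (\<tau> - 2) / (\<tau> - 1) * ln (real n) = 2 * A" by (simp add: A_def)
    moreover have "ln 2 \<ge> (0::real)" by simp
    ultimately have "\<bar>2 * ln (real (m_par n)) - (2 * (\<tau> - 2) / (\<tau> - 1)) * ln (real n)\<bar> \<le> 2 * (c * ln (ln (real n))) + 2 * ln 2"
      by (simp only:)
    then show ?case using ln by (simp add: abs_divide divide_right_mono mult.assoc)
  qed
qed

end

subsection \<open>Conditional distribution functions\<close>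

lemma prob_space_CM_FPP: "prob_space (CM_FPP F n)"
proof -
  interpret W: prob_space EW by (rule prob_space_EW)
  interpret pair_prob_space "measure_pmf (CM_graph F n)" EW ..
  show ?thesis unfolding CM_FPP_def by (rule prob_space_axioms)
qed

lemma cdf_CM_cond:
  assumes X: "X \<in> borel_measurable (CM_FPP F n)" and E: "\<And>\<omega>. X \<omega> \<le> x \<longleftrightarrow> (CM_W n \<omega>, CM_H n \<omega>) \<in> E"
  shows "cdf (distr (CM_cond F n) borel X) x = measure (CM_FPP F n) (CM_event F n E) / measure (CM_FPP F n) (CM_event F n UNIV)"
proof -
  interpret prob_space "CM_FPP F n" by (rule prob_space_CM_FPP)
  note [measurable] = X measurable_CM_connected
  have "X \<in> borel_measurable (CM_cond F n)" using X by (simp add: CM_cond_def measurable_def)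
  then have "cdf (distr (CM_cond F n) borel X) x = measure (CM_cond F n) (X -` {..x} \<inter> space (CM_cond F n))"
    unfolding cdf_def2 by (subst measure_distr) auto
  also have "X -` {..x} \<inter> space (CM_cond F n) = {\<omega> \<in> space (CM_cond F n). X \<omega> \<le> x}" by auto
  also have "measure (CM_cond F n) {\<omega> \<in> space (CM_cond F n). X \<omega> \<le> x} = cond_prob (CM_FPP F n) (\<lambda>\<omega>. X \<omega> \<le> x) (CM_connected n)"
    unfolding CM_cond_def by (rule measure_uniform_measure_eq_cond_prob) auto
  also have "\<dots> = measure (CM_FPP F n) (CM_event F n E) / measure (CM_FPP F n) (CM_event F n UNIV)"
    unfolding cond_prob_def CM_event_def E by (simp add: conj_commute)
  finally show ?thesis .
qed

text \<open>The normalising probability is at most one, so dividing by it preserves a lower bound.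
  Applied to the complement, this turns into the upper bound.\<close>

lemma cond_sandwich:
  fixes a a' \<delta> :: real
  assumes E: "E \<in> sets (borel \<Otimes>\<^sub>M count_space UNIV)"
    and le: "a \<le> measure (CM_FPP F n) (CM_event F n E) + \<delta>" "a' \<le> measure (CM_FPP F n) (CM_event F n (- E)) + \<delta>"
      "1 \<le> measure (CM_FPP F n) (CM_event F n UNIV) + \<delta>" "\<delta> < 1"
  shows "a - \<delta> \<le> measure (CM_FPP F n) (CM_event F n E) / measure (CM_FPP F n) (CM_event F n UNIV)"
    "measure (CM_FPP F n) (CM_event F n E) / measure (CM_FPP F n) (CM_event F n UNIV) \<le> 1 - a' + \<delta>"
proof -
  interpret prob_space "CM_FPP F n" by (rule prob_space_CM_FPP)
  let ?p = "\<lambda>E. measure (CM_FPP F n) (CM_event F n E)"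
  have E': "- E \<in> sets (borel \<Otimes>\<^sub>M count_space UNIV)"
    using sets.compl_sets[OF E] by (simp add: space_pair_measure Compl_eq_Diff_UNIV)
  have "CM_event F n UNIV = CM_event F n E \<union> CM_event F n (- E)" by (auto simp: CM_event_def)
  then have sum: "?p UNIV = ?p E + ?p (- E)"
    using finite_measure_Union[OF sets_CM_event[OF E] sets_CM_event[OF E']] by (auto simp: CM_event_def)
  have p: "0 < ?p UNIV" "?p UNIV \<le> 1" using le by auto
  have ge: "q \<le> q / ?p UNIV" if "q \<ge> 0" for q
    using p that by (simp add: le_divide_eq mult_left_le)
  show "a - \<delta> \<le> ?p E / ?p UNIV" using ge[of "?p E"] le(1) by simp
  have "?p E / ?p UNIV = 1 - ?p (- E) / ?p UNIV" using p(1) sum by (simp add: field_simps)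
  then show "?p E / ?p UNIV \<le> 1 - a' + \<delta>" using ge[of "?p (- E)"] le(2) by simp
qed

text \<open>Monotonicity traps the value at the moving point between values at two fixed points
  close to \<open>x\<close>, and continuity of the limit closes the gap.\<close>

lemma cdf_moving_point:
  fixes M :: "nat \<Rightarrow> real measure" and v :: "nat \<Rightarrow> real"
  assumes M: "\<And>i. real_distribution (M i)" and lim: "\<And>y. (\<lambda>i. cdf (M i) y) \<longlonglongrightarrow> \<Phi> y" and cont: "isCont \<Phi> x"
    and m: "filterlim m at_top sequentially" and v: "v \<longlonglongrightarrow> x"
  shows "(\<lambda>n. cdf (M (m n)) (v n)) \<longlonglongrightarrow> \<Phi> x"
proof (rule order_tendstoI)
  have mono: "cdf (M i) y \<le> cdf (M i) z" if "y \<le> z" for i y z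
  proof -
    interpret real_distribution "M i" by (rule M)
    show ?thesis using that by (rule cdf_nondecreasing)
  qed
  have sub: "(\<lambda>n. cdf (M (m n)) y) \<longlonglongrightarrow> \<Phi> y" for y using filterlim_compose[OF lim m] .
  have left: "(\<Phi> \<longlongrightarrow> \<Phi> x) (at_left x)" and right: "(\<Phi> \<longlongrightarrow> \<Phi> x) (at_right x)"
    using cont by (auto simp: isCont_def filterlim_at_split)
  {
    fix a assume "a < \<Phi> x"
    then have "eventually (\<lambda>y. a < \<Phi> y) (at_left x)" using order_tendstoD(1)[OF left] by blast
    then obtain b where "b < x" "\<And>y. b < y \<Longrightarrow> y < x \<Longrightarrow> a < \<Phi> y" unfolding eventually_at_left_field by blast
    then obtain y where y: "y < x" "a < \<Phi> y" using dense by blast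
    from order_tendstoD(1)[OF sub y(2)] order_tendstoD(1)[OF v y(1)]
    show "eventually (\<lambda>n. a < cdf (M (m n)) (v n)) sequentially"
      by eventually_elim (use mono in \<open>meson less_imp_le order_less_le_trans\<close>)
  next
    fix a assume "\<Phi> x < a"
    then have "eventually (\<lambda>y. \<Phi> y < a) (at_right x)" using order_tendstoD(2)[OF right] by blast
    then obtain b where "x < b" "\<And>y. x < y \<Longrightarrow> y < b \<Longrightarrow> \<Phi> y < a" unfolding eventually_at_right_field by blast
    then obtain y where y: "x < y" "\<Phi> y < a" using dense by blast
    from order_tendstoD(2)[OF sub y(2)] order_tendstoD(2)[OF v y(1)]
    show "eventually (\<lambda>n. cdf (M (m n)) (v n) < a) sequentially"
      by eventually_elim (use mono in \<open>meson less_imp_le order_le_less_trans\<close>)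
  }
qed

lemma ennreal_le_measureD:
  assumes "prob_space M" "ennreal a \<le> emeasure M A + ennreal \<delta>"
  shows "a \<le> measure M A + \<bar>\<delta>\<bar>"
proof -
  interpret prob_space M by fact
  have "ennreal a \<le> ennreal (measure M A) + ennreal \<bar>\<delta>\<bar>"
    using assms(2) unfolding emeasure_eq_measure by (rule order_trans) (intro add_left_mono ennreal_leI, simp)
  then have "a \<le> measure M A + \<bar>\<delta>\<bar> \<or> a \<le> 0" by (auto simp: ennreal_le_iff2 simp flip: ennreal_plus)
  then show ?thesis using measure_nonneg[of M A] abs_ge_zero[of \<delta>] by linarith
qed

context heavy_tail begin

lemma core_law_UNIV: "core_law UNIV \<epsilon> k m = 1"
  using time_law_const[of m 1] by (simp add: core_law_def time_law_def core_def)

lemma core_law_atMost: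
  assumes "\<epsilon> \<ge> 0"
  shows "core_law ({..x} \<times> UNIV) \<epsilon> k m = ennreal (time_cdf m (x - \<epsilon>))"
    "(\<lambda>\<tau>. core ({..x} \<times> UNIV) \<epsilon> k \<tau> a b) \<in> borel_measurable borel"
proof -
  have eq: "core ({..x} \<times> UNIV) \<epsilon> k \<tau> a b = indicator {..x - \<epsilon>} \<tau>" for \<tau> a b
    using assms by (force simp: core_def indicator_def)
  then show "(\<lambda>\<tau>. core ({..x} \<times> UNIV) \<epsilon> k \<tau> a b) \<in> borel_measurable borel" by simp
  show "core_law ({..x} \<times> UNIV) \<epsilon> k m = ennreal (time_cdf m (x - \<epsilon>))"
    unfolding time_cdf_ennreal[symmetric] time_law_def core_law_def eq ennreal_indicator ..
qed

text \<open>Delays only increase the time, so an upper half-line is its own robust interior, whereas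
  a lower half-line is shortened by \<open>\<epsilon>\<close>.\<close>

lemma core_law_greaterThan:
  assumes "\<epsilon> \<ge> 0"
  shows "core_law ({x<..} \<times> UNIV) \<epsilon> k m = ennreal (1 - time_cdf m x)"
    "(\<lambda>\<tau>. core ({x<..} \<times> UNIV) \<epsilon> k \<tau> a b) \<in> borel_measurable borel"
proof -
  have eq: "core ({x<..} \<times> UNIV) \<epsilon> k \<tau> a b = indicator {x<..} \<tau>" for \<tau> a b
    using assms by (force simp: core_def indicator_def)
  then show "(\<lambda>\<tau>. core ({x<..} \<times> UNIV) \<epsilon> k \<tau> a b) \<in> borel_measurable borel" by simp
  show "core_law ({x<..} \<times> UNIV) \<epsilon> k m = ennreal (1 - time_cdf m x)"
    unfolding time_cdf_compl[symmetric] time_law_def core_law_def eq ennreal_indicator ..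
qed

definition records_cdf :: "nat \<Rightarrow> real \<Rightarrow> real" where
  "records_cdf m y = measure_pmf.prob (two_records m) {r. real r \<le> y}"

text \<open>The threshold moves by \<open>1\<close> for the connecting edge, by \<open>k\<close> for
  the edges of the late phase where they do harm, namely for the lower half-line only, and by
  \<open>w\<close> for the distance between labels and records.\<close>

lemma core_law_hops:
  assumes \<epsilon>: "\<epsilon> \<ge> 0" and w: "w > 0"
  shows "ennreal (records_cdf m (z - 1 - real k - w)) \<le> core_law (UNIV \<times> {h. real h \<le> z}) \<epsilon> k m + ennreal (2 * (1 + \<mu>) * time_const / w)"
    "ennreal (1 - records_cdf m (z - 1 + w)) \<le> core_law (UNIV \<times> {h. z < real h}) \<epsilon> k m + ennreal (2 * (1 + \<mu>) * time_const / w)"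
    "(\<lambda>\<tau>. core (UNIV \<times> {h. real h \<le> z}) \<epsilon> k \<tau> a b) \<in> borel_measurable borel"
    "(\<lambda>\<tau>. core (UNIV \<times> {h. z < real h}) \<epsilon> k \<tau> a b) \<in> borel_measurable borel"
proof -
  let ?g = "\<lambda>h. if real (h + 1 + k) \<le> z then 1 else 0 :: real" and ?g' = "\<lambda>h. if z < real (h + 1) then 1 else 0 :: real"
  have eq: "core (UNIV \<times> {h. real h \<le> z}) \<epsilon> k \<tau> a b = ?g (b + a)" for \<tau> a b
  proof -
    have "(\<forall>r\<le>k. real (a + b + 1 + r) \<le> z) \<longleftrightarrow> real (b + a + 1 + k) \<le> z" by (force simp: add_ac)
    then show ?thesis using \<epsilon> by (auto simp: core_def)
  qed
  have eq': "core (UNIV \<times> {h. z < real h}) \<epsilon> k \<tau> a b = ?g' (b + a)" for \<tau> a b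
  proof -
    have "(\<forall>r\<le>k. z < real (a + b + 1 + r)) \<longleftrightarrow> z < real (b + a + 1)" by (force simp: add_ac)
    then show ?thesis using \<epsilon> by (auto simp: core_def)
  qed
  show "(\<lambda>\<tau>. core (UNIV \<times> {h. real h \<le> z}) \<epsilon> k \<tau> a b) \<in> borel_measurable borel" unfolding eq by simp
  show "(\<lambda>\<tau>. core (UNIV \<times> {h. z < real h}) \<epsilon> k \<tau> a b) \<in> borel_measurable borel" unfolding eq' by simp
  have law: "core_law (UNIV \<times> {h. real h \<le> z}) \<epsilon> k m = hop_law m (\<lambda>h. ennreal (?g h))"
    "core_law (UNIV \<times> {h. z < real h}) \<epsilon> k m = hop_law m (\<lambda>h. ennreal (?g' h))"
    unfolding core_law_def hop_law_def eq eq' by (rule refl)+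
  let ?f = "\<lambda>r. indicator {r. real r \<le> z - 1 - real k - w} r :: ennreal" and ?f' = "\<lambda>r. indicator {r. z - 1 + w < real r} r :: ennreal"
  have far: "1 \<le> ennreal (\<bar>x - y\<bar> / w)" if "x + w \<le> y" for x y :: real
  proof -
    have "1 \<le> \<bar>x - y\<bar> / w" using that w by (simp add: le_divide_eq)
    then show ?thesis by simp
  qed
  have "?f r \<le> ennreal (?g h) + ennreal (\<bar>real h - real r\<bar> / w)" for r h
    using far[of "real r" "real h"] by (auto simp: indicator_def abs_minus_commute)
  from hop_law_records[of ?f "\<lambda>h. ennreal (?g h)", OF this w]
  show "ennreal (records_cdf m (z - 1 - real k - w)) \<le> core_law (UNIV \<times> {h. real h \<le> z}) \<epsilon> k m + ennreal (2 * (1 + \<mu>) * time_const / w)"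
    unfolding law records_cdf_def by (simp add: measure_pmf.emeasure_eq_measure)
  have "?f' r \<le> ennreal (?g' h) + ennreal (\<bar>real h - real r\<bar> / w)" for r h
    using far[of "real h" "real r"] by (auto simp: indicator_def abs_minus_commute)
  from hop_law_records[of ?f' "\<lambda>h. ennreal (?g' h)", OF this w]
  have "ennreal (measure_pmf.prob (two_records m) {r. z - 1 + w < real r}) \<le> core_law (UNIV \<times> {h. z < real h}) \<epsilon> k m + ennreal (2 * (1 + \<mu>) * time_const / w)"
    unfolding law by (simp add: measure_pmf.emeasure_eq_measure)
  moreover have "measure_pmf.prob (two_records m) {r. z - 1 + w < real r} = 1 - records_cdf m (z - 1 + w)"
  proof -
    have "{r. z - 1 + w < real r} = UNIV - {r. real r \<le> z - 1 + w}" by auto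
    then show ?thesis unfolding records_cdf_def using measure_pmf.prob_compl[of "{r. real r \<le> z - 1 + w}" "two_records m"] by simp
  qed
  ultimately show "ennreal (1 - records_cdf m (z - 1 + w)) \<le> core_law (UNIV \<times> {h. z < real h}) \<epsilon> k m + ennreal (2 * (1 + \<mu>) * time_const / w)" by simp
qed

subsection \<open>The limit laws\<close>

lemma mon_eps: "eventually (\<lambda>n. mon 0 (- 1) n \<ge> 0 \<and> \<bar>\<delta>_par n\<bar> < 1) sequentially"
proof -
  have "(\<lambda>n. \<bar>\<delta>_par n\<bar>) \<longlonglongrightarrow> 0" using \<delta>_par_lim by (rule tendsto_rabs_zero)
  then have "eventually (\<lambda>n. \<bar>\<delta>_par n\<bar> < 1) sequentially" by (rule order_tendstoD) simp
  then show ?thesis by eventually_elim (simp add: mon_nonneg)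
qed

lemma weight_limit: "\<exists>V. real_distribution V \<and> weak_conv_m (\<lambda>n. distr (CM_cond F n) borel (CM_W n)) V"
proof -
  obtain V G where V: "real_distribution V" "\<And>x. (\<lambda>m. time_cdf m x) \<longlonglongrightarrow> G x"
    "\<And>x. G x \<le> cdf V x" "\<And>x y. x < y \<Longrightarrow> cdf V x \<le> G y" using time_limit by metis
  let ?c = "\<lambda>n x. cdf (distr (CM_cond F n) borel (CM_W n)) x"
  let ?\<epsilon> = "mon 0 (- 1)"
  have sub: "(\<lambda>n. time_cdf (m_par n) y) \<longlonglongrightarrow> G y" for y using filterlim_compose[OF V(2) m_par_at_top] .
  have \<delta>: "(\<lambda>n. \<bar>\<delta>_par n\<bar>) \<longlonglongrightarrow> 0" using \<delta>_par_lim by (rule tendsto_rabs_zero)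
  have bounds: "eventually (\<lambda>n. time_cdf (m_par n) (x - ?\<epsilon> n) - \<bar>\<delta>_par n\<bar> \<le> ?c n x \<and> ?c n x \<le> time_cdf (m_par n) x + \<bar>\<delta>_par n\<bar>) sequentially" for x
    using comparison mon_eps
  proof eventually_elim
    case (elim n)
    let ?E = "{..x} \<times> UNIV :: (real \<times> nat) set"
    have compl: "- ?E = {x<..} \<times> UNIV" by auto
    have E: "?E \<in> sets (borel \<Otimes>\<^sub>M count_space UNIV)" "{x<..} \<times> UNIV \<in> sets (borel \<Otimes>\<^sub>M count_space (UNIV :: nat set))" by auto
    have \<epsilon>: "?\<epsilon> n \<ge> 0" using elim by blast
    note le = ennreal_le_measureD[OF prob_space_CM_FPP]
    have 1: "time_cdf (m_par n) (x - ?\<epsilon> n) \<le> measure (CM_FPP F n) (CM_event F n ?E) + \<bar>\<delta>_par n\<bar>"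
      by (rule le) (use elim(1)[rule_format, OF E(1) core_law_atMost(2)[OF \<epsilon>]] in \<open>simp only: core_law_atMost(1)[OF \<epsilon>]\<close>)
    have 2: "1 - time_cdf (m_par n) x \<le> measure (CM_FPP F n) (CM_event F n (- ?E)) + \<bar>\<delta>_par n\<bar>"
      unfolding compl
      by (rule le) (use elim(1)[rule_format, OF E(2) core_law_greaterThan(2)[OF \<epsilon>]] in \<open>simp only: core_law_greaterThan(1)[OF \<epsilon>]\<close>)
    have 3: "1 \<le> measure (CM_FPP F n) (CM_event F n UNIV) + \<bar>\<delta>_par n\<bar>"
    proof (rule le)
      have "core_law UNIV (?\<epsilon> n) (k_par n) (m_par n) \<le> emeasure (CM_FPP F n) (CM_event F n UNIV) + ennreal (\<delta>_par n)"
        by (rule elim(1)[rule_format]) (use sets.top[of "borel \<Otimes>\<^sub>M count_space UNIV"] in \<open>auto simp: core_def space_pair_measure\<close>)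
      then show "ennreal 1 \<le> emeasure (CM_FPP F n) (CM_event F n UNIV) + ennreal (\<delta>_par n)" by (simp add: core_law_UNIV)
    qed
    have "?c n x = measure (CM_FPP F n) (CM_event F n ?E) / measure (CM_FPP F n) (CM_event F n UNIV)"
      by (rule cdf_CM_cond[OF measurable_CM_W]) auto
    then show ?case using cond_sandwich[OF E(1) 1 2 3] elim(2) by auto
  qed
  have "weak_conv_m (\<lambda>n. distr (CM_cond F n) borel (CM_W n)) V"
    unfolding weak_conv_m_def weak_conv_def
  proof (intro allI impI)
    fix x assume cont: "isCont (cdf V) x"
    show "(\<lambda>n. ?c n x) \<longlonglongrightarrow> cdf V x"
    proof (rule order_tendstoI)
      fix a assume a: "a < cdf V x"
      have "(cdf V \<longlongrightarrow> cdf V x) (at_left x)" using cont by (auto simp: isCont_def filterlim_at_split)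
      then have "eventually (\<lambda>y. a < cdf V y) (at_left x)" using a by (rule order_tendstoD)
      then obtain b where "b < x" "\<And>y. b < y \<Longrightarrow> y < x \<Longrightarrow> a < cdf V y" unfolding eventually_at_left_field by blast
      then obtain z where z: "z < x" "a < cdf V z" using dense by blast
      \<comment> \<open>Two intermediate points: the gap from \<open>y\<close> to \<open>x\<close>
        absorbs the shift by \<open>?\<epsilon> n\<close>, the gap from \<open>z\<close> to
        \<open>y\<close> the passage from \<open>cdf V\<close> to \<open>G\<close>.\<close>
      obtain y where y: "z < y" "y < x" using z(1) dense by blast
      have "a < G y" using z V(4)[OF y(1)] by linarith
      moreover have "(\<lambda>n. time_cdf (m_par n) y - \<bar>\<delta>_par n\<bar>) \<longlonglongrightarrow> G y - 0" by (intro tendsto_diff sub \<delta>)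
      ultimately have "eventually (\<lambda>n. a < time_cdf (m_par n) y - \<bar>\<delta>_par n\<bar>) sequentially" by (intro order_tendstoD(1)) auto
      moreover have "eventually (\<lambda>n. ?\<epsilon> n < x - y) sequentially" by (rule order_tendstoD(2)[OF mon_lim]) (use y in auto)
      ultimately show "eventually (\<lambda>n. a < ?c n x) sequentially" using bounds[of x]
      proof eventually_elim
        case (elim n)
        have "time_cdf (m_par n) y \<le> time_cdf (m_par n) (x - ?\<epsilon> n)" using elim(2) by (intro time_cdf_mono) simp
        then show ?case using elim by linarith
      qed
    next
      fix a assume "cdf V x < a"
      then have "G x < a" using V(3)[of x] by linarith
      moreover have "(\<lambda>n. time_cdf (m_par n) x + \<bar>\<delta>_par n\<bar>) \<longlonglongrightarrow> G x + 0" by (intro tendsto_add sub \<delta>)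
      ultimately have "eventually (\<lambda>n. time_cdf (m_par n) x + \<bar>\<delta>_par n\<bar> < a) sequentially" by (intro order_tendstoD(2)) auto
      with bounds[of x] show "eventually (\<lambda>n. ?c n x < a) sequentially" by eventually_elim linarith
    qed
  qed
  then show ?thesis using V(1) by blast
qed

lemma records_cdf_lim:
  assumes m: "filterlim m at_top sequentially" and v: "(\<lambda>n. (y n - 2 * ln (real (m n))) / sqrt (2 * ln (real (m n)))) \<longlonglongrightarrow> x"
  shows "(\<lambda>n. records_cdf (m n) (y n)) \<longlonglongrightarrow> cdf std_normal_distribution x"
proof -
  let ?M = "\<lambda>m. distr (measure_pmf (two_records m)) borel (\<lambda>r. (real r - 2 * ln (real m)) / sqrt (2 * ln (real m)))"
  interpret N: real_distribution std_normal_distribution by (rule real_dist_normal_dist)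
  have cont: "isCont (cdf std_normal_distribution) x" for x
  proof -
    have "emeasure std_normal_distribution {x} = 0"
      by (subst emeasure_density) (auto intro!: nn_integral_null_set simp: null_sets_def)
    then show ?thesis by (simp add: N.isCont_cdf measure_def)
  qed
  have "(\<lambda>n. cdf (?M (m n)) ((y n - 2 * ln (real (m n))) / sqrt (2 * ln (real (m n))))) \<longlonglongrightarrow> cdf std_normal_distribution x"
  proof (rule cdf_moving_point[where M = ?M, OF _ _ cont m v])
    show "real_distribution (?M i)" for i
      by (rule prob_space.real_distribution_distr) (auto intro: prob_space_measure_pmf)
    show "(\<lambda>i. cdf (?M i) z) \<longlonglongrightarrow> cdf std_normal_distribution z" for z
      using records_clt cont by (simp add: weak_conv_m_def weak_conv_def)
  qed
  moreover have "eventually (\<lambda>n. cdf (?M (m n)) ((y n - 2 * ln (real (m n))) / sqrt (2 * ln (real (m n)))) = records_cdf (m n) (y n)) sequentially"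
    using m[unfolded filterlim_at_top, rule_format, of 2]
  proof eventually_elim
    case (elim n)
    then have "sqrt (2 * ln (real (m n))) > 0" by simp
    then have "(\<lambda>r. (real r - 2 * ln (real (m n))) / sqrt (2 * ln (real (m n)))) -` {..(y n - 2 * ln (real (m n))) / sqrt (2 * ln (real (m n)))} = {r. real r \<le> y n}"
      by (auto simp: divide_le_cancel)
    then show ?case unfolding cdf_def2 records_cdf_def by (subst measure_distr) auto
  qed
  ultimately show ?thesis by (rule Lim_transform_eventually)
qed

text \<open>By \<open>m_par_log\<close> the centring \<open>2 * ln m\<close> and
  \<open>\<alpha> * ln n\<close> differ by less than the scale of the fluctuations, and so does the
  perturbation \<open>e\<close>. The ratio of the two scales tends to one.\<close>

lemma hop_centering:
  assumes e: "(\<lambda>n. e n / sqrt (ln (real n))) \<longlonglongrightarrow> 0"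
  defines "\<alpha> \<equiv> 2 * (\<tau> - 2) / (\<tau> - 1)"
  shows "(\<lambda>n. (\<alpha> * ln (real n) + x * sqrt (\<alpha> * ln (real n)) + e n - 2 * ln (real (m_par n))) / sqrt (2 * ln (real (m_par n)))) \<longlonglongrightarrow> x"
proof -
  have \<alpha>: "\<alpha> > 0" using \<tau> by (simp add: \<alpha>_def)
  let ?r = "\<lambda>n. sqrt (ln (real n))"
  note ml = m_par_log[folded \<alpha>_def]
  have inv: "(\<lambda>n. 1 / ?r n) \<longlonglongrightarrow> 0" by real_asymp
  have ln: "eventually (\<lambda>n. ln (real n) > 0) sequentially" using eventually_ge_at_top[of 2] by eventually_elim simp
  have "(\<lambda>n. \<alpha> + (2 * ln (real (m_par n)) - \<alpha> * ln (real n)) / ?r n * (1 / ?r n)) \<longlonglongrightarrow> \<alpha> + 0 * 0"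
    by (intro tendsto_intros ml inv)
  moreover have "eventually (\<lambda>n. \<alpha> + (2 * ln (real (m_par n)) - \<alpha> * ln (real n)) / ?r n * (1 / ?r n) = 2 * ln (real (m_par n)) / ln (real n)) sequentially"
    using ln by eventually_elim (simp add: diff_divide_distrib)
  ultimately have "(\<lambda>n. 2 * ln (real (m_par n)) / ln (real n)) \<longlonglongrightarrow> \<alpha>" by (auto elim: Lim_transform_eventually)
  then have sq: "(\<lambda>n. sqrt (2 * ln (real (m_par n)) / ln (real n))) \<longlonglongrightarrow> sqrt \<alpha>" by (rule tendsto_real_sqrt)
  have "(\<lambda>n. (- ((2 * ln (real (m_par n)) - \<alpha> * ln (real n)) / ?r n) + x * sqrt \<alpha> + e n / ?r n) / sqrt (2 * ln (real (m_par n)) / ln (real n)))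
     \<longlonglongrightarrow> (- 0 + x * sqrt \<alpha> + 0) / sqrt \<alpha>"
    using \<alpha> by (intro tendsto_intros ml e sq) auto
  moreover have "eventually (\<lambda>n. (- ((2 * ln (real (m_par n)) - \<alpha> * ln (real n)) / ?r n) + x * sqrt \<alpha> + e n / ?r n) / sqrt (2 * ln (real (m_par n)) / ln (real n))
     = (\<alpha> * ln (real n) + x * sqrt (\<alpha> * ln (real n)) + e n - 2 * ln (real (m_par n))) / sqrt (2 * ln (real (m_par n)))) sequentially"
    using ln
  proof eventually_elim
    case (elim n)
    have r: "?r n > 0" using elim by simp
    have "- ((2 * ln (real (m_par n)) - \<alpha> * ln (real n)) / ?r n) + x * sqrt \<alpha> + e n / ?r n
      = (\<alpha> * ln (real n) + x * sqrt (\<alpha> * ln (real n)) + e n - 2 * ln (real (m_par n))) / ?r n"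
      using r by (simp add: real_sqrt_mult field_simps)
    then show ?case using r by (simp add: real_sqrt_divide)
  qed
  ultimately show ?thesis using \<alpha> by (auto elim: Lim_transform_eventually)
qed

lemma hopcount_limit:
  "weak_conv_m (\<lambda>n. distr (CM_cond F n) borel
      (\<lambda>\<omega>. (real (CM_H n \<omega>) - (2 * (\<tau> - 2) / (\<tau> - 1)) * ln (real n)) / sqrt ((2 * (\<tau> - 2) / (\<tau> - 1)) * ln (real n))))
     std_normal_distribution"
proof -
  define \<alpha> where "\<alpha> = 2 * (\<tau> - 2) / (\<tau> - 1)"
  have \<alpha>: "\<alpha> > 0" using \<tau> by (simp add: \<alpha>_def)
  define X where "X = (\<lambda>n \<omega>. (real (CM_H n \<omega>) - \<alpha> * ln (real n)) / sqrt (\<alpha> * ln (real n)))"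
  define z where "z = (\<lambda>x n. \<alpha> * ln (real n) + x * sqrt (\<alpha> * ln (real n)))"
  \<comment> \<open>Any order strictly between \<open>1\<close> and the square root of
    \<open>ln n\<close> serves: the coupling cost \<open>C / w n\<close> vanishes, and a shift by
    \<open>w n\<close> is invisible after normalisation.\<close>
  define w where "w = (\<lambda>n. ln (real n) powr (1/3))"
  define C where "C = 2 * (1 + \<mu>) * time_const"
  have C: "C \<ge> 0" using \<mu>_ge2 time_const_pos by (simp add: C_def)
  let ?c = "\<lambda>n x. cdf (distr (CM_cond F n) borel (X n)) x"
  let ?\<epsilon> = "mon 0 (- 1)"
  let ?\<delta> = "\<lambda>n. \<bar>\<delta>_par n\<bar> + C / w n"
  have \<delta>: "?\<delta> \<longlonglongrightarrow> 0"
  proof -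
    have "(\<lambda>n. C / w n) \<longlonglongrightarrow> 0" unfolding w_def by real_asymp
    then show ?thesis using tendsto_add[OF tendsto_rabs_zero[OF \<delta>_par_lim]] by fastforce
  qed
  have \<delta>1: "eventually (\<lambda>n. ?\<delta> n < 1) sequentially" by (rule order_tendstoD(2)[OF \<delta>]) simp
  have lo: "(\<lambda>n. records_cdf (m_par n) (z x n - 1 - real (k_par n) - w n) - ?\<delta> n) \<longlonglongrightarrow> cdf std_normal_distribution x - 0" for x
  proof (intro tendsto_diff \<delta> records_cdf_lim m_par_at_top)
    have "(\<lambda>n. - (1 / sqrt (ln (real n))) - real (k_par n) / sqrt (ln (real n)) - w n / sqrt (ln (real n))) \<longlonglongrightarrow> - 0 - 0 - 0"
      unfolding w_def by (intro tendsto_diff tendsto_minus k_par_lim) real_asymp+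
    then have "(\<lambda>n. (- 1 - real (k_par n) - w n) / sqrt (ln (real n))) \<longlonglongrightarrow> 0" by (simp add: diff_divide_distrib)
    from hop_centering[OF this, folded \<alpha>_def, of x]
    show "(\<lambda>n. (z x n - 1 - real (k_par n) - w n - 2 * ln (real (m_par n))) / sqrt (2 * ln (real (m_par n)))) \<longlonglongrightarrow> x"
      by (simp add: z_def diff_diff_eq add_diff_eq algebra_simps)
  qed
  have hi: "(\<lambda>n. records_cdf (m_par n) (z x n - 1 + w n) + ?\<delta> n) \<longlonglongrightarrow> cdf std_normal_distribution x + 0" for x
  proof (intro tendsto_add[OF _ \<delta>] records_cdf_lim m_par_at_top)
    have "(\<lambda>n. - (1 / sqrt (ln (real n))) + w n / sqrt (ln (real n))) \<longlonglongrightarrow> - 0 + 0"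
      unfolding w_def by (intro tendsto_add tendsto_minus) real_asymp+
    then have "(\<lambda>n. (- 1 + w n) / sqrt (ln (real n))) \<longlonglongrightarrow> 0" by (simp add: diff_divide_distrib)
    from hop_centering[OF this, folded \<alpha>_def, of x]
    show "(\<lambda>n. (z x n - 1 + w n - 2 * ln (real (m_par n))) / sqrt (2 * ln (real (m_par n)))) \<longlonglongrightarrow> x"
      by (simp add: z_def algebra_simps)
  qed
  have bounds: "eventually (\<lambda>n. records_cdf (m_par n) (z x n - 1 - real (k_par n) - w n) - ?\<delta> n \<le> ?c n x
      \<and> ?c n x \<le> records_cdf (m_par n) (z x n - 1 + w n) + ?\<delta> n) sequentially" for x
    using comparison mon_eps \<delta>1 eventually_ge_at_top[of 3]
  proof eventually_elim
    case (elim n)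
    let ?E = "UNIV \<times> {h. real h \<le> z x n} :: (real \<times> nat) set" and ?E' = "UNIV \<times> {h. z x n < real h} :: (real \<times> nat) set"
    have compl: "- ?E = ?E'" by auto
    have E: "?E \<in> sets (borel \<Otimes>\<^sub>M count_space UNIV)" "?E' \<in> sets (borel \<Otimes>\<^sub>M count_space UNIV)" by auto
    have \<epsilon>: "?\<epsilon> n \<ge> 0" using elim by blast
    have w: "w n > 0" using elim by (simp add: w_def)
    have le: "a \<le> measure (CM_FPP F n) (CM_event F n D) + ?\<delta> n"
      if "ennreal a \<le> core_law D (?\<epsilon> n) (k_par n) (m_par n) + ennreal (C / w n)"
        "D \<in> sets (borel \<Otimes>\<^sub>M count_space UNIV)" "\<And>a b. (\<lambda>\<tau>. core D (?\<epsilon> n) (k_par n) \<tau> a b) \<in> borel_measurable borel" for a D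
    proof -
      have "ennreal a \<le> (emeasure (CM_FPP F n) (CM_event F n D) + ennreal (\<delta>_par n)) + ennreal (C / w n)"
        using that(1) elim(1)[rule_format, OF that(2,3)] by (meson add_right_mono order_trans)
      also have "\<dots> \<le> (emeasure (CM_FPP F n) (CM_event F n D) + ennreal \<bar>\<delta>_par n\<bar>) + ennreal (C / w n)"
        by (intro add_left_mono add_right_mono ennreal_leI) simp
      also have "\<dots> = emeasure (CM_FPP F n) (CM_event F n D) + ennreal (?\<delta> n)"
        using C w by (simp add: add.assoc)
      finally show ?thesis using ennreal_le_measureD[OF prob_space_CM_FPP] C w by fastforce
    qed
    have 1: "records_cdf (m_par n) (z x n - 1 - real (k_par n) - w n) \<le> measure (CM_FPP F n) (CM_event F n ?E) + ?\<delta> n"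
      by (rule le[OF core_law_hops(1)[OF \<epsilon> w, folded C_def] E(1) core_law_hops(3)[OF \<epsilon> w]])
    have 2: "1 - records_cdf (m_par n) (z x n - 1 + w n) \<le> measure (CM_FPP F n) (CM_event F n (- ?E)) + ?\<delta> n"
      unfolding compl by (rule le[OF core_law_hops(2)[OF \<epsilon> w, folded C_def] E(2) core_law_hops(4)[OF \<epsilon> w]])
    have 3: "1 \<le> measure (CM_FPP F n) (CM_event F n UNIV) + ?\<delta> n"
      by (rule le) (use sets.top[of "borel \<Otimes>\<^sub>M count_space UNIV"] in \<open>auto simp: core_law_UNIV core_def space_pair_measure\<close>)
    have "?c n x = measure (CM_FPP F n) (CM_event F n ?E) / measure (CM_FPP F n) (CM_event F n UNIV)"
    proof (rule cdf_CM_cond)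
      note [measurable] = measurable_CM_H
      show "X n \<in> borel_measurable (CM_FPP F n)" unfolding X_def by measurable
      have "sqrt (\<alpha> * ln (real n)) > 0" using \<alpha> elim by simp
      then show "X n \<omega> \<le> x \<longleftrightarrow> (CM_W n \<omega>, CM_H n \<omega>) \<in> ?E" for \<omega>
        by (auto simp: X_def z_def divide_le_eq algebra_simps)
    qed
    then show ?case using cond_sandwich[OF E(1) 1 2 3] elim(3) by auto
  qed
  have "weak_conv_m (\<lambda>n. distr (CM_cond F n) borel (X n)) std_normal_distribution"
    unfolding weak_conv_m_def weak_conv_def
  proof (intro allI impI)
    fix x
    show "(\<lambda>n. ?c n x) \<longlonglongrightarrow> cdf std_normal_distribution x"
    proof (rule tendsto_sandwich)
      show "(\<lambda>n. records_cdf (m_par n) (z x n - 1 - real (k_par n) - w n) - ?\<delta> n) \<longlonglongrightarrow> cdf std_normal_distribution x" using lo by simp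
      show "(\<lambda>n. records_cdf (m_par n) (z x n - 1 + w n) + ?\<delta> n) \<longlonglongrightarrow> cdf std_normal_distribution x" using hi by simp
    qed (use bounds[of x] in \<open>eventually_elim, blast\<close>)+
  qed
  then show ?thesis by (simp add: X_def \<alpha>_def)
qed

end

theorem theorem3p2:
  fixes F :: "nat pmf" and \<tau> c1 c2 :: real
  assumes "\<forall>k::nat. k < 2 \<longrightarrow> pmf F k = 0"
    and "\<forall>k. pmf F k \<noteq> 1"
    and "2 < \<tau>" and "\<tau> < 3" and "0 < c1" and "c1 \<le> c2"
    and "\<forall>x::real. x \<ge> 1 \<longrightarrow>
           c1 * x powr (-(\<tau> - 1)) \<le> measure_pmf.prob F {k. real k > x} \<and>
           measure_pmf.prob F {k. real k > x} \<le> c2 * x powr (-(\<tau> - 1))"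
  shows "weak_conv_m
           (\<lambda>n. distr (CM_cond F n) borel
              (\<lambda>\<omega>. (real (CM_H n \<omega>) - (2 * (\<tau> - 2) / (\<tau> - 1)) * ln (real n))
                     / sqrt ((2 * (\<tau> - 2) / (\<tau> - 1)) * ln (real n))))
           (density lborel std_normal_density)
       \<and> (\<exists>V. real_distribution V \<and>
              weak_conv_m (\<lambda>n. distr (CM_cond F n) borel (CM_W n)) V)"
proof -
  interpret heavy_tail F \<tau> c1 c2 by unfold_locales (use assms in auto)
  show ?thesis using hopcount_limit weight_limit by blast
qed

end
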